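(* Let $n\ge1$. The residue matrices $A_{nj}$, $j=1,\dots,m$, and $A_{n\infty}=-\sum_{j=1}^mA_{nj}$ of the spectral matrix $A_n(z)$ satisfy, with respect to the deformation variable $t$, the Schlesinger equations $$\dot A_{nj}=[B_\infty,A_{nj}]+\sum_{k\ne j}\frac{\dot z_j-\dot z_k}{z_j-z_k}[A_{nk},A_{nj}],\qquad j=1,\dots,m,$$ $$\dot A_{n\infty}=[B_\infty,A_{n\infty}],$$ where $$B_\infty=\begin{pmatrix}\dfrac{\dot\kappa_n}{\kappa_n}&0\\[6pt]\dfrac{\kappa_n\dot{\bar\phi}_n(0)+\dot\kappa_n\bar\phi_n(0)}{\kappa_n^2}&-\dfrac{\dot\kappa_n}{\kappa_n}\end{pmatrix}.$$
   Context: Regular semi-classical weight depending on a deformation variable $t$ ($\dot{}=d/dt$, $'=d/dz$): $w(z)=\prod_{j=1}^m(z-z_j(t))^{\rho_j}$ with $m\ge2$ distinct points $z_j=z_j(t)$ depending differentiably on $t$, and $t$-independent exponents $\rho_j\in\mathbb C\setminus\mathbb Z_{\ge0}$. One singular point is fixed at the origin, $z_1=0$ for all $t$. A branch of $w$ analytic in a cut plane is fixed; let $\mathbb T=\{|\zeta|=1\}$ be parametrised by $\zeta=e^{i\theta}$, $\theta\in(-\pi,\pi]$, the cuts being such that on $\mathbb T$ the branch is analytic except possibly at $-1$ and at those $z_j$ lying on $\mathbb T$. For all $t$ assume $w(e^{\pi i})=w(e^{-\pi i})$, $z^jw,z^jw'\in L^1(\mathbb T)$ for all $j\in\mathbb Z$,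 and $\det[w_{j-k}]_{0\le j,k\le n-1}\neq0$ for all $n\ge1$, where $w_k=\int_{\mathbb T}\frac{d\zeta}{2\pi i\zeta}w(\zeta)\zeta^{-k}$. The bi-orthonormal polynomials are $\phi_n(z)=\kappa_nz^n+\dots+\phi_n(0)$ and $\bar\phi_n(z)=\kappa_nz^n+\dots+\bar\phi_n(0)$ with $\kappa_n\neq0$ (differentiable in $t$), satisfying $\int_{\mathbb T}\frac{d\zeta}{2\pi i\zeta}w(\zeta)\phi_m(\zeta)\bar\phi_n(\bar\zeta)=\delta_{m,n}$, $\bar\zeta=\zeta^{-1}$; the bar on $\bar\phi_n$ is notation, not complex conjugation. $\phi^*_n(z)=z^n\bar\phi_n(1/z)$. Assume $\phi_n(0)\neq0$, $\bar\phi_n(0)\ne0$. For $n\ge1$ and $z\notin\mathbb T$, $\epsilon_n(z)=\int_{\mathbb T}\frac{d\zeta}{2\pi i\zeta}\frac{\zeta+z}{\zeta-z}w(\zeta)\phi_n(\zeta)$ and $\epsilon^*_n(z)=-z^n\int_{\mathbb T}\frac{d\zeta}{2\pi i\zeta}\frac{\zeta+z}{\zeta-z}w(\zeta)\bar\phi_n(\bar\zeta)$. Put $$Y_n(z)=\begin{pmatrix}\phi_n&\epsilon_n/w\\ \phi^*_n&-\epsilon^*_n/w\end{pmatrix},$$ and let $A_n(z)$ be the matrix with $Y_n'=A_nY_n$; for these weights $A_n(z)=\sum_{j=1}^m\frac{A_{nj}}{z-z_j}$, which defines the residue matrices $A_{nj}$ ($z$-independent). *)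

theory Defs
  imports "HOL-Analysis.Analysis" "Jordan_Normal_Form.Determinant"
begin

(* "$" below is the component of a complex^2^2 matrix; the Jordan_Normal_Form
   types are used for the Toeplitz determinants only, whose size varies. *)
no_notation Matrix.vec_index (infixl "$" 100)

section \<open>Integration over the unit circle and Toeplitz determinants\<close>

(* The integral of f(zeta) dzeta / (2 pi i zeta) over the unit circle,
   with zeta = exp(i theta), theta in (-pi, pi]. *)
definition circle_integral :: "(complex \<Rightarrow> complex) \<Rightarrow> complex" where
  "circle_integral f = (LINT \<theta>:{-pi<..pi}|lborel. f (cis \<theta>)) / (2 * complex_of_real pi)"

definition circle_integrable :: "(complex \<Rightarrow> complex) \<Rightarrow> bool" where
  "circle_integrable f \<longleftrightarrow> set_integrable lborel {-pi<..pi} (\<lambda>\<theta>. f (cis \<theta>))"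

definition fourier_coeff :: "(complex \<Rightarrow> complex) \<Rightarrow> int \<Rightarrow> complex" where
  "fourier_coeff w k = circle_integral (\<lambda>\<zeta>. w \<zeta> * \<zeta> powi (- k))"

definition toeplitz_det :: "(complex \<Rightarrow> complex) \<Rightarrow> nat \<Rightarrow> complex" where
  "toeplitz_det w n =
     Determinant.det (Matrix.mat n n (\<lambda>(j, k). fourier_coeff w (int j - int k)))"

section \<open>The weight\<close>

(* All values at z of the multivalued function prod_{j in J} (z - a_j)^(rho_j);
   the set is empty if z is one of the a_j. *)
definition power_product_values ::
    "nat set \<Rightarrow> (nat \<Rightarrow> complex) \<Rightarrow> (nat \<Rightarrow> complex) \<Rightarrow> complex \<Rightarrow> complex set" where
  "power_product_values J a \<rho> z =
     {exp (\<Sum>j\<in>J. \<rho> j * l j) | l. \<forall>j\<in>J. exp (l j) = z - a j}"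

(* For t in U, w t is a branch, analytic off the cuts C t, of
   prod_{j=1..m} (z - z_j(t))^(rho_j), with z_j(t) = zs t j.  The branch depends continuously
   on t: otherwise w could be multiplied by a t-dependent constant, which changes kappa_n.
   No shape is imposed on the cuts beyond closedness (which follows from the openness of the
   joint domain) and their position relative to the unit circle. The points z_j(t) belong to
   C t automatically, as power_product_values is empty there. *)
definition analytic_branch_family ::
    "real set \<Rightarrow> nat \<Rightarrow> (real \<Rightarrow> nat \<Rightarrow> complex) \<Rightarrow> (nat \<Rightarrow> complex) \<Rightarrow> (real \<Rightarrow> complex set)
       \<Rightarrow> (real \<Rightarrow> complex \<Rightarrow> complex) \<Rightarrow> bool" where
  "analytic_branch_family U m zs \<rho> C w \<longleftrightarrow>
     open {(t, z). t \<in> U \<and> z \<notin> C t} \<and>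
     continuous_on {(t, z). t \<in> U \<and> z \<notin> C t} (\<lambda>(t, z). w t z) \<and>
     (\<forall>t\<in>U. w t holomorphic_on - C t \<and>
        (\<forall>z. z \<notin> C t \<longrightarrow> w t z \<in> power_product_values {1..m} (zs t) \<rho> z) \<and>
        sphere 0 1 \<inter> C t \<subseteq> insert (-1) (zs t ` {1..m}))"

(* w(e^{pi i}) = w(e^{- pi i}), as boundary values along the unit circle. *)
definition closed_on_circle :: "(complex \<Rightarrow> complex) \<Rightarrow> bool" where
  "closed_on_circle w \<longleftrightarrow>
     (\<exists>l. ((\<lambda>\<theta>. w (cis \<theta>)) \<longlongrightarrow> l) (at_left pi) \<and>
          ((\<lambda>\<theta>. w (cis \<theta>)) \<longlongrightarrow> l) (at_right (- pi)))"

section \<open>Bi-orthonormal polynomials and associated functions\<close>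

(* phib stands for the polynomials written with a bar: an independent sequence, not the
   complex conjugates of phi. On the unit circle the conjugate of zeta is 1 / zeta. *)
definition biorthonormal_system ::
    "(complex \<Rightarrow> complex) \<Rightarrow> (nat \<Rightarrow> complex) \<Rightarrow> (nat \<Rightarrow> complex poly) \<Rightarrow> (nat \<Rightarrow> complex poly)
       \<Rightarrow> bool" where
  "biorthonormal_system w \<kappa> \<phi> \<phi>b \<longleftrightarrow>
     (\<forall>n. \<kappa> n \<noteq> 0 \<and> degree (\<phi> n) = n \<and> degree (\<phi>b n) = n \<and>
          lead_coeff (\<phi> n) = \<kappa> n \<and> lead_coeff (\<phi>b n) = \<kappa> n) \<and>
     (\<forall>k n. circle_integral (\<lambda>\<zeta>. w \<zeta> * poly (\<phi> k) \<zeta> * poly (\<phi>b n) (1 / \<zeta>))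
              = (if k = n then 1 else 0))"

(* The reciprocal polynomial phi*_n, used at z \<noteq> 0 only. *)
definition phi_star :: "(nat \<Rightarrow> complex poly) \<Rightarrow> nat \<Rightarrow> complex \<Rightarrow> complex" where
  "phi_star \<phi>b n z = z ^ n * poly (\<phi>b n) (1 / z)"

definition epsilon ::
    "(complex \<Rightarrow> complex) \<Rightarrow> (nat \<Rightarrow> complex poly) \<Rightarrow> nat \<Rightarrow> complex \<Rightarrow> complex" where
  "epsilon w \<phi> n z =
     circle_integral (\<lambda>\<zeta>. (\<zeta> + z) / (\<zeta> - z) * w \<zeta> * poly (\<phi> n) \<zeta>)"

definition epsilon_star ::
    "(complex \<Rightarrow> complex) \<Rightarrow> (nat \<Rightarrow> complex poly) \<Rightarrow> nat \<Rightarrow> complex \<Rightarrow> complex" where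
  "epsilon_star w \<phi>b n z =
     - (z ^ n) * circle_integral (\<lambda>\<zeta>. (\<zeta> + z) / (\<zeta> - z) * w \<zeta> * poly (\<phi>b n) (1 / \<zeta>))"

definition Y_matrix ::
    "(complex \<Rightarrow> complex) \<Rightarrow> (nat \<Rightarrow> complex poly) \<Rightarrow> (nat \<Rightarrow> complex poly) \<Rightarrow> nat
       \<Rightarrow> complex \<Rightarrow> complex^2^2" where
  "Y_matrix w \<phi> \<phi>b n z =
     vector [vector [poly (\<phi> n) z, epsilon w \<phi> n z / w z],
             vector [phi_star \<phi>b n z, - (epsilon_star w \<phi>b n z / w z)]]"

section \<open>Spectral and deformation matrices\<close>

definition smult_matrix :: "complex \<Rightarrow> complex^2^2 \<Rightarrow> complex^2^2" where
  "smult_matrix c M = map_matrix (\<lambda>x. c * x) M"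

definition commutator :: "complex^2^2 \<Rightarrow> complex^2^2 \<Rightarrow> complex^2^2" where
  "commutator M N = M ** N - N ** M"

definition partial_fraction_matrix ::
    "nat \<Rightarrow> (nat \<Rightarrow> complex) \<Rightarrow> (nat \<Rightarrow> complex^2^2) \<Rightarrow> complex \<Rightarrow> complex^2^2" where
  "partial_fraction_matrix m a R z = (\<Sum>j\<in>{1..m}. smult_matrix (1 / (z - a j)) (R j))"

(* Y' = S Y on D, with ' the complex derivative of the entries. *)
definition spectral_equation ::
    "complex set \<Rightarrow> (complex \<Rightarrow> complex^2^2) \<Rightarrow> (complex \<Rightarrow> complex^2^2) \<Rightarrow> bool" where
  "spectral_equation D Y S \<longleftrightarrow>
     (\<forall>z\<in>D. \<forall>i k. ((\<lambda>x. Y x $ i $ k) has_field_derivative (S z ** Y z) $ i $ k) (at z))"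

definition B_infinity ::
    "(real \<Rightarrow> nat \<Rightarrow> complex) \<Rightarrow> (real \<Rightarrow> nat \<Rightarrow> complex poly) \<Rightarrow> nat \<Rightarrow> real \<Rightarrow> complex^2^2" where
  "B_infinity \<kappa> \<phi>b n t =
     (let K = \<kappa> t n; dK = vector_derivative (\<lambda>s. \<kappa> s n) (at t);
          b = poly (\<phi>b t n) 0; db = vector_derivative (\<lambda>s. poly (\<phi>b s n) 0) (at t)
      in vector [vector [dK / K, 0],
                 vector [(K * db + dK * b) / K\<^sup>2, - (dK / K)]])"

end

theory Submission
  imports Defs
begin

text \<open>The proof rests on an algebraic description of the two columns of \<open>Y\<close>. Write \<open>Y = (f, x / w)\<close>.
The column \<open>f = (\<phi>\<^sub>n, \<phi>\<^sub>n\<^sup>*)\<close> is polynomial, and \<open>x = F f + p\<close> with a polynomial vector \<open>p\<close> and the Caratheodory function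
\<open>F(z) = \<integral> w(\<zeta>) (\<zeta> + z) / (\<zeta> - z)\<close>, because multiplying the kernel by a power of \<open>\<zeta>\<close> instead of the
same power of \<open>z\<close> costs only a polynomial (\<open>kernel_column_decomposition\<close>). All transcendental content
sits in the scalar \<open>F\<close>, and \<open>F\<close> satisfies two first-order equations with the same singular data: with
\<open>V = w' / w\<close> and \<open>V\<^sub>t = \<partial>\<^sub>t w / w\<close>, both rational, \<open>F' - V F\<close> and \<open>\<partial>\<^sub>t F - V\<^sub>t F\<close> are rational with
simple poles at the \<open>z\<^sub>j\<close>, whose residues are proportional at every \<open>z\<^sub>j \<noteq> 0\<close> with ratio
\<open>-\<partial>\<^sub>t z\<^sub>j\<close> (\<open>F_deriv\<close>, \<open>U_kernel\<close>).

Because of this proportionality, the equation \<open>Y' = A Y\<close> determines exactly the polar part of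
\<open>\<partial>\<^sub>t Y Y\<^sup>-\<^sup>1\<close> at each \<open>z\<^sub>j\<close>: it is \<open>- (\<partial>\<^sub>t z\<^sub>j) A\<^sub>j / (z - z\<^sub>j)\<close> (\<open>residue_relations\<close>). Subtracting these
poles leaves a matrix whose entries, multiplied by \<open>det (f, x) = - 2 z\<^sup>n\<close>, are polynomials, as \<open>F\<close> cancels
in 2 by 2 minors. Orthogonality makes them \<open>O(z\<^sup>n)\<close> at 0 and at infinity, hence constant multiples
of \<open>z\<^sup>n\<close>, and the leading coefficients at infinity give \<open>B\<^sub>\<infinity>\<close> (\<open>deformation_equations\<close>). So
\<open>\<partial>\<^sub>t Y = (B\<^sub>\<infinity> - \<Sum>\<^sub>j (\<partial>\<^sub>t z\<^sub>j) A\<^sub>j / (z - z\<^sub>j)) Y\<close>. The point \<open>z\<^sub>1 = 0\<close> is harmless because it does not move.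

Equality of the mixed derivatives of \<open>Y\<close> in \<open>t\<close> and \<open>z\<close>, compared pole by pole, is the Schlesinger
system; differentiability of the residue matrices in \<open>t\<close> comes out of the same computation, since they
are recovered from \<open>Y'\<close> and \<open>Y\<close> at finitely many fixed points \<open>z\<close>
(\<open>schlesinger_from_cross_differentiation\<close>).

The analytic work is to differentiate \<open>\<integral> w h\<close> under the integral sign although the singularities may lie
on the circle and move along or across it (\<open>weight_integral_deriv\<close>). Integrability of \<open>w'\<close> forces
\<open>w / (\<zeta> - z\<^sub>j)\<close> to be integrable, hence \<open>Re \<rho>\<^sub>j > 0\<close> whenever \<open>z\<^sub>j\<close> is on the circle. Near such a point
\<open>|w|\<close> is comparable with \<open>|\<zeta> - z\<^sub>j(t)|\<close> to the power \<open>Re \<rho>\<^sub>j\<close>, uniformly in \<open>t\<close> (\<open>local_bound\<close>), and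
this bounds the difference quotients of \<open>w\<close> in \<open>t\<close> by a fixed integrable function, so that
dominated convergence applies. Differentiability of the coefficients of the polynomials then
follows by Gram-Schmidt from that of the moments and of \<open>\<kappa>\<^sub>n\<close>.\<close>

section \<open>Polynomial functions determined by their growth\<close>

text \<open>Polynomial functions are used instead of polynomials so that concrete expressions are recognised as
polynomial by closure rules, with no coefficients to write down.\<close>

definition polyfun :: "(complex \<Rightarrow> complex) \<Rightarrow> bool" where
  "polyfun f \<longleftrightarrow> (\<exists>P. \<forall>z. f z = poly P z)"

lemma polyfun_poly [intro]: "polyfun (\<lambda>z. poly P z)" by (auto simp: polyfun_def)
lemma polyfun_const [intro]: "polyfun (\<lambda>z. c)" unfolding polyfun_def by (intro exI[of _ "[:c:]"]) simp
lemma polyfun_id [intro]: "polyfun (\<lambda>z. z)" unfolding polyfun_def by (intro exI[of _ "[:0,1:]"]) simp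
lemma polyfun_add [intro]: "polyfun f \<Longrightarrow> polyfun g \<Longrightarrow> polyfun (\<lambda>z. f z + g z)"
  unfolding polyfun_def by (metis poly_add)
lemma polyfun_diff [intro]: "polyfun f \<Longrightarrow> polyfun g \<Longrightarrow> polyfun (\<lambda>z. f z - g z)"
  unfolding polyfun_def by (metis poly_diff)
lemma polyfun_mult [intro]: "polyfun f \<Longrightarrow> polyfun g \<Longrightarrow> polyfun (\<lambda>z. f z * g z)"
  unfolding polyfun_def by (metis poly_mult)
lemma polyfun_minus [intro]: "polyfun f \<Longrightarrow> polyfun (\<lambda>z. - f z)"
  unfolding polyfun_def by (metis poly_minus)
lemma polyfun_power [intro]: "polyfun f \<Longrightarrow> polyfun (\<lambda>z. f z ^ k)"
  unfolding polyfun_def by (metis poly_power)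
lemma polyfun_sum [intro]: "(\<And>i. i \<in> I \<Longrightarrow> polyfun (f i)) \<Longrightarrow> polyfun (\<lambda>z. \<Sum>i\<in>I. f i z)"
  by (induction I rule: infinite_finite_induct) auto

lemma polyfun_divide:
  assumes "polyfun f" "f a = 0"
  obtains g where "polyfun g" "\<And>z. f z = (z - a) * g z"
proof -
  obtain P where P: "\<And>z. f z = poly P z" using assms(1) by (auto simp: polyfun_def)
  then obtain Q where Q: "P = [:-a, 1:] * Q" using assms(2) poly_eq_0_iff_dvd[of P a] by (auto simp: dvd_def)
  then have "f z = (z - a) * poly Q z" for z unfolding P Q poly_mult by simp
  then show ?thesis using that[of "poly Q"] by blast
qed

lemma polyfun_isCont: "polyfun f \<Longrightarrow> isCont f z"
proof -
  assume "polyfun f"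
  then obtain P where "f = poly P" by (auto simp: polyfun_def)
  then show ?thesis by simp
qed

lemma polyfun_infinite_zero:
  assumes "polyfun f" "infinite S" "\<And>z. z \<in> S \<Longrightarrow> f z = 0" shows "f z = 0"
proof -
  obtain P where P: "\<And>z. f z = poly P z" using assms(1) by (auto simp: polyfun_def)
  have "P = 0"
  proof (rule ccontr)
    assume "P \<noteq> 0"
    then have "finite {z. poly P z = 0}" by (rule poly_roots_finite)
    moreover have "S \<subseteq> {z. poly P z = 0}" using assms(3) P by auto
    ultimately show False using assms(2) finite_subset by blast
  qed
  then show ?thesis by (simp add: P)
qed

text \<open>The bound at 0 makes the polynomial divisible by \<open>z\<^sup>n\<close>, the limit at infinity bounds its degree by \<open>n\<close>.
This plays the part of Liouville's theorem.\<close>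

lemma polyfun_growth:
  assumes f: "polyfun f" and bd: "eventually (\<lambda>z. norm (f z) \<le> B * norm z ^ n) (at 0)"
    and lim: "((\<lambda>z. f z / z ^ n) \<longlongrightarrow> c) at_infinity"
  shows "f z = c * z ^ n"
proof -
  obtain P where P: "f = poly P" using f by (auto simp: polyfun_def)
  show ?thesis
  proof (cases "P = 0")
    case True
    then have "((\<lambda>z::complex. 0) \<longlongrightarrow> c) at_infinity" using lim by (simp add: P)
    then have "c = 0" using tendsto_unique[OF trivial_limit_at_infinity tendsto_const] by metis
    then show ?thesis using True by (simp add: P)
  next
    case False
    define k where "k = order 0 P"
    obtain Q where Q: "P = [:-0, 1:] ^ k * Q" "\<not> [:-0, 1:] dvd Q"
      using order_decomp[OF False, of 0] by (auto simp: k_def)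
    have Q0: "poly Q 0 \<noteq> 0" using Q(2) by (simp add: poly_eq_0_iff_dvd)
    have PQ: "poly P z = z ^ k * poly Q z" for z by (simp add: Q(1) poly_power)
    have "n \<le> k"
    proof (rule ccontr)
      assume "\<not> n \<le> k"
      then have kn: "k < n" by simp
      have "eventually (\<lambda>z. norm (poly Q z) \<le> B * norm z ^ (n - k)) (at 0)"
        using bd eventually_neq_at_within[of 0 0 UNIV]
      proof eventually_elim
        case (elim z)
        have "norm z ^ n = norm z ^ k * norm z ^ (n - k)" using kn by (simp add: power_add[symmetric])
        then have "norm z ^ k * norm (poly Q z) \<le> norm z ^ k * (B * norm z ^ (n - k))"
          using elim by (simp add: P PQ norm_mult norm_power mult_ac)
        then show ?case using elim by simp
      qed
      moreover have "((\<lambda>z::complex. B * norm z ^ (n - k)) \<longlongrightarrow> 0) (at 0)"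
        using kn by (auto intro!: tendsto_eq_intros)
      ultimately have "((\<lambda>z. poly Q z) \<longlongrightarrow> 0) (at 0)" by (rule Lim_null_comparison)
      moreover have "((\<lambda>z. poly Q z) \<longlongrightarrow> poly Q 0) (at 0)" using isCont_def poly_isCont by blast
      ultimately show False using Q0 LIM_unique by blast
    qed
    define R where "R = [:0, 1:] ^ (k - n) * Q"
    have PR: "poly P z = z ^ n * poly R z" for z
      using \<open>n \<le> k\<close> by (simp add: PQ R_def poly_power power_add[symmetric])
    have Rc: "((\<lambda>z. poly R z) \<longlongrightarrow> c) at_infinity"
    proof (rule Lim_transform_eventually[OF lim])
      have "eventually (\<lambda>z::complex. z \<noteq> 0) at_infinity" by (auto simp: eventually_at_infinity intro: exI[of _ 1])
      then show "eventually (\<lambda>z. f z / z ^ n = poly R z) at_infinity"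
        by eventually_elim (simp add: P PR)
    qed
    obtain a p where R: "R = pCons a p" by (cases R)
    have "p = 0"
    proof (rule ccontr)
      assume "p \<noteq> 0"
      then have "filterlim (poly R) at_infinity at_infinity" unfolding R by (intro filterlim_poly_at_infinity) simp
      with Rc show False
        using not_tendsto_and_filterlim_at_infinity[OF trivial_limit_at_infinity] by blast
    qed
    then have "((\<lambda>z::complex. a) \<longlongrightarrow> c) at_infinity" using Rc R by simp
    then have "a = c" using tendsto_unique[OF trivial_limit_at_infinity tendsto_const] by metis
    then show ?thesis using \<open>p = 0\<close> by (simp add: P PR R mult.commute)
  qed
qed

lemma infinity_eventually_simple:
  assumes "finite S" shows "eventually (\<lambda>z::complex. norm z > 1 \<and> z \<noteq> 0 \<and> z \<notin> S) at_infinity"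
proof -
  have "bounded S" using assms by (rule finite_imp_bounded)
  then obtain b where b: "\<And>z. z \<in> S \<Longrightarrow> norm z \<le> b" unfolding bounded_iff by blast
  show ?thesis unfolding eventually_at_infinity
    by (rule exI[of _ "max 2 (b + 1)"]) (use b in force)
qed

lemma zero_eventually_simple:
  assumes "finite S" shows "eventually (\<lambda>z::complex. norm z < 1 \<and> z \<noteq> 0 \<and> z \<notin> S) (at 0)"
proof -
  have "eventually (\<lambda>z. z \<notin> S - {0}) (nhds (0::complex))"
  proof -
    have "open (- (S - {0}))" by (intro open_Compl finite_imp_closed finite_Diff assms)
    then have "eventually (\<lambda>z. z \<in> - (S - {0})) (nhds (0::complex))" by (rule eventually_nhds_in_open) auto
    then show ?thesis by eventually_elim auto
  qed
  then have "eventually (\<lambda>z. z \<notin> S - {0}) (at (0::complex))" by (simp add: eventually_nhds_conv_at)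
  moreover have "eventually (\<lambda>z::complex. norm z < 1) (at 0)" by (auto simp: eventually_at intro!: exI[of _ 1])
  ultimately show ?thesis using eventually_neq_at_within[of "0::complex" 0 UNIV] by eventually_elim auto
qed

lemma tendsto_inverse_shift_infinity: "((\<lambda>z::complex. c / (z - a)) \<longlongrightarrow> 0) at_infinity"
proof -
  have "filterlim (\<lambda>z. z + (- a)) at_infinity (at_infinity :: complex filter)"
    by (rule tendsto_add_filterlim_at_infinity'[OF filterlim_ident tendsto_const])
  then have "((\<lambda>z. inverse (z + (- a))) \<longlongrightarrow> 0) at_infinity"
    by (rule filterlim_compose[OF tendsto_inverse_0])
  then have "((\<lambda>z. c * inverse (z + (- a))) \<longlongrightarrow> c * 0) at_infinity" by (intro tendsto_intros)
  then show ?thesis by (simp add: divide_inverse)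
qed

text \<open>The order \<open>O(z\<^sup>n)\<close> in a punctured neighbourhood of 0.\<close>

definition bigO0 :: "nat \<Rightarrow> (complex \<Rightarrow> complex) \<Rightarrow> bool" where
  "bigO0 n f \<longleftrightarrow> (\<exists>B. eventually (\<lambda>z. norm (f z) \<le> B * norm z ^ n) (at 0))"

lemma bigO0_add: assumes "bigO0 n f" "bigO0 n g" shows "bigO0 n (\<lambda>z. f z + g z)"
proof -
  obtain B C where B: "eventually (\<lambda>z. norm (f z) \<le> B * norm z ^ n) (at 0)" and C: "eventually (\<lambda>z. norm (g z) \<le> C * norm z ^ n) (at 0)"
    using assms unfolding bigO0_def by blast
  have "eventually (\<lambda>z. norm (f z + g z) \<le> (B + C) * norm z ^ n) (at 0)"
    using B C
  proof eventually_elim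
    case (elim z) then show ?case using norm_triangle_ineq[of "f z" "g z"] by (simp add: distrib_right)
  qed
  then show ?thesis unfolding bigO0_def by blast
qed

lemma bigO0_mult: assumes "bigO0 n f" "bigO0 0 g" shows "bigO0 n (\<lambda>z. g z * f z)"
proof -
  obtain B C where B: "eventually (\<lambda>z. norm (f z) \<le> B * norm z ^ n) (at 0)" and C: "eventually (\<lambda>z. norm (g z) \<le> C * norm z ^ 0) (at 0)"
    using assms unfolding bigO0_def by blast
  have "eventually (\<lambda>z. norm (g z * f z) \<le> (C * B) * norm z ^ n) (at 0)"
    using B C
  proof eventually_elim
    case (elim z)
    then have "norm (g z) * norm (f z) \<le> C * (B * norm z ^ n)" by (intro mult_mono) (auto intro: order_trans[OF norm_ge_zero])
    then show ?case by (simp add: norm_mult mult.assoc)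
  qed
  then show ?thesis unfolding bigO0_def by blast
qed

lemma bigO0_minus: "bigO0 n f \<Longrightarrow> bigO0 n (\<lambda>z. - f z)" by (simp add: bigO0_def)
lemma bigO0_diff: "bigO0 n f \<Longrightarrow> bigO0 n g \<Longrightarrow> bigO0 n (\<lambda>z. f z - g z)"
  using bigO0_add[OF _ bigO0_minus, of n f g] by simp
lemma bigO0_zero: "bigO0 n (\<lambda>z. 0)" unfolding bigO0_def by (rule exI[of _ 0]) simp
lemma bigO0_sum: "(\<And>i. i \<in> I \<Longrightarrow> bigO0 n (f i)) \<Longrightarrow> bigO0 n (\<lambda>z. \<Sum>i\<in>I. f i z)"
  by (induction I rule: infinite_finite_induct) (auto intro: bigO0_add bigO0_zero)

lemma bigO0_cont: assumes "isCont f 0" shows "bigO0 0 f"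
proof -
  have "eventually (\<lambda>z. dist (f z) (f 0) < 1) (at 0)" using assms tendstoD[of f "f 0" "at 0" 1] by (simp add: isCont_def)
  then have "eventually (\<lambda>z. norm (f z) \<le> (norm (f 0) + 1) * norm z ^ 0) (at 0)"
  proof eventually_elim
    case (elim z) then show ?case using norm_triangle_ineq2[of "f z" "f 0"] by (simp add: dist_norm)
  qed
  then show ?thesis unfolding bigO0_def by blast
qed

lemma bigO0_cong: assumes "bigO0 n f" "eventually (\<lambda>z. f z = g z) (at 0)" shows "bigO0 n g"
proof -
  obtain B where "eventually (\<lambda>z. norm (f z) \<le> B * norm z ^ n) (at 0)" using assms unfolding bigO0_def by blast
  then have "eventually (\<lambda>z. norm (g z) \<le> B * norm z ^ n) (at 0)" using assms(2) by eventually_elim simp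
  then show ?thesis unfolding bigO0_def by blast
qed

text \<open>The form needed below: the polynomial is known only through an expression that makes sense off the circle,
off 0 and off the singular points, and the growth is known for that expression.\<close>

lemma polyfun_growth':
  assumes "polyfun f" "finite S" "\<And>z. norm z \<noteq> 1 \<Longrightarrow> z \<noteq> 0 \<Longrightarrow> z \<notin> S \<Longrightarrow> f z = g z"
    and "bigO0 n g" and "((\<lambda>z. g z / z ^ n) \<longlongrightarrow> c) at_infinity"
  shows "f z = c * z ^ n"
proof -
  have e0: "eventually (\<lambda>z. g z = f z) (at 0)" using zero_eventually_simple[OF assms(2)] by eventually_elim (use assms(3) in auto)
  have ei: "eventually (\<lambda>z. g z / z ^ n = f z / z ^ n) at_infinity" using infinity_eventually_simple[OF assms(2)] by eventually_elim (use assms(3) in auto)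
  have "bigO0 n f" using bigO0_cong[OF assms(4) e0] .
  then obtain B where "eventually (\<lambda>z. norm (f z) \<le> B * norm z ^ n) (at 0)" unfolding bigO0_def by blast
  then show ?thesis using polyfun_growth[OF assms(1) _ Lim_transform_eventually[OF assms(5) ei]] by blast
qed

lemma polyfun_matrix_vector: "(\<And>i. polyfun (\<lambda>z. v z $ i)) \<Longrightarrow> polyfun (\<lambda>z. ((M::complex^2^2) *v v z) $ i)"
  unfolding matrix_vector_mult_def by (simp add: sum_2) (intro polyfun_add polyfun_mult polyfun_const, blast+)

lemma matrix_vector_smult_right: "(M::complex^2^2) *v (c *s v) = c *s (M *v v)"
  unfolding Finite_Cartesian_Product.vec_eq_iff matrix_vector_mult_def by (simp add: sum_2 algebra_simps)

section \<open>A deformation equation from growth at 0 and infinity\<close>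

text \<open>Here \<open>f\<close> and \<open>x\<close> are the columns, \<open>df\<close> is the \<open>t\<close>-derivative of \<open>f\<close> and \<open>y\<close> is that of \<open>x\<close> after the
logarithmic \<open>t\<close>-derivative of the weight has been removed. The relations \<open>res1\<close> and \<open>res2\<close> say that adding
the poles \<open>s\<^sub>j A\<^sub>j / (z - a\<^sub>j)\<close> cancels those of \<open>df\<close> and \<open>y\<close>, so that the corrected derivatives are
\<open>Zf\<close> and \<open>F Zf + Zp\<close> with polynomial \<open>Zf\<close> and \<open>Zp\<close>. By Cramer's rule the matrix taking \<open>(f, x)\<close> to them has
entries \<open>N1\<close> and \<open>N2\<close> divided by \<open>- 2 z\<^sup>n\<close>. In these minors \<open>F\<close> drops out, so they are polynomials, and their
growth forces them to be multiples of \<open>z\<^sup>n\<close>.\<close>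

lemma deformation_by_growth:
  fixes f p df dp x y :: "complex \<Rightarrow> complex^2" and A :: "nat \<Rightarrow> complex^2^2"
  assumes J: "finite J"
    and polys: "\<And>i. polyfun (\<lambda>z. f z $ i)" "\<And>i. polyfun (\<lambda>z. p z $ i)" "\<And>i. polyfun (\<lambda>z. df z $ i)" "\<And>i. polyfun (\<lambda>z. dp z $ i)"
    and x: "\<And>z. norm z \<noteq> 1 \<Longrightarrow> z \<noteq> 0 \<Longrightarrow> z \<notin> a ` J \<Longrightarrow> x z = F z *s f z + p z"
    and y: "\<And>z. norm z \<noteq> 1 \<Longrightarrow> z \<noteq> 0 \<Longrightarrow> z \<notin> a ` J \<Longrightarrow> y z = F z *s df z
        + (\<Sum>j\<in>J. s j * \<rho> j * (cw + (z + a j) * I j) / (z - a j)) *s f z + dp z + (\<Sum>j\<in>J. s j * \<rho> j / (z - a j)) *s p z"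
    and res1: "\<And>j. j \<in> J \<Longrightarrow> s j \<noteq> 0 \<Longrightarrow> A j *v f (a j) = 0"
    and res2: "\<And>j. j \<in> J \<Longrightarrow> s j \<noteq> 0 \<Longrightarrow> A j *v p (a j) = - ((\<rho> j * (cw + 2 * a j * I j)) *s f (a j) + \<rho> j *s p (a j))"
    and s0: "\<And>j. j \<in> J \<Longrightarrow> s j \<noteq> 0 \<Longrightarrow> a j \<noteq> 0"
    and det: "\<And>z. norm z \<noteq> 1 \<Longrightarrow> z \<noteq> 0 \<Longrightarrow> z \<notin> a ` J \<Longrightarrow> f z $ 1 * x z $ 2 - f z $ 2 * x z $ 1 = - 2 * z ^ n"
    and O0: "\<And>i. bigO0 n (\<lambda>z. x z $ i)" "\<And>i. bigO0 n (\<lambda>z. y z $ i)"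
    and inf_f: "\<And>i. ((\<lambda>z. f z $ i / z ^ n) \<longlongrightarrow> fi $ i) at_infinity" "\<And>i. ((\<lambda>z. df z $ i / z ^ n) \<longlongrightarrow> dfi $ i) at_infinity"
    and inf_x: "\<And>i. ((\<lambda>z. x z $ i) \<longlongrightarrow> xi $ i) at_infinity" "\<And>i. ((\<lambda>z. y z $ i) \<longlongrightarrow> yi $ i) at_infinity"
    and Binf: "\<And>i. dfi $ i * xi $ 2 - yi $ i * fi $ 2 = - 2 * Binf $ i $ 1" "\<And>i. yi $ i * fi $ 1 - dfi $ i * xi $ 1 = - 2 * Binf $ i $ 2"
    and z: "norm z \<noteq> 1" "z \<noteq> 0" "z \<notin> a ` J"
  shows "df z + (\<Sum>j\<in>J. (s j / (z - a j)) *s (A j *v f z)) = Binf *v f z"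
    and "y z + (\<Sum>j\<in>J. (s j / (z - a j)) *s (A j *v x z)) = Binf *v x z"
proof -
  define zf where "zf z = df z + (\<Sum>j\<in>J. (s j / (z - a j)) *s (A j *v f z))" for z
  define zx where "zx z = y z + (\<Sum>j\<in>J. (s j / (z - a j)) *s (A j *v x z))" for z
  have "\<forall>j\<in>J. \<forall>i. \<exists>g. polyfun g \<and> (\<forall>z. s j * (A j *v f z) $ i = (z - a j) * g z)"
  proof (intro ballI allI)
    fix j and i :: 2 assume j: "j \<in> J"
    show "\<exists>g. polyfun g \<and> (\<forall>z. s j * (A j *v f z) $ i = (z - a j) * g z)"
    proof (rule polyfun_divide[of "\<lambda>z. s j * (A j *v f z) $ i" "a j"])
      show "polyfun (\<lambda>z. s j * (A j *v f z) $ i)" by (intro polyfun_mult polyfun_const polyfun_matrix_vector polys)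
      show "s j * (A j *v f (a j)) $ i = 0" using res1[OF j] by (cases "s j = 0") auto
    qed blast
  qed
  then obtain gf where gf: "\<And>j i. j \<in> J \<Longrightarrow> polyfun (gf j i)" "\<And>j i z. j \<in> J \<Longrightarrow> s j * (A j *v f z) $ i = (z - a j) * gf j i z"
    by metis
  define num where "num j z = s j *s ((\<rho> j * (cw + (z + a j) * I j)) *s f z + \<rho> j *s p z + A j *v p z)" for j z
  have "\<forall>j\<in>J. \<forall>i. \<exists>g. polyfun g \<and> (\<forall>z. num j z $ i = (z - a j) * g z)"
  proof (intro ballI allI)
    fix j and i :: 2 assume j: "j \<in> J"
    show "\<exists>g. polyfun g \<and> (\<forall>z. num j z $ i = (z - a j) * g z)"
    proof (rule polyfun_divide[of "\<lambda>z. num j z $ i" "a j"])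
      show "polyfun (\<lambda>z. num j z $ i)" unfolding num_def
        by (simp only: vector_smult_component vector_add_component)
           (intro polyfun_mult polyfun_add polyfun_const polyfun_id polyfun_matrix_vector polys)
      show "num j (a j) $ i = 0"
      proof (cases "s j = 0")
        case False
        show ?thesis unfolding num_def res2[OF j False] mult_2[symmetric] by simp
      qed (simp add: num_def)
    qed blast
  qed
  then obtain gp where gp: "\<And>j i. j \<in> J \<Longrightarrow> polyfun (gp j i)" "\<And>j i z. j \<in> J \<Longrightarrow> num j z $ i = (z - a j) * gp j i z"
    by metis
  define Zf where "Zf i z = df z $ i + (\<Sum>j\<in>J. gf j i z)" for i z
  define Zp where "Zp i z = dp z $ i + (\<Sum>j\<in>J. gp j i z)" for i z
  have Zf_poly: "polyfun (Zf i)" for i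
    using polyfun_add[OF polys(3)[of i] polyfun_sum[of J "\<lambda>j. gf j i"]] gf(1) by (simp add: Zf_def[abs_def])
  have Zp_poly: "polyfun (Zp i)" for i
    using polyfun_add[OF polys(4)[of i] polyfun_sum[of J "\<lambda>j. gp j i"]] gp(1) by (simp add: Zp_def[abs_def])
  have zf_eq: "zf z $ i = Zf i z" if "z \<notin> a ` J" for z i
  proof -
    have "s j / (z - a j) * (A j *v f z) $ i = gf j i z" if j: "j \<in> J" for j
    proof -
      have "z - a j \<noteq> 0" using \<open>z \<notin> a ` J\<close> j by auto
      then show ?thesis using gf(2)[OF j, of z i] by (simp add: field_simps)
    qed
    then show ?thesis unfolding zf_def Zf_def by (simp add: sum_component)
  qed
  have zx_eq: "zx z $ i = F z * Zf i z + Zp i z" if z: "norm z \<noteq> 1" "z \<noteq> 0" "z \<notin> a ` J" for z i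
  proof -
    have nz: "z - a j \<noteq> 0" if "j \<in> J" for j using z(3) that by auto
    have t: "s j * \<rho> j * (cw + (z + a j) * I j) / (z - a j) * f z $ i + s j * \<rho> j / (z - a j) * p z $ i
         + s j / (z - a j) * (A j *v x z) $ i = F z * gf j i z + gp j i z" if j: "j \<in> J" for j
    proof -
      have Ax: "A j *v x z = F z *s (A j *v f z) + A j *v p z"
        using x[OF z] by (simp add: matrix_vector_right_distrib matrix_vector_smult_right)
      have "(z - a j) * (F z * gf j i z + gp j i z) = F z * (s j * (A j *v f z) $ i) + num j z $ i"
        unfolding gf(2)[OF j] gp(2)[OF j] by (simp add: algebra_simps)
      also have "\<dots> = s j * \<rho> j * (cw + (z + a j) * I j) * f z $ i + s j * \<rho> j * p z $ i + s j * (A j *v x z) $ i"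
        unfolding Ax num_def by (simp add: algebra_simps)
      finally show ?thesis using nz[OF j] by (simp add: divide_simps mult.commute)
    qed
    have "zx z $ i = F z * df z $ i + dp z $ i + (\<Sum>j\<in>J. s j * \<rho> j * (cw + (z + a j) * I j) / (z - a j) * f z $ i
       + s j * \<rho> j / (z - a j) * p z $ i + s j / (z - a j) * (A j *v x z) $ i)"
      unfolding zx_def y[OF z] by (simp add: sum_component sum.distrib sum_distrib_right)
    also have "\<dots> = F z * df z $ i + dp z $ i + (\<Sum>j\<in>J. F z * gf j i z + gp j i z)"
      by (simp only: sum.cong[OF refl t])
    also have "\<dots> = F z * Zf i z + Zp i z" unfolding Zf_def Zp_def by (simp add: sum.distrib sum_distrib_left algebra_simps)
    finally show ?thesis .
  qed
  \<comment> \<open>the numerators given by the rule of Cramer; in terms of \<open>Zf\<close> and \<open>Zp\<close> they are free of \<open>F\<close>\<close>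
  define N1 where "N1 i z = Zf i z * p z $ 2 - Zp i z * f z $ 2" for i z
  define N2 where "N2 i z = Zp i z * f z $ 1 - Zf i z * p z $ 1" for i z
  have N_poly: "polyfun (N1 i)" "polyfun (N2 i)" for i
    unfolding N1_def N2_def by (intro polyfun_diff polyfun_mult Zf_poly Zp_poly polys)+
  have N_eq: "N1 i z = zf z $ i * x z $ 2 - zx z $ i * f z $ 2" "N2 i z = zx z $ i * f z $ 1 - zf z $ i * x z $ 1"
    if z: "norm z \<noteq> 1" "z \<noteq> 0" "z \<notin> a ` J" for z i
    unfolding N1_def N2_def zf_eq[OF z(3)] zx_eq[OF z] x[OF z] by (simp_all add: algebra_simps)
  have fO: "bigO0 0 (\<lambda>z. f z $ i)" for i by (intro bigO0_cont polyfun_isCont polys)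
  have zfO: "bigO0 0 (\<lambda>z. zf z $ i)" for i
  proof (rule bigO0_cong)
    show "bigO0 0 (Zf i)" by (intro bigO0_cont polyfun_isCont Zf_poly)
    show "eventually (\<lambda>z. Zf i z = zf z $ i) (at 0)"
      using zero_eventually_simple[OF finite_imageI[OF J, of a]] by eventually_elim (use zf_eq in auto)
  qed
  have zxO: "bigO0 n (\<lambda>z. zx z $ i)" for i
  proof -
    have "bigO0 n (\<lambda>z. s j / (z - a j) * (A j *v x z) $ i)" if j: "j \<in> J" for j
    proof (cases "s j = 0")
      case True then show ?thesis by (simp add: bigO0_zero)
    next
      case False
      have "bigO0 n (\<lambda>z. (A j *v x z) $ i)"
        unfolding matrix_vector_mult_def by (simp add: sum_2) (intro bigO0_add bigO0_mult O0 bigO0_cont, auto)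
      then show ?thesis using s0[OF j False] by (intro bigO0_mult bigO0_cont continuous_intros) auto
    qed
    then show ?thesis unfolding zx_def by (simp add: sum_component) (intro bigO0_add O0 bigO0_sum, blast)
  qed
  have NO: "bigO0 n (\<lambda>z. zf z $ i * x z $ 2 - zx z $ i * f z $ 2)" "bigO0 n (\<lambda>z. zx z $ i * f z $ 1 - zf z $ i * x z $ 1)" for i
    using bigO0_diff[OF bigO0_mult[OF O0(1)[of 2] zfO[of i]] bigO0_mult[OF zxO[of i] fO[of 2]]]
      bigO0_diff[OF bigO0_mult[OF zxO[of i] fO[of 1]] bigO0_mult[OF O0(1)[of 1] zfO[of i]]] by (simp_all add: mult.commute)
  have zf_inf: "((\<lambda>z. zf z $ i / z ^ n) \<longlongrightarrow> dfi $ i) at_infinity" for i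
  proof -
    have "((\<lambda>z. df z $ i / z ^ n + (\<Sum>j\<in>J. s j / (z - a j) * (A j $ i $ 1 * (f z $ 1 / z ^ n) + A j $ i $ 2 * (f z $ 2 / z ^ n))))
       \<longlongrightarrow> dfi $ i + (\<Sum>j\<in>J. 0 * (A j $ i $ 1 * fi $ 1 + A j $ i $ 2 * fi $ 2))) at_infinity"
      by (intro tendsto_intros inf_f tendsto_inverse_shift_infinity)
    moreover have "zf z $ i / z ^ n = df z $ i / z ^ n + (\<Sum>j\<in>J. s j / (z - a j) * (A j $ i $ 1 * (f z $ 1 / z ^ n) + A j $ i $ 2 * (f z $ 2 / z ^ n)))" for z
      unfolding zf_def by (simp add: sum_component matrix_vector_mult_def sum_2 add_divide_distrib sum_divide_distrib distrib_left mult_ac)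
    ultimately show ?thesis by simp
  qed
  have zx_inf: "((\<lambda>z. zx z $ i) \<longlongrightarrow> yi $ i) at_infinity" for i
  proof -
    have "((\<lambda>z. y z $ i + (\<Sum>j\<in>J. s j / (z - a j) * (A j $ i $ 1 * (x z $ 1) + A j $ i $ 2 * (x z $ 2))))
       \<longlongrightarrow> yi $ i + (\<Sum>j\<in>J. 0 * (A j $ i $ 1 * xi $ 1 + A j $ i $ 2 * xi $ 2))) at_infinity"
      by (intro tendsto_intros inf_x tendsto_inverse_shift_infinity)
    then show ?thesis unfolding zx_def by (simp add: sum_component matrix_vector_mult_def sum_2)
  qed
  have Ninf: "((\<lambda>z. (zf z $ i * x z $ 2 - zx z $ i * f z $ 2) / z ^ n) \<longlongrightarrow> - 2 * Binf $ i $ 1) at_infinity"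
       "((\<lambda>z. (zx z $ i * f z $ 1 - zf z $ i * x z $ 1) / z ^ n) \<longlongrightarrow> - 2 * Binf $ i $ 2) at_infinity" for i
  proof -
    have "((\<lambda>z. zf z $ i / z ^ n * x z $ 2 - zx z $ i * (f z $ 2 / z ^ n)) \<longlongrightarrow> dfi $ i * xi $ 2 - yi $ i * fi $ 2) at_infinity"
      by (intro tendsto_intros inf_f inf_x zf_inf zx_inf)
    then show "((\<lambda>z. (zf z $ i * x z $ 2 - zx z $ i * f z $ 2) / z ^ n) \<longlongrightarrow> - 2 * Binf $ i $ 1) at_infinity"
      unfolding Binf(1)[symmetric] by (simp add: diff_divide_distrib)
    have "((\<lambda>z. zx z $ i * (f z $ 1 / z ^ n) - zf z $ i / z ^ n * x z $ 1) \<longlongrightarrow> yi $ i * fi $ 1 - dfi $ i * xi $ 1) at_infinity"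
      by (intro tendsto_intros inf_f inf_x zf_inf zx_inf)
    then show "((\<lambda>z. (zx z $ i * f z $ 1 - zf z $ i * x z $ 1) / z ^ n) \<longlongrightarrow> - 2 * Binf $ i $ 2) at_infinity"
      unfolding Binf(2)[symmetric] by (simp add: diff_divide_distrib)
  qed
  have N: "N1 i z = - 2 * Binf $ i $ 1 * z ^ n" "N2 i z = - 2 * Binf $ i $ 2 * z ^ n" for i
    by (rule polyfun_growth'[OF N_poly(1) finite_imageI[OF J] N_eq(1) NO(1) Ninf(1)]; assumption)
       (rule polyfun_growth'[OF N_poly(2) finite_imageI[OF J] N_eq(2) NO(2) Ninf(2)]; assumption)
  have R1: "(- 2 * z ^ n) * zf z $ i = (- 2 * z ^ n) * (Binf *v f z) $ i" for i
  proof -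
    have "(- 2 * z ^ n) * zf z $ i = (f z $ 1 * x z $ 2 - f z $ 2 * x z $ 1) * zf z $ i" using det[OF z] by simp
    also have "\<dots> = N1 i z * f z $ 1 + N2 i z * f z $ 2" unfolding N_eq[OF z] by (simp add: algebra_simps)
    finally show ?thesis unfolding N by (simp add: matrix_vector_mult_def sum_2 algebra_simps)
  qed
  have R2: "(- 2 * z ^ n) * zx z $ i = (- 2 * z ^ n) * (Binf *v x z) $ i" for i
  proof -
    have "(- 2 * z ^ n) * zx z $ i = (f z $ 1 * x z $ 2 - f z $ 2 * x z $ 1) * zx z $ i" using det[OF z] by simp
    also have "\<dots> = N1 i z * x z $ 1 + N2 i z * x z $ 2" unfolding N_eq[OF z] by (simp add: algebra_simps)
    finally show ?thesis unfolding N by (simp add: matrix_vector_mult_def sum_2 algebra_simps)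
  qed
  show "df z + (\<Sum>j\<in>J. (s j / (z - a j)) *s (A j *v f z)) = Binf *v f z"
    using R1 z(2) by (simp add: Finite_Cartesian_Product.vec_eq_iff zf_def[symmetric])
  show "y z + (\<Sum>j\<in>J. (s j / (z - a j)) *s (A j *v x z)) = Binf *v x z"
    using R2 z(2) by (simp add: Finite_Cartesian_Product.vec_eq_iff zx_def[symmetric])
qed

section \<open>Partial fractions and cross differentiation\<close>

lemma has_vector_derivative_iff_quotient:
  fixes f :: "real \<Rightarrow> 'a::real_normed_vector"
  shows "(f has_vector_derivative D) (at x) \<longleftrightarrow> ((\<lambda>y. (f y - f x) /\<^sub>R (y - x)) \<longlongrightarrow> D) (at x)"
proof -
  have "(f has_vector_derivative D) (at x) \<longleftrightarrow> ((\<lambda>y. norm (f y - f x - (y - x) *\<^sub>R D) / norm (y - x)) \<longlongrightarrow> 0) (at x)"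
    unfolding has_vector_derivative_def has_derivative_iff_norm by (simp add: bounded_linear_scaleR_left)
  also have "\<dots> \<longleftrightarrow> ((\<lambda>y. norm ((f y - f x) /\<^sub>R (y - x) - D)) \<longlongrightarrow> 0) (at x)"
  proof (rule filterlim_cong[OF refl refl])
    show "eventually (\<lambda>y. norm (f y - f x - (y - x) *\<^sub>R D) / norm (y - x) = norm ((f y - f x) /\<^sub>R (y - x) - D)) (at x)"
    proof (rule eventually_mono[OF eventually_neq_at_within])
      fix y assume "y \<noteq> x"
      then have "(f y - f x) /\<^sub>R (y - x) - D = (f y - f x - (y - x) *\<^sub>R D) /\<^sub>R (y - x)"
        by (simp add: scaleR_diff_right)
      then show "norm (f y - f x - (y - x) *\<^sub>R D) / norm (y - x) = norm ((f y - f x) /\<^sub>R (y - x) - D)"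
        by (simp add: divide_inverse mult.commute)
    qed
  qed
  also have "\<dots> \<longleftrightarrow> ((\<lambda>y. (f y - f x) /\<^sub>R (y - x)) \<longlongrightarrow> D) (at x)"
    by (simp add: tendsto_norm_zero_iff LIM_zero_iff)
  finally show ?thesis .
qed

text \<open>Multiplying by \<open>z - a\<^sub>k\<close> turns one pole into a constant, and subtracting the value at a reference point \<open>p\<close>
removes that constant; what remains is a partial fraction with one pole fewer.\<close>

lemma partial_fraction_zero:
  fixes a c :: "'i \<Rightarrow> complex"
  assumes "finite J" "inj_on a J" "infinite D" "\<And>z. z \<in> D \<Longrightarrow> z \<notin> a ` J"
    and "\<And>z. z \<in> D \<Longrightarrow> (\<Sum>j\<in>J. c j / (z - a j)) = 0"
  shows "\<forall>j\<in>J. c j = 0"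
  using assms
proof (induction J arbitrary: c D rule: finite_induct)
  case (insert k J)
  obtain p where p: "p \<in> D" using insert.prems(2) by (metis ex_in_conv finite.emptyI)
  have ne: "z - a j \<noteq> 0" if "z \<in> D" "j \<in> insert k J" for z j using insert.prems(3)[OF that(1)] that(2) by auto
  have ak: "a j - a k \<noteq> 0" if "j \<in> J" for j using insert.prems(1) insert.hyps that by (auto simp: inj_on_def)
  define S where "S z = (\<Sum>j\<in>insert k J. c j / (z - a j))" for z
  have S: "(z - a k) * S z = c k + (\<Sum>j\<in>J. c j + c j * (a j - a k) / (z - a j))" if "z \<in> D" for z
  proof -
    have "(z - a k) * (c j / (z - a j)) = c j + c j * (a j - a k) / (z - a j)" if "j \<in> J" for j
      using ne[OF \<open>z \<in> D\<close>, of j] that by (simp add: divide_simps) (simp add: algebra_simps)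
    then have "(\<Sum>j\<in>J. (z - a k) * (c j / (z - a j))) = (\<Sum>j\<in>J. c j + c j * (a j - a k) / (z - a j))" by (rule sum.cong[OF refl])
    moreover have "(z - a k) * (c k / (z - a k)) = c k" using ne[OF that, of k] by simp
    ultimately show ?thesis unfolding S_def using insert.hyps by (simp add: distrib_left sum_distrib_left)
  qed
  have "\<forall>j\<in>J. c j * (a j - a k) / (p - a j) = 0"
  proof (rule insert.IH)
    show "inj_on a J" using insert.prems(1) by simp
    show "infinite (D - {p})" using insert.prems(2) by simp
    show "z \<notin> a ` J" if "z \<in> D - {p}" for z using insert.prems(3) that by auto
    fix z assume z: "z \<in> D - {p}"
    have "(\<Sum>j\<in>J. c j + c j * (a j - a k) / (z - a j)) = (\<Sum>j\<in>J. c j + c j * (a j - a k) / (p - a j))"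
    proof -
      have S0: "S z = 0" "S p = 0" unfolding S_def using insert.prems(4) z p by blast+
      have zD: "z \<in> D" using z by blast
      have "c k + (\<Sum>j\<in>J. c j + c j * (a j - a k) / (z - a j)) = c k + (\<Sum>j\<in>J. c j + c j * (a j - a k) / (p - a j))"
        unfolding S[OF zD, symmetric] S[OF p, symmetric] S0 by simp
      then show ?thesis by (rule add_left_imp_eq)
    qed
    then have "0 = (\<Sum>j\<in>J. c j * (a j - a k) / (z - a j) - c j * (a j - a k) / (p - a j))"
      by (simp add: sum.distrib sum_subtractf)
    also have "\<dots> = (\<Sum>j\<in>J. (p - z) * (c j * (a j - a k) / (p - a j) / (z - a j)))"
    proof (rule sum.cong[OF refl])
      fix j assume "j \<in> J"
      then have n: "z - a j \<noteq> 0" "p - a j \<noteq> 0" using ne[of z j] ne[of p j] z p by auto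
      show "c j * (a j - a k) / (z - a j) - c j * (a j - a k) / (p - a j) = (p - z) * (c j * (a j - a k) / (p - a j) / (z - a j))"
        using n by (simp add: divide_simps) (simp add: algebra_simps)
    qed
    finally have "(p - z) * (\<Sum>j\<in>J. c j * (a j - a k) / (p - a j) / (z - a j)) = 0" by (simp add: sum_distrib_left)
    then show "(\<Sum>j\<in>J. c j * (a j - a k) / (p - a j) / (z - a j)) = 0" using z by auto
  qed
  then have H: "c j * (a j - a k) / (p - a j) = 0" if "j \<in> J" for j using that by blast
  have cj: "c j = 0" if "j \<in> J" for j using H[OF that] ak[OF that] ne[OF p, of j] that by simp
  have "(\<Sum>j\<in>J. c j / (p - a j)) = 0" by (intro sum.neutral ballI) (simp only: cj div_0)
  then have "c k / (p - a k) = 0" using insert.prems(4)[OF p] sum.insert[OF insert.hyps, of "\<lambda>j. c j / (p - a j)"] by (simp only: add_0_right)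
  then have "c k = 0" using ne[OF p, of k] by simp
  then show ?case using cj by blast
qed simp

lemma differentiable_eventually:
  fixes f :: "real \<Rightarrow> complex"
  assumes "f differentiable (at t0)" "eventually (\<lambda>t. f t = g t) (nhds t0)"
  shows "g differentiable (at t0)"
proof -
  obtain d where "d > 0" "\<And>t. dist t t0 < d \<Longrightarrow> f t = g t" using assms(2) unfolding eventually_nhds_metric by blast
  then show ?thesis using differentiable_transform_within[OF assms(1), of d] by auto
qed

text \<open>The pole-by-pole elimination of the preceding uniqueness proof, carried out with \<open>t\<close>-dependent poles: each step
uses only products, quotients and differences of differentiable functions.\<close>

lemma partial_fraction_differentiable:
  fixes a c :: "real \<Rightarrow> 'i \<Rightarrow> complex"
  assumes "finite J" "inj_on (a t0) J" "infinite D"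
    and "\<And>j. j \<in> J \<Longrightarrow> (\<lambda>t. a t j) differentiable (at t0)"
    and "\<And>z. z \<in> D \<Longrightarrow> eventually (\<lambda>t. z \<notin> a t ` J) (nhds t0)"
    and "\<And>z. z \<in> D \<Longrightarrow> (\<lambda>t. \<Sum>j\<in>J. c t j / (z - a t j)) differentiable (at t0)"
  shows "\<forall>j\<in>J. (\<lambda>t. c t j) differentiable (at t0)"
  using assms
proof (induction J arbitrary: c D rule: finite_induct)
  case (insert k J)
  obtain p where p: "p \<in> D" using insert.prems(2) by (metis ex_in_conv finite.emptyI)
  define S where "S z t = (\<Sum>j\<in>insert k J. c t j / (z - a t j))" for z t
  have Sd: "S z differentiable (at t0)" if "z \<in> D" for z using insert.prems(5)[OF that] by (simp add: S_def[abs_def])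
  have ad: "(\<lambda>t. a t j) differentiable (at t0)" if "j \<in> insert k J" for j using insert.prems(3)[OF that] .
  have ne0: "z - a t0 j \<noteq> 0" if "z \<in> D" "j \<in> insert k J" for z j
    using eventually_nhds_x_imp_x[OF insert.prems(4)[OF that(1)]] that(2) by auto
  have S: "(z - a t k) * S z t = c t k + (\<Sum>j\<in>J. c t j + c t j * (a t j - a t k) / (z - a t j))" if n: "z \<notin> a t ` insert k J" for z t
  proof -
    have ne: "z - a t j \<noteq> 0" if "j \<in> insert k J" for j using n that by auto
    have "(z - a t k) * (c t j / (z - a t j)) = c t j + c t j * (a t j - a t k) / (z - a t j)" if "j \<in> J" for j
      using ne[of j] that by (simp add: divide_simps) (simp add: algebra_simps)
    then have "(\<Sum>j\<in>J. (z - a t k) * (c t j / (z - a t j))) = (\<Sum>j\<in>J. c t j + c t j * (a t j - a t k) / (z - a t j))" by (rule sum.cong[OF refl])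
    moreover have "(z - a t k) * (c t k / (z - a t k)) = c t k" using ne[of k] by simp
    ultimately show ?thesis unfolding S_def using insert.hyps by (simp add: distrib_left sum_distrib_left)
  qed
  define b where "b t j = c t j * (a t j - a t k) / (p - a t j)" for t j
  have bd: "\<forall>j\<in>J. (\<lambda>t. b t j) differentiable (at t0)"
  proof (rule insert.IH)
    show "inj_on (a t0) J" using insert.prems(1) by simp
    show "infinite (D - {p})" using insert.prems(2) by simp
    show "(\<lambda>t. a t j) differentiable (at t0)" if "j \<in> J" for j using ad that by simp
    show "eventually (\<lambda>t. z \<notin> a t ` J) (nhds t0)" if "z \<in> D - {p}" for z
      using insert.prems(4)[of z] that by (auto elim: eventually_mono)
    fix z assume z: "z \<in> D - {p}"
    have zD: "z \<in> D" "z \<noteq> p" using z by auto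
    have "(\<lambda>t. ((z - a t k) * S z t - (p - a t k) * S p t) / (p - z)) differentiable (at t0)"
      using z by (intro differentiable_divide differentiable_diff differentiable_mult differentiable_const ad Sd p) auto
    moreover have "eventually (\<lambda>t. ((z - a t k) * S z t - (p - a t k) * S p t) / (p - z) = (\<Sum>j\<in>J. b t j / (z - a t j))) (nhds t0)"
      using insert.prems(4)[OF zD(1)] insert.prems(4)[OF p]
    proof eventually_elim
      case (elim t)
      have "(z - a t k) * S z t - (p - a t k) * S p t = (\<Sum>j\<in>J. c t j * (a t j - a t k) / (z - a t j) - c t j * (a t j - a t k) / (p - a t j))"
        using S[of z t] S[of p t] elim by (simp add: sum.distrib sum_subtractf)
      also have "\<dots> = (\<Sum>j\<in>J. (p - z) * (b t j / (z - a t j)))"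
      proof (rule sum.cong[OF refl])
        fix j assume "j \<in> J"
        then have n: "z - a t j \<noteq> 0" "p - a t j \<noteq> 0" using elim by auto
        show "c t j * (a t j - a t k) / (z - a t j) - c t j * (a t j - a t k) / (p - a t j) = (p - z) * (b t j / (z - a t j))"
          unfolding b_def using n by (simp add: divide_simps) (simp add: algebra_simps)
      qed
      finally have "(z - a t k) * S z t - (p - a t k) * S p t = (p - z) * (\<Sum>j\<in>J. b t j / (z - a t j))"
        by (simp only: sum_distrib_left)
      then show ?case using zD by simp
    qed
    ultimately show "(\<lambda>t. \<Sum>j\<in>J. b t j / (z - a t j)) differentiable (at t0)" by (rule differentiable_eventually)
  qed
  have cd: "(\<lambda>t. c t j) differentiable (at t0)" if j: "j \<in> J" for j
  proof (rule differentiable_eventually)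
    have akj: "a t0 j - a t0 k \<noteq> 0" using insert.prems(1) insert.hyps j by (auto simp: inj_on_def)
    show "(\<lambda>t. b t j * (p - a t j) / (a t j - a t k)) differentiable (at t0)"
      using akj j bd by (intro differentiable_divide differentiable_mult differentiable_diff differentiable_const ad) auto
    have "isCont (\<lambda>t. a t j - a t k) t0" using ad j
      by (intro continuous_intros differentiable_imp_continuous_within) auto
    then have "((\<lambda>t. a t j - a t k) \<longlongrightarrow> a t0 j - a t0 k) (nhds t0)" by (simp only: isCont_def tendsto_nhds_iff simp_thms)
    then have "eventually (\<lambda>t. a t j - a t k \<noteq> 0) (nhds t0)"
      using akj by (rule tendsto_imp_eventually_ne)
    then show "eventually (\<lambda>t. b t j * (p - a t j) / (a t j - a t k) = c t j) (nhds t0)"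
      using insert.prems(4)[OF p]
    proof eventually_elim
      case (elim t)
      then have "p - a t j \<noteq> 0" using j by auto
      then show ?case using elim by (simp add: b_def)
    qed
  qed
  have ck: "(\<lambda>t. c t k) differentiable (at t0)"
  proof (rule differentiable_eventually)
    show "(\<lambda>t. (p - a t k) * (S p t - (\<Sum>j\<in>J. c t j / (p - a t j)))) differentiable (at t0)"
      using ne0[OF p] insert.hyps
      by (intro differentiable_mult differentiable_diff differentiable_const ad Sd p differentiable_sum differentiable_divide cd ballI) auto
    show "eventually (\<lambda>t. (p - a t k) * (S p t - (\<Sum>j\<in>J. c t j / (p - a t j))) = c t k) (nhds t0)"
      using insert.prems(4)[OF p]
    proof eventually_elim
      case (elim t)
      then have "p - a t k \<noteq> 0" by auto
      then show ?case using insert.hyps by (simp add: S_def)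
    qed
  qed
  show ?case using cd ck by simp
qed simp

text \<open>Split \<open>1 / ((z - a\<^sub>j) (z - a\<^sub>k))\<close> into simple poles. Antisymmetry of \<open>c\<close> removes the double poles on the
diagonal and lets the two families of simple poles be collected into differences \<open>s\<^sub>j - s\<^sub>k\<close>.\<close>

lemma double_partial_fraction:
  fixes a s :: "'i \<Rightarrow> complex" and c :: "'i \<Rightarrow> 'i \<Rightarrow> complex"
  assumes J: "finite J" and inj: "inj_on a J" and z: "z \<notin> a ` J"
    and anti: "\<And>j k. j \<in> J \<Longrightarrow> k \<in> J \<Longrightarrow> c j k = - c k j"
  shows "(\<Sum>j\<in>J. \<Sum>k\<in>J. s j * c j k / ((z - a j) * (z - a k)))
    = - (\<Sum>j\<in>J. (\<Sum>k\<in>J - {j}. (s j - s k) / (a j - a k) * c k j) / (z - a j))"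
proof -
  define T where "T j k = s j * c j k / ((a j - a k) * (z - a j))" for j k
  define T' where "T' j k = s j * c j k / ((a j - a k) * (z - a k))" for j k
  have nz: "z - a j \<noteq> 0" if "j \<in> J" for j using z that by auto
  have cjj: "c j j = 0" if "j \<in> J" for j using anti[OF that that] by simp
  have "(\<Sum>j\<in>J. \<Sum>k\<in>J. s j * c j k / ((z - a j) * (z - a k))) = (\<Sum>j\<in>J. \<Sum>k\<in>J. T j k - T' j k)"
  proof (intro sum.cong refl)
    fix j k assume jk: "j \<in> J" "k \<in> J"
    show "s j * c j k / ((z - a j) * (z - a k)) = T j k - T' j k"
    proof (cases "j = k")
      case True then show ?thesis using cjj jk by (simp add: T_def T'_def)
    next
      case False
      then have "a j - a k \<noteq> 0" using inj jk by (auto simp: inj_on_def)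
      then show ?thesis using nz[OF jk(1)] nz[OF jk(2)] unfolding T_def T'_def
        by (simp add: divide_simps) (simp add: algebra_simps)
    qed
  qed
  also have "\<dots> = (\<Sum>j\<in>J. \<Sum>k\<in>J. T j k) - (\<Sum>j\<in>J. \<Sum>k\<in>J. T' j k)" by (simp add: sum_subtractf)
  also have "(\<Sum>j\<in>J. \<Sum>k\<in>J. T' j k) = (\<Sum>j\<in>J. \<Sum>k\<in>J. T' k j)" by (rule sum.swap)
  also have "(\<Sum>j\<in>J. \<Sum>k\<in>J. T j k) - (\<Sum>j\<in>J. \<Sum>k\<in>J. T' k j) = (\<Sum>j\<in>J. \<Sum>k\<in>J. T j k - T' k j)" by (simp add: sum_subtractf)
  also have "\<dots> = (\<Sum>j\<in>J. - (\<Sum>k\<in>J - {j}. (s j - s k) / (a j - a k) * c k j) / (z - a j))"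
  proof (rule sum.cong[OF refl])
    fix j assume j: "j \<in> J"
    have "(\<Sum>k\<in>J. T j k - T' k j) = (\<Sum>k\<in>J - {j}. T j k - T' k j)"
      using J j by (subst sum.remove[of J j]) (auto simp: T_def T'_def)
    also have "\<dots> = (\<Sum>k\<in>J - {j}. - ((s j - s k) / (a j - a k) * c k j) / (z - a j))"
    proof (rule sum.cong[OF refl])
      fix k assume k: "k \<in> J - {j}"
      then have n: "a j - a k \<noteq> 0" "a k - a j \<noteq> 0" using inj j by (auto simp: inj_on_def)
      have e: "a k - a j = - (a j - a k)" by simp
      have c: "c j k = - c k j" using anti j k by blast
      show "T j k - T' k j = - ((s j - s k) / (a j - a k) * c k j) / (z - a j)"
        unfolding T_def T'_def c e using n nz[OF j] by (simp add: divide_simps) (simp add: algebra_simps)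
    qed
    finally show "(\<Sum>k\<in>J. T j k - T' k j) = - (\<Sum>k\<in>J - {j}. (s j - s k) / (a j - a k) * c k j) / (z - a j)"
      by (simp add: sum_negf sum_divide_distrib)
  qed
  finally show ?thesis by (simp add: sum_negf)
qed

lemma has_vector_derivative_entries:
  fixes M :: "real \<Rightarrow> complex^2^2"
  assumes "\<And>i k. ((\<lambda>t. M t $ i $ k) has_vector_derivative M' $ i $ k) (at t0)"
  shows "(M has_vector_derivative M') (at t0)"
proof -
  have "((\<lambda>t. ((M t - M t0) /\<^sub>R (t - t0)) $ i $ k) \<longlongrightarrow> M' $ i $ k) (at t0)" for i k
    using assms[of i k] unfolding has_vector_derivative_iff_quotient by simp
  then show ?thesis unfolding has_vector_derivative_iff_quotient by (intro vec_tendstoI)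
qed

lemma partial_fraction_matrix_entry:
  "partial_fraction_matrix m a R z $ i $ k = (\<Sum>j\<in>{1..m}. R j $ i $ k / (z - a j))"
  by (simp add: partial_fraction_matrix_def sum_component smult_matrix_def map_matrix_def)

lemma commutator_entry:
  "commutator M N $ i $ l = M $ i $ 1 * N $ 1 $ l + M $ i $ 2 * N $ 2 $ l - (N $ i $ 1 * M $ 1 $ l + N $ i $ 2 * M $ 2 $ l)"
  by (simp add: commutator_def matrix_matrix_mult_def sum_2)

text \<open>The index \<open>c\<close> runs over the two columns. A column solves the \<open>z\<close>-equation and the \<open>t\<close>-equation up to the scalar
multiples \<open>v\<close> and \<open>u\<close>, which record that the second column of the fundamental matrix has been multiplied by the weight;
these scalars disappear from the compatibility condition because \<open>\<partial>\<^sub>t v = v' = \<partial>\<^sub>z u\<close>.\<close>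

lemma schlesinger_from_cross_differentiation:
  fixes zs :: "real \<Rightarrow> nat \<Rightarrow> complex" and A :: "real \<Rightarrow> nat \<Rightarrow> complex^2^2" and s :: "nat \<Rightarrow> complex"
    and X X' :: "2 \<Rightarrow> real \<Rightarrow> complex \<Rightarrow> complex^2" and dX Q :: "2 \<Rightarrow> complex \<Rightarrow> complex^2"
    and v :: "2 \<Rightarrow> real \<Rightarrow> complex \<Rightarrow> complex" and u v' :: "2 \<Rightarrow> complex \<Rightarrow> complex" and Binf :: "complex^2^2"
  assumes inj: "inj_on (zs t0) {1..m}" and D: "open D" "D \<noteq> {}"
    and zs: "\<And>j. j \<in> {1..m} \<Longrightarrow> ((\<lambda>t. zs t j) has_vector_derivative s j) (at t0)"
    and off: "eventually (\<lambda>t. \<forall>z\<in>D. z \<notin> zs t ` {1..m}) (nhds t0)"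
    and spec: "eventually (\<lambda>t. \<forall>z\<in>D. \<forall>c. X' c t z = partial_fraction_matrix m (zs t) (A t) z *v X c t z + v c t z *s X c t z) (nhds t0)"
    and det: "eventually (\<lambda>t. \<forall>z\<in>D. X 1 t z $ 1 * X 2 t z $ 2 - X 1 t z $ 2 * X 2 t z $ 1 \<noteq> 0) (nhds t0)"
    and Xt: "\<And>z c i. z \<in> D \<Longrightarrow> ((\<lambda>t. X c t z $ i) has_vector_derivative dX c z $ i) (at t0)"
    and lax: "\<And>z c. z \<in> D \<Longrightarrow> dX c z = Binf *v X c t0 z - (\<Sum>j\<in>{1..m}. (s j / (z - zs t0 j)) *s (A t0 j *v X c t0 z)) + u c z *s X c t0 z"
    and Xz: "\<And>z c i. z \<in> D \<Longrightarrow> ((\<lambda>z. X c t0 z $ i) has_field_derivative X' c t0 z $ i) (at z)"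
    and X't: "\<And>z c i. z \<in> D \<Longrightarrow> ((\<lambda>t. X' c t z $ i) has_vector_derivative Q c z $ i) (at t0)"
    and dXz: "\<And>z c i. z \<in> D \<Longrightarrow> ((\<lambda>z. dX c z $ i) has_field_derivative Q c z $ i) (at z)"
    and vt: "\<And>z c. z \<in> D \<Longrightarrow> ((\<lambda>t. v c t z) has_vector_derivative v' c z) (at t0)"
    and uz: "\<And>z c. z \<in> D \<Longrightarrow> (u c has_field_derivative v' c z) (at z)"
  shows "\<forall>j\<in>{1..m}. ((\<lambda>t. A t j) has_vector_derivative
      (commutator Binf (A t0 j) + (\<Sum>k\<in>{1..m} - {j}. smult_matrix ((s j - s k) / (zs t0 j - zs t0 k)) (commutator (A t0 k) (A t0 j))))) (at t0)"
proof -
  let ?J = "{1..m}"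
  have infD: "infinite D" using D by (meson finite_imp_not_open)
  have off0: "z - zs t0 j \<noteq> 0" if "z \<in> D" "j \<in> ?J" for z j
    using eventually_nhds_x_imp_x[OF off] that by auto
  define e where "e i k t z = (\<Sum>j\<in>?J. A t j $ i $ k / (z - zs t j))" for i k t z
  have spec': "eventually (\<lambda>t. \<forall>z\<in>D. \<forall>c i. X' c t z $ i = e i 1 t z * X c t z $ 1 + e i 2 t z * X c t z $ 2 + v c t z * X c t z $ i) (nhds t0)"
    using spec by eventually_elim (simp add: matrix_vector_mult_def sum_2 partial_fraction_matrix_entry e_def)
  have e_diff: "(\<lambda>t. e i k t z) differentiable (at t0)" if z: "z \<in> D" for i k z
  proof -
    define N where "N c t = X' c t z $ i - v c t z * X c t z $ i" for c t
    define d where "d t = X 1 t z $ 1 * X 2 t z $ 2 - X 1 t z $ 2 * X 2 t z $ 1" for t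
    have dif: "(\<lambda>t. X c t z $ i) differentiable (at t0)" "(\<lambda>t. X' c t z $ i) differentiable (at t0)" "(\<lambda>t. v c t z) differentiable (at t0)" for c i
      using differentiableI_vector[OF Xt[OF z]] differentiableI_vector[OF X't[OF z]] differentiableI_vector[OF vt[OF z]] by blast+
    have Nd: "N c differentiable (at t0)" for c unfolding N_def by (intro differentiable_diff differentiable_mult dif)
    have dd: "d differentiable (at t0)" unfolding d_def by (intro differentiable_diff differentiable_mult dif)
    have d0: "d t0 \<noteq> 0" using eventually_nhds_x_imp_x[OF det] z by (simp add: d_def)
    have ev: "eventually (\<lambda>t. (N 1 t * X 2 t z $ 2 - N 2 t * X 1 t z $ 2) / d t = e i 1 t z \<and> (N 2 t * X 1 t z $ 1 - N 1 t * X 2 t z $ 1) / d t = e i 2 t z) (nhds t0)"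
      using spec' det
    proof eventually_elim
      case (elim t)
      have dt: "d t \<noteq> 0" using elim(2) z by (simp add: d_def)
      have n: "N c t = e i 1 t z * X c t z $ 1 + e i 2 t z * X c t z $ 2" for c using elim(1) z by (simp add: N_def)
      have "N 1 t * X 2 t z $ 2 - N 2 t * X 1 t z $ 2 = e i 1 t z * d t" unfolding n d_def by (simp add: algebra_simps)
      moreover have "N 2 t * X 1 t z $ 1 - N 1 t * X 2 t z $ 1 = e i 2 t z * d t" unfolding n d_def by (simp add: algebra_simps)
      ultimately show ?case using dt by simp
    qed
    have "(\<lambda>t. e i 1 t z) differentiable (at t0)"
      by (rule differentiable_eventually[where f="\<lambda>t. (N 1 t * X 2 t z $ 2 - N 2 t * X 1 t z $ 2) / d t"])
         (intro differentiable_divide differentiable_diff differentiable_mult Nd dd dif d0, use ev in eventually_elim, blast)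
    moreover have "(\<lambda>t. e i 2 t z) differentiable (at t0)"
      by (rule differentiable_eventually[where f="\<lambda>t. (N 2 t * X 1 t z $ 1 - N 1 t * X 2 t z $ 1) / d t"])
         (intro differentiable_divide differentiable_diff differentiable_mult Nd dd dif d0, use ev in eventually_elim, blast)
    ultimately show ?thesis using exhaust_2[of k] by auto
  qed
  have "(\<lambda>t. A t j $ i $ k) differentiable (at t0)" if j: "j \<in> ?J" for i k j
  proof -
    have "\<forall>j\<in>?J. (\<lambda>t. A t j $ i $ k) differentiable (at t0)"
    proof (rule partial_fraction_differentiable[where a=zs and D=D])
      show "(\<lambda>t. zs t j) differentiable (at t0)" if "j \<in> ?J" for j using zs[OF that] by (rule differentiableI_vector)
      show "eventually (\<lambda>t. z \<notin> zs t ` ?J) (nhds t0)" if "z \<in> D" for z using off by eventually_elim (use that in blast)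
      show "(\<lambda>t. \<Sum>j\<in>?J. A t j $ i $ k / (z - zs t j)) differentiable (at t0)" if "z \<in> D" for z
        using e_diff[OF that, of i k] by (simp add: e_def)
    qed (use inj infD in auto)
    then show ?thesis using j by blast
  qed
  then have A'_ex: "((\<lambda>t. A t j $ i $ k) has_vector_derivative vector_derivative (\<lambda>t. A t j $ i $ k) (at t0)) (at t0)" if "j \<in> ?J" for j i k
    using that vector_derivative_works by blast
  define A' where "A' j i k = vector_derivative (\<lambda>t. A t j $ i $ k) (at t0)" for j i k
  have A': "((\<lambda>t. A t j $ i $ k) has_vector_derivative A' j i k) (at t0)" if "j \<in> ?J" for j i k
    using A'_ex[OF that] by (simp only: A'_def)
  define b where "b i k z = Binf $ i $ k - (\<Sum>j\<in>?J. s j * A t0 j $ i $ k / (z - zs t0 j))" for i k z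
  define b' where "b' i k z = (\<Sum>j\<in>?J. s j * A t0 j $ i $ k / (z - zs t0 j)\<^sup>2)" for i k z
  define \<alpha> where "\<alpha> i k z = (\<Sum>j\<in>?J. A' j i k / (z - zs t0 j)) + b' i k z" for i k z
  have e_der: "((\<lambda>t. e i k t z) has_vector_derivative \<alpha> i k z) (at t0)" if z: "z \<in> D" for i k z
  proof -
    have "((\<lambda>t. A t j $ i $ k / (z - zs t j)) has_vector_derivative A' j i k / (z - zs t0 j) + s j * A t0 j $ i $ k / (z - zs t0 j)\<^sup>2) (at t0)" if j: "j \<in> ?J" for j
    proof -
      have "((\<lambda>y. 1 / (z - y)) has_field_derivative 1 / (z - zs t0 j)\<^sup>2) (at (zs t0 j))"
        using off0[OF z j] by (auto intro!: derivative_eq_intros simp: divide_simps power2_eq_square)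
      from field_vector_diff_chain_at[OF zs[OF j] this]
      have "((\<lambda>t. 1 / (z - zs t j)) has_vector_derivative s j * (1 / (z - zs t0 j)\<^sup>2)) (at t0)" by (simp add: o_def)
      from has_vector_derivative_mult[OF A'[OF j] this] show ?thesis by (simp add: algebra_simps)
    qed
    then show ?thesis unfolding e_def \<alpha>_def b'_def sum.distrib[symmetric] by (intro has_vector_derivative_sum)
  qed
  have b_der: "(b i k has_field_derivative b' i k z) (at z)" if z: "z \<in> D" for i k z
  proof -
    have "((\<lambda>z. s j * A t0 j $ i $ k / (z - zs t0 j)) has_field_derivative - (s j * A t0 j $ i $ k / (z - zs t0 j)\<^sup>2)) (at z)" if j: "j \<in> ?J" for j
      using off0[OF z j] by (auto intro!: derivative_eq_intros simp: divide_simps power2_eq_square)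
    then have "((\<lambda>z. Binf $ i $ k - (\<Sum>j\<in>?J. s j * A t0 j $ i $ k / (z - zs t0 j))) has_field_derivative 0 - (\<Sum>j\<in>?J. - (s j * A t0 j $ i $ k / (z - zs t0 j)\<^sup>2))) (at z)"
      by (intro DERIV_diff DERIV_const DERIV_sum)
    then show ?thesis by (simp add: b_def[abs_def] b'_def sum_negf)
  qed
  have lax': "dX c z $ i = b i 1 z * X c t0 z $ 1 + b i 2 z * X c t0 z $ 2 + u c z * X c t0 z $ i" if z: "z \<in> D" for c z i
    unfolding lax[OF z] b_def
    by (simp add: matrix_vector_mult_def sum_2 sum_component sum_distrib_left sum_distrib_right sum.distrib algebra_simps add_divide_distrib)
  have spec0: "X' c t0 z $ i = e i 1 t0 z * X c t0 z $ 1 + e i 2 t0 z * X c t0 z $ 2 + v c t0 z * X c t0 z $ i" if "z \<in> D" for c z i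
    using eventually_nhds_x_imp_x[OF spec'] that by blast
  have Q1: "Q c z $ i = \<alpha> i 1 z * X c t0 z $ 1 + e i 1 t0 z * dX c z $ 1 + (\<alpha> i 2 z * X c t0 z $ 2 + e i 2 t0 z * dX c z $ 2)
       + (v' c z * X c t0 z $ i + v c t0 z * dX c z $ i)" if z: "z \<in> D" for c z i
  proof -
    have "((\<lambda>t. e i 1 t z * X c t z $ 1 + e i 2 t z * X c t z $ 2 + v c t z * X c t z $ i) has_vector_derivative
       (e i 1 t0 z * dX c z $ 1 + \<alpha> i 1 z * X c t0 z $ 1 + (e i 2 t0 z * dX c z $ 2 + \<alpha> i 2 z * X c t0 z $ 2)
       + (v c t0 z * dX c z $ i + v' c z * X c t0 z $ i))) (at t0)"
      by (intro has_vector_derivative_add has_vector_derivative_mult e_der Xt vt z)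
    moreover obtain d where d: "d > 0" "\<And>t. dist t t0 < d \<Longrightarrow> \<forall>z\<in>D. \<forall>c i. X' c t z $ i = e i 1 t z * X c t z $ 1 + e i 2 t z * X c t z $ 2 + v c t z * X c t z $ i"
      using spec' unfolding eventually_nhds_metric by blast
    ultimately have "((\<lambda>t. X' c t z $ i) has_vector_derivative
       (e i 1 t0 z * dX c z $ 1 + \<alpha> i 1 z * X c t0 z $ 1 + (e i 2 t0 z * dX c z $ 2 + \<alpha> i 2 z * X c t0 z $ 2)
       + (v c t0 z * dX c z $ i + v' c z * X c t0 z $ i))) (at t0)"
      using z by (elim has_vector_derivative_transform_within_open[where S="ball t0 d"]) (auto simp: dist_commute)
    from vector_derivative_unique_at[OF X't[OF z] this] show ?thesis by (simp add: algebra_simps)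
  qed
  have Q2: "Q c z $ i = b' i 1 z * X c t0 z $ 1 + b i 1 z * X' c t0 z $ 1 + (b' i 2 z * X c t0 z $ 2 + b i 2 z * X' c t0 z $ 2)
       + (v' c z * X c t0 z $ i + u c z * X' c t0 z $ i)" if z: "z \<in> D" for c z i
  proof -
    have "((\<lambda>z. b i 1 z * X c t0 z $ 1 + b i 2 z * X c t0 z $ 2 + u c z * X c t0 z $ i) has_field_derivative
       (b' i 1 z * X c t0 z $ 1 + X' c t0 z $ 1 * b i 1 z + (b' i 2 z * X c t0 z $ 2 + X' c t0 z $ 2 * b i 2 z)
       + (v' c z * X c t0 z $ i + X' c t0 z $ i * u c z))) (at z)"
      by (intro DERIV_add DERIV_mult b_der Xz uz z)
    then have "((\<lambda>z. dX c z $ i) has_field_derivative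
       (b' i 1 z * X c t0 z $ 1 + X' c t0 z $ 1 * b i 1 z + (b' i 2 z * X c t0 z $ 2 + X' c t0 z $ 2 * b i 2 z)
       + (v' c z * X c t0 z $ i + X' c t0 z $ i * u c z))) (at z)"
      by (rule has_field_derivative_transform_within_open[OF _ D(1) z]) (use lax' in simp)
    from DERIV_unique[OF dXz[OF z] this] show ?thesis by (simp add: algebra_simps)
  qed
  define E where "E i k z = \<alpha> i k z - b' i k z - (b i 1 z * e 1 k t0 z + b i 2 z * e 2 k t0 z - (e i 1 t0 z * b 1 k z + e i 2 t0 z * b 2 k z))" for i k z
  have EX: "E i 1 z * X c t0 z $ 1 + E i 2 z * X c t0 z $ 2 = 0" if z: "z \<in> D" for i c z
  proof -
    have "\<alpha> i 1 z * X c t0 z $ 1 + e i 1 t0 z * dX c z $ 1 + (\<alpha> i 2 z * X c t0 z $ 2 + e i 2 t0 z * dX c z $ 2) + (v' c z * X c t0 z $ i + v c t0 z * dX c z $ i)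
      = b' i 1 z * X c t0 z $ 1 + b i 1 z * X' c t0 z $ 1 + (b' i 2 z * X c t0 z $ 2 + b i 2 z * X' c t0 z $ 2) + (v' c z * X c t0 z $ i + u c z * X' c t0 z $ i)"
      using Q1[OF z, of c i] Q2[OF z, of c i] by simp
    then show ?thesis unfolding lax'[OF z] spec0[OF z] E_def by (simp add: algebra_simps)
  qed
  have E0: "E i k z = 0" if z: "z \<in> D" for i k z
  proof -
    define d where "d = X 1 t0 z $ 1 * X 2 t0 z $ 2 - X 1 t0 z $ 2 * X 2 t0 z $ 1"
    have d0: "d \<noteq> 0" using eventually_nhds_x_imp_x[OF det] z by (simp add: d_def)
    have "E i 1 z * d = (E i 1 z * X 1 t0 z $ 1 + E i 2 z * X 1 t0 z $ 2) * X 2 t0 z $ 2 - (E i 1 z * X 2 t0 z $ 1 + E i 2 z * X 2 t0 z $ 2) * X 1 t0 z $ 2"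
      by (simp add: d_def algebra_simps)
    also have "\<dots> = 0" unfolding EX[OF z] by simp
    finally have 1: "E i 1 z = 0" using d0 by simp
    have "E i 2 z * d = (E i 1 z * X 2 t0 z $ 1 + E i 2 z * X 2 t0 z $ 2) * X 1 t0 z $ 1 - (E i 1 z * X 1 t0 z $ 1 + E i 2 z * X 1 t0 z $ 2) * X 2 t0 z $ 1"
      by (simp add: d_def algebra_simps)
    also have "\<dots> = 0" unfolding EX[OF z] by simp
    finally have "E i 2 z = 0" using d0 by simp
    then show ?thesis using 1 exhaust_2[of k] by auto
  qed
  define R where "R j = commutator Binf (A t0 j) + (\<Sum>k\<in>?J - {j}. smult_matrix ((s j - s k) / (zs t0 j - zs t0 k)) (commutator (A t0 k) (A t0 j)))" for j
  have key: "\<forall>j\<in>?J. A' j i l - R j $ i $ l = 0" for i l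
  proof (rule partial_fraction_zero[where a="zs t0" and D=D])
    show "z \<notin> zs t0 ` ?J" if "z \<in> D" for z using eventually_nhds_x_imp_x[OF off] that by blast
    fix z assume z: "z \<in> D"
    define c where "c j k = commutator (A t0 j) (A t0 k) $ i $ l" for j k
    define y where "y j = 1 / (z - zs t0 j)" for j
    have ey: "e p q t0 z = (\<Sum>k\<in>?J. A t0 k $ p $ q * y k)" for p q by (simp add: e_def y_def)
    have by': "b p q z = Binf $ p $ q - (\<Sum>j\<in>?J. s j * A t0 j $ p $ q * y j)" for p q by (simp add: b_def y_def)
    have "(\<Sum>j\<in>?J. A' j i l / (z - zs t0 j)) = b i 1 z * e 1 l t0 z + b i 2 z * e 2 l t0 z - (e i 1 t0 z * b 1 l z + e i 2 t0 z * b 2 l z)"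
      using E0[OF z, of i l] by (simp add: E_def \<alpha>_def)
    also have "\<dots> = (Binf $ i $ 1 * e 1 l t0 z + Binf $ i $ 2 * e 2 l t0 z - (e i 1 t0 z * Binf $ 1 $ l + e i 2 t0 z * Binf $ 2 $ l))
       - ((\<Sum>j\<in>?J. s j * A t0 j $ i $ 1 * y j) * e 1 l t0 z + (\<Sum>j\<in>?J. s j * A t0 j $ i $ 2 * y j) * e 2 l t0 z
          - ((\<Sum>j\<in>?J. s j * A t0 j $ 1 $ l * y j) * e i 1 t0 z + (\<Sum>j\<in>?J. s j * A t0 j $ 2 $ l * y j) * e i 2 t0 z))"
      unfolding by' by (simp add: algebra_simps)
    also have "Binf $ i $ 1 * e 1 l t0 z + Binf $ i $ 2 * e 2 l t0 z - (e i 1 t0 z * Binf $ 1 $ l + e i 2 t0 z * Binf $ 2 $ l)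
       = (\<Sum>j\<in>?J. commutator Binf (A t0 j) $ i $ l / (z - zs t0 j))"
      unfolding ey commutator_entry y_def
      by (simp add: sum_distrib_left sum_distrib_right sum.distrib sum_subtractf add_divide_distrib diff_divide_distrib algebra_simps)
    also have "(\<Sum>j\<in>?J. s j * A t0 j $ i $ 1 * y j) * e 1 l t0 z + (\<Sum>j\<in>?J. s j * A t0 j $ i $ 2 * y j) * e 2 l t0 z
          - ((\<Sum>j\<in>?J. s j * A t0 j $ 1 $ l * y j) * e i 1 t0 z + (\<Sum>j\<in>?J. s j * A t0 j $ 2 $ l * y j) * e i 2 t0 z)
       = (\<Sum>j\<in>?J. \<Sum>k\<in>?J. s j * c j k / ((z - zs t0 j) * (z - zs t0 k)))"
      unfolding ey sum_product sum.distrib[symmetric] sum_subtractf[symmetric]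
    proof (intro sum.cong refl)
      fix j k
      have "s j * c j k / ((z - zs t0 j) * (z - zs t0 k)) = s j * c j k * (y j * y k)" by (simp add: y_def)
      then show "s j * A t0 j $ i $ 1 * y j * (A t0 k $ 1 $ l * y k) + s j * A t0 j $ i $ 2 * y j * (A t0 k $ 2 $ l * y k)
          - (s j * A t0 j $ 1 $ l * y j * (A t0 k $ i $ 1 * y k) + s j * A t0 j $ 2 $ l * y j * (A t0 k $ i $ 2 * y k))
        = s j * c j k / ((z - zs t0 j) * (z - zs t0 k))"
        by (simp only: c_def commutator_entry) (simp add: algebra_simps)
    qed
    also have "\<dots> = - (\<Sum>j\<in>?J. (\<Sum>k\<in>?J - {j}. (s j - s k) / (zs t0 j - zs t0 k) * c k j) / (z - zs t0 j))"
      by (rule double_partial_fraction) (use inj eventually_nhds_x_imp_x[OF off] z in \<open>auto simp: c_def commutator_entry\<close>)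
    finally have "(\<Sum>j\<in>?J. A' j i l / (z - zs t0 j)) = (\<Sum>j\<in>?J. commutator Binf (A t0 j) $ i $ l / (z - zs t0 j)
        + (\<Sum>k\<in>?J - {j}. (s j - s k) / (zs t0 j - zs t0 k) * c k j) / (z - zs t0 j))"
      by (simp add: sum.distrib)
    also have "\<dots> = (\<Sum>j\<in>?J. R j $ i $ l / (z - zs t0 j))"
      by (intro sum.cong refl) (simp add: R_def c_def sum_component smult_matrix_def map_matrix_def add_divide_distrib)
    finally show "(\<Sum>j\<in>?J. (A' j i l - R j $ i $ l) / (z - zs t0 j)) = 0"
      by (simp add: diff_divide_distrib sum_subtractf)
  qed (use inj infD in auto)
  show ?thesis
  proof
    fix j assume j: "j \<in> ?J"
    have "A' j i l = R j $ i $ l" for i l using key[of i l] j by auto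
    then have "((\<lambda>t. A t j) has_vector_derivative R j) (at t0)"
      using A'[OF j] by (intro has_vector_derivative_entries) simp
    then show "((\<lambda>t. A t j) has_vector_derivative
      (commutator Binf (A t0 j) + (\<Sum>k\<in>?J - {j}. smult_matrix ((s j - s k) / (zs t0 j - zs t0 k)) (commutator (A t0 k) (A t0 j))))) (at t0)"
      by (simp add: R_def)
  qed
qed

section \<open>Branches of the weight\<close>

text \<open>After division by the right-hand side the branch takes only countably many values, one for each choice of
logarithms, and a continuous function on a connected set with countable range is constant.\<close>

lemma branch_formula:
  fixes f :: "'a::topological_space \<Rightarrow> complex" and d :: "nat \<Rightarrow> 'a \<Rightarrow> complex"
  assumes conn: "connected S" and s0: "s0 \<in> S" and s: "s \<in> S" and J: "finite J"
    and dcont: "\<And>k. k \<in> J \<Longrightarrow> continuous_on S (d k)"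
    and ratio: "\<And>k s. k \<in> J \<Longrightarrow> s \<in> S \<Longrightarrow> d k s / d k s0 \<notin> \<real>\<^sub>\<le>\<^sub>0"
    and fcont: "continuous_on S f"
    and val: "\<And>s. s \<in> S \<Longrightarrow> \<exists>l. (\<forall>k\<in>J. exp (l k) = d k s) \<and> f s = exp (\<Sum>k\<in>J. \<rho> k * l k)"
  shows "f s = f s0 * exp (\<Sum>k\<in>J. \<rho> k * Ln (d k s / d k s0))"
proof -
  obtain l0 where l0: "\<forall>k\<in>J. exp (l0 k) = d k s0" "f s0 = exp (\<Sum>k\<in>J. \<rho> k * l0 k)"
    using val[OF s0] by blast
  have nz0: "d k s0 \<noteq> 0" if "k \<in> J" for k using l0(1) that by (metis exp_not_eq_zero)
  define c where "c s = f s * exp (- (\<Sum>k\<in>J. \<rho> k * Ln (d k s / d k s0)))" for s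
  have c_cont: "continuous_on S c"
    unfolding c_def using ratio nz0 by (intro continuous_intros fcont dcont) auto
  have img: "c ` S \<subseteq> (\<lambda>N. exp (\<Sum>k\<in>J. \<rho> k * (l0 k + 2 * pi * \<i> * of_int (N k)))) ` (PiE J (\<lambda>_. UNIV::int set))"
  proof
    fix y assume "y \<in> c ` S"
    then obtain s where s: "s \<in> S" "y = c s" by blast
    obtain l where l: "\<forall>k\<in>J. exp (l k) = d k s" "f s = exp (\<Sum>k\<in>J. \<rho> k * l k)"
      using val[OF s(1)] by blast
    have "\<exists>N::int. l k - Ln (d k s / d k s0) = l0 k + of_int (2 * N) * pi * \<i>" if "k \<in> J" for k
    proof -
      have nz: "d k s \<noteq> 0" using l(1) that by (metis exp_not_eq_zero)
      have "exp (l k - Ln (d k s / d k s0)) = exp (l0 k)"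
        using that l l0 nz nz0[OF that] by (simp add: exp_diff)
      then show ?thesis using exp_eq by blast
    qed
    then obtain N :: "nat \<Rightarrow> int" where N: "\<And>k. k \<in> J \<Longrightarrow> l k - Ln (d k s / d k s0) = l0 k + of_int (2 * N k) * pi * \<i>"
      by metis
    have "c s = exp (\<Sum>k\<in>J. \<rho> k * (l k - Ln (d k s / d k s0)))"
      by (simp add: c_def l(2) exp_minus exp_diff[symmetric] divide_inverse[symmetric] sum_subtractf[symmetric] right_diff_distrib)
    also have "(\<Sum>k\<in>J. \<rho> k * (l k - Ln (d k s / d k s0))) = (\<Sum>k\<in>J. \<rho> k * (l0 k + 2 * pi * \<i> * of_int (restrict N J k)))"
      by (intro sum.cong refl) (simp add: N)
    finally show "y \<in> (\<lambda>N. exp (\<Sum>k\<in>J. \<rho> k * (l0 k + 2 * pi * \<i> * of_int (N k)))) ` (PiE J (\<lambda>_. UNIV::int set))"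
      using s(2) by (intro image_eqI[where x="restrict N J"]) auto
  qed
  have "countable (c ` S)"
    using countable_subset[OF img countable_image[OF countable_PiE[OF J]]] by simp
  moreover have "connected (c ` S)" using conn c_cont by (rule connected_continuous_image[rotated])
  ultimately have "c s = c s0"
    using connected_uncountable[of "c ` S" "c s" "c s0"] s s0 by blast
  moreover have "c s0 = f s0"
  proof -
    have "(\<Sum>k\<in>J. \<rho> k * Ln (d k s0 / d k s0)) = 0" using nz0 by (intro sum.neutral) simp
    then show ?thesis by (simp add: c_def)
  qed
  ultimately have "c s = f s0" by simp
  then show ?thesis
    by (simp add: c_def exp_minus field_simps)
qed

lemma norm_exp_Ln_bounds:
  assumes "finite J" "\<And>k. k \<in> J \<Longrightarrow> x k \<noteq> 0"
  shows "norm (exp (\<Sum>k\<in>J. \<rho> k * Ln (x k))) \<le> (\<Prod>k\<in>J. exp (pi * norm (\<rho> k)) * norm (x k) powr Re (\<rho> k))" (is "?a \<le> ?b")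
    and "(\<Prod>k\<in>J. exp (- (pi * norm (\<rho> k))) * norm (x k) powr Re (\<rho> k)) \<le> norm (exp (\<Sum>k\<in>J. \<rho> k * Ln (x k)))" (is "?c \<le> _")
proof -
  have eq: "?a = (\<Prod>k\<in>J. exp (Re (\<rho> k * Ln (x k))))"
    using assms(1) by (simp only: exp_sum prod_norm[symmetric] norm_exp_eq_Re)
  have R: "Re (\<rho> k * Ln (x k)) = Re (\<rho> k) * ln (norm (x k)) - Im (\<rho> k) * Im (Ln (x k))" if "k \<in> J" for k
    using assms(2)[OF that] by simp
  have I: "\<bar>Im (\<rho> k) * Im (Ln (x k))\<bar> \<le> pi * norm (\<rho> k)" if "k \<in> J" for k
  proof -
    have "\<bar>Im (Ln (x k))\<bar> \<le> pi" using assms(2)[OF that] mpi_less_Im_Ln[of "x k"] Im_Ln_le_pi[of "x k"] by linarith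
    then show ?thesis unfolding abs_mult using abs_Im_le_cmod[of "\<rho> k"]
      by (metis abs_ge_zero mult.commute mult_mono' )
  qed
  have pw: "norm (x k) powr Re (\<rho> k) = exp (Re (\<rho> k) * ln (norm (x k)))" if "k \<in> J" for k
    using assms(2)[OF that] by (simp add: powr_def)
  show "?a \<le> ?b" unfolding eq
  proof (rule prod_mono)
    fix k assume k: "k \<in> J"
    show "0 \<le> exp (Re (\<rho> k * Ln (x k))) \<and> exp (Re (\<rho> k * Ln (x k))) \<le> exp (pi * norm (\<rho> k)) * norm (x k) powr Re (\<rho> k)"
      unfolding R[OF k] pw[OF k] exp_add[symmetric] using I[OF k] by (simp add: abs_le_iff)
  qed
  show "?c \<le> norm (exp (\<Sum>k\<in>J. \<rho> k * Ln (x k)))" unfolding eq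
  proof (rule prod_mono)
    fix k assume k: "k \<in> J"
    show "0 \<le> exp (- (pi * norm (\<rho> k))) * norm (x k) powr Re (\<rho> k) \<and> exp (- (pi * norm (\<rho> k))) * norm (x k) powr Re (\<rho> k) \<le> exp (Re (\<rho> k * Ln (x k)))"
      unfolding R[OF k] pw[OF k] exp_add[symmetric] using I[OF k] by (simp add: abs_le_iff)
  qed
qed

text \<open>If two numbers lie in one open half-plane, their quotient avoids the branch cut of the logarithm.\<close>

lemma half_plane_ratio:
  assumes "0 < Re (x * c)" "0 < Re (y * c)"
  shows "x / y \<notin> \<real>\<^sub>\<le>\<^sub>0"
proof
  assume "x / y \<in> \<real>\<^sub>\<le>\<^sub>0"
  then obtain r where r: "x / y = of_real r" "r \<le> 0"
    by (metis nonpos_Reals_cases)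
  have "y \<noteq> 0" using assms by auto
  then have "x = of_real r * y" using r by (simp add: field_simps)
  then have "Re (x * c) = r * Re (y * c)" by (simp add: algebra_simps)
  then show False using assms r(2) by (smt (verit) mult_nonneg_nonneg mult_minus_left)
qed

lemma isCont_cis [simp]: "isCont cis x"
proof -
  have "cis = (\<lambda>x. exp (\<i> * of_real x))" by (simp add: fun_eq_iff cis_conv_exp)
  moreover have "isCont (\<lambda>x. exp (\<i> * complex_of_real x)) x" by (intro continuous_intros)
  ultimately show ?thesis by simp
qed

text \<open>The data of the problem at one fixed \<open>t\<close>. Everything that does not involve the deformation is proved here once.\<close>

locale weight =
  fixes m :: nat and a :: "nat \<Rightarrow> complex" and \<rho> :: "nat \<Rightarrow> complex"
    and C :: "complex set" and w :: "complex \<Rightarrow> complex"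
  assumes distinct: "inj_on a {1..m}"
    and exponent_nz: "\<And>j. j \<in> {1..m} \<Longrightarrow> \<rho> j \<noteq> 0"
    and closed_C: "closed C"
    and cont: "continuous_on (- C) w"
    and vals: "\<And>z. z \<notin> C \<Longrightarrow> w z \<in> power_product_values {1..m} a \<rho> z"
    and circle_C: "sphere 0 1 \<inter> C \<subseteq> insert (-1) (a ` {1..m})"
    and closed: "closed_on_circle w"
    and integrable: "\<And>j::int. circle_integrable (\<lambda>\<zeta>. \<zeta> powi j * w \<zeta>)"
    and integrable_deriv: "\<And>j::int. circle_integrable (\<lambda>\<zeta>. \<zeta> powi j * deriv w \<zeta>)"
begin

text \<open>The logarithmic derivative \<open>w' / w\<close>.\<close>

definition log_z_deriv :: "complex \<Rightarrow> complex" where "log_z_deriv z = (\<Sum>j\<in>{1..m}. \<rho> j / (z - a j))"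

lemma ne_point: "z \<notin> C \<Longrightarrow> j \<in> {1..m} \<Longrightarrow> z \<noteq> a j"
  using vals[of z] unfolding power_product_values_def by force

lemma weight_nonzero: "z \<notin> C \<Longrightarrow> w z \<noteq> 0"
  using vals[of z] by (auto simp: power_product_values_def)

lemma weight_z_deriv: assumes "z \<notin> C" shows "(w has_field_derivative log_z_deriv z * w z) (at z)"
proof -
  obtain r where r: "r > 0" "ball z r \<subseteq> - C"
    using closed_C assms by (meson ComplI open_Compl open_contains_ball_eq)
  have ratio: "(s - a k) / (z - a k) \<notin> \<real>\<^sub>\<le>\<^sub>0" if "k \<in> {1..m}" "s \<in> ball z r" for k s
  proof -
    have zk: "z - a k \<noteq> 0" using ne_point[OF assms that(1)] by simp
    have "a k \<notin> ball z r" using r(2) ne_point that(1) by blast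
    then have "norm (s - z) < norm (z - a k)" using that(2) by (simp add: dist_norm norm_minus_commute)
    then have "norm ((s - z) / (z - a k)) < 1" using zk by (simp add: norm_divide)
    then have "Re ((s - z) / (z - a k)) > -1" using abs_Re_le_cmod[of "(s - z) / (z - a k)"] by linarith
    moreover have "(s - a k) / (z - a k) = 1 + (s - z) / (z - a k)" using zk by (simp add: field_simps)
    ultimately have "Re ((s - a k) / (z - a k)) > 0" by simp
    then show ?thesis by (simp add: complex_nonpos_Reals_iff)
  qed
  have eq: "w s = w z * exp (\<Sum>k\<in>{1..m}. \<rho> k * Ln ((s - a k) / (z - a k)))" if "s \<in> ball z r" for s
  proof (rule branch_formula[where S="ball z r" and d="\<lambda>k s. s - a k"])
    show "continuous_on (ball z r) w" using cont r(2) continuous_on_subset by blast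
    show "\<exists>l. (\<forall>k\<in>{1..m}. exp (l k) = s - a k) \<and> w s = exp (\<Sum>k\<in>{1..m}. \<rho> k * l k)" if "s \<in> ball z r" for s
      using vals[of s] r(2) that unfolding power_product_values_def by blast
  qed (use r that ratio in \<open>auto intro!: continuous_intros\<close>)
  have zk: "z - a k \<noteq> 0" if "k \<in> {1..m}" for k using ne_point[OF assms that] by simp
  have "((\<lambda>s. \<Sum>k\<in>{1..m}. \<rho> k * Ln ((s - a k) / (z - a k))) has_field_derivative log_z_deriv z) (at z)"
    unfolding log_z_deriv_def
  proof (rule DERIV_sum)
    fix k assume k: "k \<in> {1..m}"
    show "((\<lambda>s. \<rho> k * Ln ((s - a k) / (z - a k))) has_field_derivative \<rho> k / (z - a k)) (at z)"
      using ratio[OF k, of z] r(1) zk[OF k] by (auto intro!: derivative_eq_intros)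
  qed
  then have "((\<lambda>s. w z * exp (\<Sum>k\<in>{1..m}. \<rho> k * Ln ((s - a k) / (z - a k)))) has_field_derivative
      w z * (exp (\<Sum>k\<in>{1..m}. \<rho> k * Ln ((z - a k) / (z - a k))) * log_z_deriv z)) (at z)"
    by (intro DERIV_cmult DERIV_fun_exp)
  moreover have "(\<Sum>k\<in>{1..m}. \<rho> k * Ln ((z - a k) / (z - a k))) = 0"
    using zk by (intro sum.neutral) simp
  ultimately have "((\<lambda>s. w z * exp (\<Sum>k\<in>{1..m}. \<rho> k * Ln ((s - a k) / (z - a k)))) has_field_derivative log_z_deriv z * w z) (at z)"
    by (simp add: mult.commute)
  then show ?thesis
    by (rule has_field_derivative_transform_within_open[OF _ open_ball centre_in_ball[THEN iffD2, OF r(1)]])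
      (rule eq[symmetric])
qed

lemma cis_nbhd: "eventually (\<lambda>x. cis x \<noteq> cis y) (at y)"
proof -
  have "cis x \<noteq> cis y" if "x \<noteq> y" "dist x y < 2 * pi" for x
  proof
    assume "cis x = cis y"
    then have "sin x = sin y \<and> cos x = cos y" by (simp add: complex_eq_iff)
    then obtain n :: int where n: "x = y + 2 * pi * n" using sin_cos_eq_iff by blast
    then have "\<bar>real_of_int n\<bar> < 1" using that(2) by (simp add: dist_real_def abs_mult)
    then have "n = 0" by linarith
    then show False using n that by simp
  qed
  then show ?thesis by (auto simp: eventually_at intro!: exI[of _ "2*pi"])
qed

text \<open>The point \<open>-1\<close> may lie on a cut without being singular. As the boundary values from
both sides agree, \<open>w(exp(i \<theta>))\<close> extends to a continuous \<open>2 \<pi>\<close>-periodic function away from the singular points,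
which is again a branch of the power product.\<close>

lemma circle_extension:
  obtains g where "\<And>\<theta>. cis \<theta> \<notin> C \<Longrightarrow> g \<theta> = w (cis \<theta>)"
    and "\<And>\<theta>. cis \<theta> \<notin> a ` {1..m} \<Longrightarrow> isCont g \<theta>"
    and "\<And>\<theta>. cis \<theta> \<notin> a ` {1..m} \<Longrightarrow> g \<theta> \<in> power_product_values {1..m} a \<rho> (cis \<theta>)"
    and "\<And>\<theta>. g (\<theta> + 2 * pi) = g \<theta>"
proof -
  obtain l where l: "((\<lambda>\<theta>. w (cis \<theta>)) \<longlongrightarrow> l) (at_left pi)" "((\<lambda>\<theta>. w (cis \<theta>)) \<longlongrightarrow> l) (at_right (- pi))"
    using closed by (auto simp: closed_on_circle_def)
  define g where "g \<theta> = (if cis \<theta> \<in> C then l else w (cis \<theta>))" for \<theta>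
  have on: "cis \<theta> \<in> sphere 0 1" for \<theta> by simp
  have 1: "isCont g \<theta> \<and> g \<theta> \<in> power_product_values {1..m} a \<rho> (cis \<theta>)" if "cis \<theta> \<notin> C" for \<theta>
  proof
    have "isCont w (cis \<theta>)" using weight_z_deriv[OF that] by (rule DERIV_isCont)
    then have "isCont (\<lambda>\<theta>. w (cis \<theta>)) \<theta>"
      by (rule isCont_o2[rotated]) simp
    moreover have "eventually (\<lambda>x. cis x \<notin> C) (nhds \<theta>)"
    proof -
      have "open (cis -` (- C))" using closed_C by (intro open_vimage) (auto intro!: continuous_intros)
      then have "eventually (\<lambda>x. x \<in> cis -` (- C)) (nhds \<theta>)" using that by (intro eventually_nhds_in_open) auto
      then show ?thesis by simp
    qed
    ultimately show "isCont g \<theta>"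
      by (subst isCont_cong[where g="\<lambda>\<theta>. w (cis \<theta>)"]) (auto simp: g_def elim!: eventually_mono)
    show "g \<theta> \<in> power_product_values {1..m} a \<rho> (cis \<theta>)" using vals[OF that] that by (simp add: g_def)
  qed
  have 2: "isCont g \<theta> \<and> g \<theta> \<in> power_product_values {1..m} a \<rho> (cis \<theta>)" if C: "cis \<theta> \<in> C" and na: "cis \<theta> \<notin> a ` {1..m}" for \<theta>
  proof -
    have m1: "cis \<theta> = -1" using circle_C C na on by blast
    then have "cis \<theta> = cis pi" by simp
    then have "sin \<theta> = sin pi \<and> cos \<theta> = cos pi" by (simp add: complex_eq_iff)
    then obtain k :: int where k: "\<theta> = pi + 2 * pi * k" using sin_cos_eq_iff by blast
    have cis_shift: "cis (x - 2 * pi * real_of_int j) = cis x" for x j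
      using sin_cos_eq_iff[of "x - 2 * pi * real_of_int j" x]
      by (smt (verit) complex_eq_iff cis.sel mult_minus_right of_int_minus)
    have "open (- (a ` {1..m}))" by (simp add: open_Compl finite_imp_closed)
    then have "open (cis -` (- (a ` {1..m})))" by (intro open_vimage) (auto intro!: continuous_intros)
    then have "eventually (\<lambda>x. x \<in> cis -` (- (a ` {1..m}))) (nhds \<theta>)" using na by (intro eventually_nhds_in_open) auto
    then have "eventually (\<lambda>x. cis x \<notin> a ` {1..m}) (at \<theta>)" by (simp add: eventually_at_filter eventually_mono)
    then have ev: "eventually (\<lambda>x. cis x \<notin> C) (at \<theta>)"
      using cis_nbhd[of \<theta>] by eventually_elim (metis IntI circle_C in_mono insertE m1 on)
    have "((\<lambda>x. w (cis (x - 2 * pi * real_of_int k))) \<longlongrightarrow> l) (at_left \<theta>)"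
      by (rule filterlim_compose[OF l(1)]) (auto simp: filterlim_at k eventually_at_filter intro!: tendsto_eq_intros)
    then have L: "((\<lambda>x. w (cis x)) \<longlongrightarrow> l) (at_left \<theta>)" by (simp only: cis_shift)
    have "((\<lambda>x. w (cis (x - 2 * pi * real_of_int (k + 1)))) \<longlongrightarrow> l) (at_right \<theta>)"
      by (rule filterlim_compose[OF l(2)]) (auto simp: filterlim_at k eventually_at_filter algebra_simps intro!: tendsto_eq_intros)
    then have R: "((\<lambda>x. w (cis x)) \<longlongrightarrow> l) (at_right \<theta>)" by (simp only: cis_shift)
    have "((\<lambda>x. w (cis x)) \<longlongrightarrow> l) (at \<theta>)" using L R filterlim_split_at by blast
    then have "(g \<longlongrightarrow> l) (at \<theta>)"
      by (rule Lim_transform_eventually) (use ev in eventually_elim, simp add: g_def)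
    then have ic: "isCont g \<theta>" using C by (simp add: isCont_def g_def)
    have "g \<theta> \<in> power_product_values {1..m} a \<rho> (cis \<theta>)"
    proof -
      have nak: "cis \<theta> \<noteq> a k" if "k \<in> {1..m}" for k using na that by blast
      have cisc: "isCont (\<lambda>x. (cis x - a k) / (cis \<theta> - a k)) \<theta>" if "k \<in> {1..m}" for k
        using nak[OF that] by (intro continuous_intros isCont_cis) auto
      have "eventually (\<lambda>x. Re ((cis x - a k) / (cis \<theta> - a k)) > 1/2) (at \<theta>)" if "k \<in> {1..m}" for k
      proof -
        have "((\<lambda>x. Re ((cis x - a k) / (cis \<theta> - a k))) \<longlongrightarrow> 1) (at \<theta>)"
          using tendsto_Re[OF cisc[OF that, unfolded isCont_def]] nak[OF that] by simp
        then show ?thesis by (rule order_tendstoD) simp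
      qed
      then have "eventually (\<lambda>x. \<forall>k\<in>{1..m}. Re ((cis x - a k) / (cis \<theta> - a k)) > 1/2) (at \<theta>)"
        by (simp add: eventually_ball_finite)
      with ev have "eventually (\<lambda>x. cis x \<notin> C \<and> (\<forall>k\<in>{1..m}. Re ((cis x - a k) / (cis \<theta> - a k)) > 1/2)) (at \<theta>)"
        by eventually_elim simp
      then obtain d where d: "d > 0" "\<And>x. x \<noteq> \<theta> \<Longrightarrow> dist x \<theta> < d \<Longrightarrow> cis x \<notin> C \<and> (\<forall>k\<in>{1..m}. Re ((cis x - a k) / (cis \<theta> - a k)) > 1/2)"
        unfolding eventually_at by auto
      define S where "S = {\<theta><..<\<theta>+d}"
      define s0 where "s0 = \<theta> + d/2"
      have dS: "cis x \<notin> C \<and> (\<forall>k\<in>{1..m}. Re ((cis x - a k) / (cis \<theta> - a k)) > 1/2)" if "x \<in> S" for x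
        using that by (intro d(2)) (auto simp: S_def dist_real_def)
      have s0S: "s0 \<in> S" using d(1) by (simp add: S_def s0_def)
      have nr: "(cis x - a k) / (cis s0 - a k) \<notin> \<real>\<^sub>\<le>\<^sub>0" if "x \<in> insert \<theta> S" "k \<in> {1..m}" for x k
      proof (rule half_plane_ratio[where c="inverse (cis \<theta> - a k)"])
        show "0 < Re ((cis x - a k) * inverse (cis \<theta> - a k))"
        proof (cases "x = \<theta>")
          case True then show ?thesis using nak[OF that(2)] by (simp add: divide_inverse[symmetric])
        next
          case False
          then have "1/2 < Re ((cis x - a k) / (cis \<theta> - a k))" using dS[of x] that by blast
          then have "0 < Re ((cis x - a k) / (cis \<theta> - a k))" by linarith
          then show ?thesis by (simp only: divide_inverse)
        qed
        show "0 < Re ((cis s0 - a k) * inverse (cis \<theta> - a k))"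
        proof -
          have "1/2 < Re ((cis s0 - a k) / (cis \<theta> - a k))" using dS[OF s0S] that by blast
          then have "0 < Re ((cis s0 - a k) / (cis \<theta> - a k))" by linarith
          then show ?thesis by (simp only: divide_inverse)
        qed
      qed
      have f: "g x = g s0 * exp (\<Sum>k\<in>{1..m}. \<rho> k * Ln ((cis x - a k) / (cis s0 - a k)))" if "x \<in> S" for x
      proof (rule branch_formula[where S=S and d="\<lambda>k s. cis s - a k"])
        show "continuous_on S g" by (rule continuous_at_imp_continuous_on) (use dS 1 in auto)
        show "\<exists>l. (\<forall>k\<in>{1..m}. exp (l k) = cis s - a k) \<and> g s = exp (\<Sum>k\<in>{1..m}. \<rho> k * l k)" if "s \<in> S" for s
          using 1 dS[OF that] unfolding power_product_values_def by blast
      qed (use s0S that nr in \<open>auto simp: S_def intro!: continuous_intros\<close>)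
      have nb: "at_right \<theta> \<noteq> bot" by simp
      have "(g \<longlongrightarrow> g \<theta>) (at_right \<theta>)" using ic unfolding isCont_def filterlim_at_split by blast
      moreover have "(g \<longlongrightarrow> g s0 * exp (\<Sum>k\<in>{1..m}. \<rho> k * Ln ((cis \<theta> - a k) / (cis s0 - a k)))) (at_right \<theta>)"
      proof (rule Lim_transform_eventually)
        have "isCont (\<lambda>x. g s0 * exp (\<Sum>k\<in>{1..m}. \<rho> k * Ln ((cis x - a k) / (cis s0 - a k)))) \<theta>"
          using nr[of \<theta>] dS[OF s0S] ne_point[of "cis s0"] by (intro continuous_intros isCont_cis) auto
        then show "((\<lambda>x. g s0 * exp (\<Sum>k\<in>{1..m}. \<rho> k * Ln ((cis x - a k) / (cis s0 - a k)))) \<longlongrightarrow> g s0 * exp (\<Sum>k\<in>{1..m}. \<rho> k * Ln ((cis \<theta> - a k) / (cis s0 - a k)))) (at_right \<theta>)"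
          unfolding isCont_def filterlim_at_split by blast
        show "\<forall>\<^sub>F x in at_right \<theta>. g s0 * exp (\<Sum>k\<in>{1..m}. \<rho> k * Ln ((cis x - a k) / (cis s0 - a k))) = g x"
          using d(1) f unfolding eventually_at_right_field by (intro exI[of _ "\<theta>+d"]) (auto simp: S_def)
      qed
      ultimately have G: "g \<theta> = g s0 * exp (\<Sum>k\<in>{1..m}. \<rho> k * Ln ((cis \<theta> - a k) / (cis s0 - a k)))"
        using tendsto_unique[OF nb] by blast
      obtain l0 where l0: "\<And>k. k \<in> {1..m} \<Longrightarrow> exp (l0 k) = cis s0 - a k" "g s0 = exp (\<Sum>k\<in>{1..m}. \<rho> k * l0 k)"
        using 1 dS[OF s0S] unfolding power_product_values_def by blast
      have "g \<theta> = exp (\<Sum>k\<in>{1..m}. \<rho> k * (l0 k + Ln ((cis \<theta> - a k) / (cis s0 - a k))))"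
        unfolding G l0(2) by (simp add: exp_add[symmetric] sum.distrib[symmetric] distrib_left)
      moreover have "exp (l0 k + Ln ((cis \<theta> - a k) / (cis s0 - a k))) = cis \<theta> - a k" if "k \<in> {1..m}" for k
      proof -
        have "(cis \<theta> - a k) / (cis s0 - a k) \<noteq> 0" using na that ne_point[of "cis s0" k] dS[OF s0S] by auto
        then show ?thesis using l0(1)[OF that] by (simp add: exp_add)
      qed
      ultimately show ?thesis unfolding power_product_values_def
        by (auto intro!: exI[of _ "\<lambda>k. l0 k + Ln ((cis \<theta> - a k) / (cis s0 - a k))"])
    qed
    with ic show ?thesis by blast
  qed
  show ?thesis
  proof (rule that[of g])
    show "g \<theta> = w (cis \<theta>)" if "cis \<theta> \<notin> C" for \<theta> using that by (simp add: g_def)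
    show "isCont g \<theta>" "g \<theta> \<in> power_product_values {1..m} a \<rho> (cis \<theta>)" if "cis \<theta> \<notin> a ` {1..m}" for \<theta>
      using 1 2 that by blast+
    show "g (\<theta> + 2 * pi) = g \<theta>" for \<theta> by (simp add: g_def cis.code)
  qed
qed

end

section \<open>Comparison of the weight with a power near a singular point\<close>

lemma powr_ratio_bounds:
  fixes x r q :: real
  assumes "1/3 \<le> x" "x \<le> 3" "\<bar>r\<bar> \<le> q"
  shows "x powr r \<le> 3 powr q" "3 powr (- q) \<le> x powr r"
proof -
  have l: "\<bar>ln x\<bar> \<le> ln 3"
    using ln_le_cancel_iff[of x 3] ln_le_cancel_iff[of "1/3" x] assms by (auto simp: ln_div abs_le_iff)
  have "\<bar>r * ln x\<bar> \<le> q * ln 3"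
    unfolding abs_mult by (rule mult_mono) (use assms l in auto)
  then show "x powr r \<le> 3 powr q" "3 powr (- q) \<le> x powr r"
    using assms(1) by (auto simp: powr_def)
qed

context weight
begin

text \<open>A bound for the factors contributed by the singular points other than the nearest one, and by the arguments of all
logarithms, when the weight is compared at two points of a short arc.\<close>

definition ratio_constant :: real where "ratio_constant = (\<Prod>k\<in>{1..m}. exp (pi * norm (\<rho> k)) * 3 powr norm (\<rho> k))"

lemma ratio_constant_pos: "ratio_constant > 0" unfolding ratio_constant_def by (intro prod_pos) auto

text \<open>The branch formula along the arc from \<open>p\<close> to \<open>\<theta>\<close>, estimated by absolute values. The arc must not cross the ray through
\<open>a\<^sub>j\<close> (condition \<open>sgn\<close>) and must be short compared with its distance to the other points (condition \<open>other\<close>);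
then every \<open>\<zeta> - a\<^sub>k\<close> stays in a half-plane and no logarithm jumps.\<close>

lemma arc_bound:
  assumes gc: "\<And>\<theta>. cis \<theta> \<notin> a ` {1..m} \<Longrightarrow> isCont g \<theta>"
    and gv: "\<And>\<theta>. cis \<theta> \<notin> a ` {1..m} \<Longrightarrow> g \<theta> \<in> power_product_values {1..m} a \<rho> (cis \<theta>)"
    and j: "j \<in> {1..m}" and aj: "a j = of_real R * cis \<beta>"
    and sgn: "\<exists>\<sigma>. \<forall>s\<in>closed_segment p \<theta>. sin (s - \<beta>) * \<sigma> > 0"
    and other: "\<And>k. k \<in> {1..m} - {j} \<Longrightarrow> \<exists>c. \<forall>s\<in>closed_segment p \<theta>. norm (cis s - a k - c) < norm c / 2"
  shows "norm (g \<theta>) \<le> norm (g p) * ratio_constant * (norm (cis \<theta> - a j) / norm (cis p - a j)) powr Re (\<rho> j)"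
    and "norm (g p) * (norm (cis \<theta> - a j) / norm (cis p - a j)) powr Re (\<rho> j) \<le> ratio_constant * norm (g \<theta>)"
proof -
  define S where "S = closed_segment p \<theta>"
  have pS: "p \<in> S" and tS: "\<theta> \<in> S" by (auto simp: S_def)
  obtain \<sigma> where \<sigma>: "\<And>s. s \<in> S \<Longrightarrow> sin (s - \<beta>) * \<sigma> > 0" using sgn unfolding S_def by blast
  have "\<forall>k\<in>{1..m}-{j}. \<exists>c. \<forall>s\<in>S. norm (cis s - a k - c) < norm c / 2" using other unfolding S_def by blast
  then obtain c where c: "\<And>k s. k \<in> {1..m} - {j} \<Longrightarrow> s \<in> S \<Longrightarrow> norm (cis s - a k - c k) < norm (c k) / 2" by metis
  \<comment> \<open>multiplication by \<open>e k\<close> moves \<open>cis s - a k\<close>, for all \<open>s\<close> on the arc, into the right half-plane\<close>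
  define e where "e k = (if k = j then - \<i> * cis (- \<beta>) * of_real \<sigma> else inverse (c k))" for k
  have half: "0 < Re ((cis s - a k) * e k)" if k: "k \<in> {1..m}" and s: "s \<in> S" for k s
  proof (cases "k = j")
    case True
    have "Re ((cis s - a k) * e k) = sin (s - \<beta>) * \<sigma>"
      by (simp add: True e_def aj sin_diff algebra_simps)
    then show ?thesis using \<sigma>[OF s] by simp
  next
    case False
    have c0: "c k \<noteq> 0" using c[of k s] False k s by auto
    have "norm ((cis s - a k - c k) / c k) < 1/2" using c[of k s] False k s c0 by (simp add: norm_divide field_simps)
    then have "Re ((cis s - a k - c k) / c k) > - 1" using abs_Re_le_cmod[of "(cis s - a k - c k) / c k"] by linarith
    moreover have "(cis s - a k) * e k = 1 + (cis s - a k - c k) / c k" using False c0 by (simp add: e_def field_simps)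
    ultimately show ?thesis by simp
  qed
  have ratio: "(cis s - a k) / (cis p - a k) \<notin> \<real>\<^sub>\<le>\<^sub>0" if "k \<in> {1..m}" "s \<in> S" for k s
    by (rule half_plane_ratio[where c="e k"]) (use half that pS in auto)
  have nz: "cis s - a k \<noteq> 0" if "k \<in> {1..m}" "s \<in> S" for k s
    using half[OF that] by (metis mult_zero_left less_irrefl zero_complex.sel(1))
  then have na: "cis s \<notin> a ` {1..m}" if "s \<in> S" for s using that by fastforce
  have f: "g \<theta> = g p * exp (\<Sum>k\<in>{1..m}. \<rho> k * Ln ((cis \<theta> - a k) / (cis p - a k)))"
  proof (rule branch_formula[where S=S and d="\<lambda>k s. cis s - a k"])
    show "connected S" by (simp add: S_def)
    show "continuous_on S g" by (rule continuous_at_imp_continuous_on) (use gc na in auto)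
    show "\<exists>l. (\<forall>k\<in>{1..m}. exp (l k) = cis s - a k) \<and> g s = exp (\<Sum>k\<in>{1..m}. \<rho> k * l k)" if "s \<in> S" for s
      using gv[OF na[OF that]] unfolding power_product_values_def by blast
    show "continuous_on S (\<lambda>s. cis s - a k)" for k
      by (intro continuous_intros)
  qed (use pS tS ratio in auto)
  define x where "x k = (cis \<theta> - a k) / (cis p - a k)" for k
  have x0: "x k \<noteq> 0" if "k \<in> {1..m}" for k using nz[OF that pS] nz[OF that tS] by (simp add: x_def)
  define y where "y = norm (x j) powr Re (\<rho> j)"
  have y0: "y \<ge> 0" by (simp add: y_def)
  have xk: "1/3 \<le> norm (x k) \<and> norm (x k) \<le> 3" if k: "k \<in> {1..m}" "k \<noteq> j" for k
  proof -
    have c0: "norm (c k) > 0" using c[of k p] k pS by (smt (verit) DiffI norm_ge_zero singletonD field_sum_of_halves)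
    have h1: "norm (c k) / 2 \<le> norm (cis s - a k) \<and> norm (cis s - a k) \<le> 3 * (norm (c k) / 2)" if "s \<in> S" for s
    proof -
      have "norm (cis s - a k - c k) < norm (c k) / 2" using c[of k s] k that by blast
      then show ?thesis using norm_triangle_ineq2[of "c k" "cis s - a k"] norm_triangle_ineq2[of "cis s - a k" "c k"]
        by (simp add: norm_minus_commute)
    qed
    have "norm (cis p - a k) > 0" using h1[OF pS] c0 by linarith
    then show ?thesis using h1[OF pS] h1[OF tS] unfolding x_def norm_divide by (simp add: field_simps)
  qed
  have up: "(\<Prod>k\<in>{1..m}. exp (pi * norm (\<rho> k)) * norm (x k) powr Re (\<rho> k)) \<le> ratio_constant * y"
  proof -
    have "(\<Prod>k\<in>{1..m}. exp (pi * norm (\<rho> k)) * norm (x k) powr Re (\<rho> k))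
        \<le> (\<Prod>k\<in>{1..m}. exp (pi * norm (\<rho> k)) * 3 powr norm (\<rho> k) * (if k = j then y else 1))"
    proof (rule prod_mono, intro conjI)
      fix k assume k: "k \<in> {1..m}"
      show "exp (pi * norm (\<rho> k)) * norm (x k) powr Re (\<rho> k) \<le> exp (pi * norm (\<rho> k)) * 3 powr norm (\<rho> k) * (if k = j then y else 1)"
      proof (cases "k = j")
        case True
        have "1 \<le> (3::real) powr norm (\<rho> j)" by (rule ge_one_powr_ge_zero) auto
        then show ?thesis using True y0 mult_right_mono[of 1 "3 powr norm (\<rho> j)" y] by (simp add: y_def mult.assoc)
      next
        case False
        then show ?thesis using powr_ratio_bounds(1)[of "norm (x k)" "Re (\<rho> k)" "norm (\<rho> k)"] xk[OF k False] abs_Re_le_cmod by simp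
      qed
    qed auto
    also have "\<dots> = ratio_constant * y" using j by (simp add: prod.distrib ratio_constant_def)
    finally show ?thesis .
  qed
  have lo: "y \<le> ratio_constant * (\<Prod>k\<in>{1..m}. exp (- (pi * norm (\<rho> k))) * norm (x k) powr Re (\<rho> k))"
  proof -
    have "y = (\<Prod>k\<in>{1..m}. if k = j then y else 1)" using j by simp
    also have "\<dots> \<le> (\<Prod>k\<in>{1..m}. (exp (pi * norm (\<rho> k)) * 3 powr norm (\<rho> k)) * (exp (- (pi * norm (\<rho> k))) * norm (x k) powr Re (\<rho> k)))"
    proof (rule prod_mono, intro conjI)
      fix k assume k: "k \<in> {1..m}"
      have eq: "(exp (pi * norm (\<rho> k)) * 3 powr norm (\<rho> k)) * (exp (- (pi * norm (\<rho> k))) * norm (x k) powr Re (\<rho> k))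
          = 3 powr norm (\<rho> k) * norm (x k) powr Re (\<rho> k)" by (simp add: exp_minus field_simps)
      show "(if k = j then y else 1) \<le> (exp (pi * norm (\<rho> k)) * 3 powr norm (\<rho> k)) * (exp (- (pi * norm (\<rho> k))) * norm (x k) powr Re (\<rho> k))"
        unfolding eq
      proof (cases "k = j")
        case True
        have "1 \<le> (3::real) powr norm (\<rho> j)" by (rule ge_one_powr_ge_zero) auto
        then show "(if k = j then y else 1) \<le> 3 powr norm (\<rho> k) * norm (x k) powr Re (\<rho> k)"
          using True y0 mult_right_mono[of 1 "3 powr norm (\<rho> j)" y] by (simp add: y_def)
      next
        case False
        have "1 = 3 powr norm (\<rho> k) * 3 powr (- norm (\<rho> k))" by (simp add: powr_minus)
        also have "\<dots> \<le> 3 powr norm (\<rho> k) * norm (x k) powr Re (\<rho> k)"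
          using powr_ratio_bounds(2)[of "norm (x k)" "Re (\<rho> k)" "norm (\<rho> k)"] xk[OF k False] abs_Re_le_cmod
          by (intro mult_left_mono) auto
        finally show "(if k = j then y else 1) \<le> 3 powr norm (\<rho> k) * norm (x k) powr Re (\<rho> k)" using False by simp
      qed
    qed (use y0 in auto)
    also have "\<dots> = ratio_constant * (\<Prod>k\<in>{1..m}. exp (- (pi * norm (\<rho> k))) * norm (x k) powr Re (\<rho> k))"
      by (simp only: prod.distrib[symmetric] ratio_constant_def)
    finally show ?thesis .
  qed
  have yx: "(norm (cis \<theta> - a j) / norm (cis p - a j)) powr Re (\<rho> j) = y" by (simp add: y_def x_def norm_divide)
  have ng: "norm (g \<theta>) = norm (g p) * norm (exp (\<Sum>k\<in>{1..m}. \<rho> k * Ln (x k)))"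
    by (subst f) (simp only: norm_mult x_def)
  note B = norm_exp_Ln_bounds[of "{1..m}" x \<rho>, OF finite_atLeastAtMost x0]
  show "norm (g \<theta>) \<le> norm (g p) * ratio_constant * (norm (cis \<theta> - a j) / norm (cis p - a j)) powr Re (\<rho> j)"
  proof -
    have "norm (exp (\<Sum>k\<in>{1..m}. \<rho> k * Ln (x k))) \<le> ratio_constant * y" using B(1) up by linarith
    then show ?thesis unfolding yx ng mult.assoc by (rule mult_left_mono) simp
  qed
  show "norm (g p) * (norm (cis \<theta> - a j) / norm (cis p - a j)) powr Re (\<rho> j) \<le> ratio_constant * norm (g \<theta>)"
  proof -
    have "y \<le> ratio_constant * norm (exp (\<Sum>k\<in>{1..m}. \<rho> k * Ln (x k)))"
      using lo mult_left_mono[OF B(2), of ratio_constant] ratio_constant_pos by linarith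
    then have "norm (g p) * y \<le> norm (g p) * (ratio_constant * norm (exp (\<Sum>k\<in>{1..m}. \<rho> k * Ln (x k))))"
      by (rule mult_left_mono) simp
    then show ?thesis unfolding yx ng by (simp add: mult_ac)
  qed
qed

end

text \<open>The data of the problem as \<open>t\<close> varies. Joint continuity of the weight fixes the branch coherently in \<open>t\<close>.\<close>

locale weight_family =
  fixes U :: "real set" and m :: nat and zs :: "real \<Rightarrow> nat \<Rightarrow> complex" and \<rho> :: "nat \<Rightarrow> complex"
    and C :: "real \<Rightarrow> complex set" and w :: "real \<Rightarrow> complex \<Rightarrow> complex"
  assumes open_U: "open U"
    and wt: "\<And>t. t \<in> U \<Longrightarrow> weight m (zs t) \<rho> (C t) (w t)"
    and zs_diff: "\<And>t j. t \<in> U \<Longrightarrow> j \<in> {1..m} \<Longrightarrow> (\<lambda>s. zs s j) differentiable (at t)"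
    and open_dom: "open {(t, z). t \<in> U \<and> z \<notin> C t}"
    and cont_dom: "continuous_on {(t, z). t \<in> U \<and> z \<notin> C t} (\<lambda>(t, z). w t z)"
begin

lemma zs_cont: "t \<in> U \<Longrightarrow> j \<in> {1..m} \<Longrightarrow> isCont (\<lambda>s. zs s j) t"
  using zs_diff differentiable_imp_continuous_within by blast

lemma w_cont: assumes "t \<in> U" "z \<notin> C t" shows "isCont (\<lambda>s. w s z) t" "eventually (\<lambda>s. s \<in> U \<and> z \<notin> C s) (nhds t)"
proof -
  let ?D = "{(t, z). t \<in> U \<and> z \<notin> C t}"
  have "isCont (\<lambda>(t, z). w t z) (t, z)" using cont_dom open_dom assms by (simp add: continuous_on_eq_continuous_at)
  then have "isCont (\<lambda>s. (\<lambda>(t, z). w t z) (s, z)) t" by (rule isCont_o2[rotated]) (intro continuous_intros)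
  then show "isCont (\<lambda>s. w s z) t" by simp
  have "open ((\<lambda>s. (s, z)) -` ?D)" by (intro open_vimage open_dom continuous_intros)
  then have "eventually (\<lambda>s. s \<in> (\<lambda>s. (s, z)) -` ?D) (nhds t)" using assms by (intro eventually_nhds_in_open) auto
  then show "eventually (\<lambda>s. s \<in> U \<and> z \<notin> C s) (nhds t)" by simp
qed

text \<open>Two base points are fixed on the circle, one on each side of \<open>z\<^sub>j(t\<^sub>0)\<close>. There the weight is continuous and non-zero in
\<open>t\<close>, so it is bounded above and below for \<open>t\<close> near \<open>t\<^sub>0\<close>, and \<open>arc_bound\<close> carries the bounds to every \<open>\<zeta>\<close> on the same
side of \<open>z\<^sub>j(t)\<close>. The radial projection \<open>sgn (zs t j)\<close> separates the two sides and is excluded, at the cost of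
one point of the circle for each \<open>t\<close>.\<close>

lemma local_bound:
  assumes t0: "t0 \<in> U" and j: "j \<in> {1..m}" and on: "norm (zs t0 j) = 1"
  obtains \<delta> \<eta> K where "\<delta> > 0" "\<eta> > 0" "K > 0"
    "\<And>t \<zeta>. \<bar>t - t0\<bar> < \<eta> \<Longrightarrow> norm \<zeta> = 1 \<Longrightarrow> \<zeta> \<notin> C t \<Longrightarrow> norm (\<zeta> - zs t0 j) < \<delta> \<Longrightarrow> \<zeta> \<noteq> sgn (zs t j) \<Longrightarrow>
        t \<in> U \<and> norm (w t \<zeta>) \<le> K * norm (\<zeta> - zs t j) powr Re (\<rho> j) \<and> norm (\<zeta> - zs t j) powr Re (\<rho> j) \<le> K * norm (w t \<zeta>)"
proof -
  interpret W0: weight m "zs t0" \<rho> "C t0" "w t0" using wt[OF t0] .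
  define a where "a = zs t0 j"
  have a0: "a \<noteq> 0" using on by (auto simp: a_def)
  define \<theta>0 where "\<theta>0 = Arg a"
  have a\<theta>: "a = cis \<theta>0" using cis_Arg[OF a0] on by (simp add: a_def \<theta>0_def sgn_div_norm)
  define N where "N = Min (insert 1 ((\<lambda>k. norm (a - zs t0 k)) ` ({1..m} - {j})))"
  have N: "N > 0" "\<And>k. k \<in> {1..m} - {j} \<Longrightarrow> N \<le> norm (a - zs t0 k)" "N \<le> 1"
  proof -
    have "norm (a - zs t0 k) > 0" if "k \<in> {1..m} - {j}" for k
    proof -
      have "k \<in> {1..m}" "k \<noteq> j" using that by auto
      then have "zs t0 k \<noteq> a" using inj_onD[OF W0.distinct _ _ j] unfolding a_def by blast
      then show ?thesis by simp
    qed
    then show "N > 0" unfolding N_def by (subst Min_gr_iff) auto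
    show "N \<le> norm (a - zs t0 k)" if "k \<in> {1..m} - {j}" for k
      unfolding N_def by (rule Min_le) (use that in auto)
    show "N \<le> 1" unfolding N_def by (rule Min_le) auto
  qed
  have "eventually (\<lambda>x. cis x \<notin> C t0) (at \<theta>0)"
  proof -
    have "open (- (insert (-1) (zs t0 ` {1..m}) - {a}))" by (intro open_Compl finite_imp_closed finite_Diff) auto
    then have "open (cis -` (- (insert (-1) (zs t0 ` {1..m}) - {a})))" by (intro open_vimage) (auto intro!: continuous_intros)
    then have "eventually (\<lambda>x. x \<in> cis -` (- (insert (-1) (zs t0 ` {1..m}) - {a}))) (nhds \<theta>0)"
      by (intro eventually_nhds_in_open) (auto simp: a\<theta>)
    then have "eventually (\<lambda>x. cis x \<notin> insert (-1) (zs t0 ` {1..m}) - {a}) (at \<theta>0)"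
      unfolding eventually_nhds_conv_at by (auto elim: eventually_mono)
    then show ?thesis using W0.cis_nbhd[of \<theta>0]
    proof eventually_elim
      case (elim x)
      have "cis x \<in> sphere 0 1" by simp
      moreover have "cis x \<notin> insert (-1) (zs t0 ` {1..m})" using elim a\<theta> by blast
      ultimately show ?case using W0.circle_C by blast
    qed
  qed
  then obtain d where d: "d > 0" "\<And>x. x \<noteq> \<theta>0 \<Longrightarrow> \<bar>x - \<theta>0\<bar> < d \<Longrightarrow> cis x \<notin> C t0"
    unfolding eventually_at by (auto simp: dist_real_def)
  define \<omega> where "\<omega> = min (d / 2) (N / 8)"
  have \<omega>: "\<omega> > 0" "\<omega> < d" "\<omega> \<le> N / 8" "\<omega> \<le> 1/8" using d(1) N by (auto simp: \<omega>_def)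
  have pC: "cis (\<theta>0 + \<sigma> * \<omega>) \<notin> C t0" if "\<sigma> \<in> {-1, 1}" for \<sigma>
    using that \<omega> by (intro d(2)) (auto simp: abs_mult)
  \<comment> \<open>the quotient of \<open>|w|\<close> by the comparison function at the base point on side \<open>\<sigma>\<close>\<close>
  define n0 where "n0 \<sigma> t = norm (w t (cis (\<theta>0 + \<sigma> * \<omega>))) / norm (cis (\<theta>0 + \<sigma> * \<omega>) - zs t j) powr Re (\<rho> j)" for \<sigma> t
  have n0c: "isCont (n0 \<sigma>) t0" and n0p: "n0 \<sigma> t0 > 0" if "\<sigma> \<in> {-1, 1}" for \<sigma>
  proof -
    have ne: "cis (\<theta>0 + \<sigma> * \<omega>) - zs t0 j \<noteq> 0" using W0.ne_point[OF pC[OF that] j] by simp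
    show "isCont (n0 \<sigma>) t0" unfolding n0_def using ne
      by (intro continuous_intros w_cont(1)[OF t0 pC[OF that]] zs_cont[OF t0 j]) auto
    show "n0 \<sigma> t0 > 0" unfolding n0_def using ne W0.weight_nonzero[OF pC[OF that]] by simp
  qed
  define L where "L = max (2 * max (n0 1 t0) (n0 (-1) t0)) (max (2 / n0 1 t0) (2 / n0 (-1) t0))"
  have ev1: "eventually (\<lambda>t. t \<in> U \<and> cis (\<theta>0 + \<sigma> * \<omega>) \<notin> C t \<and> n0 \<sigma> t \<le> L \<and> 1 / n0 \<sigma> t \<le> L) (nhds t0)" if "\<sigma> \<in> {-1, 1}" for \<sigma>
  proof -
    have T: "(n0 \<sigma> \<longlongrightarrow> n0 \<sigma> t0) (nhds t0)" using n0c[OF that] by (simp add: isCont_def tendsto_nhds_iff)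
    have "eventually (\<lambda>t. n0 \<sigma> t < 2 * n0 \<sigma> t0) (nhds t0)"
      using n0p[OF that] by (intro order_tendstoD(2)[OF T]) auto
    moreover have "eventually (\<lambda>t. n0 \<sigma> t > n0 \<sigma> t0 / 2) (nhds t0)"
      using n0p[OF that] by (intro order_tendstoD(1)[OF T]) auto
    ultimately show ?thesis using w_cont(2)[OF t0 pC[OF that]]
    proof eventually_elim
      case (elim t)
      have "1 / n0 \<sigma> t \<le> 2 / n0 \<sigma> t0" using elim n0p[OF that] by (simp add: field_simps)
      then have "n0 \<sigma> t \<le> L \<and> 1 / n0 \<sigma> t \<le> L" using elim that unfolding L_def by auto
      then show ?case using elim by blast
    qed
  qed
  have ev2: "eventually (\<lambda>t. norm (zs t k - zs t0 k) < N / 8) (nhds t0)" if "k \<in> {1..m}" for k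
  proof -
    have "((\<lambda>t. zs t k) \<longlongrightarrow> zs t0 k) (nhds t0)" using zs_cont[OF t0 that] by (simp add: isCont_def tendsto_nhds_iff)
    then have "eventually (\<lambda>t. dist (zs t k) (zs t0 k) < N / 8) (nhds t0)" using N(1) by (intro tendstoD) auto
    then show ?thesis by (simp add: dist_norm)
  qed
  have "\<forall>k\<in>{1..m}. eventually (\<lambda>t. norm (zs t k - zs t0 k) < N / 8) (nhds t0)" using ev2 by blast
  then have ev2': "eventually (\<lambda>t. \<forall>k\<in>{1..m}. norm (zs t k - zs t0 k) < N / 8) (nhds t0)"
    by (rule eventually_ball_finite[rotated]) simp
  have "isCont Ln 1" by (rule continuous_at_Ln) simp
  then have "(Ln \<longlongrightarrow> 0) (nhds 1)" by (simp add: isCont_def tendsto_nhds_iff)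
  then have lnc: "((\<lambda>x. Im (Ln x)) \<longlongrightarrow> 0) (nhds 1)" using tendsto_Im by fastforce
  then have "eventually (\<lambda>x. \<bar>Im (Ln x)\<bar> < \<omega>) (nhds 1)"
    using \<omega>(1) tendstoD[of "\<lambda>x. Im (Ln x)" 0 "nhds 1" \<omega>] by (simp add: dist_real_def)
  then obtain \<delta> where \<delta>: "\<delta> > 0" "\<And>x. norm (x - 1) < \<delta> \<Longrightarrow> \<bar>Im (Ln x)\<bar> < \<omega>"
    unfolding eventually_nhds_metric by (auto simp: dist_norm)
  have ev3: "eventually (\<lambda>t. norm (zs t j / a - 1) < min \<delta> 1) (nhds t0)"
  proof -
    have "((\<lambda>t. zs t j / a) \<longlongrightarrow> zs t0 j / a) (nhds t0)" using zs_cont[OF t0 j] a0 by (intro tendsto_intros) (auto simp: isCont_def tendsto_nhds_iff)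
    then have "eventually (\<lambda>t. dist (zs t j / a) 1 < min \<delta> 1) (nhds t0)" using \<delta>(1) a0 by (intro tendstoD) (auto simp: a_def)
    then show ?thesis by (simp add: dist_norm)
  qed
  have "eventually (\<lambda>t. (t \<in> U \<and> cis (\<theta>0 + 1 * \<omega>) \<notin> C t \<and> n0 1 t \<le> L \<and> 1 / n0 1 t \<le> L)
     \<and> (t \<in> U \<and> cis (\<theta>0 + (-1) * \<omega>) \<notin> C t \<and> n0 (-1) t \<le> L \<and> 1 / n0 (-1) t \<le> L)
     \<and> (\<forall>k\<in>{1..m}. norm (zs t k - zs t0 k) < N / 8) \<and> norm (zs t j / a - 1) < min \<delta> 1) (nhds t0)"
    by (rule eventually_conj[OF ev1[of 1] eventually_conj[OF ev1[of "-1"] eventually_conj[OF ev2' ev3]]]) auto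
  then obtain \<eta> where \<eta>: "\<eta> > 0" and near: "\<And>t. \<bar>t - t0\<bar> < \<eta> \<Longrightarrow> (t \<in> U \<and> cis (\<theta>0 + 1 * \<omega>) \<notin> C t \<and> n0 1 t \<le> L \<and> 1 / n0 1 t \<le> L)
     \<and> (t \<in> U \<and> cis (\<theta>0 + (-1) * \<omega>) \<notin> C t \<and> n0 (-1) t \<le> L \<and> 1 / n0 (-1) t \<le> L)
     \<and> (\<forall>k\<in>{1..m}. norm (zs t k - zs t0 k) < N / 8) \<and> norm (zs t j / a - 1) < min \<delta> 1"
    unfolding eventually_nhds_metric by (auto simp: dist_real_def)
  have L0: "L > 0" using n0p[of 1] unfolding L_def by (simp add: less_max_iff_disj)
  have K: "L * W0.ratio_constant > 0" using L0 W0.ratio_constant_pos by simp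
  have main: "t \<in> U \<and> norm (w t \<zeta>) \<le> (L * W0.ratio_constant) * norm (\<zeta> - zs t j) powr Re (\<rho> j) \<and> norm (\<zeta> - zs t j) powr Re (\<rho> j) \<le> (L * W0.ratio_constant) * norm (w t \<zeta>)"
    if t: "\<bar>t - t0\<bar> < \<eta>" and \<zeta>: "norm \<zeta> = 1" "\<zeta> \<notin> C t" "norm (\<zeta> - zs t0 j) < \<delta>" "\<zeta> \<noteq> sgn (zs t j)" for t \<zeta>
  proof -
    have tU: "t \<in> U" using near[OF t] by blast
    interpret W: weight m "zs t" \<rho> "C t" "w t" using wt[OF tU] .
    define b where "b = zs t j"
    have b0: "b \<noteq> 0" using near[OF t] by (auto simp: b_def)
    define \<beta> where "\<beta> = \<theta>0 + Im (Ln (b / a))"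
    define \<theta> where "\<theta> = \<theta>0 + Im (Ln (\<zeta> / a))"
    have polar: "x = of_real (norm x) * cis (\<theta>0 + Im (Ln (x / a)))" if "x \<noteq> 0" for x
    proof -
      have "x / a = exp (Ln (x / a))" using that a0 by simp
      also have "\<dots> = of_real (exp (Re (Ln (x / a)))) * cis (Im (Ln (x / a)))" by (simp add: exp_eq_polar)
      also have "exp (Re (Ln (x / a))) = norm x" using that a0 a\<theta> by (simp add: norm_divide)
      finally have "x = of_real (norm x) * (cis \<theta>0 * cis (Im (Ln (x / a))))" using a0 a\<theta> by (simp add: field_simps)
      then show ?thesis by (simp add: cis_mult)
    qed
    have zn: "\<zeta> \<noteq> 0" using \<zeta>(1) by auto
    have z\<theta>: "\<zeta> = cis \<theta>" using polar[OF zn] \<zeta>(1) by (simp add: \<theta>_def)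
    have b\<beta>: "b = of_real (norm b) * cis \<beta>" using polar[OF b0] by (simp add: \<beta>_def)
    have \<theta>\<omega>: "\<bar>\<theta> - \<theta>0\<bar> < \<omega>"
    proof -
      have "norm (\<zeta> / a - 1) = norm (\<zeta> - a)" using a0 a\<theta> by (simp add: divide_simps norm_divide norm_mult)
      then show ?thesis using \<delta>(2)[of "\<zeta> / a"] \<zeta>(3) by (simp add: \<theta>_def a_def)
    qed
    have \<beta>\<omega>: "\<bar>\<beta> - \<theta>0\<bar> < \<omega>" using \<delta>(2)[of "b / a"] near[OF t] by (simp add: \<beta>_def b_def)
    have ne: "\<theta> \<noteq> \<beta>"
    proof
      assume "\<theta> = \<beta>"
      then have "\<zeta> = sgn b" using b\<beta> b0 z\<theta> by (metis div_by_0 nonzero_mult_div_cancel_left norm_eq_zero of_real_eq_0_iff scaleR_conv_of_real sgn_div_norm divide_inverse mult.commute of_real_inverse)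
      then show False using \<zeta>(4) by (simp add: b_def)
    qed
    define \<sigma> :: real where "\<sigma> = (if \<theta> > \<beta> then 1 else -1)"
    have \<sigma>: "\<sigma> \<in> {-1, 1}" by (simp add: \<sigma>_def)
    define p where "p = \<theta>0 + \<sigma> * \<omega>"
    obtain g where g: "\<And>\<theta>. cis \<theta> \<notin> C t \<Longrightarrow> g \<theta> = w t (cis \<theta>)"
      "\<And>\<theta>. cis \<theta> \<notin> zs t ` {1..m} \<Longrightarrow> isCont g \<theta>"
      "\<And>\<theta>. cis \<theta> \<notin> zs t ` {1..m} \<Longrightarrow> g \<theta> \<in> power_product_values {1..m} (zs t) \<rho> (cis \<theta>)"
      using W.circle_extension by metis
    have seg: "\<bar>s - \<theta>0\<bar> \<le> \<omega> \<and> 0 < (s - \<beta>) * \<sigma> \<and> \<bar>s - \<beta>\<bar> \<le> 2 * \<omega>" if "s \<in> closed_segment p \<theta>" for s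
      using that \<theta>\<omega> \<beta>\<omega> ne by (auto simp: \<sigma>_def p_def closed_segment_eq_real_ivl split: if_splits)
    have npC: "cis p \<notin> C t" using near[OF t] \<sigma> by (auto simp: p_def)
    have aj: "zs t j = of_real (norm b) * cis \<beta>" using b\<beta> by (simp add: b_def)
    have sg: "\<exists>\<sigma>. \<forall>s\<in>closed_segment p \<theta>. sin (s - \<beta>) * \<sigma> > 0"
    proof (intro exI ballI)
      fix s assume s: "s \<in> closed_segment p \<theta>"
      have "2 * \<omega> < pi" using \<omega> pi_gt3 by linarith
      then show "sin (s - \<beta>) * \<sigma> > 0"
        using seg[OF s] sin_gt_zero[of "s - \<beta>"] sin_gt_zero[of "- (s - \<beta>)"] \<sigma> by (auto simp del: minus_diff_eq)
    qed
    have oth: "\<exists>c. \<forall>s\<in>closed_segment p \<theta>. norm (cis s - zs t k - c) < norm c / 2" if k: "k \<in> {1..m} - {j}" for k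
    proof (intro exI ballI)
      fix s assume s: "s \<in> closed_segment p \<theta>"
      have "norm (cis s - a) \<le> \<bar>s - \<theta>0\<bar>"
      proof -
        have "cis s = cis \<theta>0 * cis (s - \<theta>0)" by (simp add: cis_mult)
        then have "cis s - a = cis \<theta>0 * (exp (\<i> * of_real (s - \<theta>0)) - 1)"
          unfolding a\<theta> by (simp only: cis_conv_exp[of "s - \<theta>0"] right_diff_distrib mult_1_right)
        then have "norm (cis s - a) = norm (exp (\<i> * of_real (s - \<theta>0)) - 1)" by (simp add: norm_mult)
        also have "\<dots> \<le> \<bar>s - \<theta>0\<bar>" using norm_exp_i_times[of "s-\<theta>0"] dist_exp_i_1[of "s - \<theta>0"] abs_sin_x_le_abs_x[of "(s - \<theta>0) / 2"] by simp
        finally show ?thesis .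
      qed
      then have "norm (cis s - a) \<le> N / 8" using seg[OF s] \<omega>(3) by linarith
      moreover have "norm (zs t k - zs t0 k) < N / 8" using near[OF t] k by blast
      moreover have "norm (cis s - zs t k - (a - zs t0 k)) \<le> norm (cis s - a) + norm (zs t k - zs t0 k)"
        using norm_triangle_ineq4[of "cis s - a" "zs t k - zs t0 k"] by (simp add: algebra_simps)
      moreover have "N \<le> norm (a - zs t0 k)" using N(2)[OF k] .
      ultimately show "norm (cis s - zs t k - (a - zs t0 k)) < norm (a - zs t0 k) / 2" using N(1) by linarith
    qed
    note AB = W.arc_bound[OF g(2,3) j aj sg oth]
    have g1: "g \<theta> = w t \<zeta>" "g p = w t (cis p)" using g(1) \<zeta>(2) z\<theta> npC by auto
    define X where "X = norm (\<zeta> - zs t j) powr Re (\<rho> j)"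
    define Y where "Y = norm (cis p - zs t j) powr Re (\<rho> j)"
    have Y0: "Y > 0" using W.ne_point[OF npC j] by (simp add: Y_def)
    have pw: "(norm (cis \<theta> - zs t j) / norm (cis p - zs t j)) powr Re (\<rho> j) = X / Y"
      by (simp add: X_def Y_def z\<theta> powr_divide)
    have nn: "n0 \<sigma> t = norm (w t (cis p)) / Y" by (simp add: n0_def Y_def p_def)
    have nL: "n0 \<sigma> t \<le> L" "1 / n0 \<sigma> t \<le> L" using near[OF t] \<sigma> by auto
    have nt0: "n0 \<sigma> t > 0" using W.weight_nonzero[OF npC] Y0 by (simp add: nn)
    have X0: "X \<ge> 0" by (simp add: X_def)
    have "norm (w t \<zeta>) \<le> n0 \<sigma> t * (W0.ratio_constant * X)" using AB(1) unfolding g1 pw nn by (simp add: field_simps)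
    also have "\<dots> \<le> L * (W0.ratio_constant * X)" using nL(1) X0 W0.ratio_constant_pos by (intro mult_right_mono) auto
    finally have 1: "norm (w t \<zeta>) \<le> L * W0.ratio_constant * X" by (simp add: mult.assoc)
    have "n0 \<sigma> t * X \<le> W0.ratio_constant * norm (w t \<zeta>)" using AB(2) unfolding g1 pw nn by (simp add: field_simps)
    then have "X \<le> (1 / n0 \<sigma> t) * (W0.ratio_constant * norm (w t \<zeta>))" using nt0 by (simp add: field_simps)
    also have "\<dots> \<le> L * (W0.ratio_constant * norm (w t \<zeta>))" using nL(2) W0.ratio_constant_pos by (intro mult_right_mono) auto
    finally have 2: "X \<le> L * W0.ratio_constant * norm (w t \<zeta>)" by (simp add: mult.assoc)
    show ?thesis using 1 2 tU by (simp add: X_def)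
  qed
  show ?thesis using that[OF \<delta>(1) \<eta> K main] by blast
qed

end

section \<open>Integrals over the unit circle\<close>

abbreviation (input) Tset :: "real set" where "Tset \<equiv> {-pi<..pi}"

lemma circle_integrable_add: "circle_integrable f \<Longrightarrow> circle_integrable g \<Longrightarrow> circle_integrable (\<lambda>\<zeta>. f \<zeta> + g \<zeta>)"
  unfolding circle_integrable_def by (rule set_integral_add)

lemma circle_integrable_cmult: "circle_integrable f \<Longrightarrow> circle_integrable (\<lambda>\<zeta>. c * f \<zeta>)"
  unfolding circle_integrable_def by (rule set_integrable_mult_right)

lemma circle_integrable_diff: "circle_integrable f \<Longrightarrow> circle_integrable g \<Longrightarrow> circle_integrable (\<lambda>\<zeta>. f \<zeta> - g \<zeta>)"
  unfolding circle_integrable_def by (rule set_integral_diff)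

lemma circle_integrable_sum:
  "finite I \<Longrightarrow> (\<And>i. i \<in> I \<Longrightarrow> circle_integrable (f i)) \<Longrightarrow> circle_integrable (\<lambda>\<zeta>. \<Sum>i\<in>I. f i \<zeta>)"
proof (induction I rule: finite_induct)
  case empty
  then show ?case by (simp add: circle_integrable_def set_integrable_def)
next
  case (insert x F)
  then show ?case by (simp add: circle_integrable_add)
qed

lemma ci_add: "circle_integrable f \<Longrightarrow> circle_integrable g \<Longrightarrow>
    circle_integral (\<lambda>\<zeta>. f \<zeta> + g \<zeta>) = circle_integral f + circle_integral g"
  unfolding circle_integrable_def circle_integral_def by (simp add: set_integral_add add_divide_distrib)

lemma ci_diff: "circle_integrable f \<Longrightarrow> circle_integrable g \<Longrightarrow>
    circle_integral (\<lambda>\<zeta>. f \<zeta> - g \<zeta>) = circle_integral f - circle_integral g"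
  unfolding circle_integrable_def circle_integral_def by (simp add: set_integral_diff diff_divide_distrib)

lemma ci_cmult: "circle_integral (\<lambda>\<zeta>. c * f \<zeta>) = c * circle_integral f"
  unfolding circle_integral_def by simp

lemma ci_zero [simp]: "circle_integral (\<lambda>\<zeta>. 0) = 0"
  unfolding circle_integral_def by simp

lemma ci_sum:
  "finite I \<Longrightarrow> (\<And>i. i \<in> I \<Longrightarrow> circle_integrable (f i)) \<Longrightarrow>
    circle_integral (\<lambda>\<zeta>. \<Sum>i\<in>I. f i \<zeta>) = (\<Sum>i\<in>I. circle_integral (f i))"
proof (induction I rule: finite_induct)
  case (insert x F)
  then show ?case by (simp add: ci_add circle_integrable_sum)
qed simp

lemma circle_cong: "(\<And>\<zeta>. norm \<zeta> = 1 \<Longrightarrow> f \<zeta> = g \<zeta>) \<Longrightarrow> circle_integral f = circle_integral g"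
  unfolding circle_integral_def by simp

lemma countable_cis_vimage:
  assumes "countable F" shows "countable {\<theta>. cis \<theta> \<in> F}"
proof -
  have "countable {\<theta>. cis \<theta> = z}" for z
  proof (cases "\<exists>\<theta>0. cis \<theta>0 = z")
    case True
    then obtain \<theta>0 where \<theta>0: "cis \<theta>0 = z" by blast
    have "{\<theta>. cis \<theta> = z} \<subseteq> range (\<lambda>k::int. \<theta>0 + 2 * pi * k)"
    proof
      fix \<theta> assume "\<theta> \<in> {\<theta>. cis \<theta> = z}"
      then have "sin \<theta> = sin \<theta>0 \<and> cos \<theta> = cos \<theta>0" using \<theta>0 by (auto simp: complex_eq_iff)
      then show "\<theta> \<in> range (\<lambda>k::int. \<theta>0 + 2 * pi * k)" using sin_cos_eq_iff[of \<theta> \<theta>0] by auto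
    qed
    then show ?thesis by (rule countable_subset) auto
  next
    case False
    then have "{\<theta>. cis \<theta> = z} = {}" by auto
    then show ?thesis by simp
  qed
  then have "countable (\<Union>z\<in>F. {\<theta>. cis \<theta> = z})" using assms by auto
  moreover have "(\<Union>z\<in>F. {\<theta>. cis \<theta> = z}) = {\<theta>. cis \<theta> \<in> F}" by auto
  ultimately show ?thesis by simp
qed

text \<open>Countably many exceptional points are allowed so that those of a whole sequence of parameters \<open>t\<close> can be discarded at once.\<close>

lemma AE_cis_notin:
  assumes "countable F" shows "AE \<theta> in lborel. cis \<theta> \<notin> F"
proof -
  have "{\<theta>. cis \<theta> \<in> F} \<in> null_sets lborel"
    using countable_cis_vimage[OF assms] by (rule countable_imp_null_set_lborel)
  then show ?thesis by (rule AE_I') auto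
qed

lemma circle_integrable_bound:
  assumes "circle_integrable f" "set_borel_measurable lborel Tset (\<lambda>\<theta>. g (cis \<theta>))" "countable F"
    "\<And>\<zeta>. norm \<zeta> = 1 \<Longrightarrow> \<zeta> \<notin> F \<Longrightarrow> norm (g \<zeta>) \<le> norm (f \<zeta>)"
  shows "circle_integrable g"
  unfolding circle_integrable_def
proof (rule set_integrable_bound)
  show "set_integrable lborel Tset (\<lambda>\<theta>. f (cis \<theta>))" using assms(1) by (simp add: circle_integrable_def)
  show "AE x in lborel. x \<in> Tset \<longrightarrow> norm (g (cis x)) \<le> norm (f (cis x))"
    using AE_cis_notin[OF assms(3)] by eventually_elim (use assms(4) in auto)
qed fact

lemma circle_measurable_mult:
  assumes "circle_integrable f" "(\<lambda>\<theta>. h (cis \<theta>)) \<in> borel_measurable borel"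
  shows "set_borel_measurable lborel Tset (\<lambda>\<theta>. f (cis \<theta>) * h (cis \<theta>))"
proof -
  have "(\<lambda>x. indicator Tset x *\<^sub>R f (cis x)) \<in> borel_measurable lborel"
    using assms(1) unfolding circle_integrable_def set_integrable_def by (rule borel_measurable_integrable)
  then have "(\<lambda>x. (indicator Tset x *\<^sub>R f (cis x)) * h (cis x)) \<in> borel_measurable lborel"
    using assms(2) by (intro borel_measurable_times) auto
  then show ?thesis unfolding set_borel_measurable_def by simp
qed

lemma cis_measurable [measurable]: "cis \<in> borel_measurable borel"
  by (intro borel_measurable_continuous_onI continuous_intros)

lemma circle_integrable_mult_bounded:
  assumes f: "circle_integrable f" and h: "(\<lambda>\<theta>. h (cis \<theta>)) \<in> borel_measurable borel"
    and b: "\<And>\<zeta>. norm \<zeta> = 1 \<Longrightarrow> norm (h \<zeta>) \<le> B"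
  shows "circle_integrable (\<lambda>\<zeta>. f \<zeta> * h \<zeta>)"
proof (rule circle_integrable_bound[where F="{}" and f="\<lambda>\<zeta>. of_real B * f \<zeta>"])
  show "circle_integrable (\<lambda>\<zeta>. of_real B * f \<zeta>)" by (rule circle_integrable_cmult[OF f])
  show "norm (f \<zeta> * h \<zeta>) \<le> norm (of_real B * f \<zeta>)" if "norm \<zeta> = 1" for \<zeta>
  proof -
    have "norm (h \<zeta>) \<le> \<bar>B\<bar>" using b[OF that] by simp
    then have "norm (f \<zeta>) * norm (h \<zeta>) \<le> norm (f \<zeta>) * \<bar>B\<bar>" by (rule mult_left_mono) simp
    then show ?thesis by (simp add: norm_mult mult.commute)
  qed
qed (use circle_measurable_mult[OF f h] in auto)

lemma circle_continuous_facts: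
  fixes h :: "complex \<Rightarrow> complex"
  assumes "continuous_on (sphere 0 1) h"
  shows "(\<lambda>\<theta>. h (cis \<theta>)) \<in> borel_measurable borel" and "\<exists>B. \<forall>\<zeta>. norm \<zeta> = 1 \<longrightarrow> norm (h \<zeta>) \<le> B"
proof -
  have "continuous_on UNIV (\<lambda>\<theta>. h (cis \<theta>))"
    by (rule continuous_on_compose2[OF assms]) (auto intro!: continuous_intros)
  then show "(\<lambda>\<theta>. h (cis \<theta>)) \<in> borel_measurable borel" by (rule borel_measurable_continuous_onI)
  have "compact (h ` sphere 0 1)" by (rule compact_continuous_image[OF assms]) simp
  then have "bounded (h ` sphere 0 1)" by (rule compact_imp_bounded)
  then show "\<exists>B. \<forall>\<zeta>. norm \<zeta> = 1 \<longrightarrow> norm (h \<zeta>) \<le> B" unfolding bounded_iff by force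
qed

lemma circle_integrable_mult_continuous:
  assumes "circle_integrable f" "continuous_on (sphere 0 1) h"
  shows "circle_integrable (\<lambda>\<zeta>. f \<zeta> * h \<zeta>)"
  using circle_continuous_facts[OF assms(2)] circle_integrable_mult_bounded[OF assms(1)] by blast

definition circle_L1 :: "(complex \<Rightarrow> complex) \<Rightarrow> real" where
  "circle_L1 f = (LINT \<theta>:Tset|lborel. norm (f (cis \<theta>))) / (2 * pi)"

lemma ci_norm_bound:
  assumes f: "circle_integrable f" and h: "continuous_on (sphere 0 1) h"
    and b: "\<And>\<zeta>. norm \<zeta> = 1 \<Longrightarrow> norm (h \<zeta>) \<le> B"
  shows "norm (circle_integral (\<lambda>\<zeta>. f \<zeta> * h \<zeta>)) \<le> B * circle_L1 f"
proof -
  have i: "set_integrable lborel Tset (\<lambda>\<theta>. f (cis \<theta>) * h (cis \<theta>))"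
    using circle_integrable_mult_continuous[OF f h] by (simp add: circle_integrable_def)
  have fi: "set_integrable lborel Tset (\<lambda>\<theta>. f (cis \<theta>))" using f by (simp add: circle_integrable_def)
  have "norm (LINT \<theta>:Tset|lborel. f (cis \<theta>) * h (cis \<theta>)) \<le> (LINT \<theta>:Tset|lborel. norm (f (cis \<theta>) * h (cis \<theta>)))"
    by (rule set_integral_norm_bound[OF i])
  also have "\<dots> \<le> (LINT \<theta>:Tset|lborel. B * norm (f (cis \<theta>)))"
  proof (rule set_integral_mono)
    show "set_integrable lborel Tset (\<lambda>\<theta>. norm (f (cis \<theta>) * h (cis \<theta>)))" by (rule set_integrable_norm[OF i])
    show "set_integrable lborel Tset (\<lambda>\<theta>. B * norm (f (cis \<theta>)))"
      by (rule set_integrable_mult_right) (use set_integrable_norm[OF fi] in simp)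
    show "norm (f (cis x) * h (cis x)) \<le> B * norm (f (cis x))" for x
      unfolding norm_mult mult.commute[of B] by (rule mult_left_mono) (use b in auto)
  qed
  also have "\<dots> = B * (LINT \<theta>:Tset|lborel. norm (f (cis \<theta>)))" by simp
  finally show ?thesis unfolding circle_integral_def circle_L1_def
    by (simp add: norm_divide norm_mult divide_right_mono)
qed

text \<open>Differentiation under the integral sign away from the circle, by an explicit second-order estimate of the kernel.\<close>

lemma kernel_has_derivative:
  assumes f: "circle_integrable f" and z: "norm z \<noteq> 1"
  shows "((\<lambda>z. circle_integral (\<lambda>\<zeta>. f \<zeta> * ((\<zeta> + z) / (\<zeta> - z)))) has_field_derivative
      circle_integral (\<lambda>\<zeta>. f \<zeta> * (2 * \<zeta> / (\<zeta> - z)\<^sup>2))) (at z)"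
proof -
  define r where "r = \<bar>norm z - 1\<bar> / 2"
  have r: "r > 0" using z by (simp add: r_def)
  define B where "B = 2 / (r ^ 2 * r)"
  define M where "M = B * circle_L1 f"
  have far: "norm (\<zeta> - z') \<ge> r" if "norm \<zeta> = 1" "norm (z' - z) < r" for \<zeta> z'
  proof -
    have "\<bar>norm z - norm \<zeta>\<bar> \<le> norm (\<zeta> - z)" by (metis norm_minus_commute norm_triangle_ineq3)
    then have "2 * r \<le> norm (\<zeta> - z)" using that by (simp add: r_def)
    moreover have "norm (\<zeta> - z) \<le> norm (\<zeta> - z') + norm (z' - z)" by (metis norm_diff_triangle_ineq add.commute diff_add_cancel norm_triangle_ineq add_diff_eq)
    ultimately show ?thesis using that(2) by linarith
  qed
  have far': "norm (\<zeta> - z) \<ge> r" if "norm \<zeta> = 1" for \<zeta> using far[OF that, of z] r by simp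
  have est: "norm ((circle_integral (\<lambda>\<zeta>. f \<zeta> * ((\<zeta> + y) / (\<zeta> - y))) - circle_integral (\<lambda>\<zeta>. f \<zeta> * ((\<zeta> + z) / (\<zeta> - z)))) / (y - z)
      - circle_integral (\<lambda>\<zeta>. f \<zeta> * (2 * \<zeta> / (\<zeta> - z)\<^sup>2))) \<le> norm (y - z) * M" if y: "y \<noteq> z" "norm (y - z) < r" for y
  proof -
    have nz: "\<zeta> - z \<noteq> 0" "\<zeta> - y \<noteq> 0" if "norm \<zeta> = 1" for \<zeta>
      using far'[OF that] far[OF that y(2)] r by auto
    have c1: "continuous_on (sphere 0 1) (\<lambda>\<zeta>. (\<zeta> + y) / (\<zeta> - y))"
      by (intro continuous_intros ballI) (use nz in simp)
    have c2: "continuous_on (sphere 0 1) (\<lambda>\<zeta>. (\<zeta> + z) / (\<zeta> - z))"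
      by (intro continuous_intros ballI) (use nz in simp)
    have c3: "continuous_on (sphere 0 1) (\<lambda>\<zeta>. 2 * \<zeta> / (\<zeta> - z)\<^sup>2)"
      by (intro continuous_intros ballI) (use nz in simp)
    note I = circle_integrable_mult_continuous[OF f]
    have c4: "continuous_on (sphere 0 1) (\<lambda>\<zeta>. 2 * \<zeta> * (y - z) / ((\<zeta> - z)\<^sup>2 * (\<zeta> - y)))"
      using nz by (intro continuous_intros) auto
    have "(circle_integral (\<lambda>\<zeta>. f \<zeta> * ((\<zeta> + y) / (\<zeta> - y))) - circle_integral (\<lambda>\<zeta>. f \<zeta> * ((\<zeta> + z) / (\<zeta> - z)))) / (y - z)
      - circle_integral (\<lambda>\<zeta>. f \<zeta> * (2 * \<zeta> / (\<zeta> - z)\<^sup>2))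
      = circle_integral (\<lambda>\<zeta>. (1 / (y - z)) * (f \<zeta> * ((\<zeta> + y) / (\<zeta> - y)) - f \<zeta> * ((\<zeta> + z) / (\<zeta> - z))) - f \<zeta> * (2 * \<zeta> / (\<zeta> - z)\<^sup>2))"
      using I[OF c1] I[OF c2] I[OF c3]
      by (simp add: ci_diff ci_cmult circle_integrable_diff circle_integrable_cmult del: times_divide_eq_right times_divide_eq_left)
         (simp)
    also have "\<dots> = circle_integral (\<lambda>\<zeta>. f \<zeta> * (2 * \<zeta> * (y - z) / ((\<zeta> - z)\<^sup>2 * (\<zeta> - y))))"
    proof (rule circle_cong)
      fix \<zeta> :: complex assume "norm \<zeta> = 1"
      then have n: "\<zeta> - z \<noteq> 0" "\<zeta> - y \<noteq> 0" "y - z \<noteq> 0" using nz y by auto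
      have "(1 / (y - z)) * ((\<zeta> + y) / (\<zeta> - y) - (\<zeta> + z) / (\<zeta> - z)) = 2 * \<zeta> / ((\<zeta> - z) * (\<zeta> - y))"
        using n by (simp add: divide_simps) (simp add: algebra_simps)
      moreover have "2 * \<zeta> / ((\<zeta> - z) * (\<zeta> - y)) - 2 * \<zeta> / (\<zeta> - z)\<^sup>2 = 2 * \<zeta> * (y - z) / ((\<zeta> - z)\<^sup>2 * (\<zeta> - y))"
        using n by (simp add: divide_simps power2_eq_square) (simp add: algebra_simps)
      ultimately have "(1 / (y - z)) * ((\<zeta> + y) / (\<zeta> - y) - (\<zeta> + z) / (\<zeta> - z)) - 2 * \<zeta> / (\<zeta> - z)\<^sup>2 = 2 * \<zeta> * (y - z) / ((\<zeta> - z)\<^sup>2 * (\<zeta> - y))" by simp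
      then show "(1 / (y - z)) * (f \<zeta> * ((\<zeta> + y) / (\<zeta> - y)) - f \<zeta> * ((\<zeta> + z) / (\<zeta> - z))) - f \<zeta> * (2 * \<zeta> / (\<zeta> - z)\<^sup>2) = f \<zeta> * (2 * \<zeta> * (y - z) / ((\<zeta> - z)\<^sup>2 * (\<zeta> - y)))"
        by (metis (no_types, lifting) mult.left_commute right_diff_distrib)
    qed
    also have "norm \<dots> \<le> (B * norm (y - z)) * circle_L1 f"
    proof (rule ci_norm_bound[OF f c4])
      fix \<zeta> :: complex assume z1: "norm \<zeta> = 1"
      have "r ^ 2 * r \<le> norm ((\<zeta> - z)\<^sup>2 * (\<zeta> - y))"
        unfolding norm_mult norm_power using far'[OF z1] far[OF z1 y(2)] r by (intro mult_mono power_mono) auto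
      then have "2 * norm (y - z) / norm ((\<zeta> - z)\<^sup>2 * (\<zeta> - y)) \<le> 2 * norm (y - z) / (r ^ 2 * r)"
        using r nz[OF z1] by (intro divide_left_mono mult_pos_pos) auto
      then show "norm (2 * \<zeta> * (y - z) / ((\<zeta> - z)\<^sup>2 * (\<zeta> - y))) \<le> B * norm (y - z)"
        by (simp add: norm_divide norm_mult z1 B_def)
    qed
    finally show ?thesis by (simp add: M_def mult_ac)
  qed
  have "((\<lambda>y. (circle_integral (\<lambda>\<zeta>. f \<zeta> * ((\<zeta> + y) / (\<zeta> - y))) - circle_integral (\<lambda>\<zeta>. f \<zeta> * ((\<zeta> + z) / (\<zeta> - z)))) / (y - z)
      - circle_integral (\<lambda>\<zeta>. f \<zeta> * (2 * \<zeta> / (\<zeta> - z)\<^sup>2))) \<longlongrightarrow> 0) (at z)"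
  proof (rule Lim_null_comparison)
    show "eventually (\<lambda>y. norm ((circle_integral (\<lambda>\<zeta>. f \<zeta> * ((\<zeta> + y) / (\<zeta> - y))) - circle_integral (\<lambda>\<zeta>. f \<zeta> * ((\<zeta> + z) / (\<zeta> - z)))) / (y - z)
      - circle_integral (\<lambda>\<zeta>. f \<zeta> * (2 * \<zeta> / (\<zeta> - z)\<^sup>2))) \<le> norm (y - z) * M) (at z)"
      unfolding eventually_at using r est by (intro exI[of _ r]) (auto simp: dist_norm)
    show "((\<lambda>y. norm (y - z) * M) \<longlongrightarrow> 0) (at z)" by (auto intro!: tendsto_eq_intros)
  qed
  then show ?thesis unfolding has_field_derivative_iff by (rule LIM_zero_cancel)
qed

section \<open>Integrability near the singular points and integration by parts\<close>

text \<open>Near the angle of \<open>a\<close> the integrand is at least the reciprocal of the distance of the angles.\<close>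

lemma not_integrable_simple_pole:
  assumes a: "norm a = 1" shows "\<not> circle_integrable (\<lambda>\<zeta>. 1 / (\<zeta> - a))"
proof
  assume I: "circle_integrable (\<lambda>\<zeta>. 1 / (\<zeta> - a))"
  define \<theta>0 where "\<theta>0 = Arg a"
  have a\<theta>: "a = cis \<theta>0" using a cis_Arg[of a] by (cases "a = 0") (auto simp: \<theta>0_def sgn_div_norm)
  have \<theta>0: "-pi < \<theta>0" "\<theta>0 \<le> pi" using mpi_less_Arg[of a] Arg_le_pi[of a] by (auto simp: \<theta>0_def)
  define c where "c = (\<theta>0 - pi) / 2"
  have c: "-pi < c" "c < \<theta>0" using \<theta>0 by (auto simp: c_def)
  have Ir: "set_integrable lborel Tset (\<lambda>\<theta>. norm (1 / (cis \<theta> - a)))"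
    using I unfolding circle_integrable_def by (rule set_integrable_norm)
  define Q where "Q = (LINT \<theta>:Tset|lborel. norm (1 / (cis \<theta> - a)))"
  have Q0: "Q \<ge> 0" unfolding Q_def set_lebesgue_integral_def by (intro Bochner_Integration.integral_nonneg) auto
  define e where "e = (\<theta>0 - c) * exp (- (Q + 1))"
  have "exp (- (Q + 1)) < 1" using Q0 by simp
  then have e: "e > 0" "e < \<theta>0 - c" using c by (auto simp: e_def mult_less_cancel_left1)
  have cont: "continuous_on {c..\<theta>0 - e} (\<lambda>\<theta>. 1 / (\<theta>0 - \<theta>))" using e by (intro continuous_intros) auto
  have F: "((\<lambda>\<theta>. - ln (\<theta>0 - \<theta>)) has_vector_derivative 1 / (\<theta>0 - \<theta>)) (at \<theta> within {c..\<theta>0 - e})" if "\<theta> \<in> {c..\<theta>0-e}" for \<theta>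
    using that e by (auto intro!: derivative_eq_intros simp: has_real_derivative_iff_has_vector_derivative[symmetric] field_simps)
  have "(\<integral>\<theta>. indicator {c..\<theta>0-e} \<theta> *\<^sub>R (1 / (\<theta>0 - \<theta>)) \<partial>lborel) = - ln (\<theta>0 - (\<theta>0 - e)) - - ln (\<theta>0 - c)"
    by (rule integral_FTC_Icc[OF _ _ cont]) (use F e in auto)
  also have "\<dots> = ln (\<theta>0 - c) - ln e" by simp
  also have "ln e = ln (\<theta>0 - c) - (Q + 1)" unfolding e_def using c by (subst ln_mult) auto
  finally have "(\<integral>\<theta>. indicator {c..\<theta>0-e} \<theta> *\<^sub>R (1 / (\<theta>0 - \<theta>)) \<partial>lborel) = Q + 1" by simp
  moreover have "(\<integral>\<theta>. indicator {c..\<theta>0-e} \<theta> *\<^sub>R (1 / (\<theta>0 - \<theta>)) \<partial>lborel) \<le> Q"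
    unfolding Q_def set_lebesgue_integral_def
  proof (rule integral_mono)
    show "integrable lborel (\<lambda>\<theta>. indicator {c..\<theta>0-e} \<theta> *\<^sub>R (1 / (\<theta>0 - \<theta>)))"
      using has_bochner_integral_FTC_Icc[OF _ F cont] e by (auto simp: has_bochner_integral_iff)
    show "integrable lborel (\<lambda>x. indicat_real Tset x *\<^sub>R cmod (1 / (cis x - a)))" using Ir by (simp add: set_integrable_def)
    fix \<theta>
    show "indicator {c..\<theta>0-e} \<theta> *\<^sub>R (1 / (\<theta>0 - \<theta>)) \<le> indicat_real Tset \<theta> *\<^sub>R cmod (1 / (cis \<theta> - a))"
    proof (cases "\<theta> \<in> {c..\<theta>0-e}")
      case True
      have t: "\<theta> \<in> Tset" "\<theta> < \<theta>0" "- pi < \<theta>" using True c e \<theta>0 by auto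
      have "cis \<theta> \<noteq> a"
      proof
        assume "cis \<theta> = a"
        then have "Arg (cis \<theta>) = Arg (cis \<theta>0)" by (simp add: a\<theta>)
        then show False using t \<theta>0 by (simp add: Arg_cis)
      qed
      have "cis \<theta> - a = cis \<theta>0 * (exp (\<i> * of_real (\<theta> - \<theta>0)) - 1)"
        unfolding a\<theta> by (simp only: cis_conv_exp[symmetric] right_diff_distrib mult_1_right cis_mult) simp
      then have "norm (cis \<theta> - a) = norm (exp (\<i> * of_real (\<theta> - \<theta>0)) - 1)" by (simp add: norm_mult)
      also have "\<dots> \<le> \<bar>\<theta> - \<theta>0\<bar>" using dist_exp_i_1[of "\<theta> - \<theta>0"] abs_sin_x_le_abs_x[of "(\<theta> - \<theta>0) / 2"] by simp
      finally have "norm (cis \<theta> - a) \<le> \<theta>0 - \<theta>" using t by simp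
      then have "1 / (\<theta>0 - \<theta>) \<le> 1 / norm (cis \<theta> - a)" using \<open>cis \<theta> \<noteq> a\<close> by (intro divide_left_mono mult_pos_pos) (use t in auto)
      then show ?thesis using True t(1) by (simp add: norm_divide)
    qed auto
  qed
  ultimately show False by simp
qed

context weight
begin

lemma w_integrable: "circle_integrable w"
  using integrable[of 0] by simp

lemma w_mult_integrable: "continuous_on (sphere 0 1) h \<Longrightarrow> circle_integrable (\<lambda>\<zeta>. w \<zeta> * h \<zeta>)"
  by (rule circle_integrable_mult_continuous[OF w_integrable])

text \<open>Contains every point of the circle at which the weight may fail to be analytic.\<close>

definition exceptional :: "complex set" where "exceptional = insert (-1) (a ` {1..m})"

lemma finite_exceptional [simp]: "finite exceptional" by (simp add: exceptional_def)

lemma not_exceptional: "norm \<zeta> = 1 \<Longrightarrow> \<zeta> \<notin> exceptional \<Longrightarrow> \<zeta> \<notin> C"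
  using circle_C by (auto simp: exceptional_def)

text \<open>Near \<open>a\<^sub>j\<close> the logarithmic derivative of the weight is \<open>\<rho>\<^sub>j / (\<zeta> - a\<^sub>j)\<close> plus a bounded term and \<open>\<rho>\<^sub>j \<noteq> 0\<close>, so the quotient is
dominated by \<open>w'\<close> and \<open>w\<close>. This is where integrability of \<open>w'\<close> enters.\<close>

lemma w_div_integrable:
  assumes j: "j \<in> {1..m}" shows "circle_integrable (\<lambda>\<zeta>. w \<zeta> / (\<zeta> - a j))"
proof -
  define N where "N = Min (insert 1 ((\<lambda>k. norm (a j - a k)) ` ({1..m} - {j})))"
  have N: "N > 0" "\<And>k. k \<in> {1..m} - {j} \<Longrightarrow> N \<le> norm (a j - a k)"
  proof -
    have "norm (a j - a k) > 0" if "k \<in> {1..m} - {j}" for k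
    proof -
      have "k \<in> {1..m}" "k \<noteq> j" using that by auto
      then have "a k \<noteq> a j" using inj_onD[OF distinct _ _ j] by blast
      then show ?thesis by simp
    qed
    then show "N > 0" unfolding N_def by (subst Min_gr_iff) auto
    show "N \<le> norm (a j - a k)" if "k \<in> {1..m} - {j}" for k
      unfolding N_def by (rule Min_le) (use that in auto)
  qed
  define \<delta> where "\<delta> = N / 2"
  have \<delta>: "\<delta> > 0" using N by (simp add: \<delta>_def)
  define R where "R = (\<Sum>k\<in>{1..m}. norm (\<rho> k) / \<delta>)"
  have R0: "R \<ge> 0" using \<delta> by (simp add: R_def sum_nonneg)
  have \<rho>j: "norm (\<rho> j) > 0" using exponent_nz[OF j] by simp
  define K where "K = 1 / \<delta> + R / norm (\<rho> j)"
  have der: "circle_integrable (deriv w)" using integrable_deriv[of 0] by simp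
  have f: "set_integrable lborel Tset (\<lambda>\<theta>. (1 / norm (\<rho> j)) * norm (deriv w (cis \<theta>)) + K * norm (w (cis \<theta>)))"
    using der w_integrable unfolding circle_integrable_def
    by (intro set_integral_add set_integrable_mult_right set_integrable_norm) auto
  have pt: "norm (w \<zeta> / (\<zeta> - a j)) \<le> (1 / norm (\<rho> j)) * norm (deriv w \<zeta>) + K * norm (w \<zeta>)" if \<zeta>: "norm \<zeta> = 1" "\<zeta> \<notin> exceptional" for \<zeta>
  proof (cases "norm (\<zeta> - a j) \<ge> \<delta>")
    case True
    have "norm (w \<zeta> / (\<zeta> - a j)) \<le> norm (w \<zeta>) / \<delta>" unfolding norm_divide using True \<delta> by (intro divide_left_mono mult_pos_pos) auto
    also have "\<dots> \<le> K * norm (w \<zeta>)" using R0 by (simp add: K_def algebra_simps)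
    also have "\<dots> \<le> (1 / norm (\<rho> j)) * norm (deriv w \<zeta>) + K * norm (w \<zeta>)" by simp
    finally show ?thesis .
  next
    case False
    have nC: "\<zeta> \<notin> C" using not_exceptional \<zeta> by blast
    have d: "deriv w \<zeta> = log_z_deriv \<zeta> * w \<zeta>" using weight_z_deriv[OF nC] by (rule DERIV_imp_deriv)
    have log_z_deriv: "log_z_deriv \<zeta> = \<rho> j / (\<zeta> - a j) + (\<Sum>k\<in>{1..m}-{j}. \<rho> k / (\<zeta> - a k))"
      unfolding log_z_deriv_def using j by (simp add: sum.remove)
    have "norm (\<Sum>k\<in>{1..m}-{j}. \<rho> k / (\<zeta> - a k)) \<le> (\<Sum>k\<in>{1..m}-{j}. norm (\<rho> k) / \<delta>)"
    proof (rule sum_norm_le)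
      fix k assume k: "k \<in> {1..m} - {j}"
      have "norm (a j - a k) \<le> norm (\<zeta> - a k) + norm (\<zeta> - a j)"
        using norm_triangle_ineq4[of "\<zeta> - a k" "\<zeta> - a j"] by simp
      then have "norm (\<zeta> - a k) \<ge> \<delta>" using N(2)[OF k] False by (simp add: \<delta>_def)
      then show "norm (\<rho> k / (\<zeta> - a k)) \<le> norm (\<rho> k) / \<delta>" unfolding norm_divide using \<delta> by (intro divide_left_mono mult_pos_pos) auto
    qed
    also have "\<dots> \<le> R" unfolding R_def using \<delta> by (intro sum_mono2) auto
    finally have S: "norm (\<Sum>k\<in>{1..m}-{j}. \<rho> k / (\<zeta> - a k)) \<le> R" .
    have "\<rho> j * (w \<zeta> / (\<zeta> - a j)) = deriv w \<zeta> - (\<Sum>k\<in>{1..m}-{j}. \<rho> k / (\<zeta> - a k)) * w \<zeta>"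
      unfolding d log_z_deriv by (simp add: algebra_simps)
    then have "norm (\<rho> j) * norm (w \<zeta> / (\<zeta> - a j)) \<le> norm (deriv w \<zeta>) + R * norm (w \<zeta>)"
      using norm_triangle_ineq4[of "deriv w \<zeta>" "(\<Sum>k\<in>{1..m}-{j}. \<rho> k / (\<zeta> - a k)) * w \<zeta>"] mult_right_mono[OF S, of "norm (w \<zeta>)"]
      by (simp add: norm_mult[symmetric])
    then have "norm (w \<zeta> / (\<zeta> - a j)) \<le> (norm (deriv w \<zeta>) + R * norm (w \<zeta>)) / norm (\<rho> j)"
      using \<rho>j by (simp add: field_simps)
    also have "\<dots> \<le> (1 / norm (\<rho> j)) * norm (deriv w \<zeta>) + K * norm (w \<zeta>)"
      using \<delta> by (simp add: K_def algebra_simps add_divide_distrib)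
    finally show ?thesis .
  qed
  have ms: "set_borel_measurable lborel Tset (\<lambda>\<theta>. w (cis \<theta>) * (\<lambda>\<zeta>. 1 / (\<zeta> - a j)) (cis \<theta>))"
    by (rule circle_measurable_mult[OF w_integrable]) measurable
  show ?thesis unfolding circle_integrable_def
  proof (rule set_integrable_bound[OF f])
    show "set_borel_measurable lborel Tset (\<lambda>\<theta>. w (cis \<theta>) / (cis \<theta> - a j))" using ms by simp
    show "AE x in lborel. x \<in> Tset \<longrightarrow> norm (w (cis x) / (cis x - a j)) \<le> norm ((1 / norm (\<rho> j)) * norm (deriv w (cis x)) + K * norm (w (cis x)))"
      using AE_cis_notin[OF countable_finite[OF finite_exceptional]]
    proof eventually_elim
      case (elim x)
      then show ?case using pt[of "cis x"] by (auto intro: order_trans[OF _ abs_ge_self])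
    qed
  qed
qed

text \<open>A single weight is a family that does not move, which makes \<open>local_bound\<close> available for it.\<close>

lemma constant_family: "weight_family UNIV m (\<lambda>_. a) \<rho> (\<lambda>_. C) (\<lambda>_. w)"
proof
  have eq: "{(t::real, z). t \<in> UNIV \<and> z \<notin> C} = snd -` (- C)" by auto
  show "open {(t::real, z). t \<in> UNIV \<and> z \<notin> C}" unfolding eq
    by (rule open_vimage) (use closed_C in \<open>auto intro!: continuous_intros\<close>)
  have "continuous_on (snd -` (- C)) (\<lambda>p::real \<times> complex. w (snd p))"
    by (rule continuous_on_compose2[OF cont]) (auto intro!: continuous_intros)
  then show "continuous_on {(t::real, z). t \<in> UNIV \<and> z \<notin> C} (\<lambda>(t, z). w z)"
    unfolding eq by (simp add: case_prod_beta')
qed (use weight_axioms in auto)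

lemma local_bound_fixed:
  assumes j: "j \<in> {1..m}" and on: "norm (a j) = 1"
  obtains \<delta> K where "\<delta> > 0" "K > 0"
    "\<And>\<zeta>. norm \<zeta> = 1 \<Longrightarrow> \<zeta> \<notin> C \<Longrightarrow> norm (\<zeta> - a j) < \<delta> \<Longrightarrow>
        norm (w \<zeta>) \<le> K * norm (\<zeta> - a j) powr Re (\<rho> j) \<and> norm (\<zeta> - a j) powr Re (\<rho> j) \<le> K * norm (w \<zeta>)"
proof -
  interpret W: weight_family UNIV m "\<lambda>_. a" \<rho> "\<lambda>_. C" "\<lambda>_. w" by (rule constant_family)
  obtain \<delta> \<eta> K where L: "\<delta> > 0" "\<eta> > 0" "K > 0"
    "\<And>t \<zeta>. \<bar>t - (0::real)\<bar> < \<eta> \<Longrightarrow> norm \<zeta> = 1 \<Longrightarrow> \<zeta> \<notin> C \<Longrightarrow> norm (\<zeta> - a j) < \<delta> \<Longrightarrow> \<zeta> \<noteq> sgn (a j) \<Longrightarrow>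
        t \<in> UNIV \<and> norm (w \<zeta>) \<le> K * norm (\<zeta> - a j) powr Re (\<rho> j) \<and> norm (\<zeta> - a j) powr Re (\<rho> j) \<le> K * norm (w \<zeta>)"
    by (rule W.local_bound[of 0 j]) (use j on in auto)
  have sg: "sgn (a j) = a j" using on by (simp add: sgn_div_norm)
  have "norm (w \<zeta>) \<le> K * norm (\<zeta> - a j) powr Re (\<rho> j) \<and> norm (\<zeta> - a j) powr Re (\<rho> j) \<le> K * norm (w \<zeta>)"
    if "norm \<zeta> = 1" "\<zeta> \<notin> C" "norm (\<zeta> - a j) < \<delta>" for \<zeta>
    using L(4)[of 0 \<zeta>] L(2) that ne_point[OF that(2) j] sg by simp
  then show ?thesis by (rule that[OF L(1,3)])
qed

text \<open>Otherwise \<open>|w|\<close> is bounded below near \<open>a\<^sub>j\<close>, and integrability of \<open>w / (\<zeta> - a\<^sub>j)\<close> would make a simple pole integrable.\<close>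

lemma Re_exponent_pos:
  assumes j: "j \<in> {1..m}" and on: "norm (a j) = 1" shows "Re (\<rho> j) > 0"
proof (rule ccontr)
  assume "\<not> Re (\<rho> j) > 0"
  then have r: "Re (\<rho> j) \<le> 0" by simp
  obtain \<delta> K where L: "\<delta> > 0" "K > 0"
    "\<And>\<zeta>. norm \<zeta> = 1 \<Longrightarrow> \<zeta> \<notin> C \<Longrightarrow> norm (\<zeta> - a j) < \<delta> \<Longrightarrow>
        norm (w \<zeta>) \<le> K * norm (\<zeta> - a j) powr Re (\<rho> j) \<and> norm (\<zeta> - a j) powr Re (\<rho> j) \<le> K * norm (w \<zeta>)"
    using local_bound_fixed[OF j on] by metis
  define d where "d = min \<delta> 1"
  have d: "d > 0" "d \<le> \<delta>" "d \<le> 1" using L by (auto simp: d_def)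
  have f: "set_integrable lborel Tset (\<lambda>\<theta>. K * norm (w (cis \<theta>) / (cis \<theta> - a j)) + 1 / d)"
    using w_div_integrable[OF j] unfolding circle_integrable_def
    by (intro set_integral_add set_integrable_mult_right set_integrable_norm)
       (auto simp: set_integrable_def intro: integrable_real_indicator)
  have pt: "norm (1 / (\<zeta> - a j)) \<le> K * norm (w \<zeta> / (\<zeta> - a j)) + 1 / d" if \<zeta>: "norm \<zeta> = 1" "\<zeta> \<notin> exceptional" for \<zeta>
  proof (cases "norm (\<zeta> - a j) < d")
    case True
    have nC: "\<zeta> \<notin> C" using not_exceptional \<zeta> by blast
    have p: "norm (\<zeta> - a j) > 0" using ne_point[OF nC j] by simp
    have "1 = 1 powr Re (\<rho> j)" by simp
    also have "\<dots> \<le> norm (\<zeta> - a j) powr Re (\<rho> j)"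
      by (rule powr_mono2') (use r p True d in auto)
    also have "\<dots> \<le> K * norm (w \<zeta>)" using L(3)[OF \<zeta>(1) nC] True d by simp
    finally have "1 / norm (\<zeta> - a j) \<le> K * norm (w \<zeta>) / norm (\<zeta> - a j)" by (intro divide_right_mono) auto
    then show ?thesis using d by (simp add: norm_divide add_increasing2)
  next
    case False
    have "norm (1 / (\<zeta> - a j)) \<le> 1 / d" unfolding norm_divide using False d by (simp add: frac_le)
    then show ?thesis using L(2) by (simp add: add_increasing)
  qed
  have "circle_integrable (\<lambda>\<zeta>. 1 / (\<zeta> - a j))"
    unfolding circle_integrable_def
  proof (rule set_integrable_bound[OF f])
    have "(\<lambda>\<theta>. 1 / (cis \<theta> - a j)) \<in> borel_measurable borel" by measurable
    then show "set_borel_measurable lborel Tset (\<lambda>\<theta>. 1 / (cis \<theta> - a j))"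
      unfolding set_borel_measurable_def by measurable
    show "AE x in lborel. x \<in> Tset \<longrightarrow> norm (1 / (cis x - a j)) \<le> norm (K * norm (w (cis x) / (cis x - a j)) + 1 / d)"
      using AE_cis_notin[OF countable_finite[OF finite_exceptional]]
    proof eventually_elim
      case (elim x)
      then show ?case using pt[of "cis x"] by (auto intro: order_trans[OF _ abs_ge_self])
    qed
  qed
  then show False using not_integrable_simple_pole[OF on] by blast
qed

text \<open>The integrand is, up to the factor \<open>\<i>\<close>, the \<open>\<theta>\<close>-derivative of \<open>k w\<close> on the circle. There are no boundary terms: at \<open>-1\<close> the
boundary values agree, and at a singular point on the circle the weight tends to 0 because its exponent has positive real part.\<close>

lemma integration_by_parts:
  assumes k: "\<And>\<zeta>. norm \<zeta> = 1 \<Longrightarrow> (k has_field_derivative k' \<zeta>) (at \<zeta>)"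
    and k': "continuous_on (sphere 0 1) k'"
  shows "circle_integral (\<lambda>\<zeta>. w \<zeta> * (\<zeta> * (k' \<zeta> + log_z_deriv \<zeta> * k \<zeta>))) = 0"
proof -
  obtain g where g: "\<And>\<theta>. cis \<theta> \<notin> C \<Longrightarrow> g \<theta> = w (cis \<theta>)"
    and gc: "\<And>\<theta>. cis \<theta> \<notin> a ` {1..m} \<Longrightarrow> isCont g \<theta>"
    and "\<And>\<theta>. cis \<theta> \<notin> a ` {1..m} \<Longrightarrow> g \<theta> \<in> power_product_values {1..m} a \<rho> (cis \<theta>)"
    and per: "\<And>\<theta>. g (\<theta> + 2 * pi) = g \<theta>"
    using circle_extension by metis
  \<comment> \<open>the weight along the circle, extended by 0 to the singular points; it is continuous because \<open>Re \<rho> > 0\<close> there\<close>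
  define h where "h \<theta> = (if cis \<theta> \<in> a ` {1..m} then 0 else g \<theta>)" for \<theta>
  have opn: "open (cis -` (- F))" if "finite F" for F :: "complex set"
    by (rule open_vimage[OF open_Compl[OF finite_imp_closed[OF that]]]) (intro continuous_intros)
  have hc: "isCont h \<theta>" for \<theta>
  proof (cases "cis \<theta> \<in> a ` {1..m}")
    case False
    have "eventually (\<lambda>x. x \<in> cis -` (- (a ` {1..m}))) (nhds \<theta>)" using False by (intro eventually_nhds_in_open opn) auto
    then have "eventually (\<lambda>x. h x = g x) (nhds \<theta>)" by eventually_elim (simp add: h_def)
    then show ?thesis using gc[OF False] isCont_cong by blast
  next
    case True
    then obtain j where j: "j \<in> {1..m}" "cis \<theta> = a j" by auto
    then have on: "norm (a j) = 1" by (metis norm_cis)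
    obtain \<delta> K where L: "\<delta> > 0" "K > 0"
      "\<And>\<zeta>. norm \<zeta> = 1 \<Longrightarrow> \<zeta> \<notin> C \<Longrightarrow> norm (\<zeta> - a j) < \<delta> \<Longrightarrow>
        norm (w \<zeta>) \<le> K * norm (\<zeta> - a j) powr Re (\<rho> j) \<and> norm (\<zeta> - a j) powr Re (\<rho> j) \<le> K * norm (w \<zeta>)"
      using local_bound_fixed[OF j(1) on] by metis
    have T: "((\<lambda>x. K * norm (cis x - a j) powr Re (\<rho> j)) \<longlongrightarrow> 0) (at \<theta>)"
    proof -
      have "((\<lambda>x. norm (cis x - a j)) \<longlongrightarrow> 0) (at \<theta>)"
        using isCont_cis[of \<theta>] j(2) by (simp add: isCont_def tendsto_norm_zero_iff LIM_zero_iff)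
      then have "((\<lambda>x. norm (cis x - a j) powr Re (\<rho> j)) \<longlongrightarrow> 0 powr Re (\<rho> j)) (at \<theta>)"
        by (rule tendsto_powr') (use Re_exponent_pos[OF j(1) on] in auto)
      then show ?thesis by (auto intro: tendsto_mult_right_zero)
    qed
    have "((\<lambda>x. cis x) \<longlongrightarrow> a j) (at \<theta>)" using isCont_cis[of \<theta>] j(2) by (simp add: isCont_def)
    then have e1: "eventually (\<lambda>x. norm (cis x - a j) < \<delta>) (at \<theta>)"
      using tendstoD[OF _ L(1)] by (fastforce simp: dist_norm)
    have "eventually (\<lambda>x. x \<in> cis -` (- (exceptional - {a j}))) (nhds \<theta>)" by (intro eventually_nhds_in_open opn) (auto simp: j)
    then have e2: "eventually (\<lambda>x. cis x \<notin> exceptional - {a j}) (at \<theta>)" unfolding eventually_nhds_conv_at by (auto elim: eventually_mono)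
    have "eventually (\<lambda>x. norm (h x) \<le> K * norm (cis x - a j) powr Re (\<rho> j)) (at \<theta>)"
      using e1 e2 cis_nbhd[of \<theta>]
    proof eventually_elim
      case (elim x)
      then have nb: "cis x \<notin> exceptional" using j by auto
      then have nC: "cis x \<notin> C" by (intro not_exceptional) auto
      have "h x = w (cis x)" using nb g[OF nC] by (auto simp: h_def exceptional_def)
      then show ?case using L(3)[of "cis x"] nC elim by simp
    qed
    then have "(h \<longlongrightarrow> 0) (at \<theta>)" using T by (rule Lim_null_comparison)
    then show ?thesis using True by (simp add: isCont_def h_def)
  qed
  have kc: "isCont (\<lambda>x. k (cis x)) \<theta>" for \<theta>
    by (rule isCont_o2[OF isCont_cis]) (rule DERIV_isCont[OF k], simp)
  define B where "B = {\<theta> \<in> {-pi<..<pi}. cis \<theta> \<in> exceptional}"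
  have "finite B" unfolding B_def
  proof (rule finite_subset[OF _ finite_vimage_IntI[OF finite_exceptional, of cis "{-pi<..<pi}"]])
    show "inj_on cis {-pi<..<pi}" by (rule inj_onI) (metis Arg_cis greaterThanLessThan_iff greaterThanAtMost_iff less_imp_le)
  qed auto
  define q where "q \<theta> = k (cis \<theta>) * h \<theta>" for \<theta>
  define f where "f \<theta> = \<i> * (w (cis \<theta>) * (cis \<theta> * (k' (cis \<theta>) + log_z_deriv (cis \<theta>) * k (cis \<theta>))))" for \<theta>
  have FTC: "(f has_integral (q pi - q (-pi))) {-pi..pi}"
  proof (rule fundamental_theorem_of_calculus_interior_strong[OF \<open>finite B\<close>])
    show "continuous_on {- pi..pi} q" unfolding q_def
      by (intro continuous_at_imp_continuous_on ballI continuous_intros hc kc)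
    fix x assume x: "x \<in> {-pi<..<pi} - B"
    then have nb: "cis x \<notin> exceptional" by (auto simp: B_def)
    then have nC: "cis x \<notin> C" by (intro not_exceptional) auto
    have dc: "(cis has_vector_derivative \<i> * cis x) (at x)"
    proof -
      have "((\<lambda>x. exp (\<i> * of_real x)) has_vector_derivative \<i> * exp (\<i> * of_real x)) (at x)"
        by (auto intro!: derivative_eq_intros has_vector_derivative_real_field)
      then show ?thesis by (simp add: cis_conv_exp[abs_def])
    qed
    have "((\<lambda>z. k z * w z) has_field_derivative (k' (cis x) * w (cis x) + log_z_deriv (cis x) * w (cis x) * k (cis x))) (at (cis x))"
      by (rule DERIV_mult) (use k weight_z_deriv[OF nC] in auto)
    from field_vector_diff_chain_at[OF dc this]
    have D: "((\<lambda>x. k (cis x) * w (cis x)) has_vector_derivative f x) (at x)"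
      by (simp add: o_def f_def algebra_simps)
    have op: "open (cis -` (- exceptional))" by (rule opn) simp
    show "(q has_vector_derivative f x) (at x)"
    proof (rule has_vector_derivative_transform_within_open[OF D op])
      show "x \<in> cis -` (- exceptional)" using nb by simp
      fix y assume "y \<in> cis -` (- exceptional)"
      then have nby: "cis y \<notin> exceptional" by simp
      then have "cis y \<notin> C" by (intro not_exceptional) auto
      then show "k (cis y) * w (cis y) = q y" using nby g by (auto simp: q_def h_def exceptional_def)
    qed
  qed simp
  have "cis (-pi) = cis pi" by (simp add: complex_eq_iff)
  moreover have "g pi = g (-pi)" using per[of "-pi"] by simp
  ultimately have "q pi = q (-pi)" unfolding q_def h_def by (simp only:)
  with FTC have "(f has_integral 0) {-pi..pi}" by simp
  moreover have "(f has_integral 0) {-pi..pi} \<longleftrightarrow> (f has_integral 0) Tset"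
    by (rule has_integral_spike_set_eq) (auto intro: negligible_subset[of "{-pi}"])
  ultimately have "(f has_integral 0) Tset" by simp
  then have f0: "integral Tset f = 0" by (rule integral_unique)
  have kcont: "continuous_on (sphere 0 1) k"
    by (rule continuous_at_imp_continuous_on) (use DERIV_isCont[OF k] in auto)
  have log_z_deriv: "circle_integrable (\<lambda>\<zeta>. w \<zeta> * (\<zeta> * (k' \<zeta> + log_z_deriv \<zeta> * k \<zeta>)))"
  proof -
    have "circle_integrable (\<lambda>\<zeta>. w \<zeta> * (\<zeta> * k' \<zeta>) + (\<Sum>j\<in>{1..m}. \<rho> j * (w \<zeta> / (\<zeta> - a j) * (\<zeta> * k \<zeta>))))"
      by (intro circle_integrable_add circle_integrable_sum circle_integrable_cmult w_mult_integrable
          circle_integrable_mult_continuous[OF w_div_integrable] continuous_intros k' kcont) auto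
    moreover have "w \<zeta> * (\<zeta> * k' \<zeta>) + (\<Sum>j\<in>{1..m}. \<rho> j * (w \<zeta> / (\<zeta> - a j) * (\<zeta> * k \<zeta>))) = w \<zeta> * (\<zeta> * (k' \<zeta> + log_z_deriv \<zeta> * k \<zeta>))" for \<zeta>
      by (simp add: log_z_deriv_def sum_distrib_left sum_distrib_right algebra_simps)
    ultimately show ?thesis by simp
  qed
  have fi: "set_integrable lborel Tset f"
    using log_z_deriv unfolding circle_integrable_def f_def by (rule set_integrable_mult_right)
  have "(LINT x:Tset|lborel. f x) = 0" using set_borel_integral_eq_integral(2)[OF fi] f0 by simp
  then have "circle_integral (\<lambda>\<zeta>. \<i> * (w \<zeta> * (\<zeta> * (k' \<zeta> + log_z_deriv \<zeta> * k \<zeta>)))) = 0"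
    unfolding circle_integral_def f_def by simp
  then show ?thesis unfolding ci_cmult by simp
qed

end

section \<open>Differentiation of integrals against the weight\<close>

lemma norm_exp_diff_one: "norm (exp y - 1) \<le> exp (norm y) * norm y" for y :: complex
proof -
  have "norm (exp y - exp 0) \<le> exp (norm y) * norm (y - 0)"
  proof (rule field_differentiable_bound[where S="cball 0 (norm y)" and f'=exp])
    show "(exp has_field_derivative exp z) (at z within cball 0 (norm y))" for z
      by (auto intro!: derivative_eq_intros)
    show "norm (exp z) \<le> exp (norm y)" if "z \<in> cball 0 (norm y)" for z :: complex
      by (rule order_trans[OF norm_exp]) (use that in simp)
  qed auto
  then show ?thesis by simp
qed

context weight_family
begin

definition zs_dot :: "real \<Rightarrow> nat \<Rightarrow> complex" where "zs_dot t j = vector_derivative (\<lambda>s. zs s j) (at t)"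

text \<open>The logarithmic derivative of the weight with respect to \<open>t\<close>.\<close>

definition log_t_deriv :: "real \<Rightarrow> complex \<Rightarrow> complex" where "log_t_deriv t z = - (\<Sum>j\<in>{1..m}. zs_dot t j * \<rho> j / (z - zs t j))"

lemma zs_deriv: "t \<in> U \<Longrightarrow> j \<in> {1..m} \<Longrightarrow> ((\<lambda>s. zs s j) has_vector_derivative zs_dot t j) (at t)"
  unfolding zs_dot_def using zs_diff vector_derivative_works by blast

text \<open>The branch formula along a path in the parameter \<open>t\<close>, at fixed \<open>z\<close>. Joint continuity of the weight is essential here.\<close>

lemma branch_in_time:
  assumes S: "connected S" "t0 \<in> S" "s \<in> S" "S \<subseteq> U"
    and nC: "\<And>s. s \<in> S \<Longrightarrow> z \<notin> C s"
    and close: "\<And>s k. s \<in> S \<Longrightarrow> k \<in> {1..m} \<Longrightarrow> norm (zs s k - zs t0 k) \<le> norm (z - zs t0 k) / 2"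
  shows "w s z = w t0 z * exp (\<Sum>k\<in>{1..m}. \<rho> k * Ln ((z - zs s k) / (z - zs t0 k)))"
proof (rule branch_formula[OF S(1-3) finite_atLeastAtMost, where d="\<lambda>k s. z - zs s k"])
  have c: "continuous_on S (\<lambda>s. zs s k)" if "k \<in> {1..m}" for k
    by (rule continuous_at_imp_continuous_on) (use zs_cont that S(4) in auto)
  show "continuous_on S (\<lambda>s. z - zs s k)" if "k \<in> {1..m}" for k
    by (intro continuous_intros c that)
  show "continuous_on S (\<lambda>s. w s z)"
    by (rule continuous_at_imp_continuous_on) (use w_cont(1) nC S(4) in auto)
  show "\<exists>l. (\<forall>k\<in>{1..m}. exp (l k) = z - zs s k) \<and> w s z = exp (\<Sum>k\<in>{1..m}. \<rho> k * l k)" if "s \<in> S" for s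
    using weight.vals[OF wt nC[OF that]] that S(4) unfolding power_product_values_def by blast
  show "(z - zs s k) / (z - zs t0 k) \<notin> \<real>\<^sub>\<le>\<^sub>0" if "k \<in> {1..m}" "s \<in> S" for k s
  proof (rule half_plane_ratio[where c="inverse (z - zs t0 k)"])
    have ne: "z - zs t0 k \<noteq> 0" using weight.ne_point[OF wt nC] S that by auto
    then show "0 < Re ((z - zs t0 k) * inverse (z - zs t0 k))" by simp
    have "norm ((zs s k - zs t0 k) / (z - zs t0 k)) \<le> 1 / 2" using close[OF that(2,1)] ne by (simp add: norm_divide field_simps)
    then have "Re ((zs s k - zs t0 k) / (z - zs t0 k)) \<le> 1/2" using complex_Re_le_cmod order_trans by blast
    moreover have "(z - zs s k) * inverse (z - zs t0 k) = 1 - (zs s k - zs t0 k) / (z - zs t0 k)"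
      using ne by (simp add: field_simps)
    ultimately show "0 < Re ((z - zs s k) * inverse (z - zs t0 k))" by simp
  qed
qed

lemma weight_t_deriv:
  assumes t0: "t0 \<in> U" and z: "z \<notin> C t0"
  shows "((\<lambda>s. w s z) has_vector_derivative log_t_deriv t0 z * w t0 z) (at t0)"
proof -
  have ne: "z - zs t0 k \<noteq> 0" if "k \<in> {1..m}" for k using weight.ne_point[OF wt[OF t0] z that] by simp
  have "eventually (\<lambda>s. norm (zs s k - zs t0 k) \<le> norm (z - zs t0 k) / 2) (nhds t0)" if "k \<in> {1..m}" for k
  proof -
    have "((\<lambda>t. zs t k) \<longlongrightarrow> zs t0 k) (nhds t0)" using zs_cont[OF t0 that] by (simp add: isCont_def tendsto_nhds_iff)
    then have "eventually (\<lambda>t. dist (zs t k) (zs t0 k) < norm (z - zs t0 k) / 2) (nhds t0)" using ne[OF that] by (intro tendstoD) auto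
    then show ?thesis by eventually_elim (simp add: dist_norm)
  qed
  then have "\<forall>k\<in>{1..m}. eventually (\<lambda>s. norm (zs s k - zs t0 k) \<le> norm (z - zs t0 k) / 2) (nhds t0)" by blast
  then have "eventually (\<lambda>s. \<forall>k\<in>{1..m}. norm (zs s k - zs t0 k) \<le> norm (z - zs t0 k) / 2) (nhds t0)"
    by (rule eventually_ball_finite[rotated]) simp
  with w_cont(2)[OF t0 z] have "eventually (\<lambda>s. (s \<in> U \<and> z \<notin> C s) \<and> (\<forall>k\<in>{1..m}. norm (zs s k - zs t0 k) \<le> norm (z - zs t0 k) / 2)) (nhds t0)"
    by (rule eventually_conj)
  then obtain e where e: "e > 0" "\<And>s. dist s t0 < e \<Longrightarrow> (s \<in> U \<and> z \<notin> C s) \<and> (\<forall>k\<in>{1..m}. norm (zs s k - zs t0 k) \<le> norm (z - zs t0 k) / 2)"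
    unfolding eventually_nhds_metric by blast
  have eq: "w s z = w t0 z * exp (\<Sum>k\<in>{1..m}. \<rho> k * Ln ((z - zs s k) / (z - zs t0 k)))" if "s \<in> ball t0 e" for s
    by (rule branch_in_time[where S="ball t0 e"]) (use e that in \<open>auto simp: dist_commute\<close>)
  have "((\<lambda>s. Ln ((z - zs s k) / (z - zs t0 k))) has_vector_derivative - zs_dot t0 k / (z - zs t0 k)) (at t0)" if k: "k \<in> {1..m}" for k
  proof -
    have "((\<lambda>x. Ln ((z - x) / (z - zs t0 k))) has_field_derivative - 1 / (z - zs t0 k)) (at (zs t0 k))"
      using ne[OF k] by (auto intro!: derivative_eq_intros simp: divide_simps)
    from field_vector_diff_chain_at[OF zs_deriv[OF t0 k] this] show ?thesis by (simp add: o_def)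
  qed
  then have "((\<lambda>s. \<Sum>k\<in>{1..m}. \<rho> k * Ln ((z - zs s k) / (z - zs t0 k))) has_vector_derivative (\<Sum>k\<in>{1..m}. \<rho> k * (- zs_dot t0 k / (z - zs t0 k)))) (at t0)"
    by (intro has_vector_derivative_sum has_vector_derivative_mult_right)
  moreover have "(\<Sum>k\<in>{1..m}. \<rho> k * (- zs_dot t0 k / (z - zs t0 k))) = log_t_deriv t0 z"
    by (simp add: log_t_deriv_def sum_negf[symmetric] mult.commute)
  ultimately have D: "((\<lambda>s. \<Sum>k\<in>{1..m}. \<rho> k * Ln ((z - zs s k) / (z - zs t0 k))) has_vector_derivative log_t_deriv t0 z) (at t0)" by simp
  have z0: "(\<Sum>k\<in>{1..m}. \<rho> k * Ln ((z - zs t0 k) / (z - zs t0 k))) = 0" using ne by (intro sum.neutral) simp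
  have "((\<lambda>x. w t0 z * exp x) has_field_derivative w t0 z) (at (\<Sum>k\<in>{1..m}. \<rho> k * Ln ((z - zs t0 k) / (z - zs t0 k))))"
    unfolding z0 by (auto intro!: derivative_eq_intros)
  from field_vector_diff_chain_at[OF D this]
  have "((\<lambda>s. w t0 z * exp (\<Sum>k\<in>{1..m}. \<rho> k * Ln ((z - zs s k) / (z - zs t0 k)))) has_vector_derivative log_t_deriv t0 z * w t0 z) (at t0)"
    by (simp add: o_def)
  then show ?thesis
    by (rule has_vector_derivative_transform_within_open[OF _ open_ball centre_in_ball[THEN iffD2, OF e(1)]])
      (rule eq[symmetric])
qed

text \<open>For \<open>\<zeta>\<close> so close to \<open>z\<^sub>j\<close> that the singularity may have passed it between \<open>t\<^sub>0\<close> and \<open>t\<close>, nothing is gained from cancellation,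
but both values of the weight are small. With \<open>r = Re \<rho>\<^sub>j > 0\<close> and \<open>e\<close> proportional to \<open>|t - t\<^sub>0|\<close>, each is at most a
constant times \<open>e\<^sup>r\<close>. For \<open>r \<ge> 1\<close> this is \<open>O(e)\<close>. For \<open>r < 1\<close> it is \<open>e\<close> times \<open>e\<^sup>r\<^sup>-\<^sup>1\<close>, and \<open>e\<^sup>r\<^sup>-\<^sup>1\<close> is at most the same
power of the smaller quantity \<open>|\<zeta> - z\<^sub>j(t\<^sub>0)|\<close>, which is comparable with \<open>|w| / |\<zeta> - z\<^sub>j(t\<^sub>0)|\<close>.\<close>

lemma near_bound:
  assumes t0: "t0 \<in> U" and j: "j \<in> {1..m}" and M: "M > 0"
    and Lip: "eventually (\<lambda>t. norm (zs t j - zs t0 j) \<le> M * \<bar>t - t0\<bar>) (nhds t0)"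
  shows "\<exists>\<eta> B. \<eta> > 0 \<and> B \<ge> 0 \<and> (\<forall>t \<zeta>. \<bar>t - t0\<bar> < \<eta> \<longrightarrow> norm \<zeta> = 1 \<longrightarrow> \<zeta> \<notin> C t \<longrightarrow> \<zeta> \<notin> C t0 \<longrightarrow> \<zeta> \<noteq> sgn (zs t j) \<longrightarrow>
      norm (\<zeta> - zs t0 j) < 2 * M * \<bar>t - t0\<bar> \<longrightarrow>
      norm (w t \<zeta> - w t0 \<zeta>) \<le> \<bar>t - t0\<bar> * (B * (1 + norm (w t0 \<zeta>) / norm (\<zeta> - zs t0 j))))"
proof (cases "norm (zs t0 j) = 1")
  case False
  define \<eta> where "\<eta> = \<bar>norm (zs t0 j) - 1\<bar> / (2 * M)"
  have \<eta>: "\<eta> > 0" using False M by (simp add: \<eta>_def)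
  have "\<not> norm (\<zeta> - zs t0 j) < 2 * M * \<bar>t - t0\<bar>" if "\<bar>t - t0\<bar> < \<eta>" "norm \<zeta> = 1" for t \<zeta>
  proof -
    have "2 * M * \<bar>t - t0\<bar> < \<bar>norm (zs t0 j) - 1\<bar>" using that(1) M by (simp add: \<eta>_def field_simps)
    also have "\<dots> \<le> norm (\<zeta> - zs t0 j)" using norm_triangle_ineq3[of \<zeta> "zs t0 j"] that(2) by (simp add: abs_minus_commute)
    finally show ?thesis by simp
  qed
  then show ?thesis using \<eta> by (intro exI[of _ \<eta>] exI[of _ 0]) auto
next
  case True
  interpret W0: weight m "zs t0" \<rho> "C t0" "w t0" using wt[OF t0] .
  define r where "r = Re (\<rho> j)"
  have r: "r > 0" using W0.Re_exponent_pos[OF j True] by (simp add: r_def)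
  obtain \<delta> \<eta>0 K where L: "\<delta> > 0" "\<eta>0 > 0" "K > 0"
    "\<And>t \<zeta>. \<bar>t - t0\<bar> < \<eta>0 \<Longrightarrow> norm \<zeta> = 1 \<Longrightarrow> \<zeta> \<notin> C t \<Longrightarrow> norm (\<zeta> - zs t0 j) < \<delta> \<Longrightarrow> \<zeta> \<noteq> sgn (zs t j) \<Longrightarrow>
        t \<in> U \<and> norm (w t \<zeta>) \<le> K * norm (\<zeta> - zs t j) powr Re (\<rho> j) \<and> norm (\<zeta> - zs t j) powr Re (\<rho> j) \<le> K * norm (w t \<zeta>)"
    by (rule local_bound[OF t0 j True]) blast
  obtain \<eta>1 where \<eta>1: "\<eta>1 > 0" "\<And>t. \<bar>t - t0\<bar> < \<eta>1 \<Longrightarrow> norm (zs t j - zs t0 j) \<le> M * \<bar>t - t0\<bar>"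
    using Lip unfolding eventually_nhds_metric dist_real_def by blast
  define \<eta> where "\<eta> = min (min \<eta>0 \<eta>1) (min (\<delta> / (2 * M)) (1 / (3 * M)))"
  have \<eta>: "\<eta> > 0" "\<eta> \<le> \<eta>0" "\<eta> \<le> \<eta>1" "\<eta> \<le> \<delta> / (2 * M)" "\<eta> \<le> 1 / (3 * M)" using L \<eta>1 M by (auto simp: \<eta>_def)
  define B where "B = 6 * M * K * (1 + K)"
  have B: "B \<ge> 0" using M L(3) by (simp add: B_def)
  have "norm (w t \<zeta> - w t0 \<zeta>) \<le> \<bar>t - t0\<bar> * (B * (1 + norm (w t0 \<zeta>) / norm (\<zeta> - zs t0 j)))"
    if h: "\<bar>t - t0\<bar> < \<eta>" "norm \<zeta> = 1" "\<zeta> \<notin> C t" "\<zeta> \<notin> C t0" "\<zeta> \<noteq> sgn (zs t j)" "norm (\<zeta> - zs t0 j) < 2 * M * \<bar>t - t0\<bar>" for t \<zeta>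
  proof -
    define e where "e = 3 * M * \<bar>t - t0\<bar>"
    define x where "x = norm (\<zeta> - zs t0 j)"
    have x: "x > 0" using W0.ne_point[OF h(4) j] by (simp add: x_def)
    have "t \<noteq> t0" using h(6) x by (auto simp: x_def)
    then have t_pos: "\<bar>t - t0\<bar> > 0" by simp
    have e: "e > 0" "e \<le> 1" "x < e"
    proof -
      show "e > 0" using t_pos M by (simp add: e_def)
      have "M * \<bar>t - t0\<bar> \<le> M * (1 / (3 * M))" using h(1) \<eta>(5) M by (intro mult_left_mono) auto
      then show "e \<le> 1" using M by (simp add: e_def)
      have "2 * M * \<bar>t - t0\<bar> \<le> e" using M by (simp add: e_def)
      then show "x < e" using h(6) by (simp add: x_def)
    qed
    have x\<delta>: "x < \<delta>"
    proof -
      have "2 * M * \<bar>t - t0\<bar> < 2 * M * (\<delta> / (2 * M))" using h(1) \<eta>(4) M by (intro mult_strict_left_mono) auto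
      then show ?thesis using h(6) M by (simp add: x_def)
    qed
    have 1: "norm (w t \<zeta>) \<le> K * norm (\<zeta> - zs t j) powr r"
      using L(4)[of t \<zeta>] h x\<delta> \<eta> by (simp add: r_def x_def)
    have sg: "sgn (zs t0 j) = zs t0 j" using True by (simp add: sgn_div_norm)
    have 2: "norm (w t0 \<zeta>) \<le> K * x powr r \<and> x powr r \<le> K * norm (w t0 \<zeta>)"
      using L(4)[of t0 \<zeta>] h x\<delta> L(2) W0.ne_point[OF h(4) j] sg by (simp add: r_def x_def)
    have "norm (\<zeta> - zs t j) \<le> x + norm (zs t j - zs t0 j)"
      using norm_triangle_ineq4[of "\<zeta> - zs t0 j" "zs t j - zs t0 j"] by (simp add: x_def)
    also have "\<dots> \<le> e" using h(6) \<eta>1(2)[of t] h(1) \<eta>(3) by (simp add: e_def x_def)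
    finally have "norm (\<zeta> - zs t j) \<le> e" .
    then have 3: "norm (\<zeta> - zs t j) powr r \<le> e powr r" using r by (intro powr_mono2) auto
    have 4: "x powr r \<le> e powr r" by (rule powr_mono2) (use r e x in auto)
    have "norm (w t \<zeta> - w t0 \<zeta>) \<le> norm (w t \<zeta>) + norm (w t0 \<zeta>)" by (rule norm_triangle_ineq4)
    also have "\<dots> \<le> 2 * K * e powr r"
      using 1 2 mult_left_mono[OF 3, of K] mult_left_mono[OF 4, of K] L(3) by linarith
    also have "\<dots> \<le> 2 * K * (e * (1 + K) * (1 + norm (w t0 \<zeta>) / x))"
    proof -
      have "e powr r \<le> e * (1 + K) * (1 + norm (w t0 \<zeta>) / x)"
      proof (cases "r \<ge> 1")
        case r1: True
        have "e powr r \<le> e powr 1" using e r1 by (intro powr_mono') auto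
        then have "e powr r \<le> e * 1 * 1" using e by simp
        also have "\<dots> \<le> e * (1 + K) * (1 + norm (w t0 \<zeta>) / x)" using e L(3) x by (intro mult_mono) auto
        finally show ?thesis .
      next
        case False
        have "e powr r = e powr 1 * e powr (r - 1)" by (simp only: powr_add[symmetric]) simp
        also have "\<dots> = e * e powr (r - 1)" using e by simp
        also have "\<dots> \<le> e * x powr (r - 1)" using False e x by (intro mult_left_mono powr_mono2') auto
        also have "x powr (r - 1) = x powr r / x" using x by (simp add: powr_diff)
        also have "e * (x powr r / x) \<le> e * (K * norm (w t0 \<zeta>) / x)" using 2 e x by (intro mult_left_mono divide_right_mono) auto
        also have "\<dots> = e * K * (norm (w t0 \<zeta>) / x)" by simp
        also have "\<dots> \<le> e * (1 + K) * (1 + norm (w t0 \<zeta>) / x)" using e L(3) x by (intro mult_mono) auto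
        finally show ?thesis .
      qed
      then show ?thesis using L(3) by (intro mult_left_mono) auto
    qed
    also have "\<dots> = \<bar>t - t0\<bar> * (B * (1 + norm (w t0 \<zeta>) / norm (\<zeta> - zs t0 j)))"
      by (simp add: B_def e_def x_def algebra_simps)
    finally show ?thesis .
  qed
  then show ?thesis using \<eta>(1) B by blast
qed

text \<open>A majorant of the difference quotient that does not depend on \<open>t\<close>. If no singular point can have come near \<open>\<zeta>\<close>, the branch
formula in \<open>t\<close> gives \<open>w(t) / w(t\<^sub>0) - 1\<close> as an exponential minus one with exponent of size \<open>|t - t\<^sub>0| / |\<zeta> - z\<^sub>k(t\<^sub>0)|\<close>;
otherwise \<open>near_bound\<close> applies.\<close>

lemma quotient_bound:
  assumes t0: "t0 \<in> U"
  obtains \<eta> B where "\<eta> > 0" "B \<ge> 0"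
    "\<And>t \<zeta>. \<bar>t - t0\<bar> < \<eta> \<Longrightarrow> t \<noteq> t0 \<Longrightarrow> norm \<zeta> = 1 \<Longrightarrow> \<zeta> \<notin> insert (-1) (zs t0 ` {1..m}) \<Longrightarrow> \<zeta> \<notin> zs t ` {1..m}
      \<Longrightarrow> \<zeta> \<notin> (\<lambda>j. sgn (zs t j)) ` {1..m} \<Longrightarrow>
      t \<in> U \<and> norm (w t \<zeta> - w t0 \<zeta>) \<le> \<bar>t - t0\<bar> * (B * (1 + (\<Sum>k\<in>{1..m}. norm (w t0 \<zeta>) / norm (\<zeta> - zs t0 k))))"
proof -
  \<comment> \<open>larger by 1 than a common Lipschitz constant of the moving points at \<open>t0\<close>\<close>
  define M where "M = 2 + (\<Sum>k\<in>{1..m}. norm (zs_dot t0 k))"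
  have M: "M > 0" unfolding M_def by (intro add_pos_nonneg sum_nonneg) auto
  have M1: "M - 1 \<ge> 0" unfolding M_def by (simp add: add_nonneg_nonneg sum_nonneg)
  have Lip1: "eventually (\<lambda>t. norm (zs t k - zs t0 k) \<le> (M - 1) * \<bar>t - t0\<bar>) (nhds t0)" if k: "k \<in> {1..m}" for k
  proof -
    have "((\<lambda>y. norm ((zs y k - zs t0 k) /\<^sub>R (y - t0))) \<longlongrightarrow> norm (zs_dot t0 k)) (at t0)"
      by (intro tendsto_norm zs_deriv[OF t0 k, unfolded has_vector_derivative_iff_quotient])
    moreover have "norm (zs_dot t0 k) < M - 1"
    proof -
      have "norm (zs_dot t0 k) \<le> (\<Sum>k\<in>{1..m}. norm (zs_dot t0 k))" using k by (intro member_le_sum) auto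
      then show ?thesis by (simp add: M_def)
    qed
    ultimately have "eventually (\<lambda>y. norm ((zs y k - zs t0 k) /\<^sub>R (y - t0)) < M - 1) (at t0)" by (rule order_tendstoD)
    then have "eventually (\<lambda>y. norm (zs y k - zs t0 k) \<le> (M - 1) * \<bar>y - t0\<bar>) (at t0)"
      using eventually_neq_at_within[of t0 t0 UNIV]
      by eventually_elim (simp only: norm_scaleR abs_inverse, simp add: field_simps)
    then show ?thesis by (simp add: eventually_nhds_conv_at)
  qed
  have Lip: "eventually (\<lambda>t. norm (zs t k - zs t0 k) \<le> M * \<bar>t - t0\<bar>) (nhds t0)" if k: "k \<in> {1..m}" for k
    using Lip1[OF k] by eventually_elim (simp add: algebra_simps)
  have "\<forall>j\<in>{1..m}. \<exists>\<eta> B. \<eta> > 0 \<and> B \<ge> 0 \<and> (\<forall>t \<zeta>. \<bar>t - t0\<bar> < \<eta> \<longrightarrow> norm \<zeta> = 1 \<longrightarrow> \<zeta> \<notin> C t \<longrightarrow> \<zeta> \<notin> C t0 \<longrightarrow> \<zeta> \<noteq> sgn (zs t j) \<longrightarrow>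
      norm (\<zeta> - zs t0 j) < 2 * M * \<bar>t - t0\<bar> \<longrightarrow>
      norm (w t \<zeta> - w t0 \<zeta>) \<le> \<bar>t - t0\<bar> * (B * (1 + norm (w t0 \<zeta>) / norm (\<zeta> - zs t0 j))))"
    using near_bound[OF t0 _ M Lip] by blast
  then obtain \<eta>j Bj where NB: "\<And>j. j \<in> {1..m} \<Longrightarrow> \<eta>j j > 0 \<and> Bj j \<ge> 0 \<and> (\<forall>t \<zeta>. \<bar>t - t0\<bar> < \<eta>j j \<longrightarrow> norm \<zeta> = 1 \<longrightarrow> \<zeta> \<notin> C t \<longrightarrow> \<zeta> \<notin> C t0 \<longrightarrow> \<zeta> \<noteq> sgn (zs t j) \<longrightarrow>
      norm (\<zeta> - zs t0 j) < 2 * M * \<bar>t - t0\<bar> \<longrightarrow>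
      norm (w t \<zeta> - w t0 \<zeta>) \<le> \<bar>t - t0\<bar> * (Bj j * (1 + norm (w t0 \<zeta>) / norm (\<zeta> - zs t0 j))))"
    by metis
  have "\<forall>k\<in>{1..m}. eventually (\<lambda>t. norm (zs t k - zs t0 k) \<le> (M - 1) * \<bar>t - t0\<bar> \<and> \<bar>t - t0\<bar> < \<eta>j k) (nhds t0)"
  proof
    fix k assume k: "k \<in> {1..m}"
    have "eventually (\<lambda>t. \<bar>t - t0\<bar> < \<eta>j k) (nhds t0)"
      using NB[OF k] unfolding eventually_nhds_metric dist_real_def by blast
    with Lip1[OF k] show "eventually (\<lambda>t. norm (zs t k - zs t0 k) \<le> (M - 1) * \<bar>t - t0\<bar> \<and> \<bar>t - t0\<bar> < \<eta>j k) (nhds t0)"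
      by (rule eventually_conj)
  qed
  then have "eventually (\<lambda>t. \<forall>k\<in>{1..m}. norm (zs t k - zs t0 k) \<le> (M - 1) * \<bar>t - t0\<bar> \<and> \<bar>t - t0\<bar> < \<eta>j k) (nhds t0)"
    by (rule eventually_ball_finite[rotated]) simp
  moreover have "eventually (\<lambda>t. t \<in> U) (nhds t0)" using open_U t0 by (rule eventually_nhds_in_open)
  ultimately have "eventually (\<lambda>t. t \<in> U \<and> (\<forall>k\<in>{1..m}. norm (zs t k - zs t0 k) \<le> (M - 1) * \<bar>t - t0\<bar> \<and> \<bar>t - t0\<bar> < \<eta>j k)) (nhds t0)"
    by eventually_elim blast
  then obtain \<eta> where \<eta>: "\<eta> > 0" "\<And>t. \<bar>t - t0\<bar> < \<eta> \<Longrightarrow> t \<in> U \<and> (\<forall>k\<in>{1..m}. norm (zs t k - zs t0 k) \<le> (M - 1) * \<bar>t - t0\<bar> \<and> \<bar>t - t0\<bar> < \<eta>j k)"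
    unfolding eventually_nhds_metric dist_real_def by blast
  define R where "R = (\<Sum>k\<in>{1..m}. norm (\<rho> k))"
  define B where "B = (\<Sum>j\<in>{1..m}. Bj j) + exp R * (2 * M * R)"
  have R0: "R \<ge> 0" by (simp add: R_def sum_nonneg)
  have Bs: "(\<Sum>j\<in>{1..m}. Bj j) \<ge> 0" using NB by (intro sum_nonneg) auto
  have B0: "B \<ge> 0" unfolding B_def using Bs R0 M by (intro add_nonneg_nonneg mult_nonneg_nonneg) auto
  have main: "t \<in> U \<and> norm (w t \<zeta> - w t0 \<zeta>) \<le> \<bar>t - t0\<bar> * (B * (1 + (\<Sum>k\<in>{1..m}. norm (w t0 \<zeta>) / norm (\<zeta> - zs t0 k))))"
    if h: "\<bar>t - t0\<bar> < \<eta>" "t \<noteq> t0" "norm \<zeta> = 1" "\<zeta> \<notin> insert (-1) (zs t0 ` {1..m})" "\<zeta> \<notin> zs t ` {1..m}"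
      "\<zeta> \<notin> (\<lambda>j. sgn (zs t j)) ` {1..m}" for t \<zeta>
  proof
    show tU: "t \<in> U" using \<eta>(2)[OF h(1)] by blast
    have nC: "\<zeta> \<notin> C s" if "s \<in> U" "\<zeta> \<notin> zs s ` {1..m}" for s
      using weight.circle_C[OF wt[OF that(1)]] h(3,4) that(2) by auto
    have nC0: "\<zeta> \<notin> C t0" using nC t0 h(4) by blast
    have nCt: "\<zeta> \<notin> C t" using nC tU h(5) by blast
    define T where "T = (\<Sum>k\<in>{1..m}. norm (w t0 \<zeta>) / norm (\<zeta> - zs t0 k))"
    have T0: "T \<ge> 0" by (simp add: T_def sum_nonneg)
    have "norm (w t \<zeta> - w t0 \<zeta>) \<le> \<bar>t - t0\<bar> * (B * (1 + T))"
    proof (cases "\<exists>j\<in>{1..m}. norm (\<zeta> - zs t0 j) < 2 * M * \<bar>t - t0\<bar>")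
      case True
      then obtain j where j: "j \<in> {1..m}" "norm (\<zeta> - zs t0 j) < 2 * M * \<bar>t - t0\<bar>" by blast
      have "\<bar>t - t0\<bar> < \<eta>j j" using \<eta>(2)[OF h(1)] j(1) by blast
      moreover have "\<zeta> \<noteq> sgn (zs t j)" using h(6) j(1) by blast
      ultimately have "norm (w t \<zeta> - w t0 \<zeta>) \<le> \<bar>t - t0\<bar> * (Bj j * (1 + norm (w t0 \<zeta>) / norm (\<zeta> - zs t0 j)))"
        using NB[OF j(1)] h(3) nC0 nCt j(2) by blast
      also have "\<dots> \<le> \<bar>t - t0\<bar> * (B * (1 + T))"
      proof (intro mult_left_mono mult_mono add_left_mono)
        have "Bj j \<le> (\<Sum>j\<in>{1..m}. Bj j)" using j(1) NB by (intro member_le_sum) auto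
        also have "\<dots> \<le> B" using R0 M by (simp add: B_def)
        finally show "Bj j \<le> B" .
        show "norm (w t0 \<zeta>) / norm (\<zeta> - zs t0 j) \<le> T" unfolding T_def using j(1) by (intro member_le_sum) auto
      qed (use B0 in auto)
      finally show ?thesis .
    next
      case False
      then have far: "2 * M * \<bar>t - t0\<bar> \<le> norm (\<zeta> - zs t0 k)" if "k \<in> {1..m}" for k using that by force
      have seg: "\<bar>s - t0\<bar> \<le> \<bar>t - t0\<bar>" if "s \<in> closed_segment t0 t" for s
        using that by (auto simp: closed_segment_eq_real_ivl split: if_splits)
      have cl: "norm (zs s k - zs t0 k) \<le> (M - 1) * \<bar>t - t0\<bar>" if "s \<in> closed_segment t0 t" "k \<in> {1..m}" for s k
      proof -
        have "norm (zs s k - zs t0 k) \<le> (M - 1) * \<bar>s - t0\<bar>" using \<eta>(2)[of s] seg[OF that(1)] h(1) that(2) by auto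
        also have "\<dots> \<le> (M - 1) * \<bar>t - t0\<bar>" using seg[OF that(1)] M1 by (intro mult_left_mono) auto
        finally show ?thesis .
      qed
      have form: "w t \<zeta> = w t0 \<zeta> * exp (\<Sum>k\<in>{1..m}. \<rho> k * Ln ((\<zeta> - zs t k) / (\<zeta> - zs t0 k)))"
      proof (rule branch_in_time[where S="closed_segment t0 t"])
        show sU: "closed_segment t0 t \<subseteq> U" using seg h(1) \<eta>(2) by (meson le_less_trans subsetI)
        show "norm (zs s k - zs t0 k) \<le> norm (\<zeta> - zs t0 k) / 2" if "s \<in> closed_segment t0 t" "k \<in> {1..m}" for s k
          using cl[OF that] far[OF that(2)] by (simp add: algebra_simps)
        show "\<zeta> \<notin> C s" if s: "s \<in> closed_segment t0 t" for s
        proof (rule nC)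
          show "s \<in> U" using sU s by blast
          have "M * \<bar>t - t0\<bar> > 0" using M h(2) by simp
          then have "\<zeta> \<noteq> zs s k" if "k \<in> {1..m}" for k
            using cl[OF s that] far[OF that] by (auto simp: norm_minus_commute algebra_simps)
          then show "\<zeta> \<notin> zs s ` {1..m}" by blast
        qed
      qed auto
      define x where "x k = (zs t0 k - zs t k) / (\<zeta> - zs t0 k)" for k
      have n0: "norm (\<zeta> - zs t0 k) > 0" if "k \<in> {1..m}" for k using weight.ne_point[OF wt[OF t0] nC0 that] by simp
      have xb1: "norm (x k) \<le> (M - 1) * \<bar>t - t0\<bar> / norm (\<zeta> - zs t0 k)" if "k \<in> {1..m}" for k
        unfolding x_def norm_divide using cl[of t k] that by (intro divide_right_mono) (auto simp: norm_minus_commute)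
      have xb: "norm (x k) \<le> M * \<bar>t - t0\<bar> / norm (\<zeta> - zs t0 k)" if "k \<in> {1..m}" for k
        by (rule order_trans[OF xb1[OF that]]) (intro divide_right_mono mult_right_mono, auto)
      have xh: "norm (x k) < 1/2" if "k \<in> {1..m}" for k
      proof -
        have "2 * ((M - 1) * \<bar>t - t0\<bar>) < 2 * M * \<bar>t - t0\<bar>" using h(2) by simp
        then have "2 * ((M - 1) * \<bar>t - t0\<bar>) < norm (\<zeta> - zs t0 k)" using far[OF that] by (rule less_le_trans)
        then have "(M - 1) * \<bar>t - t0\<bar> / norm (\<zeta> - zs t0 k) < 1 / 2" using n0[OF that] by (simp add: field_simps)
        then show ?thesis using xb1[OF that] by linarith
      qed
      define y where "y = (\<Sum>k\<in>{1..m}. \<rho> k * Ln ((\<zeta> - zs t k) / (\<zeta> - zs t0 k)))"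
      have Lnx: "norm (Ln ((\<zeta> - zs t k) / (\<zeta> - zs t0 k))) \<le> 2 * norm (x k)" if "k \<in> {1..m}" for k
      proof -
        have "(\<zeta> - zs t k) / (\<zeta> - zs t0 k) = 1 + x k" using n0[OF that] by (simp add: x_def field_simps)
        then show ?thesis using norm_Ln_le[OF xh[OF that]] by simp
      qed
      have y1: "norm y \<le> R" unfolding y_def R_def
      proof (rule sum_norm_le)
        fix k assume k: "k \<in> {1..m}"
        have "norm (Ln ((\<zeta> - zs t k) / (\<zeta> - zs t0 k))) \<le> 1" using Lnx[OF k] xh[OF k] by linarith
        then show "norm (\<rho> k * Ln ((\<zeta> - zs t k) / (\<zeta> - zs t0 k))) \<le> norm (\<rho> k)"
          unfolding norm_mult by (rule mult_left_le) simp
      qed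
      have y2: "norm (w t0 \<zeta>) * norm y \<le> \<bar>t - t0\<bar> * (2 * M * R) * T"
      proof -
        have "norm y \<le> (\<Sum>k\<in>{1..m}. R * (2 * (M * \<bar>t - t0\<bar> / norm (\<zeta> - zs t0 k))))"
          unfolding y_def
        proof (rule sum_norm_le)
          fix k assume k: "k \<in> {1..m}"
          have "norm (\<rho> k) \<le> R" unfolding R_def using k by (intro member_le_sum) auto
          then show "norm (\<rho> k * Ln ((\<zeta> - zs t k) / (\<zeta> - zs t0 k))) \<le> R * (2 * (M * \<bar>t - t0\<bar> / norm (\<zeta> - zs t0 k)))"
            unfolding norm_mult using Lnx[OF k] xb[OF k] R0 by (intro mult_mono) auto
        qed
        then have "norm (w t0 \<zeta>) * norm y \<le> norm (w t0 \<zeta>) * (\<Sum>k\<in>{1..m}. R * (2 * (M * \<bar>t - t0\<bar> / norm (\<zeta> - zs t0 k))))"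
          by (rule mult_left_mono) simp
        also have "\<dots> = \<bar>t - t0\<bar> * (2 * M * R) * T"
          unfolding T_def sum_distrib_left by (intro sum.cong refl) (simp add: mult_ac)
        finally show ?thesis .
      qed
      have "w t \<zeta> - w t0 \<zeta> = w t0 \<zeta> * (exp y - 1)" unfolding form y_def by (simp add: algebra_simps)
      then have "norm (w t \<zeta> - w t0 \<zeta>) = norm (w t0 \<zeta>) * norm (exp y - 1)" by (simp add: norm_mult)
      also have "\<dots> \<le> norm (w t0 \<zeta>) * (exp R * norm y)"
      proof (rule mult_left_mono)
        have "exp (norm y) * norm y \<le> exp R * norm y" using y1 by (intro mult_right_mono) auto
        then show "norm (exp y - 1) \<le> exp R * norm y" using norm_exp_diff_one[of y] by linarith
      qed simp
      also have "\<dots> = exp R * (norm (w t0 \<zeta>) * norm y)" by simp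
      also have "\<dots> \<le> exp R * (\<bar>t - t0\<bar> * (2 * M * R) * T)" using y2 by (intro mult_left_mono) auto
      also have "\<dots> = \<bar>t - t0\<bar> * (exp R * (2 * M * R) * T)" by simp
      also have "\<dots> \<le> \<bar>t - t0\<bar> * (B * (1 + T))"
        using Bs T0 R0 M B0 by (intro mult_left_mono mult_mono) (auto simp: B_def)
      finally show ?thesis .
    qed
    then show "norm (w t \<zeta> - w t0 \<zeta>) \<le> \<bar>t - t0\<bar> * (B * (1 + (\<Sum>k\<in>{1..m}. norm (w t0 \<zeta>) / norm (\<zeta> - zs t0 k))))"
      by (simp add: T_def)
  qed
  show ?thesis using that[OF \<eta>(1) B0 main] by blast
qed

lemma wU_integrable:
  assumes t0: "t0 \<in> U" and h: "continuous_on (sphere 0 1) h"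
  shows "circle_integrable (\<lambda>\<zeta>. w t0 \<zeta> * (log_t_deriv t0 \<zeta> * h \<zeta>))"
proof -
  interpret W0: weight m "zs t0" \<rho> "C t0" "w t0" using wt[OF t0] .
  have "circle_integrable (\<lambda>\<zeta>. \<Sum>j\<in>{1..m}. (- zs_dot t0 j * \<rho> j) * (w t0 \<zeta> / (\<zeta> - zs t0 j) * h \<zeta>))"
    by (intro circle_integrable_sum circle_integrable_cmult circle_integrable_mult_continuous[OF W0.w_div_integrable] h) auto
  moreover have "(\<Sum>j\<in>{1..m}. (- zs_dot t0 j * \<rho> j) * (w t0 \<zeta> / (\<zeta> - zs t0 j) * h \<zeta>)) = w t0 \<zeta> * (log_t_deriv t0 \<zeta> * h \<zeta>)" for \<zeta>
    by (simp add: log_t_deriv_def sum_distrib_left sum_distrib_right sum_negf algebra_simps)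
  ultimately show ?thesis by simp
qed

text \<open>Dominated convergence along an arbitrary sequence \<open>t \<rightarrow> t\<^sub>0\<close>. The majorant \<open>1 + \<Sum> |w| / |\<zeta> - z\<^sub>k|\<close> is integrable even if
singular points lie on the circle.\<close>

lemma weight_integral_deriv:
  assumes t0: "t0 \<in> U" and h: "continuous_on (sphere 0 1) h"
  shows "((\<lambda>t. circle_integral (\<lambda>\<zeta>. w t \<zeta> * h \<zeta>)) has_vector_derivative
      circle_integral (\<lambda>\<zeta>. w t0 \<zeta> * (log_t_deriv t0 \<zeta> * h \<zeta>))) (at t0)"
proof -
  interpret W0: weight m "zs t0" \<rho> "C t0" "w t0" using wt[OF t0] .
  obtain \<eta> B where \<eta>: "\<eta> > 0" and B: "B \<ge> 0" and QB:
    "\<And>t \<zeta>. \<bar>t - t0\<bar> < \<eta> \<Longrightarrow> t \<noteq> t0 \<Longrightarrow> norm \<zeta> = 1 \<Longrightarrow> \<zeta> \<notin> insert (-1) (zs t0 ` {1..m}) \<Longrightarrow> \<zeta> \<notin> zs t ` {1..m}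
      \<Longrightarrow> \<zeta> \<notin> (\<lambda>j. sgn (zs t j)) ` {1..m} \<Longrightarrow>
      t \<in> U \<and> norm (w t \<zeta> - w t0 \<zeta>) \<le> \<bar>t - t0\<bar> * (B * (1 + (\<Sum>k\<in>{1..m}. norm (w t0 \<zeta>) / norm (\<zeta> - zs t0 k))))"
    by (rule quotient_bound[OF t0]) blast
  obtain H where H: "\<And>\<zeta>. norm \<zeta> = 1 \<Longrightarrow> norm (h \<zeta>) \<le> H" using circle_continuous_facts(2)[OF h] by blast
  have H0: "H \<ge> 0" using order_trans[OF norm_ge_zero H[of 1]] by simp
  obtain \<eta>' where \<eta>': "\<eta>' > 0" "\<And>t. \<bar>t - t0\<bar> < \<eta>' \<Longrightarrow> t \<in> U"
    using open_U t0 unfolding open_dist dist_real_def by blast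
  define Maj where "Maj \<theta> = indicator Tset \<theta> * (H * (B * (1 + (\<Sum>k\<in>{1..m}. norm (w t0 (cis \<theta>) / (cis \<theta> - zs t0 k))))))" for \<theta>
  have Maj_int: "integrable lborel Maj"
  proof -
    have "set_integrable lborel Tset (\<lambda>\<theta>. H * (B * (1 + (\<Sum>k\<in>{1..m}. norm (w t0 (cis \<theta>) / (cis \<theta> - zs t0 k))))))"
    proof (intro set_integrable_mult_right set_integral_add)
      show "set_integrable lborel Tset (\<lambda>\<theta>. 1 :: real)" by (simp add: set_integrable_def integrable_real_indicator)
      have "set_integrable lborel Tset (\<lambda>\<theta>. norm (w t0 (cis \<theta>) / (cis \<theta> - zs t0 k)))" if "k \<in> {1..m}" for k
        using W0.w_div_integrable[OF that] unfolding circle_integrable_def by (rule set_integrable_norm)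
      then show "set_integrable lborel Tset (\<lambda>\<theta>. \<Sum>k\<in>{1..m}. norm (w t0 (cis \<theta>) / (cis \<theta> - zs t0 k)))"
        unfolding set_integrable_def scaleR_sum_right by (intro Bochner_Integration.integrable_sum)
    qed
    then show ?thesis unfolding set_integrable_def Maj_def by simp
  qed
  show ?thesis unfolding has_vector_derivative_iff_quotient tendsto_at_iff_sequentially
  proof (intro allI impI)
    fix X :: "nat \<Rightarrow> real" assume X: "\<forall>i. X i \<in> UNIV - {t0}" "X \<longlonglongrightarrow> t0"
    have "eventually (\<lambda>i. dist (X i) t0 < min \<eta> \<eta>') sequentially" using X(2) \<eta> \<eta>'(1) by (intro tendstoD) auto
    then obtain N where N: "\<And>i. i \<ge> N \<Longrightarrow> \<bar>X i - t0\<bar> < min \<eta> \<eta>'"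
      unfolding eventually_sequentially dist_real_def by blast
    define Y where "Y i = X (i + N)" for i
    have Y: "Y i \<noteq> t0" "\<bar>Y i - t0\<bar> < \<eta>" "Y i \<in> U" for i
      using X(1) N[of "i + N"] \<eta>'(2)[of "X (i+N)"] by (auto simp: Y_def)
    have Yt: "Y \<longlonglongrightarrow> t0" unfolding Y_def using X(2) by (rule LIMSEQ_ignore_initial_segment)
    define F where "F = insert (-1) (zs t0 ` {1..m}) \<union> (\<Union>i. zs (Y i) ` {1..m} \<union> (\<lambda>j. sgn (zs (Y i) j)) ` {1..m})"
    have "countable F" unfolding F_def by (intro countable_Un countable_UN countable_insert countable_image) auto
    note AEF = AE_cis_notin[OF this]
    define s where "s i \<theta> = indicator Tset \<theta> *\<^sub>R (((w (Y i) (cis \<theta>) - w t0 (cis \<theta>)) /\<^sub>R (Y i - t0)) * h (cis \<theta>))" for i \<theta>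
    have si: "circle_integrable (\<lambda>\<zeta>. ((w (Y i) \<zeta> - w t0 \<zeta>) /\<^sub>R (Y i - t0)) * h \<zeta>)"
      and sv: "circle_integral (\<lambda>\<zeta>. ((w (Y i) \<zeta> - w t0 \<zeta>) /\<^sub>R (Y i - t0)) * h \<zeta>) =
        (circle_integral (\<lambda>\<zeta>. w (Y i) \<zeta> * h \<zeta>) - circle_integral (\<lambda>\<zeta>. w t0 \<zeta> * h \<zeta>)) /\<^sub>R (Y i - t0)" for i
    proof -
      note I1 = weight.w_mult_integrable[OF wt[OF Y(3)[of i]] h] and I2 = W0.w_mult_integrable[OF h]
      have eq: "(\<lambda>\<zeta>. ((w (Y i) \<zeta> - w t0 \<zeta>) /\<^sub>R (Y i - t0)) * h \<zeta>) = (\<lambda>\<zeta>. of_real (inverse (Y i - t0)) * (w (Y i) \<zeta> * h \<zeta> - w t0 \<zeta> * h \<zeta>))"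
        by (simp add: fun_eq_iff scaleR_conv_of_real algebra_simps)
      show "circle_integrable (\<lambda>\<zeta>. ((w (Y i) \<zeta> - w t0 \<zeta>) /\<^sub>R (Y i - t0)) * h \<zeta>)"
        unfolding eq by (intro circle_integrable_cmult circle_integrable_diff I1 I2)
      show "circle_integral (\<lambda>\<zeta>. ((w (Y i) \<zeta> - w t0 \<zeta>) /\<^sub>R (Y i - t0)) * h \<zeta>) =
        (circle_integral (\<lambda>\<zeta>. w (Y i) \<zeta> * h \<zeta>) - circle_integral (\<lambda>\<zeta>. w t0 \<zeta> * h \<zeta>)) /\<^sub>R (Y i - t0)"
        unfolding eq ci_cmult ci_diff[OF I1 I2] by (simp add: scaleR_conv_of_real)
    qed
    define f where "f \<theta> = indicator Tset \<theta> *\<^sub>R (w t0 (cis \<theta>) * (log_t_deriv t0 (cis \<theta>) * h (cis \<theta>)))" for \<theta>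
    have "(\<lambda>i. integral\<^sup>L lborel (s i)) \<longlonglongrightarrow> integral\<^sup>L lborel f"
    proof (rule integral_dominated_convergence[OF _ _ Maj_int])
      show "f \<in> borel_measurable lborel"
        using wU_integrable[OF t0 h] unfolding circle_integrable_def set_integrable_def f_def by (rule borel_measurable_integrable)
      show "s i \<in> borel_measurable lborel" for i
        using si[of i] unfolding circle_integrable_def set_integrable_def s_def by (rule borel_measurable_integrable)
      show "AE \<theta> in lborel. (\<lambda>i. s i \<theta>) \<longlonglongrightarrow> f \<theta>"
        using AEF
      proof eventually_elim
        case (elim \<theta>)
        then have nC: "cis \<theta> \<notin> C t0" by (intro W0.not_exceptional) (auto simp: F_def W0.exceptional_def)
        have "((\<lambda>y. (w y (cis \<theta>) - w t0 (cis \<theta>)) /\<^sub>R (y - t0)) \<longlongrightarrow> log_t_deriv t0 (cis \<theta>) * w t0 (cis \<theta>)) (at t0)"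
          using weight_t_deriv[OF t0 nC] unfolding has_vector_derivative_iff_quotient .
        then have "(\<lambda>i. (w (Y i) (cis \<theta>) - w t0 (cis \<theta>)) /\<^sub>R (Y i - t0)) \<longlonglongrightarrow> log_t_deriv t0 (cis \<theta>) * w t0 (cis \<theta>)"
          unfolding tendsto_at_iff_sequentially using Y(1) Yt by (auto simp: o_def)
        then have "(\<lambda>i. s i \<theta>) \<longlonglongrightarrow> indicator Tset \<theta> *\<^sub>R ((log_t_deriv t0 (cis \<theta>) * w t0 (cis \<theta>)) * h (cis \<theta>))"
          unfolding s_def by (intro tendsto_intros)
        then show ?case by (simp add: f_def mult_ac)
      qed
      show "AE \<theta> in lborel. norm (s i \<theta>) \<le> Maj \<theta>" for i
        using AEF
      proof eventually_elim
        case (elim \<theta>)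
        define S where "S = (\<Sum>k\<in>{1..m}. norm (w t0 (cis \<theta>) / (cis \<theta> - zs t0 k)))"
        have "norm (w (Y i) (cis \<theta>) - w t0 (cis \<theta>)) \<le> \<bar>Y i - t0\<bar> * (B * (1 + S))"
          using QB[OF Y(2)[of i] Y(1)[of i], of "cis \<theta>"] elim by (auto simp: F_def S_def norm_divide)
        then have "norm ((w (Y i) (cis \<theta>) - w t0 (cis \<theta>)) /\<^sub>R (Y i - t0)) \<le> B * (1 + S)"
          using Y(1)[of i] by (simp only: norm_scaleR abs_inverse) (simp add: field_simps)
        then have "norm ((w (Y i) (cis \<theta>) - w t0 (cis \<theta>)) /\<^sub>R (Y i - t0)) * norm (h (cis \<theta>)) \<le> (B * (1 + S)) * H"
          by (rule mult_mono) (use H[of "cis \<theta>"] B in \<open>auto simp: S_def sum_nonneg\<close>)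
        then show ?case unfolding s_def Maj_def norm_scaleR norm_mult S_def[symmetric]
          by (cases "\<theta> \<in> Tset") (auto simp: mult_ac)
      qed
    qed
    then have "(\<lambda>i. integral\<^sup>L lborel (s i) / (2 * of_real pi)) \<longlonglongrightarrow> integral\<^sup>L lborel f / (2 * of_real pi)"
      by (intro tendsto_intros) auto
    then have "(\<lambda>i. (circle_integral (\<lambda>\<zeta>. w (Y i) \<zeta> * h \<zeta>) - circle_integral (\<lambda>\<zeta>. w t0 \<zeta> * h \<zeta>)) /\<^sub>R (Y i - t0))
       \<longlonglongrightarrow> circle_integral (\<lambda>\<zeta>. w t0 \<zeta> * (log_t_deriv t0 \<zeta> * h \<zeta>))"
      unfolding sv[symmetric] unfolding circle_integral_def set_lebesgue_integral_def s_def f_def .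
    then show "((\<lambda>y. (circle_integral (\<lambda>\<zeta>. w y \<zeta> * h \<zeta>) - circle_integral (\<lambda>\<zeta>. w t0 \<zeta> * h \<zeta>)) /\<^sub>R (y - t0)) \<circ> X)
       \<longlonglongrightarrow> circle_integral (\<lambda>\<zeta>. w t0 \<zeta> * (log_t_deriv t0 \<zeta> * h \<zeta>))"
      unfolding o_def Y_def by (rule LIMSEQ_offset)
  qed
qed

end

section \<open>The Caratheodory function\<close>

lemma circle_cong_AE:
  assumes f: "circle_integrable f" and g: "circle_integrable g" and F: "countable F"
    and eq: "\<And>\<zeta>. norm \<zeta> = 1 \<Longrightarrow> \<zeta> \<notin> F \<Longrightarrow> f \<zeta> = g \<zeta>"
  shows "circle_integral f = circle_integral g"
proof -
  have "(LINT \<theta>:Tset|lborel. f (cis \<theta>)) = (LINT \<theta>:Tset|lborel. g (cis \<theta>))"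
    unfolding set_lebesgue_integral_def
  proof (rule integral_cong_AE)
    show "(\<lambda>\<theta>. indicator Tset \<theta> *\<^sub>R f (cis \<theta>)) \<in> borel_measurable lborel"
      using f unfolding circle_integrable_def set_integrable_def by (rule borel_measurable_integrable)
    show "(\<lambda>\<theta>. indicator Tset \<theta> *\<^sub>R g (cis \<theta>)) \<in> borel_measurable lborel"
      using g unfolding circle_integrable_def set_integrable_def by (rule borel_measurable_integrable)
    show "AE \<theta> in lborel. indicator Tset \<theta> *\<^sub>R f (cis \<theta>) = indicator Tset \<theta> *\<^sub>R g (cis \<theta>)"
      using AE_cis_notin[OF F] by eventually_elim (simp add: eq)
  qed
  then show ?thesis by (simp add: circle_integral_def)
qed

lemma ci_combination:
  assumes "circle_integrable g" "finite I" "\<And>i. i \<in> I \<Longrightarrow> circle_integrable (h i)"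
  shows "circle_integral (\<lambda>\<zeta>. c * g \<zeta> + (\<Sum>i\<in>I. d i * h i \<zeta>)) = c * circle_integral g + (\<Sum>i\<in>I. d i * circle_integral (h i))"
proof -
  have "circle_integral (\<lambda>\<zeta>. \<Sum>i\<in>I. d i * h i \<zeta>) = (\<Sum>i\<in>I. circle_integral (\<lambda>\<zeta>. d i * h i \<zeta>))"
    by (intro ci_sum assms circle_integrable_cmult)
  moreover have "circle_integrable (\<lambda>\<zeta>. \<Sum>i\<in>I. d i * h i \<zeta>)" by (intro circle_integrable_sum assms circle_integrable_cmult)
  ultimately show ?thesis using ci_add[OF circle_integrable_cmult[OF assms(1)], of "\<lambda>\<zeta>. \<Sum>i\<in>I. d i * h i \<zeta>" c]
    by (simp only: ci_cmult)
qed

text \<open>The Schwarz kernel of the disc.\<close>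

definition kern :: "complex \<Rightarrow> complex \<Rightarrow> complex" where "kern z \<zeta> = (\<zeta> + z) / (\<zeta> - z)"

lemma kern_cont [continuous_intros]: "norm z \<noteq> 1 \<Longrightarrow> continuous_on (sphere 0 1) (kern z)"
  unfolding kern_def by (intro continuous_intros) auto

lemma inv_power_cont [continuous_intros]: "continuous_on (sphere 0 1) (\<lambda>\<zeta>::complex. (1 / \<zeta>) ^ k)"
  by (intro continuous_intros) auto

text \<open>\<open>(\<zeta>\<^sup>k - z\<^sup>k) (\<zeta> + z) / (\<zeta> - z)\<close> is a polynomial in \<open>z\<close> whose coefficients are polynomials in \<open>\<zeta>\<close>.\<close>

lemma kernel_power:
  assumes f: "circle_integrable f"
  shows "\<exists>S. polyfun S \<and> (\<forall>z. norm z \<noteq> 1 \<longrightarrow>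
    circle_integral (\<lambda>\<zeta>. f \<zeta> * (\<zeta> ^ k * kern z \<zeta>)) = z ^ k * circle_integral (\<lambda>\<zeta>. f \<zeta> * kern z \<zeta>) + S z)"
proof (intro exI conjI allI impI)
  define M where "M i = circle_integral (\<lambda>\<zeta>. f \<zeta> * \<zeta> ^ i)" for i
  show "polyfun (\<lambda>z. \<Sum>i<k. z ^ (k - Suc i) * (M (Suc i) + z * M i))"
    by (intro polyfun_sum polyfun_mult polyfun_add polyfun_power polyfun_id polyfun_const)
  fix z :: complex assume z: "norm z \<noteq> 1"
  have c: "continuous_on (sphere 0 1) (\<lambda>\<zeta>::complex. \<zeta> ^ k)" for k :: nat by (intro continuous_intros)
  have I: "circle_integrable (\<lambda>\<zeta>. f \<zeta> * \<zeta> ^ i)" for i by (rule circle_integrable_mult_continuous[OF f c])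
  have IK: "circle_integrable (\<lambda>\<zeta>. f \<zeta> * kern z \<zeta>)" by (rule circle_integrable_mult_continuous[OF f kern_cont[OF z]])
  have "circle_integral (\<lambda>\<zeta>. f \<zeta> * (\<zeta> ^ k * kern z \<zeta>)) =
     circle_integral (\<lambda>\<zeta>. z ^ k * (f \<zeta> * kern z \<zeta>) + (\<Sum>i<k. z ^ (k - Suc i) * (f \<zeta> * \<zeta> ^ Suc i + z * (f \<zeta> * \<zeta> ^ i))))"
  proof (rule circle_cong)
    fix \<zeta> :: complex assume "norm \<zeta> = 1"
    then have ne: "\<zeta> - z \<noteq> 0" using z by auto
    have "\<zeta> ^ k - z ^ k = (\<zeta> - z) * (\<Sum>i<k. z ^ (k - Suc i) * \<zeta> ^ i)" by (rule power_diff_sumr2)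
    then have "(\<zeta> ^ k - z ^ k) * kern z \<zeta> = (\<Sum>i<k. z ^ (k - Suc i) * \<zeta> ^ i) * (\<zeta> + z)"
      using ne by (simp add: kern_def)
    then have "\<zeta> ^ k * kern z \<zeta> = z ^ k * kern z \<zeta> + (\<Sum>i<k. z ^ (k - Suc i) * (\<zeta> ^ Suc i + z * \<zeta> ^ i))"
      by (simp add: algebra_simps sum_distrib_left sum_distrib_right sum.distrib)
    then have "f \<zeta> * (\<zeta> ^ k * kern z \<zeta>) = f \<zeta> * (z ^ k * kern z \<zeta> + (\<Sum>i<k. z ^ (k - Suc i) * (\<zeta> ^ Suc i + z * \<zeta> ^ i)))" by simp
    then show "f \<zeta> * (\<zeta> ^ k * kern z \<zeta>) = z ^ k * (f \<zeta> * kern z \<zeta>) + (\<Sum>i<k. z ^ (k - Suc i) * (f \<zeta> * \<zeta> ^ Suc i + z * (f \<zeta> * \<zeta> ^ i)))"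
      by (simp add: distrib_left sum_distrib_left mult_ac)
  qed
  also have "\<dots> = z ^ k * circle_integral (\<lambda>\<zeta>. f \<zeta> * kern z \<zeta>) + (\<Sum>i<k. z ^ (k - Suc i) * (M (Suc i) + z * M i))"
    unfolding M_def
    by (subst ci_combination) (simp_all only: ci_add ci_cmult circle_integrable_cmult circle_integrable_add I IK finite_lessThan)
  finally show "circle_integral (\<lambda>\<zeta>. f \<zeta> * (\<zeta> ^ k * kern z \<zeta>)) = z ^ k * circle_integral (\<lambda>\<zeta>. f \<zeta> * kern z \<zeta>)
      + (\<Sum>i<k. z ^ (k - Suc i) * (M (Suc i) + z * M i))" .
qed

lemma kernel_inverse_power:
  assumes f: "circle_integrable f" and kn: "k \<le> n"
  shows "\<exists>S. polyfun S \<and> (\<forall>z. norm z \<noteq> 1 \<longrightarrow>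
    z ^ n * circle_integral (\<lambda>\<zeta>. f \<zeta> * ((1 / \<zeta>) ^ k * kern z \<zeta>)) = z ^ (n - k) * circle_integral (\<lambda>\<zeta>. f \<zeta> * kern z \<zeta>) + S z)"
proof (intro exI conjI allI impI)
  define M where "M i = circle_integral (\<lambda>\<zeta>. f \<zeta> * ((1/\<zeta>) ^ k * \<zeta> ^ i))" for i
  show "polyfun (\<lambda>z. - (\<Sum>i<k. z ^ (n - Suc i) * (M (Suc i) + z * M i)))"
    by (intro polyfun_minus polyfun_sum polyfun_mult polyfun_add polyfun_power polyfun_id polyfun_const)
  fix z :: complex assume z: "norm z \<noteq> 1"
  have c: "continuous_on (sphere 0 1) (\<lambda>\<zeta>::complex. (1/\<zeta>) ^ k * \<zeta> ^ i)" for i :: nat by (intro continuous_intros) auto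
  have I: "circle_integrable (\<lambda>\<zeta>. f \<zeta> * ((1/\<zeta>) ^ k * \<zeta> ^ i))" for i by (rule circle_integrable_mult_continuous[OF f c])
  have IK: "circle_integrable (\<lambda>\<zeta>. f \<zeta> * kern z \<zeta>)" by (rule circle_integrable_mult_continuous[OF f kern_cont[OF z]])
  have "z ^ n * circle_integral (\<lambda>\<zeta>. f \<zeta> * ((1/\<zeta>) ^ k * kern z \<zeta>)) = circle_integral (\<lambda>\<zeta>. z ^ n * (f \<zeta> * ((1/\<zeta>) ^ k * kern z \<zeta>)))"
    by (simp only: ci_cmult)
  also have "\<dots> = circle_integral (\<lambda>\<zeta>. z ^ (n - k) * (f \<zeta> * kern z \<zeta>)
      + (\<Sum>i<k. (- (z ^ (n - Suc i))) * (f \<zeta> * ((1/\<zeta>) ^ k * \<zeta> ^ Suc i) + z * (f \<zeta> * ((1/\<zeta>) ^ k * \<zeta> ^ i)))))"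
  proof (rule circle_cong)
    fix \<zeta> :: complex assume n1: "norm \<zeta> = 1"
    then have ne: "\<zeta> - z \<noteq> 0" "\<zeta> \<noteq> 0" using z by auto
    have zn: "z ^ n = z ^ (n - k) * z ^ k" using kn by (simp add: power_add[symmetric])
    have zi: "z ^ (n - k) * z ^ (k - Suc i) = z ^ (n - Suc i)" if "i < k" for i using kn that by (simp add: power_add[symmetric])
    have uk: "(1/\<zeta>) ^ k * \<zeta> ^ k = 1" using ne by (simp add: power_one_over)
    have "\<zeta> ^ k - z ^ k = (\<zeta> - z) * (\<Sum>i<k. z ^ (k - Suc i) * \<zeta> ^ i)" by (rule power_diff_sumr2)
    then have d: "(\<zeta> ^ k - z ^ k) * kern z \<zeta> = (\<Sum>i<k. z ^ (k - Suc i) * \<zeta> ^ i) * (\<zeta> + z)"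
      using ne by (simp add: kern_def)
    have "z ^ n * ((1/\<zeta>) ^ k * kern z \<zeta>) = z ^ (n - k) * kern z \<zeta> * ((1/\<zeta>) ^ k * \<zeta> ^ k) - z ^ (n - k) * (1/\<zeta>) ^ k * ((\<zeta> ^ k - z ^ k) * kern z \<zeta>)"
      unfolding zn by (simp add: algebra_simps)
    also have "\<dots> = z ^ (n - k) * kern z \<zeta> - z ^ (n - k) * (1/\<zeta>) ^ k * ((\<Sum>i<k. z ^ (k - Suc i) * \<zeta> ^ i) * (\<zeta> + z))"
      unfolding uk d by simp
    also have "z ^ (n - k) * (1/\<zeta>) ^ k * ((\<Sum>i<k. z ^ (k - Suc i) * \<zeta> ^ i) * (\<zeta> + z))
       = (\<Sum>i<k. (z ^ (n - k) * z ^ (k - Suc i)) * (((1/\<zeta>) ^ k * \<zeta> ^ Suc i) + z * ((1/\<zeta>) ^ k * \<zeta> ^ i)))"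
      unfolding sum_distrib_left sum_distrib_right by (intro sum.cong refl) (simp add: algebra_simps)
    also have "\<dots> = (\<Sum>i<k. z ^ (n - Suc i) * (((1/\<zeta>) ^ k * \<zeta> ^ Suc i) + z * ((1/\<zeta>) ^ k * \<zeta> ^ i)))"
      by (rule sum.cong[OF refl]) (simp only: zi lessThan_iff)
    finally have "f \<zeta> * (z ^ n * ((1/\<zeta>) ^ k * kern z \<zeta>)) = f \<zeta> * (z ^ (n - k) * kern z \<zeta> - (\<Sum>i<k. z ^ (n - Suc i) * (((1/\<zeta>) ^ k * \<zeta> ^ Suc i) + z * ((1/\<zeta>) ^ k * \<zeta> ^ i))))"
      by simp
    also have "\<dots> = z ^ (n - k) * (f \<zeta> * kern z \<zeta>) - (\<Sum>i<k. z ^ (n - Suc i) * (f \<zeta> * ((1/\<zeta>) ^ k * \<zeta> ^ Suc i) + z * (f \<zeta> * ((1/\<zeta>) ^ k * \<zeta> ^ i))))"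
      unfolding right_diff_distrib sum_distrib_left
      by (intro arg_cong2[where f="(-)"] sum.cong refl) (simp_all add: algebra_simps)
    finally show "z ^ n * (f \<zeta> * ((1/\<zeta>) ^ k * kern z \<zeta>)) = z ^ (n - k) * (f \<zeta> * kern z \<zeta>)
      + (\<Sum>i<k. (- (z ^ (n - Suc i))) * (f \<zeta> * ((1/\<zeta>) ^ k * \<zeta> ^ Suc i) + z * (f \<zeta> * ((1/\<zeta>) ^ k * \<zeta> ^ i))))"
      by (simp only: mult_minus_left sum_negf mult.left_commute[of "f \<zeta>" "z ^ n"]) simp
  qed
  also have "\<dots> = z ^ (n - k) * circle_integral (\<lambda>\<zeta>. f \<zeta> * kern z \<zeta>) + (\<Sum>i<k. (- (z ^ (n - Suc i))) * (M (Suc i) + z * M i))"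
    unfolding M_def
    by (subst ci_combination) (simp_all only: ci_add ci_cmult circle_integrable_cmult circle_integrable_add I IK finite_lessThan)
  finally show "z ^ n * circle_integral (\<lambda>\<zeta>. f \<zeta> * ((1/\<zeta>) ^ k * kern z \<zeta>)) = z ^ (n - k) * circle_integral (\<lambda>\<zeta>. f \<zeta> * kern z \<zeta>)
      + - (\<Sum>i<k. z ^ (n - Suc i) * (M (Suc i) + z * M i))" by (simp add: sum_negf)
qed

context weight
begin

text \<open>The Caratheodory function of the weight.\<close>

definition F :: "complex \<Rightarrow> complex" where "F z = circle_integral (\<lambda>\<zeta>. w \<zeta> * kern z \<zeta>)"
definition w0 :: complex where "w0 = circle_integral w"
definition pole_moment :: "nat \<Rightarrow> complex" where "pole_moment j = circle_integral (\<lambda>\<zeta>. w \<zeta> / (\<zeta> - a j))"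

lemma pole_kernel:
  assumes j: "j \<in> {1..m}" and z: "norm z \<noteq> 1" "z \<noteq> a j"
  shows "circle_integral (\<lambda>\<zeta>. w \<zeta> / (\<zeta> - a j) * kern z \<zeta>) = (F z - (w0 + (z + a j) * pole_moment j)) / (z - a j)"
proof -
  note Id = w_div_integrable[OF j]
  have c: "(1 / (z - a j)) \<noteq> 0" using z by simp
  have "circle_integral (\<lambda>\<zeta>. w \<zeta> / (\<zeta> - a j) * kern z \<zeta>) =
     circle_integral (\<lambda>\<zeta>. (1 / (z - a j)) * (w \<zeta> * kern z \<zeta> - (w \<zeta> + (z + a j) * (w \<zeta> / (\<zeta> - a j)))))"
  proof (rule circle_cong_AE[where F="{a j}"])
    show "circle_integrable (\<lambda>\<zeta>. w \<zeta> / (\<zeta> - a j) * kern z \<zeta>)"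
      by (rule circle_integrable_mult_continuous[OF Id kern_cont[OF z(1)]])
    show "circle_integrable (\<lambda>\<zeta>. (1 / (z - a j)) * (w \<zeta> * kern z \<zeta> - (w \<zeta> + (z + a j) * (w \<zeta> / (\<zeta> - a j)))))"
      by (intro circle_integrable_cmult circle_integrable_diff circle_integrable_add w_mult_integrable kern_cont z w_integrable Id)
    fix \<zeta> :: complex assume "norm \<zeta> = 1" "\<zeta> \<notin> {a j}"
    then have n: "\<zeta> - z \<noteq> 0" "\<zeta> - a j \<noteq> 0" "z - a j \<noteq> 0" using z by auto
    have "1 / (\<zeta> - a j) * kern z \<zeta> = (1 / (z - a j)) * (kern z \<zeta> - (1 + (z + a j) * (1 / (\<zeta> - a j))))"
      using n unfolding kern_def by (simp add: divide_simps) (simp add: algebra_simps)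
    then have "w \<zeta> * (1 / (\<zeta> - a j) * kern z \<zeta>) = w \<zeta> * ((1 / (z - a j)) * (kern z \<zeta> - (1 + (z + a j) * (1 / (\<zeta> - a j)))))" by simp
    then show "w \<zeta> / (\<zeta> - a j) * kern z \<zeta> = (1 / (z - a j)) * (w \<zeta> * kern z \<zeta> - (w \<zeta> + (z + a j) * (w \<zeta> / (\<zeta> - a j))))"
      by (simp only: divide_inverse algebra_simps mult_1_left mult_1_right)
  qed auto
  also have "\<dots> = (1 / (z - a j)) * (F z - (w0 + (z + a j) * pole_moment j))"
    unfolding F_def w0_def pole_moment_def
    by (simp only: ci_cmult ci_diff ci_add circle_integrable_cmult circle_integrable_add w_mult_integrable kern_cont z not_False_eq_True w_integrable Id)
  finally show ?thesis by simp
qed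

text \<open>The rational inhomogeneity in the first-order differential equation of \<open>F\<close>. Its residue at \<open>z\<^sub>j\<close> is
\<open>- \<rho>\<^sub>j (w\<^sub>0 + 2 z\<^sub>j I\<^sub>j)\<close> for \<open>z\<^sub>j \<noteq> 0\<close>, where \<open>I\<^sub>j\<close> is the integral of \<open>w / (\<zeta> - z\<^sub>j)\<close>.\<close>

definition F_inhomogeneity :: "complex \<Rightarrow> complex" where
  "F_inhomogeneity z = - (\<Sum>j\<in>{1..m}. \<rho> j * a j * (w0 + (z + a j) * pole_moment j) / (z - a j)) / z"

text \<open>Differentiate the kernel, move the derivative from the kernel to the weight by integration by parts, and expand
the product of the kernel with each pole of \<open>w' / w\<close> in partial fractions (\<open>pole_kernel\<close>).\<close>

lemma F_deriv:
  assumes z: "norm z \<noteq> 1" "z \<noteq> 0" "z \<notin> a ` {1..m}"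
  shows "(F has_field_derivative (log_z_deriv z * F z + F_inhomogeneity z)) (at z)"
proof -
  define F' where "F' = circle_integral (\<lambda>\<zeta>. w \<zeta> * (2 * \<zeta> / (\<zeta> - z)\<^sup>2))"
  have D: "(F has_field_derivative F') (at z)"
    using kernel_has_derivative[OF w_integrable z(1)] unfolding F_def[abs_def] kern_def F'_def .
  have za: "z \<noteq> a j" if "j \<in> {1..m}" for j using z(3) that by auto
  have nz: "\<zeta> - z \<noteq> 0" if "norm \<zeta> = 1" for \<zeta> using that z(1) by auto
  have kd: "(kern z has_field_derivative - 2 * z / (\<zeta> - z)\<^sup>2) (at \<zeta>)" if "norm \<zeta> = 1" for \<zeta>
    unfolding kern_def[abs_def] using nz[OF that]
    by (auto intro!: derivative_eq_intros simp: power2_eq_square divide_simps)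
  have c: "continuous_on (sphere 0 1) (\<lambda>\<zeta>. - 2 * z / (\<zeta> - z)\<^sup>2)"
    by (intro continuous_intros) (use nz in auto)
  have c2: "continuous_on (sphere 0 1) (\<lambda>\<zeta>. 2 * \<zeta> / (\<zeta> - z)\<^sup>2)"
    by (intro continuous_intros) (use nz in auto)
  note IF = w_mult_integrable[OF c2] and IK = w_mult_integrable[OF kern_cont[OF z(1)]]
  have IJ: "circle_integrable (\<lambda>\<zeta>. w \<zeta> / (\<zeta> - a j) * kern z \<zeta>)" if "j \<in> {1..m}" for j
    by (rule circle_integrable_mult_continuous[OF w_div_integrable[OF that] kern_cont[OF z(1)]])
  have "0 = circle_integral (\<lambda>\<zeta>. w \<zeta> * (\<zeta> * (- 2 * z / (\<zeta> - z)\<^sup>2 + log_z_deriv \<zeta> * kern z \<zeta>)))"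
    using integration_by_parts[OF kd c] by simp
  also have "\<dots> = circle_integral (\<lambda>\<zeta>. (- z) * (w \<zeta> * (2 * \<zeta> / (\<zeta> - z)\<^sup>2)) + (\<Sum>j\<in>{1..m}. \<rho> j * (w \<zeta> * kern z \<zeta> + a j * (w \<zeta> / (\<zeta> - a j) * kern z \<zeta>))))"
  proof (rule circle_cong_AE[where F=exceptional])
    have "circle_integrable (\<lambda>\<zeta>. w \<zeta> * (\<zeta> * (- 2 * z / (\<zeta> - z)\<^sup>2)) + (\<Sum>j\<in>{1..m}. \<rho> j * (w \<zeta> / (\<zeta> - a j) * (\<zeta> * kern z \<zeta>))))"
      by (intro circle_integrable_add circle_integrable_sum circle_integrable_cmult w_mult_integrable
          circle_integrable_mult_continuous[OF w_div_integrable] continuous_intros c kern_cont z) auto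
    moreover have "w \<zeta> * (\<zeta> * (- 2 * z / (\<zeta> - z)\<^sup>2)) + (\<Sum>j\<in>{1..m}. \<rho> j * (w \<zeta> / (\<zeta> - a j) * (\<zeta> * kern z \<zeta>)))
       = w \<zeta> * (\<zeta> * (- 2 * z / (\<zeta> - z)\<^sup>2 + log_z_deriv \<zeta> * kern z \<zeta>))" for \<zeta>
      by (simp add: log_z_deriv_def sum_distrib_left sum_distrib_right algebra_simps)
    ultimately show "circle_integrable (\<lambda>\<zeta>. w \<zeta> * (\<zeta> * (- 2 * z / (\<zeta> - z)\<^sup>2 + log_z_deriv \<zeta> * kern z \<zeta>)))" by simp
    show "circle_integrable (\<lambda>\<zeta>. (- z) * (w \<zeta> * (2 * \<zeta> / (\<zeta> - z)\<^sup>2)) + (\<Sum>j\<in>{1..m}. \<rho> j * (w \<zeta> * kern z \<zeta> + a j * (w \<zeta> / (\<zeta> - a j) * kern z \<zeta>))))"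
      by (intro circle_integrable_add circle_integrable_sum circle_integrable_cmult IF IK IJ) auto
    fix \<zeta> :: complex assume "norm \<zeta> = 1" "\<zeta> \<notin> exceptional"
    then have na: "\<zeta> - a j \<noteq> 0" if "j \<in> {1..m}" for j using that by (auto simp: exceptional_def)
    have "\<zeta> * log_z_deriv \<zeta> = (\<Sum>j\<in>{1..m}. \<rho> j * (1 + a j / (\<zeta> - a j)))"
      unfolding log_z_deriv_def sum_distrib_left by (intro sum.cong refl) (use na in \<open>auto simp: divide_simps\<close>)
    then have "w \<zeta> * (\<zeta> * log_z_deriv \<zeta>) * kern z \<zeta> = (\<Sum>j\<in>{1..m}. \<rho> j * (w \<zeta> * kern z \<zeta> + a j * (w \<zeta> / (\<zeta> - a j) * kern z \<zeta>)))"
      by (simp add: sum_distrib_left sum_distrib_right algebra_simps)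
    then show "w \<zeta> * (\<zeta> * (- 2 * z / (\<zeta> - z)\<^sup>2 + log_z_deriv \<zeta> * kern z \<zeta>)) = (- z) * (w \<zeta> * (2 * \<zeta> / (\<zeta> - z)\<^sup>2)) + (\<Sum>j\<in>{1..m}. \<rho> j * (w \<zeta> * kern z \<zeta> + a j * (w \<zeta> / (\<zeta> - a j) * kern z \<zeta>)))"
      by (simp add: algebra_simps)
  qed (simp add: countable_finite)
  also have "\<dots> = (- z) * F' + (\<Sum>j\<in>{1..m}. \<rho> j * (F z + a j * ((F z - (w0 + (z + a j) * pole_moment j)) / (z - a j))))"
  proof -
    have "circle_integral (\<lambda>\<zeta>. (- z) * (w \<zeta> * (2 * \<zeta> / (\<zeta> - z)\<^sup>2)) + (\<Sum>j\<in>{1..m}. \<rho> j * (w \<zeta> * kern z \<zeta> + a j * (w \<zeta> / (\<zeta> - a j) * kern z \<zeta>))))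
       = (- z) * F' + (\<Sum>j\<in>{1..m}. \<rho> j * circle_integral (\<lambda>\<zeta>. w \<zeta> * kern z \<zeta> + a j * (w \<zeta> / (\<zeta> - a j) * kern z \<zeta>)))"
      unfolding F'_def by (intro ci_combination IF circle_integrable_cmult circle_integrable_add IK IJ finite_atLeastAtMost)
    also have "(\<Sum>j\<in>{1..m}. \<rho> j * circle_integral (\<lambda>\<zeta>. w \<zeta> * kern z \<zeta> + a j * (w \<zeta> / (\<zeta> - a j) * kern z \<zeta>)))
       = (\<Sum>j\<in>{1..m}. \<rho> j * (F z + a j * ((F z - (w0 + (z + a j) * pole_moment j)) / (z - a j))))"
      by (intro sum.cong refl) (simp only: ci_cmult ci_add circle_integrable_cmult IK IJ pole_kernel[OF _ z(1) za] F_def)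
    finally show ?thesis .
  qed
  also have "(\<Sum>j\<in>{1..m}. \<rho> j * (F z + a j * ((F z - (w0 + (z + a j) * pole_moment j)) / (z - a j)))) = z * (log_z_deriv z * F z + F_inhomogeneity z)"
  proof -
    have "\<rho> j * (F z + a j * ((F z - (w0 + (z + a j) * pole_moment j)) / (z - a j))) = z * (\<rho> j / (z - a j) * F z) - \<rho> j * a j * (w0 + (z + a j) * pole_moment j) / (z - a j)"
      if "j \<in> {1..m}" for j
    proof -
      have "z - a j \<noteq> 0" using za[OF that] by simp
      then show ?thesis by (simp add: divide_simps) (simp add: algebra_simps)
    qed
    then have "(\<Sum>j\<in>{1..m}. \<rho> j * (F z + a j * ((F z - (w0 + (z + a j) * pole_moment j)) / (z - a j))))
       = (\<Sum>j\<in>{1..m}. z * (\<rho> j / (z - a j) * F z) - \<rho> j * a j * (w0 + (z + a j) * pole_moment j) / (z - a j))"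
      by (rule sum.cong[OF refl])
    also have "\<dots> = z * (log_z_deriv z * F z) + z * F_inhomogeneity z"
    proof -
      have "z * F_inhomogeneity z = - (\<Sum>j\<in>{1..m}. \<rho> j * a j * (w0 + (z + a j) * pole_moment j) / (z - a j))" using z(2) by (simp add: F_inhomogeneity_def)
      then show ?thesis by (simp add: log_z_deriv_def sum_subtractf sum_distrib_left sum_distrib_right)
    qed
    finally show ?thesis by (simp add: distrib_left)
  qed
  finally have "log_z_deriv z * F z + F_inhomogeneity z = F'" using z(2) by simp
  then show ?thesis using D by simp
qed

end

context weight_family
begin

text \<open>The value of \<open>\<partial>\<^sub>t F\<close>, again by partial fractions. Its inhomogeneity has at \<open>z\<^sub>j\<close> the residue \<open>(\<partial>\<^sub>t z\<^sub>j) \<rho>\<^sub>j (w\<^sub>0 + 2 z\<^sub>j I\<^sub>j)\<close>, which for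
\<open>z\<^sub>j \<noteq> 0\<close> is \<open>- \<partial>\<^sub>t z\<^sub>j\<close> times the residue in the \<open>z\<close>-equation; this match is what the deformation equation rests on.\<close>

lemma U_kernel:
  assumes t: "t \<in> U" and z: "norm z \<noteq> 1" "z \<notin> zs t ` {1..m}"
  shows "circle_integral (\<lambda>\<zeta>. w t \<zeta> * (log_t_deriv t \<zeta> * kern z \<zeta>)) = log_t_deriv t z * weight.F (w t) z
    + (\<Sum>j\<in>{1..m}. zs_dot t j * \<rho> j * (weight.w0 (w t) + (z + zs t j) * weight.pole_moment (zs t) (w t) j) / (z - zs t j))"
proof -
  interpret W: weight m "zs t" \<rho> "C t" "w t" using wt[OF t] .
  have za: "z \<noteq> zs t j" if "j \<in> {1..m}" for j using z(2) that by auto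
  have IJ: "circle_integrable (\<lambda>\<zeta>. w t \<zeta> / (\<zeta> - zs t j) * kern z \<zeta>)" if "j \<in> {1..m}" for j
    by (rule circle_integrable_mult_continuous[OF W.w_div_integrable[OF that] kern_cont[OF z(1)]])
  have "w t \<zeta> * (log_t_deriv t \<zeta> * kern z \<zeta>) = (\<Sum>j\<in>{1..m}. (- zs_dot t j * \<rho> j) * (w t \<zeta> / (\<zeta> - zs t j) * kern z \<zeta>))" for \<zeta>
    by (simp add: log_t_deriv_def sum_distrib_left sum_distrib_right sum_negf algebra_simps)
  then have "circle_integral (\<lambda>\<zeta>. w t \<zeta> * (log_t_deriv t \<zeta> * kern z \<zeta>)) = (\<Sum>j\<in>{1..m}. (- zs_dot t j * \<rho> j) * circle_integral (\<lambda>\<zeta>. w t \<zeta> / (\<zeta> - zs t j) * kern z \<zeta>))"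
    by (simp only: ci_sum finite_atLeastAtMost circle_integrable_cmult IJ ci_cmult cong: sum.cong)
  also have "\<dots> = (\<Sum>j\<in>{1..m}. (- zs_dot t j * \<rho> j) * ((W.F z - (W.w0 + (z + zs t j) * W.pole_moment j)) / (z - zs t j)))"
    by (intro sum.cong refl) (simp only: W.pole_kernel[OF _ z(1) za])
  also have "\<dots> = log_t_deriv t z * W.F z + (\<Sum>j\<in>{1..m}. zs_dot t j * \<rho> j * (W.w0 + (z + zs t j) * W.pole_moment j) / (z - zs t j))"
  proof -
    have "(- zs_dot t j * \<rho> j) * ((W.F z - (W.w0 + (z + zs t j) * W.pole_moment j)) / (z - zs t j))
        = - (zs_dot t j * \<rho> j / (z - zs t j) * W.F z) + zs_dot t j * \<rho> j * (W.w0 + (z + zs t j) * W.pole_moment j) / (z - zs t j)" for j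
      by (simp add: divide_inverse algebra_simps)
    then show ?thesis by (simp only: log_t_deriv_def sum.distrib sum_negf sum_distrib_right mult_minus_left)
  qed
  finally show ?thesis .
qed

end

section \<open>Differentiable dependence of the biorthonormal polynomials\<close>

text \<open>A sequence of polynomials of all degrees is a basis; the functional is only assumed additive and homogeneous.\<close>

lemma linear_functional_low_degree:
  fixes L :: "complex poly \<Rightarrow> complex" and \<psi> :: "nat \<Rightarrow> complex poly"
  assumes add: "\<And>p q. L (p + q) = L p + L q" and scale: "\<And>c p. L (Polynomial.smult c p) = c * L p"
    and \<psi>: "\<And>k. degree (\<psi> k) = k" "\<And>k. lead_coeff (\<psi> k) \<noteq> 0"
    and zero: "\<And>k. k < n \<Longrightarrow> L (\<psi> k) = 0"
    and p: "\<And>i. i \<ge> n \<Longrightarrow> coeff p i = 0"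
  shows "L p = 0"
  using zero p
proof (induction n arbitrary: p)
  case 0
  then have "p = 0" by (simp add: poly_eq_iff)
  then show ?case using scale[of 0 0] by simp
next
  case (Suc n)
  define c where "c = coeff p n / lead_coeff (\<psi> n)"
  define q where "q = p + Polynomial.smult (- c) (\<psi> n)"
  have "coeff q i = 0" if "i \<ge> n" for i
  proof (cases "i = n")
    case True
    then show ?thesis using \<psi>[of n] by (simp add: q_def c_def)
  next
    case False
    then have "i > degree (\<psi> n)" using that \<psi>(1)[of n] by simp
    then show ?thesis using Suc.prems(2)[of i] False that by (simp add: q_def coeff_eq_0)
  qed
  then have "L q = 0" using Suc.IH[of q] Suc.prems(1) by simp
  then show ?case using add[of p "Polynomial.smult (- c) (\<psi> n)"] scale[of "- c" "\<psi> n"] Suc.prems(1)[of n] by (simp add: q_def)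
qed

lemma biorthogonal_nondegenerate:
  fixes B :: "complex poly \<Rightarrow> complex poly \<Rightarrow> complex"
  assumes add: "\<And>p q r. B (p + q) r = B p r + B q r" and scale: "\<And>c p r. B (Polynomial.smult c p) r = c * B p r"
    and \<psi>: "\<And>k. degree (\<psi> k) = k" "\<And>k. lead_coeff (\<psi> k) \<noteq> 0"
    and orth: "\<And>k j. B (\<psi> k) (\<xi> j) = (if k = j then 1 else 0)"
    and q: "\<And>i. i \<ge> n \<Longrightarrow> coeff q i = 0" "\<And>k. k < n \<Longrightarrow> B q (\<xi> k) = 0"
  shows "q = 0"
  using q
proof (induction n)
  case 0
  then show ?case by (simp add: poly_eq_iff)
next
  case (Suc n)
  define c where "c = coeff q n / lead_coeff (\<psi> n)"
  define r where "r = q + Polynomial.smult (- c) (\<psi> n)"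
  have "coeff r i = 0" if "i \<ge> n" for i
  proof (cases "i = n")
    case True
    then show ?thesis using \<psi>[of n] by (simp add: r_def c_def)
  next
    case False
    then have "i > degree (\<psi> n)" using that \<psi>(1)[of n] by simp
    then show ?thesis using Suc.prems(1)[of i] False that by (simp add: r_def coeff_eq_0)
  qed
  then have "B r (\<xi> n) = 0"
    by (rule linear_functional_low_degree[where L="\<lambda>p. B p (\<xi> n)" and \<psi>=\<psi> and n=n, rotated -1])
       (use \<psi>(2) in \<open>simp_all add: add scale \<psi>(1) orth\<close>)
  moreover have "B r (\<xi> n) = B q (\<xi> n) + - c * 1" by (simp only: r_def add scale orth) simp
  ultimately have "c = 0" using Suc.prems(2)[of n] by simp
  then have "coeff q n = 0" using \<psi>(2)[of n] by (simp add: c_def)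
  then have qn: "coeff q i = 0" if "n \<le> i" for i
    using Suc.prems(1)[of i] that by (cases "i = n") simp_all
  show ?case
  proof (rule Suc.IH)
    show "coeff q i = 0" if "n \<le> i" for i by (rule qn[OF that])
    show "B q (\<xi> k) = 0" if "k < n" for k by (rule Suc.prems(2)[OF less_SucI[OF that]])
  qed
qed

text \<open>Biorthonormality and the leading coefficient determine the polynomial, so it can be written through
polynomials of lower degree and moments. This formula is the source of all differentiability in \<open>t\<close>.\<close>

lemma gram_schmidt:
  fixes B :: "complex poly \<Rightarrow> complex poly \<Rightarrow> complex"
  assumes add: "\<And>p q r. B (p + q) r = B p r + B q r" and scale: "\<And>c p r. B (Polynomial.smult c p) r = c * B p r"
    and \<psi>: "\<And>k. degree (\<psi> k) = k" "\<And>k. lead_coeff (\<psi> k) \<noteq> 0"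
    and orth: "\<And>k j. B (\<psi> k) (\<xi> j) = (if k = j then 1 else 0)"
  shows "\<psi> n = Polynomial.smult (lead_coeff (\<psi> n)) (monom 1 n - (\<Sum>k<n. Polynomial.smult (B (monom 1 n) (\<xi> k)) (\<psi> k)))"
proof -
  define \<kappa> where "\<kappa> = lead_coeff (\<psi> n)"
  have B0: "B 0 r = 0" for r using scale[of 0 0 r] by simp
  have Bsum: "B (\<Sum>k\<in>I. f k) r = (\<Sum>k\<in>I. B (f k) r)" for I :: "nat set" and f r
    by (induction I rule: infinite_finite_induct) (simp_all add: B0 add)
  define S where "S = (\<Sum>k<n. Polynomial.smult (B (monom 1 n) (\<xi> k)) (\<psi> k))"
  define q where "q = \<psi> n + Polynomial.smult (- \<kappa>) (monom 1 n + Polynomial.smult (- 1) S)"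
  have "q = 0"
  proof (rule biorthogonal_nondegenerate[where B=B and \<psi>=\<psi> and \<xi>=\<xi> and n=n])
    have S0: "coeff S i = 0" if "i \<ge> n" for i
      unfolding S_def coeff_sum using that by (intro sum.neutral) (auto simp: coeff_eq_0 \<psi>(1))
    show "coeff q i = 0" if "i \<ge> n" for i
    proof (cases "i = n")
      case True
      then show ?thesis using S0[of n] \<psi>(1)[of n] by (simp add: q_def \<kappa>_def)
    next
      case False
      then have "i > degree (\<psi> n)" using that \<psi>(1) by simp
      then show ?thesis using S0[OF that] False by (simp add: q_def coeff_eq_0)
    qed
    show "B q (\<xi> k) = 0" if "k < n" for k
    proof -
      have "B S (\<xi> k) = (\<Sum>j<n. B (monom 1 n) (\<xi> j) * (if j = k then 1 else 0))"
        unfolding S_def Bsum scale orth ..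
      also have "\<dots> = B (monom 1 n) (\<xi> k)" using that by (simp add: if_distrib[of "\<lambda>x. _ * x"] cong: if_cong)
      finally have "B S (\<xi> k) = B (monom 1 n) (\<xi> k)" .
      moreover have "B q (\<xi> k) = 0 + - \<kappa> * (B (monom 1 n) (\<xi> k) + - 1 * B S (\<xi> k))"
        using that by (simp only: q_def add scale orth) simp
      ultimately show ?thesis by simp
    qed
  qed (rule add scale \<psi>(1) \<psi>(2) orth)+
  then have "\<psi> n = Polynomial.smult \<kappa> (monom 1 n + Polynomial.smult (- 1) S)" unfolding q_def by (simp add: eq_neg_iff_add_eq_0)
  then show ?thesis by (simp add: \<kappa>_def S_def)
qed

context weight
begin

definition pair :: "complex poly \<Rightarrow> complex poly \<Rightarrow> complex" where
  "pair p q = circle_integral (\<lambda>\<zeta>. w \<zeta> * (poly p \<zeta> * poly q (1 / \<zeta>)))"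

lemma poly_inv_cont: "continuous_on (sphere 0 1) (\<lambda>\<zeta>::complex. poly q (1 / \<zeta>))"
  by (intro continuous_intros) auto

lemma pair_integrable: "circle_integrable (\<lambda>\<zeta>. w \<zeta> * (poly p \<zeta> * poly q (1 / \<zeta>)))"
  by (intro w_mult_integrable continuous_intros poly_inv_cont)

lemma pair_add_left: "pair (p + q) r = pair p r + pair q r"
  unfolding pair_def by (subst ci_add[OF pair_integrable pair_integrable, symmetric]) (simp add: algebra_simps)
lemma pair_add_right: "pair r (p + q) = pair r p + pair r q"
  unfolding pair_def by (subst ci_add[OF pair_integrable pair_integrable, symmetric]) (simp add: algebra_simps)
lemma pair_smult_left: "pair (Polynomial.smult c p) r = c * pair p r"
  unfolding pair_def by (subst ci_cmult[symmetric]) (simp add: algebra_simps)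
lemma pair_smult_right: "pair r (Polynomial.smult c p) = c * pair r p"
  unfolding pair_def by (subst ci_cmult[symmetric]) (simp add: algebra_simps)

end

locale biorth_family = weight_family +
  fixes \<kappa> :: "real \<Rightarrow> nat \<Rightarrow> complex" and \<phi> \<phi>b :: "real \<Rightarrow> nat \<Rightarrow> complex poly"
  assumes bio: "\<And>t. t \<in> U \<Longrightarrow> biorthonormal_system (w t) (\<kappa> t) (\<phi> t) (\<phi>b t)"
    and \<kappa>_diff: "\<And>t N. t \<in> U \<Longrightarrow> (\<lambda>s. \<kappa> s N) differentiable (at t)"
begin

abbreviation pr where "pr t \<equiv> weight.pair (w t)"

lemma bio_facts:
  assumes "t \<in> U"
  shows "\<kappa> t k \<noteq> 0" "degree (\<phi> t k) = k" "degree (\<phi>b t k) = k" "coeff (\<phi> t k) k = \<kappa> t k" "coeff (\<phi>b t k) k = \<kappa> t k"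
    "pr t (\<phi> t k) (\<phi>b t j) = (if k = j then 1 else 0)"
proof -
  have b: "\<forall>n. \<kappa> t n \<noteq> 0 \<and> degree (\<phi> t n) = n \<and> degree (\<phi>b t n) = n \<and> lead_coeff (\<phi> t n) = \<kappa> t n \<and> lead_coeff (\<phi>b t n) = \<kappa> t n"
    "circle_integral (\<lambda>\<zeta>. w t \<zeta> * poly (\<phi> t k) \<zeta> * poly (\<phi>b t j) (1 / \<zeta>)) = (if k = j then 1 else 0)"
    using bio[OF assms] unfolding biorthonormal_system_def by blast+
  show "\<kappa> t k \<noteq> 0" "degree (\<phi> t k) = k" "degree (\<phi>b t k) = k" using b(1) by blast+
  show "coeff (\<phi> t k) k = \<kappa> t k" "coeff (\<phi>b t k) k = \<kappa> t k" using b(1) by metis+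
  show "pr t (\<phi> t k) (\<phi>b t j) = (if k = j then 1 else 0)"
    using b(2) weight.pair_def[OF wt[OF assms]] by (simp add: mult.assoc)
qed

lemma weight_integral_differentiable: "t \<in> U \<Longrightarrow> continuous_on (sphere 0 1) h \<Longrightarrow> (\<lambda>s. circle_integral (\<lambda>\<zeta>. w s \<zeta> * h \<zeta>)) differentiable (at t)"
  using weight_integral_deriv differentiableI_vector by blast

lemma poly_sum_le: "degree p \<le> n \<Longrightarrow> poly p z = (\<Sum>i\<le>n. coeff p i * z ^ i)" for p :: "complex poly"
proof -
  assume d: "degree p \<le> n"
  have "poly p z = (\<Sum>i\<le>degree p. coeff p i * z ^ i)" by (rule poly_altdef)
  also have "\<dots> = (\<Sum>i\<le>n. coeff p i * z ^ i)"
    by (rule sum.mono_neutral_left) (use d in \<open>auto simp: coeff_eq_0\<close>)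
  finally show ?thesis .
qed

lemma pr_expand_right:
  assumes t: "t \<in> U" and q: "degree q \<le> N"
  shows "pr t (monom 1 n) q = (\<Sum>i\<le>N. coeff q i * circle_integral (\<lambda>\<zeta>. w t \<zeta> * (\<zeta> ^ n * (1 / \<zeta>) ^ i)))"
proof -
  interpret W: weight m "zs t" \<rho> "C t" "w t" using wt[OF t] .
  have c: "continuous_on (sphere 0 1) (\<lambda>\<zeta>::complex. \<zeta> ^ n * (1 / \<zeta>) ^ i)" for i by (intro continuous_intros) auto
  have "w t \<zeta> * (poly (monom 1 n) \<zeta> * poly q (1 / \<zeta>)) = (\<Sum>i\<le>N. coeff q i * (w t \<zeta> * (\<zeta> ^ n * (1 / \<zeta>) ^ i)))" for \<zeta>
    unfolding poly_sum_le[OF q] by (simp add: poly_monom sum_distrib_left mult_ac)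
  then have "pr t (monom 1 n) q = circle_integral (\<lambda>\<zeta>. \<Sum>i\<le>N. coeff q i * (w t \<zeta> * (\<zeta> ^ n * (1 / \<zeta>) ^ i)))"
    by (simp only: W.pair_def)
  also have "\<dots> = (\<Sum>i\<le>N. coeff q i * circle_integral (\<lambda>\<zeta>. w t \<zeta> * (\<zeta> ^ n * (1 / \<zeta>) ^ i)))"
    by (subst ci_sum) (auto intro!: circle_integrable_cmult W.w_mult_integrable c simp only: ci_cmult)
  finally show ?thesis .
qed

lemma pr_expand_left:
  assumes t: "t \<in> U" and q: "degree q \<le> N"
  shows "pr t q (monom 1 n) = (\<Sum>i\<le>N. coeff q i * circle_integral (\<lambda>\<zeta>. w t \<zeta> * (\<zeta> ^ i * (1 / \<zeta>) ^ n)))"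
proof -
  interpret W: weight m "zs t" \<rho> "C t" "w t" using wt[OF t] .
  have c: "continuous_on (sphere 0 1) (\<lambda>\<zeta>::complex. \<zeta> ^ i * (1 / \<zeta>) ^ n)" for i by (intro continuous_intros) auto
  have "w t \<zeta> * (poly q \<zeta> * poly (monom 1 n) (1 / \<zeta>)) = (\<Sum>i\<le>N. coeff q i * (w t \<zeta> * (\<zeta> ^ i * (1 / \<zeta>) ^ n)))" for \<zeta>
    unfolding poly_sum_le[OF q] by (simp add: poly_monom sum_distrib_left sum_distrib_right mult_ac)
  then have "pr t q (monom 1 n) = circle_integral (\<lambda>\<zeta>. \<Sum>i\<le>N. coeff q i * (w t \<zeta> * (\<zeta> ^ i * (1 / \<zeta>) ^ n)))"
    by (simp only: W.pair_def)
  also have "\<dots> = (\<Sum>i\<le>N. coeff q i * circle_integral (\<lambda>\<zeta>. w t \<zeta> * (\<zeta> ^ i * (1 / \<zeta>) ^ n)))"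
    by (subst ci_sum) (auto intro!: circle_integrable_cmult W.w_mult_integrable c simp only: ci_cmult)
  finally show ?thesis .
qed

lemma phi_gram_schmidt:
  assumes t: "t \<in> U"
  shows "\<phi> t n = Polynomial.smult (\<kappa> t n) (monom 1 n - (\<Sum>k<n. Polynomial.smult (pr t (monom 1 n) (\<phi>b t k)) (\<phi> t k)))"
    and "\<phi>b t n = Polynomial.smult (\<kappa> t n) (monom 1 n - (\<Sum>k<n. Polynomial.smult (pr t (\<phi> t k) (monom 1 n)) (\<phi>b t k)))"
proof -
  interpret W: weight m "zs t" \<rho> "C t" "w t" using wt[OF t] .
  note b = bio_facts[OF t]
  show "\<phi> t n = Polynomial.smult (\<kappa> t n) (monom 1 n - (\<Sum>k<n. Polynomial.smult (pr t (monom 1 n) (\<phi>b t k)) (\<phi> t k)))"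
    using gram_schmidt[where B="pr t" and \<psi>="\<phi> t" and \<xi>="\<phi>b t" and n=n] b
    by (simp add: W.pair_add_left W.pair_smult_left)
  show "\<phi>b t n = Polynomial.smult (\<kappa> t n) (monom 1 n - (\<Sum>k<n. Polynomial.smult (pr t (\<phi> t k) (monom 1 n)) (\<phi>b t k)))"
  proof -
    have o: "pr t (\<phi> t j) (\<phi>b t k) = (if k = j then 1 else 0)" for j k using b(6)[of j k] by simp
    show ?thesis using gram_schmidt[where B="\<lambda>p q. pr t q p" and \<psi>="\<phi>b t" and \<xi>="\<phi> t" and n=n] b(1-5) o
      by (simp add: W.pair_add_right W.pair_smult_right)
  qed
qed

text \<open>Induction on the degree along the Gram-Schmidt formula, simultaneously for both families.\<close>

lemma coeff_diff:
  assumes t: "t \<in> U"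
  shows "(\<lambda>s. coeff (\<phi> s n) i) differentiable (at t) \<and> (\<lambda>s. coeff (\<phi>b s n) i) differentiable (at t)"
  using t
proof (induction n arbitrary: i t rule: less_induct)
  case (less n)
  note t = less.prems
  have evU: "eventually (\<lambda>s. s \<in> U) (nhds t)" using open_U t by (rule eventually_nhds_in_open)
  have c: "continuous_on (sphere 0 1) (\<lambda>\<zeta>::complex. \<zeta> ^ n * (1 / \<zeta>) ^ i)" for n i by (intro continuous_intros) auto
  have p1: "(\<lambda>s. pr s (monom 1 n) (\<phi>b s k)) differentiable (at t)" if k: "k < n" for k
  proof (rule differentiable_eventually)
    show "(\<lambda>s. \<Sum>i\<le>k. coeff (\<phi>b s k) i * circle_integral (\<lambda>\<zeta>. w s \<zeta> * (\<zeta> ^ n * (1 / \<zeta>) ^ i))) differentiable (at t)"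
      using less.IH[OF k t] by (intro differentiable_sum differentiable_mult weight_integral_differentiable[OF t c] ballI) auto
    show "eventually (\<lambda>s. (\<Sum>i\<le>k. coeff (\<phi>b s k) i * circle_integral (\<lambda>\<zeta>. w s \<zeta> * (\<zeta> ^ n * (1 / \<zeta>) ^ i))) = pr s (monom 1 n) (\<phi>b s k)) (nhds t)"
      using evU by eventually_elim (rule pr_expand_right[symmetric], simp_all add: bio_facts)
  qed
  have p2: "(\<lambda>s. pr s (\<phi> s k) (monom 1 n)) differentiable (at t)" if k: "k < n" for k
  proof (rule differentiable_eventually)
    show "(\<lambda>s. \<Sum>i\<le>k. coeff (\<phi> s k) i * circle_integral (\<lambda>\<zeta>. w s \<zeta> * (\<zeta> ^ i * (1 / \<zeta>) ^ n))) differentiable (at t)"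
      using less.IH[OF k t] by (intro differentiable_sum differentiable_mult weight_integral_differentiable[OF t c] ballI) auto
    show "eventually (\<lambda>s. (\<Sum>i\<le>k. coeff (\<phi> s k) i * circle_integral (\<lambda>\<zeta>. w s \<zeta> * (\<zeta> ^ i * (1 / \<zeta>) ^ n))) = pr s (\<phi> s k) (monom 1 n)) (nhds t)"
      using evU by eventually_elim (rule pr_expand_left[symmetric], simp_all add: bio_facts)
  qed
  show ?case
  proof
    show "(\<lambda>s. coeff (\<phi> s n) i) differentiable (at t)"
    proof (rule differentiable_eventually)
      show "(\<lambda>s. \<kappa> s n * (coeff (monom 1 n) i - (\<Sum>k<n. pr s (monom 1 n) (\<phi>b s k) * coeff (\<phi> s k) i))) differentiable (at t)"
        using less.IH t by (intro differentiable_mult differentiable_diff differentiable_const differentiable_sum \<kappa>_diff p1 ballI) auto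
      show "eventually (\<lambda>s. \<kappa> s n * (coeff (monom 1 n) i - (\<Sum>k<n. pr s (monom 1 n) (\<phi>b s k) * coeff (\<phi> s k) i)) = coeff (\<phi> s n) i) (nhds t)"
        using evU
      proof eventually_elim
        case (elim s)
        show ?case by (subst (2) phi_gram_schmidt(1)[OF elim]) (simp only: coeff_smult coeff_diff coeff_sum)
      qed
    qed
    show "(\<lambda>s. coeff (\<phi>b s n) i) differentiable (at t)"
    proof (rule differentiable_eventually)
      show "(\<lambda>s. \<kappa> s n * (coeff (monom 1 n) i - (\<Sum>k<n. pr s (\<phi> s k) (monom 1 n) * coeff (\<phi>b s k) i))) differentiable (at t)"
        using less.IH t by (intro differentiable_mult differentiable_diff differentiable_const differentiable_sum \<kappa>_diff p2 ballI) auto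
      show "eventually (\<lambda>s. \<kappa> s n * (coeff (monom 1 n) i - (\<Sum>k<n. pr s (\<phi> s k) (monom 1 n) * coeff (\<phi>b s k) i)) = coeff (\<phi>b s n) i) (nhds t)"
        using evU
      proof eventually_elim
        case (elim s)
        show ?case by (subst (2) phi_gram_schmidt(2)[OF elim]) (simp only: coeff_smult coeff_diff coeff_sum)
      qed
    qed
  qed
qed

lemma orthogonality:
  assumes t: "t \<in> U"
  shows "k < n \<Longrightarrow> pr t (\<phi> t n) (monom 1 k) = 0" "k < n \<Longrightarrow> pr t (monom 1 k) (\<phi>b t n) = 0"
    and "pr t (\<phi> t n) (monom 1 n) = 1 / \<kappa> t n" "pr t (monom 1 n) (\<phi>b t n) = 1 / \<kappa> t n"
proof -
  interpret W: weight m "zs t" \<rho> "C t" "w t" using wt[OF t] .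
  note b = bio_facts[OF t]
  have low1: "pr t (\<phi> t n) p = 0" if "\<And>i. i \<ge> n \<Longrightarrow> coeff p i = 0" for p
    by (rule linear_functional_low_degree[where \<psi>="\<phi>b t" and n=n]) (use b that in \<open>auto simp: W.pair_add_right W.pair_smult_right\<close>)
  have low2: "pr t p (\<phi>b t n) = 0" if "\<And>i. i \<ge> n \<Longrightarrow> coeff p i = 0" for p
    by (rule linear_functional_low_degree[where \<psi>="\<phi> t" and n=n]) (use b that in \<open>auto simp: W.pair_add_left W.pair_smult_left\<close>)
  show "pr t (\<phi> t n) (monom 1 k) = 0" if "k < n" using that by (intro low1) simp
  show "pr t (monom 1 k) (\<phi>b t n) = 0" if "k < n" using that by (intro low2) simp
  have "pr t (\<phi> t n) (monom 1 n + Polynomial.smult (- (1 / \<kappa> t n)) (\<phi>b t n)) = 0"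
    by (rule low1) (use b in \<open>auto simp: coeff_eq_0 le_less\<close>)
  then show "pr t (\<phi> t n) (monom 1 n) = 1 / \<kappa> t n" by (simp add: W.pair_add_right W.pair_smult_right b del: smult_minus_left mult_minus_left)
  have "pr t (monom 1 n + Polynomial.smult (- (1 / \<kappa> t n)) (\<phi> t n)) (\<phi>b t n) = 0"
    by (rule low2) (use b in \<open>auto simp: coeff_eq_0 le_less\<close>)
  then show "pr t (monom 1 n) (\<phi>b t n) = 1 / \<kappa> t n" by (simp add: W.pair_add_left W.pair_smult_left b del: smult_minus_left mult_minus_left)
qed

end

section \<open>Columns built from coefficients\<close>

text \<open>The first column \<open>(\<phi>, \<phi>\<^sup>*)\<close> for arbitrary coefficient sequences, so that it can also be formed with the
\<open>t\<close>-derivatives of the coefficients.\<close>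

definition poly_column :: "nat \<Rightarrow> (nat \<Rightarrow> complex) \<Rightarrow> (nat \<Rightarrow> complex) \<Rightarrow> complex \<Rightarrow> complex^2" where
  "poly_column n c d z = vector [\<Sum>k\<le>n. c k * z ^ k, \<Sum>k\<le>n. d k * z ^ (n - k)]"

definition poly_column' :: "nat \<Rightarrow> (nat \<Rightarrow> complex) \<Rightarrow> (nat \<Rightarrow> complex) \<Rightarrow> complex \<Rightarrow> complex^2" where
  "poly_column' n c d z = vector [\<Sum>k\<le>n. c k * (of_nat k * z ^ (k - 1)), \<Sum>k\<le>n. d k * (of_nat (n - k) * z ^ (n - k - 1))]"

text \<open>The second column of \<open>Y\<close> without the division by the weight. The density \<open>g\<close> is a parameter because the \<open>t\<close>-derivative
produces the same expression with \<open>g = \<partial>\<^sub>t w\<close>.\<close>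

definition kernel_column :: "(complex \<Rightarrow> complex) \<Rightarrow> nat \<Rightarrow> (nat \<Rightarrow> complex) \<Rightarrow> (nat \<Rightarrow> complex) \<Rightarrow> complex \<Rightarrow> complex^2" where
  "kernel_column g n c d z = vector [\<Sum>k\<le>n. c k * circle_integral (\<lambda>\<zeta>. g \<zeta> * (\<zeta> ^ k * kern z \<zeta>)),
      \<Sum>k\<le>n. d k * (z ^ n * circle_integral (\<lambda>\<zeta>. g \<zeta> * ((1 / \<zeta>) ^ k * kern z \<zeta>)))]"

definition kern' :: "complex \<Rightarrow> complex \<Rightarrow> complex" where "kern' z \<zeta> = 2 * \<zeta> / (\<zeta> - z)\<^sup>2"

lemma kern'_cont [continuous_intros]: "norm z \<noteq> 1 \<Longrightarrow> continuous_on (sphere 0 1) (kern' z)"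
  unfolding kern'_def by (intro continuous_intros) auto

definition kernel_column' :: "(complex \<Rightarrow> complex) \<Rightarrow> nat \<Rightarrow> (nat \<Rightarrow> complex) \<Rightarrow> (nat \<Rightarrow> complex) \<Rightarrow> complex \<Rightarrow> complex^2" where
  "kernel_column' g n c d z = vector [\<Sum>k\<le>n. c k * circle_integral (\<lambda>\<zeta>. g \<zeta> * (\<zeta> ^ k * kern' z \<zeta>)),
      \<Sum>k\<le>n. d k * (of_nat n * z ^ (n - 1) * circle_integral (\<lambda>\<zeta>. g \<zeta> * ((1 / \<zeta>) ^ k * kern z \<zeta>))
         + z ^ n * circle_integral (\<lambda>\<zeta>. g \<zeta> * ((1 / \<zeta>) ^ k * kern' z \<zeta>)))]"

lemma forall_2I: "P (1::2) \<Longrightarrow> P 2 \<Longrightarrow> P i" using exhaust_2[of i] by auto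

lemma vector_2_nth [simp]: "(vector [a, b] :: complex^2) $ 1 = a" "(vector [a, b] :: complex^2) $ 2 = b"
  by (simp_all add: vector_2)

lemma pow_cont [continuous_intros]: "continuous_on (sphere 0 1) (\<lambda>\<zeta>::complex. \<zeta> ^ k)"
  by (intro continuous_intros)

lemma polyfun_poly_column: "polyfun (\<lambda>z. poly_column n c d z $ i)"
  unfolding poly_column_def by (rule forall_2I[of _ i]) (simp_all, (intro polyfun_sum polyfun_mult polyfun_const polyfun_power polyfun_id)+)

lemma polyfun_poly_column': "polyfun (\<lambda>z. poly_column' n c d z $ i)"
  unfolding poly_column'_def by (rule forall_2I[of _ i]) (simp_all, (intro polyfun_sum polyfun_mult polyfun_const polyfun_power polyfun_id)+)

lemma poly_column_z_deriv: "((\<lambda>z. poly_column n c d z $ i) has_field_derivative poly_column' n c d z $ i) (at z)"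
  unfolding poly_column_def poly_column'_def by (rule forall_2I[of _ i]) (auto intro!: derivative_eq_intros sum.cong simp: mult_ac)

text \<open>All integrals in the column are one Caratheodory integral times the entries of the first column, up to polynomials.\<close>

lemma kernel_column_decomposition:
  assumes g: "circle_integrable g"
  obtains p where "\<And>i. polyfun (\<lambda>z. p z $ i)"
    "\<And>z. norm z \<noteq> 1 \<Longrightarrow> kernel_column g n c d z = circle_integral (\<lambda>\<zeta>. g \<zeta> * kern z \<zeta>) *s poly_column n c d z + p z"
proof -
  have "\<forall>k. \<exists>S. polyfun S \<and> (\<forall>z. norm z \<noteq> 1 \<longrightarrow>
    circle_integral (\<lambda>\<zeta>. g \<zeta> * (\<zeta> ^ k * kern z \<zeta>)) = z ^ k * circle_integral (\<lambda>\<zeta>. g \<zeta> * kern z \<zeta>) + S z)"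
    using kernel_power[OF g] by blast
  then obtain S where S: "\<And>k. polyfun (S k)" "\<And>k z. norm z \<noteq> 1 \<Longrightarrow>
    circle_integral (\<lambda>\<zeta>. g \<zeta> * (\<zeta> ^ k * kern z \<zeta>)) = z ^ k * circle_integral (\<lambda>\<zeta>. g \<zeta> * kern z \<zeta>) + S k z" by metis
  have "\<forall>k\<in>{..n}. \<exists>S. polyfun S \<and> (\<forall>z. norm z \<noteq> 1 \<longrightarrow>
    z ^ n * circle_integral (\<lambda>\<zeta>. g \<zeta> * ((1 / \<zeta>) ^ k * kern z \<zeta>)) = z ^ (n - k) * circle_integral (\<lambda>\<zeta>. g \<zeta> * kern z \<zeta>) + S z)"
    using kernel_inverse_power[OF g] by simp
  from bchoice[OF this] obtain R where R': "\<forall>k\<in>{..n}. polyfun (R k) \<and> (\<forall>z. norm z \<noteq> 1 \<longrightarrow>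
    z ^ n * circle_integral (\<lambda>\<zeta>. g \<zeta> * ((1 / \<zeta>) ^ k * kern z \<zeta>)) = z ^ (n - k) * circle_integral (\<lambda>\<zeta>. g \<zeta> * kern z \<zeta>) + R k z)"
    by blast
  have R: "polyfun (R k)" "norm z \<noteq> 1 \<Longrightarrow>
    z ^ n * circle_integral (\<lambda>\<zeta>. g \<zeta> * ((1 / \<zeta>) ^ k * kern z \<zeta>)) = z ^ (n - k) * circle_integral (\<lambda>\<zeta>. g \<zeta> * kern z \<zeta>) + R k z" if "k \<in> {..n}" for k z
    using bspec[OF R' that] by blast+
  define p :: "complex \<Rightarrow> complex^2" where "p z = vector [\<Sum>k\<le>n. c k * S k z, \<Sum>k\<le>n. d k * R k z]" for z
  have "polyfun (\<lambda>z. p z $ i)" for i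
  proof -
    have A: "polyfun (\<lambda>z. \<Sum>k\<le>n. c k * S k z)" by (rule polyfun_sum) (rule polyfun_mult[OF polyfun_const S(1)])
    have B: "polyfun (\<lambda>z. \<Sum>k\<le>n. d k * R k z)" by (rule polyfun_sum) (rule polyfun_mult[OF polyfun_const R(1)])
    show ?thesis by (rule forall_2I[of _ i]) (simp_all only: p_def vector_2_nth A B)
  qed
  moreover have "kernel_column g n c d z = circle_integral (\<lambda>\<zeta>. g \<zeta> * kern z \<zeta>) *s poly_column n c d z + p z" if z: "norm z \<noteq> 1" for z
  proof -
    have "kernel_column g n c d z $ i = (circle_integral (\<lambda>\<zeta>. g \<zeta> * kern z \<zeta>) *s poly_column n c d z + p z) $ i" for i
    proof (rule forall_2I[of _ i])
      have "(\<Sum>k\<le>n. c k * circle_integral (\<lambda>\<zeta>. g \<zeta> * (\<zeta> ^ k * kern z \<zeta>)))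
         = (\<Sum>k\<le>n. c k * (z ^ k * circle_integral (\<lambda>\<zeta>. g \<zeta> * kern z \<zeta>) + S k z))"
        by (simp only: S(2)[OF z])
      then show "kernel_column g n c d z $ 1 = (circle_integral (\<lambda>\<zeta>. g \<zeta> * kern z \<zeta>) *s poly_column n c d z + p z) $ 1"
        by (simp add: kernel_column_def poly_column_def p_def sum_distrib_left sum.distrib algebra_simps)
      have "(\<Sum>k\<le>n. d k * (z ^ n * circle_integral (\<lambda>\<zeta>. g \<zeta> * ((1 / \<zeta>) ^ k * kern z \<zeta>))))
         = (\<Sum>k\<le>n. d k * (z ^ (n - k) * circle_integral (\<lambda>\<zeta>. g \<zeta> * kern z \<zeta>) + R k z))"
        by (intro sum.cong refl) (simp only: R(2)[OF _ z])
      then show "kernel_column g n c d z $ 2 = (circle_integral (\<lambda>\<zeta>. g \<zeta> * kern z \<zeta>) *s poly_column n c d z + p z) $ 2"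
        by (simp add: kernel_column_def poly_column_def p_def sum_distrib_left sum.distrib algebra_simps)
    qed
    then show ?thesis by (simp add: Finite_Cartesian_Product.vec_eq_iff)
  qed
  ultimately show ?thesis using that by blast
qed

lemma kernel_column_z_deriv:
  assumes g: "circle_integrable g" and z: "norm z \<noteq> 1"
  shows "((\<lambda>z. kernel_column g n c d z $ i) has_field_derivative kernel_column' g n c d z $ i) (at z)"
proof -
  have K: "((\<lambda>z. circle_integral (\<lambda>\<zeta>. g \<zeta> * (h \<zeta> * kern z \<zeta>))) has_field_derivative circle_integral (\<lambda>\<zeta>. g \<zeta> * (h \<zeta> * kern' z \<zeta>))) (at z)"
    if "continuous_on (sphere 0 1) h" for h
    using kernel_has_derivative[OF circle_integrable_mult_continuous[OF g that] z] by (simp add: kern_def kern'_def mult.assoc)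
  show ?thesis
  proof (rule forall_2I[of _ i])
    show "((\<lambda>z. kernel_column g n c d z $ 1) has_field_derivative kernel_column' g n c d z $ 1) (at z)"
      unfolding kernel_column_def kernel_column'_def by simp (intro DERIV_sum DERIV_cmult K continuous_intros)
    show "((\<lambda>z. kernel_column g n c d z $ 2) has_field_derivative kernel_column' g n c d z $ 2) (at z)"
      unfolding kernel_column_def kernel_column'_def
    proof (simp, intro DERIV_sum DERIV_cmult)
      fix k
      have "((\<lambda>z. z ^ n) has_field_derivative of_nat n * z ^ (n - 1)) (at z)" by (auto intro!: derivative_eq_intros)
      from DERIV_mult[OF this K[OF inv_power_cont[of k]]]
      show "((\<lambda>z. z ^ n * circle_integral (\<lambda>\<zeta>. g \<zeta> * ((1 / \<zeta>) ^ k * kern z \<zeta>))) has_field_derivative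
         of_nat n * z ^ (n - Suc 0) * circle_integral (\<lambda>\<zeta>. g \<zeta> * ((1 / \<zeta>) ^ k * kern z \<zeta>)) +
         z ^ n * circle_integral (\<lambda>\<zeta>. g \<zeta> * ((1 / \<zeta>) ^ k * kern' z \<zeta>))) (at z)"
        by (simp add: mult.commute add.commute)
    qed
  qed
qed

lemma cauchy_bounded:
  assumes g: "circle_integrable g" and h: "continuous_on (sphere 0 1) h"
  shows "bigO0 0 (\<lambda>z. circle_integral (\<lambda>\<zeta>. g \<zeta> * (h \<zeta> / (\<zeta> - z))))"
proof -
  have "norm (circle_integral (\<lambda>\<zeta>. g \<zeta> * (h \<zeta> / (\<zeta> - z)))) \<le> (2 * circle_L1 (\<lambda>\<zeta>. g \<zeta> * h \<zeta>)) * norm z ^ 0" if z: "norm z < 1/2" for z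
  proof -
    have nb: "norm (\<zeta> - z) \<ge> 1/2" if "norm \<zeta> = 1" for \<zeta> using norm_triangle_ineq2[of \<zeta> z] that z by simp
    have "norm (circle_integral (\<lambda>\<zeta>. (g \<zeta> * h \<zeta>) * (1 / (\<zeta> - z)))) \<le> 2 * circle_L1 (\<lambda>\<zeta>. g \<zeta> * h \<zeta>)"
    proof (rule ci_norm_bound[OF circle_integrable_mult_continuous[OF g h]])
      show "continuous_on (sphere 0 1) (\<lambda>\<zeta>. 1 / (\<zeta> - z))" using z by (intro continuous_intros) auto
      show "norm (1 / (\<zeta> - z)) \<le> 2" if "norm \<zeta> = 1" for \<zeta> using nb[OF that] by (simp add: norm_divide divide_simps)
    qed
    then show ?thesis by (simp add: mult.assoc)
  qed
  then have "eventually (\<lambda>z. norm (circle_integral (\<lambda>\<zeta>. g \<zeta> * (h \<zeta> / (\<zeta> - z)))) \<le> (2 * circle_L1 (\<lambda>\<zeta>. g \<zeta> * h \<zeta>)) * norm z ^ 0) (at 0)"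
    unfolding eventually_at by (intro exI[of _ "1/2"]) auto
  then show ?thesis unfolding bigO0_def by blast
qed

lemma kernel_bounded:
  assumes g: "circle_integrable g" and h: "continuous_on (sphere 0 1) h"
  shows "bigO0 0 (\<lambda>z. circle_integral (\<lambda>\<zeta>. g \<zeta> * (h \<zeta> * kern z \<zeta>)))"
proof -
  have c: "continuous_on (sphere 0 1) (\<lambda>\<zeta>. h \<zeta> * (2 * \<zeta>))" by (intro continuous_intros h)
  have "bigO0 0 (\<lambda>z. circle_integral (\<lambda>\<zeta>. g \<zeta> * (h \<zeta> * (2 * \<zeta>) / (\<zeta> - z))) - circle_integral (\<lambda>\<zeta>. g \<zeta> * h \<zeta>))"
    by (intro bigO0_diff cauchy_bounded g c bigO0_cont continuous_const)
  then show ?thesis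
  proof (rule bigO0_cong)
    show "eventually (\<lambda>z. circle_integral (\<lambda>\<zeta>. g \<zeta> * (h \<zeta> * (2 * \<zeta>) / (\<zeta> - z))) - circle_integral (\<lambda>\<zeta>. g \<zeta> * h \<zeta>)
      = circle_integral (\<lambda>\<zeta>. g \<zeta> * (h \<zeta> * kern z \<zeta>))) (at 0)"
      using zero_eventually_simple[OF finite.emptyI]
    proof eventually_elim
      case (elim z)
      have nz: "\<zeta> - z \<noteq> 0" if "norm \<zeta> = 1" for \<zeta> using that elim by auto
      have c2: "continuous_on (sphere 0 1) (\<lambda>\<zeta>. h \<zeta> * (2 * \<zeta>) / (\<zeta> - z))" using nz by (intro continuous_intros h) auto
      have "circle_integral (\<lambda>\<zeta>. g \<zeta> * (h \<zeta> * (2 * \<zeta>) / (\<zeta> - z))) - circle_integral (\<lambda>\<zeta>. g \<zeta> * h \<zeta>)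
        = circle_integral (\<lambda>\<zeta>. g \<zeta> * (h \<zeta> * (2 * \<zeta>) / (\<zeta> - z)) - g \<zeta> * h \<zeta>)"
        by (rule ci_diff[symmetric, OF circle_integrable_mult_continuous[OF g c2] circle_integrable_mult_continuous[OF g h]])
      also have "\<dots> = circle_integral (\<lambda>\<zeta>. g \<zeta> * (h \<zeta> * kern z \<zeta>))"
      proof (rule circle_cong)
        fix \<zeta> :: complex assume "norm \<zeta> = 1"
        from nz[OF this] have "2 * \<zeta> / (\<zeta> - z) - 1 = kern z \<zeta>" unfolding kern_def by (simp add: divide_simps)
        then have "g \<zeta> * h \<zeta> * (2 * \<zeta> / (\<zeta> - z) - 1) = g \<zeta> * h \<zeta> * kern z \<zeta>" by simp
        then show "g \<zeta> * (h \<zeta> * (2 * \<zeta>) / (\<zeta> - z)) - g \<zeta> * h \<zeta> = g \<zeta> * (h \<zeta> * kern z \<zeta>)" by (simp add: right_diff_distrib mult.assoc)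
      qed
      finally show ?case .
    qed
  qed
qed

lemma cauchy_infinity:
  assumes g: "circle_integrable g" and h: "continuous_on (sphere 0 1) h"
  shows "((\<lambda>z. circle_integral (\<lambda>\<zeta>. g \<zeta> * (h \<zeta> / (\<zeta> - z)))) \<longlongrightarrow> 0) at_infinity"
proof (rule Lim_null_comparison)
  have "norm (circle_integral (\<lambda>\<zeta>. g \<zeta> * (h \<zeta> / (\<zeta> - z)))) \<le> norm (2 / (z - 0)) * circle_L1 (\<lambda>\<zeta>. g \<zeta> * h \<zeta>)" if z: "norm z \<ge> 2" for z
  proof -
    have nb: "norm (\<zeta> - z) \<ge> norm z / 2" if "norm \<zeta> = 1" for \<zeta> using norm_triangle_ineq2[of z \<zeta>] that z by (simp add: norm_minus_commute)
    have "norm (circle_integral (\<lambda>\<zeta>. (g \<zeta> * h \<zeta>) * (1 / (\<zeta> - z)))) \<le> norm (2 / (z - 0)) * circle_L1 (\<lambda>\<zeta>. g \<zeta> * h \<zeta>)"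
    proof (rule ci_norm_bound[OF circle_integrable_mult_continuous[OF g h]])
      show "continuous_on (sphere 0 1) (\<lambda>\<zeta>. 1 / (\<zeta> - z))" using z by (intro continuous_intros) auto
      show "norm (1 / (\<zeta> - z)) \<le> norm (2 / (z - 0))" if "norm \<zeta> = 1" for \<zeta>
      proof -
        have "1 / norm (\<zeta> - z) \<le> 1 / (norm z / 2)" using nb[OF that] z by (intro divide_left_mono mult_pos_pos) auto
        then show ?thesis by (simp add: norm_divide)
      qed
    qed
    then show ?thesis by (simp add: mult.assoc)
  qed
  then show "eventually (\<lambda>z. norm (circle_integral (\<lambda>\<zeta>. g \<zeta> * (h \<zeta> / (\<zeta> - z)))) \<le> norm (2 / (z - 0)) * circle_L1 (\<lambda>\<zeta>. g \<zeta> * h \<zeta>)) at_infinity"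
    unfolding eventually_at_infinity by blast
  show "((\<lambda>z::complex. norm (2 / (z - 0)) * circle_L1 (\<lambda>\<zeta>. g \<zeta> * h \<zeta>)) \<longlongrightarrow> 0) at_infinity"
    using tendsto_mult_left_zero[OF tendsto_norm_zero[OF tendsto_inverse_shift_infinity[of 2 0]]] .
qed

lemma power_ratio_infinity: "((\<lambda>z::complex. z ^ k / z ^ n) \<longlongrightarrow> (if k = n then 1 else 0)) at_infinity" if "k \<le> n"
proof (cases "k = n")
  case True
  have "((\<lambda>z::complex. 1) \<longlongrightarrow> 1) at_infinity" by simp
  moreover have "eventually (\<lambda>z::complex. 1 = z ^ k / z ^ n) at_infinity"
    using infinity_eventually_simple[OF finite.emptyI] by eventually_elim (simp add: True)
  ultimately have "((\<lambda>z::complex. z ^ k / z ^ n) \<longlongrightarrow> 1) at_infinity" by (rule Lim_transform_eventually)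
  then show ?thesis using True by simp
next
  case False
  then have kn: "n - k \<noteq> 0" using that by simp
  have "filterlim (\<lambda>z::complex. z ^ (n - k)) at_infinity at_infinity"
    using filterlim_power_at_infinity[OF kn] .
  then have "((\<lambda>z::complex. inverse (z ^ (n - k))) \<longlongrightarrow> 0) at_infinity" by (rule filterlim_compose[OF tendsto_inverse_0])
  moreover have "eventually (\<lambda>z::complex. inverse (z ^ (n - k)) = z ^ k / z ^ n) at_infinity"
    using infinity_eventually_simple[OF finite.emptyI]
  proof eventually_elim
    case (elim z)
    have "z ^ n = z ^ k * z ^ (n - k)" using that by (simp add: power_add[symmetric])
    then show ?case using elim by (simp add: divide_inverse)
  qed
  ultimately have "((\<lambda>z::complex. z ^ k / z ^ n) \<longlongrightarrow> 0) at_infinity" by (rule Lim_transform_eventually)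
  then show ?thesis using False by simp
qed

lemma poly_column_infinity: "((\<lambda>z. poly_column n c d z $ i / z ^ n) \<longlongrightarrow> (vector [c n, d 0] :: complex^2) $ i) at_infinity"
proof -
  have R: "((\<lambda>z. e * (z ^ k / z ^ n)) \<longlongrightarrow> e * (if k = n then 1 else 0)) at_infinity" if "k \<le> n" for k and e :: complex
    by (rule tendsto_mult_left[OF power_ratio_infinity[OF that]])
  have "((\<lambda>z. \<Sum>k\<le>n. c k * (z ^ k / z ^ n)) \<longlongrightarrow> (\<Sum>k\<le>n. c k * (if k = n then 1 else 0))) at_infinity"
    by (rule tendsto_sum) (rule R, simp)
  moreover have "(\<Sum>k\<le>n. c k * (if k = n then 1 else 0)) = (\<Sum>k\<le>n. if k = n then c k else 0)" by (rule sum.cong) auto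
  moreover have "(\<lambda>z. \<Sum>k\<le>n. c k * (z ^ k / z ^ n)) = (\<lambda>z. (\<Sum>k\<le>n. c k * z ^ k) / z ^ n)" by (simp add: sum_divide_distrib)
  ultimately have 1: "((\<lambda>z. (\<Sum>k\<le>n. c k * z ^ k) / z ^ n) \<longlongrightarrow> c n) at_infinity" by simp
  have "((\<lambda>z. \<Sum>k\<le>n. d k * (z ^ (n - k) / z ^ n)) \<longlongrightarrow> (\<Sum>k\<le>n. d k * (if n - k = n then 1 else 0))) at_infinity"
    by (rule tendsto_sum) (rule R, simp)
  moreover have "(\<Sum>k\<le>n. d k * (if n - k = n then 1 else 0)) = (\<Sum>k\<le>n. if k = 0 then d k else 0)"
    by (rule sum.cong) auto
  moreover have "(\<lambda>z. \<Sum>k\<le>n. d k * (z ^ (n - k) / z ^ n)) = (\<lambda>z. (\<Sum>k\<le>n. d k * z ^ (n - k)) / z ^ n)" by (simp add: sum_divide_distrib)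
  ultimately have 2: "((\<lambda>z. (\<Sum>k\<le>n. d k * z ^ (n - k)) / z ^ n) \<longlongrightarrow> d 0) at_infinity" by simp
  show ?thesis by (rule forall_2I[of _ i]) (simp_all only: poly_column_def vector_2_nth 1 2)
qed

text \<open>The geometric expansion of the kernel at \<open>z = 0\<close>, with remainder of order \<open>z\<^sup>n\<close>.\<close>

lemma kern_expand_zero:
  assumes "\<zeta> \<noteq> 0" "\<zeta> - z \<noteq> 0"
  shows "kern z \<zeta> = 2 * (\<Sum>l<n. z ^ l * (1 / \<zeta>) ^ l) + 2 * (z ^ n * ((1 / \<zeta>) ^ n * \<zeta> / (\<zeta> - z))) - 1"
proof -
  define q where "q = z * (1 / \<zeta>)"
  have q1: "1 - q \<noteq> 0" using assms by (simp add: q_def field_simps)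
  define S where "S = (\<Sum>l<n. q ^ l)"
  have "1 - q ^ n = (1 - q) * S" unfolding S_def by (rule one_diff_power_eq)
  then have qn: "q ^ n = 1 - (1 - q) * S" by (simp add: algebra_simps)
  have "2 * S + 2 * ((1 - (1 - q) * S) / (1 - q)) - 1 = (1 + q) / (1 - q)"
    using q1 by (simp add: divide_simps)
  also have "(1 + q) / (1 - q) = kern z \<zeta>" using assms q1 unfolding kern_def q_def by (simp add: field_simps)
  finally have A: "kern z \<zeta> = 2 * S + 2 * (q ^ n / (1 - q)) - 1" unfolding qn ..
  have "1 / (1 - q) = \<zeta> / (\<zeta> - z)" using assms q1 unfolding q_def by (simp add: field_simps)
  then have "q ^ n * (1 / (1 - q)) = z ^ n * (1 / \<zeta>) ^ n * (\<zeta> / (\<zeta> - z))" by (simp only: q_def power_mult_distrib)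
  then have B: "q ^ n / (1 - q) = z ^ n * ((1 / \<zeta>) ^ n * \<zeta> / (\<zeta> - z))" by simp
  have "S = (\<Sum>l<n. z ^ l * (1 / \<zeta>) ^ l)" unfolding S_def q_def by (intro sum.cong refl) (simp only: power_mult_distrib)
  then show ?thesis unfolding A B by simp
qed

text \<open>The geometric expansion of the kernel at \<open>z = \<infinity>\<close>, multiplied by \<open>z\<^sup>n\<close> to keep it polynomial.\<close>

lemma kern_expand_infinity:
  assumes "z \<noteq> 0" "\<zeta> - z \<noteq> 0"
  shows "z ^ n * kern z \<zeta> = z ^ n - 2 * (\<Sum>l\<le>n. z ^ (n - l) * \<zeta> ^ l) + 2 * (\<zeta> ^ Suc n / (\<zeta> - z))"
proof -
  have "\<zeta> ^ Suc n - z ^ Suc n = (\<zeta> - z) * (\<Sum>l<Suc n. z ^ (Suc n - Suc l) * \<zeta> ^ l)" by (rule power_diff_sumr2)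
  then have T: "(\<Sum>l\<le>n. z ^ (n - l) * \<zeta> ^ l) = (\<zeta> ^ Suc n - z ^ Suc n) / (\<zeta> - z)"
    using assms by (simp add: lessThan_Suc_atMost field_simps)
  show ?thesis unfolding kern_def T using assms by (simp add: divide_simps) (simp add: algebra_simps)
qed

section \<open>Time derivatives and orthogonality expansions of the columns\<close>

context biorth_family
begin

text \<open>The \<open>t\<close>-derivative of the weight off the singular points.\<close>

definition w_dot :: "real \<Rightarrow> complex \<Rightarrow> complex" where "w_dot t \<zeta> = w t \<zeta> * log_t_deriv t \<zeta>"

lemma w_dot_integrable: "t \<in> U \<Longrightarrow> circle_integrable (w_dot t)"
  using wU_integrable[of t "\<lambda>_. 1"] by (simp add: w_dot_def[abs_def])

lemma w_integrable: "t \<in> U \<Longrightarrow> circle_integrable (w t)"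
  by (rule weight.w_integrable[OF wt])

lemma w_dot_deriv: "t0 \<in> U \<Longrightarrow> continuous_on (sphere 0 1) h \<Longrightarrow>
   ((\<lambda>t. circle_integral (\<lambda>\<zeta>. w t \<zeta> * h \<zeta>)) has_vector_derivative circle_integral (\<lambda>\<zeta>. w_dot t0 \<zeta> * h \<zeta>)) (at t0)"
  using weight_integral_deriv[of t0 h] by (simp add: w_dot_def mult.assoc)

definition phi_coeff :: "nat \<Rightarrow> real \<Rightarrow> nat \<Rightarrow> complex" where "phi_coeff n t k = coeff (\<phi> t n) k"
definition phib_coeff :: "nat \<Rightarrow> real \<Rightarrow> nat \<Rightarrow> complex" where "phib_coeff n t k = coeff (\<phi>b t n) k"
definition phi_coeff' :: "nat \<Rightarrow> real \<Rightarrow> nat \<Rightarrow> complex" where "phi_coeff' n t k = vector_derivative (\<lambda>s. phi_coeff n s k) (at t)"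
definition phib_coeff' :: "nat \<Rightarrow> real \<Rightarrow> nat \<Rightarrow> complex" where "phib_coeff' n t k = vector_derivative (\<lambda>s. phib_coeff n s k) (at t)"

lemma phi_coeff_deriv: "t \<in> U \<Longrightarrow> ((\<lambda>s. phi_coeff n s k) has_vector_derivative phi_coeff' n t k) (at t)"
  and phib_coeff_deriv: "t \<in> U \<Longrightarrow> ((\<lambda>s. phib_coeff n s k) has_vector_derivative phib_coeff' n t k) (at t)"
  using coeff_diff[of t n k] unfolding phi_coeff_def phib_coeff_def phi_coeff'_def phib_coeff'_def by (simp_all add: vector_derivative_works)

abbreviation col1 :: "nat \<Rightarrow> real \<Rightarrow> complex \<Rightarrow> complex^2" where "col1 n t \<equiv> poly_column n (phi_coeff n t) (phib_coeff n t)"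
abbreviation col2 :: "nat \<Rightarrow> real \<Rightarrow> complex \<Rightarrow> complex^2" where "col2 n t \<equiv> kernel_column (w t) n (phi_coeff n t) (phib_coeff n t)"
abbreviation col2' :: "nat \<Rightarrow> real \<Rightarrow> complex \<Rightarrow> complex^2" where "col2' n t \<equiv> kernel_column' (w t) n (phi_coeff n t) (phib_coeff n t)"

definition col1_dot :: "nat \<Rightarrow> real \<Rightarrow> complex \<Rightarrow> complex^2" where "col1_dot n t = poly_column n (phi_coeff' n t) (phib_coeff' n t)"
definition col2_dot :: "nat \<Rightarrow> real \<Rightarrow> complex \<Rightarrow> complex^2" where
  "col2_dot n t z = kernel_column (w t) n (phi_coeff' n t) (phib_coeff' n t) z + kernel_column (w_dot t) n (phi_coeff n t) (phib_coeff n t) z"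
definition col2_dot' :: "nat \<Rightarrow> real \<Rightarrow> complex \<Rightarrow> complex^2" where
  "col2_dot' n t z = kernel_column' (w t) n (phi_coeff' n t) (phib_coeff' n t) z + kernel_column' (w_dot t) n (phi_coeff n t) (phib_coeff n t) z"

lemma sum_deriv:
  assumes t0: "t0 \<in> U" and c: "\<And>k. ((\<lambda>s. c s k) has_vector_derivative c' k) (at t0)"
    and h: "\<And>k. continuous_on (sphere 0 1) (h k)"
  shows "((\<lambda>t. \<Sum>k\<le>n. c t k * circle_integral (\<lambda>\<zeta>. w t \<zeta> * h k \<zeta>)) has_vector_derivative
    (\<Sum>k\<le>n. c' k * circle_integral (\<lambda>\<zeta>. w t0 \<zeta> * h k \<zeta>)) + (\<Sum>k\<le>n. c t0 k * circle_integral (\<lambda>\<zeta>. w_dot t0 \<zeta> * h k \<zeta>))) (at t0)"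
proof -
  have "((\<lambda>t. c t k * circle_integral (\<lambda>\<zeta>. w t \<zeta> * h k \<zeta>)) has_vector_derivative
     (c' k * circle_integral (\<lambda>\<zeta>. w t0 \<zeta> * h k \<zeta>) + c t0 k * circle_integral (\<lambda>\<zeta>. w_dot t0 \<zeta> * h k \<zeta>))) (at t0)" for k
    using has_vector_derivative_mult[OF c w_dot_deriv[OF t0 h[of k]]] by (simp add: add.commute)
  then show ?thesis unfolding sum.distrib[symmetric] by (intro has_vector_derivative_sum)
qed

lemma col1_t_deriv: assumes "t \<in> U" shows "((\<lambda>s. col1 n s z $ i) has_vector_derivative col1_dot n t z $ i) (at t)"
proof (rule forall_2I[of _ i])
  show "((\<lambda>s. col1 n s z $ 1) has_vector_derivative col1_dot n t z $ 1) (at t)"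
    unfolding poly_column_def col1_dot_def by simp (intro has_vector_derivative_sum has_vector_derivative_mult_left phi_coeff_deriv assms)
  show "((\<lambda>s. col1 n s z $ 2) has_vector_derivative col1_dot n t z $ 2) (at t)"
    unfolding poly_column_def col1_dot_def by simp (intro has_vector_derivative_sum has_vector_derivative_mult_left phib_coeff_deriv assms)
qed

lemma col1'_t_deriv: assumes "t \<in> U"
  shows "((\<lambda>s. poly_column' n (phi_coeff n s) (phib_coeff n s) z $ i) has_vector_derivative poly_column' n (phi_coeff' n t) (phib_coeff' n t) z $ i) (at t)"
proof (rule forall_2I[of _ i])
  show "((\<lambda>s. poly_column' n (phi_coeff n s) (phib_coeff n s) z $ 1) has_vector_derivative poly_column' n (phi_coeff' n t) (phib_coeff' n t) z $ 1) (at t)"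
    unfolding poly_column'_def vector_2_nth by (intro has_vector_derivative_sum has_vector_derivative_mult_left phi_coeff_deriv assms)
  show "((\<lambda>s. poly_column' n (phi_coeff n s) (phib_coeff n s) z $ 2) has_vector_derivative poly_column' n (phi_coeff' n t) (phib_coeff' n t) z $ 2) (at t)"
    unfolding poly_column'_def vector_2_nth by (intro has_vector_derivative_sum has_vector_derivative_mult_left phib_coeff_deriv assms)
qed

lemma col2_t_deriv: assumes t: "t \<in> U" and z: "norm z \<noteq> 1"
  shows "((\<lambda>s. col2 n s z $ i) has_vector_derivative col2_dot n t z $ i) (at t)"
proof (rule forall_2I[of _ i])
  show "((\<lambda>s. col2 n s z $ 1) has_vector_derivative col2_dot n t z $ 1) (at t)"
    unfolding kernel_column_def col2_dot_def vector_2_nth vector_add_component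
    by (intro sum_deriv[OF t phi_coeff_deriv[OF t]] continuous_on_mult pow_cont kern_cont z)
  have "((\<lambda>s. z ^ n * (\<Sum>k\<le>n. phib_coeff n s k * circle_integral (\<lambda>\<zeta>. w s \<zeta> * ((1 / \<zeta>) ^ k * kern z \<zeta>)))) has_vector_derivative
     z ^ n * ((\<Sum>k\<le>n. phib_coeff' n t k * circle_integral (\<lambda>\<zeta>. w t \<zeta> * ((1 / \<zeta>) ^ k * kern z \<zeta>))) +
        (\<Sum>k\<le>n. phib_coeff n t k * circle_integral (\<lambda>\<zeta>. w_dot t \<zeta> * ((1 / \<zeta>) ^ k * kern z \<zeta>))))) (at t)"
    by (intro has_vector_derivative_mult_right sum_deriv[OF t phib_coeff_deriv[OF t]] continuous_on_mult inv_power_cont kern_cont z)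
  then show "((\<lambda>s. col2 n s z $ 2) has_vector_derivative col2_dot n t z $ 2) (at t)"
    unfolding kernel_column_def col2_dot_def by (simp only: vector_2_nth vector_add_component sum_distrib_left distrib_left mult.left_commute[of "z ^ n"])
qed

lemma col2'_t_deriv: assumes t: "t \<in> U" and z: "norm z \<noteq> 1"
  shows "((\<lambda>s. col2' n s z $ i) has_vector_derivative col2_dot' n t z $ i) (at t)"
proof (rule forall_2I[of _ i])
  show "((\<lambda>s. col2' n s z $ 1) has_vector_derivative col2_dot' n t z $ 1) (at t)"
    unfolding kernel_column'_def col2_dot'_def vector_2_nth vector_add_component
    by (intro sum_deriv[OF t phi_coeff_deriv[OF t]] continuous_on_mult pow_cont kern'_cont z)
  have A: "((\<lambda>s. e * (\<Sum>k\<le>n. phib_coeff n s k * circle_integral (\<lambda>\<zeta>. w s \<zeta> * ((1 / \<zeta>) ^ k * K \<zeta>)))) has_vector_derivative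
     e * ((\<Sum>k\<le>n. phib_coeff' n t k * circle_integral (\<lambda>\<zeta>. w t \<zeta> * ((1 / \<zeta>) ^ k * K \<zeta>))) +
        (\<Sum>k\<le>n. phib_coeff n t k * circle_integral (\<lambda>\<zeta>. w_dot t \<zeta> * ((1 / \<zeta>) ^ k * K \<zeta>))))) (at t)"
    if "continuous_on (sphere 0 1) K" for e K
    by (intro has_vector_derivative_mult_right sum_deriv[OF t phib_coeff_deriv[OF t]] continuous_on_mult inv_power_cont that)
  from has_vector_derivative_add[OF A[OF kern_cont[OF z], of "of_nat n * z ^ (n - 1)"] A[OF kern'_cont[OF z], of "z ^ n"]]
  show "((\<lambda>s. col2' n s z $ 2) has_vector_derivative col2_dot' n t z $ 2) (at t)"
    unfolding kernel_column'_def col2_dot'_def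
    by (rule has_vector_derivative_eq_rhs[OF has_vector_derivative_transform_within_open[OF _ open_UNIV UNIV_I]])
       (simp_all only: vector_2_nth vector_add_component sum_distrib_left distrib_left sum.distrib[symmetric], simp_all add: mult_ac add_ac sum.distrib)
qed

lemma col2_dot_z_deriv: assumes t: "t \<in> U" and z: "norm z \<noteq> 1"
  shows "((\<lambda>z. col2_dot n t z $ i) has_field_derivative col2_dot' n t z $ i) (at z)"
  unfolding col2_dot_def col2_dot'_def vector_add_component
  by (intro DERIV_add kernel_column_z_deriv w_integrable w_dot_integrable t z)

lemma orth_low:
  assumes t: "t \<in> U" and l: "l < n"
  shows "(\<Sum>k\<le>n. phi_coeff n t k * circle_integral (\<lambda>\<zeta>. w t \<zeta> * (\<zeta> ^ k * (1 / \<zeta>) ^ l))) = 0"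
    and "(\<Sum>k\<le>n. phib_coeff n t k * circle_integral (\<lambda>\<zeta>. w t \<zeta> * (\<zeta> ^ l * (1 / \<zeta>) ^ k))) = 0"
  using orthogonality(1,2)[OF t l] pr_expand_left[OF t, of "\<phi> t n" n l] pr_expand_right[OF t, of "\<phi>b t n" n l] bio_facts[OF t]
  by (simp_all add: phi_coeff_def phib_coeff_def)

lemma orth_top:
  assumes t: "t \<in> U"
  shows "(\<Sum>k\<le>n. phib_coeff n t k * circle_integral (\<lambda>\<zeta>. w t \<zeta> * (\<zeta> ^ n * (1 / \<zeta>) ^ k))) = 1 / \<kappa> t n"
  using orthogonality(4)[OF t] pr_expand_right[OF t, of "\<phi>b t n" n n] bio_facts[OF t]
  by (simp add: phib_coeff_def)

text \<open>Orthogonality to \<open>1, \<zeta>, \<dots>\<close> annihilates the first \<open>n\<close> terms of the expansion at 0.\<close>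

lemma col2_first_zero:
  assumes t: "t \<in> U" and n: "n \<ge> 1" and z: "norm z \<noteq> 1"
  shows "col2 n t z $ 1 = z ^ n * (\<Sum>k\<le>n. phi_coeff n t k * circle_integral (\<lambda>\<zeta>. w t \<zeta> * (2 * \<zeta> ^ k * (1 / \<zeta>) ^ n * \<zeta> / (\<zeta> - z))))"
proof -
  let ?ci = "\<lambda>h. circle_integral (\<lambda>\<zeta>. w t \<zeta> * h \<zeta>)"
  have nz: "\<zeta> - z \<noteq> 0" "\<zeta> \<noteq> 0" if "norm \<zeta> = 1" for \<zeta> using that z by auto
  have c1: "continuous_on (sphere 0 1) (\<lambda>\<zeta>::complex. \<zeta> ^ k * (1 / \<zeta>) ^ l)" for k l by (intro continuous_intros) auto
  have c2: "continuous_on (sphere 0 1) (\<lambda>\<zeta>. 2 * \<zeta> ^ k * (1 / \<zeta>) ^ n * \<zeta> / (\<zeta> - z))" for k using nz by (intro continuous_intros) auto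
  note I = weight.w_mult_integrable[OF wt[OF t]]
  have E: "?ci (\<lambda>\<zeta>. \<zeta> ^ k * kern z \<zeta>) = z ^ n * ?ci (\<lambda>\<zeta>. 2 * \<zeta> ^ k * (1 / \<zeta>) ^ n * \<zeta> / (\<zeta> - z))
     + (\<Sum>l<n. 2 * z ^ l * ?ci (\<lambda>\<zeta>. \<zeta> ^ k * (1 / \<zeta>) ^ l)) - ?ci (\<lambda>\<zeta>. \<zeta> ^ k * (1 / \<zeta>) ^ 0)" for k
  proof -
    have "?ci (\<lambda>\<zeta>. \<zeta> ^ k * kern z \<zeta>) = circle_integral (\<lambda>\<zeta>. (z ^ n * (w t \<zeta> * (2 * \<zeta> ^ k * (1 / \<zeta>) ^ n * \<zeta> / (\<zeta> - z)))
       + (\<Sum>l<n. 2 * z ^ l * (w t \<zeta> * (\<zeta> ^ k * (1 / \<zeta>) ^ l)))) - w t \<zeta> * (\<zeta> ^ k * (1 / \<zeta>) ^ 0))"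
    proof (rule circle_cong)
      fix \<zeta> :: complex assume "norm \<zeta> = 1"
      note K = kern_expand_zero[OF nz(2)[OF this] nz(1)[OF this], of n]
      have "w t \<zeta> * (\<zeta> ^ k * kern z \<zeta>) = w t \<zeta> * \<zeta> ^ k * (2 * (\<Sum>l<n. z ^ l * (1 / \<zeta>) ^ l)) + w t \<zeta> * \<zeta> ^ k * (2 * (z ^ n * ((1 / \<zeta>) ^ n * \<zeta> / (\<zeta> - z)))) - w t \<zeta> * \<zeta> ^ k"
        unfolding K by (simp add: algebra_simps)
      also have "w t \<zeta> * \<zeta> ^ k * (2 * (\<Sum>l<n. z ^ l * (1 / \<zeta>) ^ l)) = (\<Sum>l<n. 2 * z ^ l * (w t \<zeta> * (\<zeta> ^ k * (1 / \<zeta>) ^ l)))"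
        unfolding sum_distrib_left by (intro sum.cong refl) (simp only: mult_ac)
      finally show "w t \<zeta> * (\<zeta> ^ k * kern z \<zeta>) = (z ^ n * (w t \<zeta> * (2 * \<zeta> ^ k * (1 / \<zeta>) ^ n * \<zeta> / (\<zeta> - z)))
       + (\<Sum>l<n. 2 * z ^ l * (w t \<zeta> * (\<zeta> ^ k * (1 / \<zeta>) ^ l)))) - w t \<zeta> * (\<zeta> ^ k * (1 / \<zeta>) ^ 0)"
        by (simp add: mult_ac)
    qed
    also have "\<dots> = circle_integral (\<lambda>\<zeta>. z ^ n * (w t \<zeta> * (2 * \<zeta> ^ k * (1 / \<zeta>) ^ n * \<zeta> / (\<zeta> - z)))
       + (\<Sum>l<n. 2 * z ^ l * (w t \<zeta> * (\<zeta> ^ k * (1 / \<zeta>) ^ l)))) - ?ci (\<lambda>\<zeta>. \<zeta> ^ k * (1 / \<zeta>) ^ 0)"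
      by (rule ci_diff) (intro circle_integrable_add circle_integrable_sum circle_integrable_cmult I c1 c2 finite_lessThan)+
    also have "circle_integral (\<lambda>\<zeta>. z ^ n * (w t \<zeta> * (2 * \<zeta> ^ k * (1 / \<zeta>) ^ n * \<zeta> / (\<zeta> - z)))
       + (\<Sum>l<n. 2 * z ^ l * (w t \<zeta> * (\<zeta> ^ k * (1 / \<zeta>) ^ l)))) = z ^ n * ?ci (\<lambda>\<zeta>. 2 * \<zeta> ^ k * (1 / \<zeta>) ^ n * \<zeta> / (\<zeta> - z))
       + (\<Sum>l<n. 2 * z ^ l * ?ci (\<lambda>\<zeta>. \<zeta> ^ k * (1 / \<zeta>) ^ l))"
      by (rule ci_combination) (intro I c1 c2 finite_lessThan)+
    finally show ?thesis .
  qed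
  have S1: "(\<Sum>k\<le>n. phi_coeff n t k * (\<Sum>l<n. 2 * z ^ l * ?ci (\<lambda>\<zeta>. \<zeta> ^ k * (1 / \<zeta>) ^ l))) = 0"
  proof -
    have "(\<Sum>k\<le>n. phi_coeff n t k * (\<Sum>l<n. 2 * z ^ l * ?ci (\<lambda>\<zeta>. \<zeta> ^ k * (1 / \<zeta>) ^ l))) = (\<Sum>k\<le>n. \<Sum>l<n. 2 * z ^ l * (phi_coeff n t k * ?ci (\<lambda>\<zeta>. \<zeta> ^ k * (1 / \<zeta>) ^ l)))"
      unfolding sum_distrib_left by (intro sum.cong refl) (simp only: mult_ac)
    also have "\<dots> = (\<Sum>l<n. \<Sum>k\<le>n. 2 * z ^ l * (phi_coeff n t k * ?ci (\<lambda>\<zeta>. \<zeta> ^ k * (1 / \<zeta>) ^ l)))" by (rule sum.swap)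
    also have "\<dots> = (\<Sum>l<n. 2 * z ^ l * (\<Sum>k\<le>n. phi_coeff n t k * ?ci (\<lambda>\<zeta>. \<zeta> ^ k * (1 / \<zeta>) ^ l)))" by (simp only: sum_distrib_left)
    also have "\<dots> = 0" by (intro sum.neutral ballI) (simp only: orth_low(1)[OF t] lessThan_iff mult_zero_right)
    finally show ?thesis .
  qed
  have S2: "(\<Sum>k\<le>n. phi_coeff n t k * ?ci (\<lambda>\<zeta>. \<zeta> ^ k * (1 / \<zeta>) ^ 0)) = 0" by (rule orth_low(1)[OF t]) (use n in simp)
  have "col2 n t z $ 1 = (\<Sum>k\<le>n. phi_coeff n t k * (z ^ n * ?ci (\<lambda>\<zeta>. 2 * \<zeta> ^ k * (1 / \<zeta>) ^ n * \<zeta> / (\<zeta> - z))))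
     + (\<Sum>k\<le>n. phi_coeff n t k * (\<Sum>l<n. 2 * z ^ l * ?ci (\<lambda>\<zeta>. \<zeta> ^ k * (1 / \<zeta>) ^ l))) - (\<Sum>k\<le>n. phi_coeff n t k * ?ci (\<lambda>\<zeta>. \<zeta> ^ k * (1 / \<zeta>) ^ 0))"
    unfolding kernel_column_def vector_2_nth E by (simp only: distrib_left right_diff_distrib sum.distrib sum_subtractf)
  then show ?thesis unfolding S1 S2 by (simp only: sum_distrib_left add_0_right diff_zero mult.left_commute[of "z ^ n"])
qed

lemma col2_first_infinity:
  assumes t: "t \<in> U" and n: "n \<ge> 1" and z: "norm z \<noteq> 1"
  shows "col2 n t z $ 1 = (\<Sum>k\<le>n. phi_coeff n t k * circle_integral (\<lambda>\<zeta>. w t \<zeta> * (2 * \<zeta> ^ k * \<zeta> / (\<zeta> - z))))"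
proof -
  let ?ci = "\<lambda>h. circle_integral (\<lambda>\<zeta>. w t \<zeta> * h \<zeta>)"
  have nz: "\<zeta> - z \<noteq> 0" if "norm \<zeta> = 1" for \<zeta> using that z by auto
  have c1: "continuous_on (sphere 0 1) (\<lambda>\<zeta>::complex. \<zeta> ^ k * (1 / \<zeta>) ^ l)" for k l by (intro continuous_intros) auto
  have c2: "continuous_on (sphere 0 1) (\<lambda>\<zeta>. 2 * \<zeta> ^ k * \<zeta> / (\<zeta> - z))" for k using nz by (intro continuous_intros) auto
  note I = weight.w_mult_integrable[OF wt[OF t]]
  have E: "?ci (\<lambda>\<zeta>. \<zeta> ^ k * kern z \<zeta>) = ?ci (\<lambda>\<zeta>. 2 * \<zeta> ^ k * \<zeta> / (\<zeta> - z)) - ?ci (\<lambda>\<zeta>. \<zeta> ^ k * (1 / \<zeta>) ^ 0)" for k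
  proof -
    have "?ci (\<lambda>\<zeta>. \<zeta> ^ k * kern z \<zeta>) = circle_integral (\<lambda>\<zeta>. w t \<zeta> * (2 * \<zeta> ^ k * \<zeta> / (\<zeta> - z)) - w t \<zeta> * (\<zeta> ^ k * (1 / \<zeta>) ^ 0))"
    proof (rule circle_cong)
      fix \<zeta> :: complex assume "norm \<zeta> = 1"
      then have K: "kern z \<zeta> = 2 * \<zeta> / (\<zeta> - z) - 1" using nz unfolding kern_def by (simp add: divide_simps)
      show "w t \<zeta> * (\<zeta> ^ k * kern z \<zeta>) = w t \<zeta> * (2 * \<zeta> ^ k * \<zeta> / (\<zeta> - z)) - w t \<zeta> * (\<zeta> ^ k * (1 / \<zeta>) ^ 0)"
        unfolding K by (simp add: algebra_simps)
    qed
    also have "\<dots> = ?ci (\<lambda>\<zeta>. 2 * \<zeta> ^ k * \<zeta> / (\<zeta> - z)) - ?ci (\<lambda>\<zeta>. \<zeta> ^ k * (1 / \<zeta>) ^ 0)"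
      by (rule ci_diff) (intro I c1 c2)+
    finally show ?thesis .
  qed
  have S2: "(\<Sum>k\<le>n. phi_coeff n t k * ?ci (\<lambda>\<zeta>. \<zeta> ^ k * (1 / \<zeta>) ^ 0)) = 0" by (rule orth_low(1)[OF t]) (use n in simp)
  have "col2 n t z $ 1 = (\<Sum>k\<le>n. phi_coeff n t k * ?ci (\<lambda>\<zeta>. 2 * \<zeta> ^ k * \<zeta> / (\<zeta> - z))) - (\<Sum>k\<le>n. phi_coeff n t k * ?ci (\<lambda>\<zeta>. \<zeta> ^ k * (1 / \<zeta>) ^ 0))"
    unfolding kernel_column_def vector_2_nth E by (simp only: right_diff_distrib sum_subtractf)
  then show ?thesis unfolding S2 by simp
qed

text \<open>In the expansion at infinity orthogonality leaves a single moment, whose value is \<open>1 / \<kappa>\<^sub>n\<close>.\<close>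

lemma col2_second_infinity:
  assumes t: "t \<in> U" and n: "n \<ge> 1" and z: "norm z \<noteq> 1" "z \<noteq> 0"
  shows "col2 n t z $ 2 = (\<Sum>k\<le>n. phib_coeff n t k * circle_integral (\<lambda>\<zeta>. w t \<zeta> * (2 * (1 / \<zeta>) ^ k * \<zeta> ^ Suc n / (\<zeta> - z)))) - 2 / \<kappa> t n"
proof -
  let ?ci = "\<lambda>h. circle_integral (\<lambda>\<zeta>. w t \<zeta> * h \<zeta>)"
  have nz: "\<zeta> - z \<noteq> 0" "\<zeta> \<noteq> 0" if "norm \<zeta> = 1" for \<zeta> using that z by auto
  have c1: "continuous_on (sphere 0 1) (\<lambda>\<zeta>::complex. \<zeta> ^ l * (1 / \<zeta>) ^ k)" for k l by (intro continuous_intros) auto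
  have c2: "continuous_on (sphere 0 1) (\<lambda>\<zeta>. 2 * (1 / \<zeta>) ^ k * \<zeta> ^ Suc n / (\<zeta> - z))" for k using nz by (intro continuous_intros) auto
  have c3: "continuous_on (sphere 0 1) (\<lambda>\<zeta>. (1 / \<zeta>) ^ k * kern z \<zeta>)" for k by (intro continuous_on_mult inv_power_cont kern_cont z)
  note I = weight.w_mult_integrable[OF wt[OF t]]
  have E: "z ^ n * ?ci (\<lambda>\<zeta>. (1 / \<zeta>) ^ k * kern z \<zeta>) = z ^ n * ?ci (\<lambda>\<zeta>. \<zeta> ^ 0 * (1 / \<zeta>) ^ k) + (\<Sum>l\<le>n. - 2 * z ^ (n - l) * ?ci (\<lambda>\<zeta>. \<zeta> ^ l * (1 / \<zeta>) ^ k))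
     + ?ci (\<lambda>\<zeta>. 2 * (1 / \<zeta>) ^ k * \<zeta> ^ Suc n / (\<zeta> - z))" for k
  proof -
    have "z ^ n * ?ci (\<lambda>\<zeta>. (1 / \<zeta>) ^ k * kern z \<zeta>) = circle_integral (\<lambda>\<zeta>. z ^ n * (w t \<zeta> * ((1 / \<zeta>) ^ k * kern z \<zeta>)))"
      by (simp only: ci_cmult)
    also have "\<dots> = circle_integral (\<lambda>\<zeta>. (z ^ n * (w t \<zeta> * (\<zeta> ^ 0 * (1 / \<zeta>) ^ k)) + (\<Sum>l\<le>n. - 2 * z ^ (n - l) * (w t \<zeta> * (\<zeta> ^ l * (1 / \<zeta>) ^ k))))
        + w t \<zeta> * (2 * (1 / \<zeta>) ^ k * \<zeta> ^ Suc n / (\<zeta> - z)))"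
    proof (rule circle_cong)
      fix \<zeta> :: complex assume "norm \<zeta> = 1"
      note K = kern_expand_infinity[OF z(2) nz(1)[OF this], of n]
      have "z ^ n * (w t \<zeta> * ((1 / \<zeta>) ^ k * kern z \<zeta>)) = w t \<zeta> * (1 / \<zeta>) ^ k * (z ^ n * kern z \<zeta>)" by (simp only: mult_ac)
      also have "\<dots> = z ^ n * (w t \<zeta> * (\<zeta> ^ 0 * (1 / \<zeta>) ^ k)) - w t \<zeta> * (1 / \<zeta>) ^ k * (2 * (\<Sum>l\<le>n. z ^ (n - l) * \<zeta> ^ l)) + w t \<zeta> * (2 * (1 / \<zeta>) ^ k * \<zeta> ^ Suc n / (\<zeta> - z))"
        unfolding K by (simp add: algebra_simps)
      also have "w t \<zeta> * (1 / \<zeta>) ^ k * (2 * (\<Sum>l\<le>n. z ^ (n - l) * \<zeta> ^ l)) = (\<Sum>l\<le>n. 2 * z ^ (n - l) * (w t \<zeta> * (\<zeta> ^ l * (1 / \<zeta>) ^ k)))"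
        unfolding sum_distrib_left by (intro sum.cong refl) (simp only: mult_ac)
      finally show "z ^ n * (w t \<zeta> * ((1 / \<zeta>) ^ k * kern z \<zeta>)) = (z ^ n * (w t \<zeta> * (\<zeta> ^ 0 * (1 / \<zeta>) ^ k)) + (\<Sum>l\<le>n. - 2 * z ^ (n - l) * (w t \<zeta> * (\<zeta> ^ l * (1 / \<zeta>) ^ k))))
        + w t \<zeta> * (2 * (1 / \<zeta>) ^ k * \<zeta> ^ Suc n / (\<zeta> - z))"
        by (simp add: sum_negf)
    qed
    also have "\<dots> = circle_integral (\<lambda>\<zeta>. z ^ n * (w t \<zeta> * (\<zeta> ^ 0 * (1 / \<zeta>) ^ k)) + (\<Sum>l\<le>n. - 2 * z ^ (n - l) * (w t \<zeta> * (\<zeta> ^ l * (1 / \<zeta>) ^ k))))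
        + ?ci (\<lambda>\<zeta>. 2 * (1 / \<zeta>) ^ k * \<zeta> ^ Suc n / (\<zeta> - z))"
      by (rule ci_add) (intro circle_integrable_add circle_integrable_sum circle_integrable_cmult I c1 c2 finite_atMost)+
    also have "circle_integral (\<lambda>\<zeta>. z ^ n * (w t \<zeta> * (\<zeta> ^ 0 * (1 / \<zeta>) ^ k)) + (\<Sum>l\<le>n. - 2 * z ^ (n - l) * (w t \<zeta> * (\<zeta> ^ l * (1 / \<zeta>) ^ k))))
        = z ^ n * ?ci (\<lambda>\<zeta>. \<zeta> ^ 0 * (1 / \<zeta>) ^ k) + (\<Sum>l\<le>n. - 2 * z ^ (n - l) * ?ci (\<lambda>\<zeta>. \<zeta> ^ l * (1 / \<zeta>) ^ k))"
      by (rule ci_combination) (intro I c1 finite_atMost)+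
    finally show ?thesis .
  qed
  have S0: "(\<Sum>k\<le>n. phib_coeff n t k * (z ^ n * ?ci (\<lambda>\<zeta>. \<zeta> ^ 0 * (1 / \<zeta>) ^ k))) = 0"
  proof -
    have "(\<Sum>k\<le>n. phib_coeff n t k * (z ^ n * ?ci (\<lambda>\<zeta>. \<zeta> ^ 0 * (1 / \<zeta>) ^ k))) = z ^ n * (\<Sum>k\<le>n. phib_coeff n t k * ?ci (\<lambda>\<zeta>. \<zeta> ^ 0 * (1 / \<zeta>) ^ k))"
      unfolding sum_distrib_left by (intro sum.cong refl) (simp only: mult_ac)
    also have "(\<Sum>k\<le>n. phib_coeff n t k * ?ci (\<lambda>\<zeta>. \<zeta> ^ 0 * (1 / \<zeta>) ^ k)) = 0" by (rule orth_low(2)[OF t]) (use n in simp)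
    finally show ?thesis by simp
  qed
  have S1: "(\<Sum>k\<le>n. phib_coeff n t k * (\<Sum>l\<le>n. - 2 * z ^ (n - l) * ?ci (\<lambda>\<zeta>. \<zeta> ^ l * (1 / \<zeta>) ^ k))) = - 2 / \<kappa> t n"
  proof -
    have "(\<Sum>k\<le>n. phib_coeff n t k * (\<Sum>l\<le>n. - 2 * z ^ (n - l) * ?ci (\<lambda>\<zeta>. \<zeta> ^ l * (1 / \<zeta>) ^ k)))
        = (\<Sum>k\<le>n. \<Sum>l\<le>n. - 2 * z ^ (n - l) * (phib_coeff n t k * ?ci (\<lambda>\<zeta>. \<zeta> ^ l * (1 / \<zeta>) ^ k)))"
      unfolding sum_distrib_left by (intro sum.cong refl) (simp only: mult_ac)
    also have "\<dots> = (\<Sum>l\<le>n. \<Sum>k\<le>n. - 2 * z ^ (n - l) * (phib_coeff n t k * ?ci (\<lambda>\<zeta>. \<zeta> ^ l * (1 / \<zeta>) ^ k)))" by (rule sum.swap)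
    also have "\<dots> = (\<Sum>l\<le>n. - 2 * z ^ (n - l) * (\<Sum>k\<le>n. phib_coeff n t k * ?ci (\<lambda>\<zeta>. \<zeta> ^ l * (1 / \<zeta>) ^ k)))" by (simp only: sum_distrib_left)
    also have "\<dots> = (\<Sum>l\<le>n. if l = n then - 2 / \<kappa> t n else 0)"
    proof (intro sum.cong refl)
      fix l assume "l \<in> {..n}"
      then show "- 2 * z ^ (n - l) * (\<Sum>k\<le>n. phib_coeff n t k * ?ci (\<lambda>\<zeta>. \<zeta> ^ l * (1 / \<zeta>) ^ k)) = (if l = n then - 2 / \<kappa> t n else 0)"
        using orth_low(2)[OF t, of l n] orth_top[OF t, of n] by (cases "l = n") (simp_all only: atMost_iff if_True if_False le_less, simp_all)
    qed
    also have "\<dots> = - 2 / \<kappa> t n" by simp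
    finally show ?thesis .
  qed
  have "col2 n t z $ 2 = (\<Sum>k\<le>n. phib_coeff n t k * (z ^ n * ?ci (\<lambda>\<zeta>. \<zeta> ^ 0 * (1 / \<zeta>) ^ k)))
     + (\<Sum>k\<le>n. phib_coeff n t k * (\<Sum>l\<le>n. - 2 * z ^ (n - l) * ?ci (\<lambda>\<zeta>. \<zeta> ^ l * (1 / \<zeta>) ^ k)))
     + (\<Sum>k\<le>n. phib_coeff n t k * ?ci (\<lambda>\<zeta>. 2 * (1 / \<zeta>) ^ k * \<zeta> ^ Suc n / (\<zeta> - z)))"
    unfolding kernel_column_def vector_2_nth E by (simp only: distrib_left sum.distrib)
  then show ?thesis unfolding S0 S1 by simp
qed

end

section \<open>The deformation equation\<close>

text \<open>The numerators \<open>r\<^sub>j\<close> depend polynomially on \<open>z\<close>. Clearing denominators gives a polynomial identity on an infinite set,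
hence everywhere, and it can be evaluated at a pole, where the original identity is meaningless.\<close>

lemma residue_vanishes:
  fixes a :: "nat \<Rightarrow> complex"
  assumes J: "finite J" and inj: "inj_on a J" and S: "infinite S" "\<And>z. z \<in> S \<Longrightarrow> z \<notin> a ` J"
    and r: "\<And>j. j \<in> J \<Longrightarrow> polyfun (r j)" and q: "polyfun q"
    and eq: "\<And>z. z \<in> S \<Longrightarrow> (\<Sum>j\<in>J. r j z / (z - a j)) = q z"
    and j: "j \<in> J"
  shows "r j (a j) = 0"
proof -
  define P where "P z = (\<Sum>k\<in>J. r k z * (\<Prod>l\<in>J - {k}. z - a l)) - q z * (\<Prod>l\<in>J. z - a l)" for z
  have pp: "polyfun (\<lambda>z. \<Prod>l\<in>I. z - a l)" for I
  proof (induction I rule: infinite_finite_induct)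
    case (insert x I)
    then show ?case using polyfun_mult[OF polyfun_diff[OF polyfun_id polyfun_const[of "a x"]] insert.IH] by simp
  qed (simp_all add: polyfun_const)
  have "polyfun P" unfolding P_def by (intro polyfun_diff polyfun_sum polyfun_mult r q pp)
  moreover have "P z = 0" if z: "z \<in> S" for z
  proof -
    have "(\<Sum>k\<in>J. r k z * (\<Prod>l\<in>J - {k}. z - a l)) = (\<Sum>k\<in>J. r k z / (z - a k) * (\<Prod>l\<in>J. z - a l))"
    proof (rule sum.cong[OF refl])
      fix k assume k: "k \<in> J"
      have "(\<Prod>l\<in>J. z - a l) = (z - a k) * (\<Prod>l\<in>J - {k}. z - a l)" using J k by (rule prod.remove)
      moreover have "z - a k \<noteq> 0" using S(2)[OF z] k by auto
      ultimately show "r k z * (\<Prod>l\<in>J - {k}. z - a l) = r k z / (z - a k) * (\<Prod>l\<in>J. z - a l)" by simp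
    qed
    also have "\<dots> = q z * (\<Prod>l\<in>J. z - a l)" unfolding sum_distrib_right[symmetric] eq[OF z] ..
    finally show ?thesis by (simp add: P_def)
  qed
  ultimately have "P (a j) = 0" by (rule polyfun_infinite_zero[OF _ S(1)])
  moreover have "(\<Prod>l\<in>J. a j - a l) = 0" using J j by (auto intro: prod_zero)
  moreover have "(\<Sum>k\<in>J. r k (a j) * (\<Prod>l\<in>J - {k}. a j - a l)) = r j (a j) * (\<Prod>l\<in>J - {j}. a j - a l)"
  proof -
    have "(\<Sum>k\<in>J - {j}. r k (a j) * (\<Prod>l\<in>J - {k}. a j - a l)) = 0"
    proof (intro sum.neutral ballI)
      fix k assume "k \<in> J - {j}"
      then have "(\<Prod>l\<in>J - {k}. a j - a l) = 0" using J j by (intro prod_zero) auto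
      then show "r k (a j) * (\<Prod>l\<in>J - {k}. a j - a l) = 0" by simp
    qed
    then show ?thesis using J j by (simp add: sum.remove)
  qed
  ultimately have "r j (a j) * (\<Prod>l\<in>J - {j}. a j - a l) = 0" by (simp add: P_def)
  moreover have "(\<Prod>l\<in>J - {j}. a j - a l) \<noteq> 0" using J inj j by (auto simp: prod_zero_iff inj_on_def)
  ultimately show ?thesis by simp
qed

lemma bigO0_power: "bigO0 n (\<lambda>z. z ^ n)"
  unfolding bigO0_def by (intro exI[of _ 1]) (simp add: norm_power)

lemma row1_bounded:
  assumes "circle_integrable g"
  shows "bigO0 0 (\<lambda>z. \<Sum>k\<le>n. c k * circle_integral (\<lambda>\<zeta>. g \<zeta> * (2 * \<zeta> ^ k * (1 / \<zeta>) ^ n * \<zeta> / (\<zeta> - z))))"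
  by (intro bigO0_sum bigO0_mult[OF _ bigO0_cont] cauchy_bounded assms continuous_const continuous_on_mult inv_power_cont pow_cont continuous_on_const continuous_on_id)

lemma row2_bigO:
  assumes "circle_integrable g" shows "bigO0 n (\<lambda>z. kernel_column g n c d z $ 2)"
proof -
  have "bigO0 n (\<lambda>z. d k * (z ^ n * circle_integral (\<lambda>\<zeta>. g \<zeta> * ((1 / \<zeta>) ^ k * kern z \<zeta>))))" for k
    using bigO0_mult[OF bigO0_mult[OF bigO0_power kernel_bounded[OF assms inv_power_cont]] bigO0_cont[OF continuous_const]]
    by (simp add: mult.commute)
  then show ?thesis unfolding kernel_column_def vector_2_nth by (intro bigO0_sum)
qed

lemma row1_vanishes:
  assumes "circle_integrable g"
  shows "((\<lambda>z. \<Sum>k\<le>n. c k * circle_integral (\<lambda>\<zeta>. g \<zeta> * (2 * \<zeta> ^ k * \<zeta> / (\<zeta> - z)))) \<longlongrightarrow> 0) at_infinity"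
proof -
  have "((\<lambda>z. \<Sum>k\<le>n. c k * circle_integral (\<lambda>\<zeta>. g \<zeta> * (2 * \<zeta> ^ k * \<zeta> / (\<zeta> - z)))) \<longlongrightarrow> (\<Sum>k\<le>n. c k * 0)) at_infinity"
    by (intro tendsto_sum tendsto_mult_left cauchy_infinity assms continuous_on_mult pow_cont continuous_on_const continuous_on_id)
  then show ?thesis by simp
qed

lemma row2_vanishes:
  assumes "circle_integrable g"
  shows "((\<lambda>z. \<Sum>k\<le>n. c k * circle_integral (\<lambda>\<zeta>. g \<zeta> * (2 * (1 / \<zeta>) ^ k * \<zeta> ^ Suc n / (\<zeta> - z)))) \<longlongrightarrow> 0) at_infinity"
proof -
  have "((\<lambda>z. \<Sum>k\<le>n. c k * circle_integral (\<lambda>\<zeta>. g \<zeta> * (2 * (1 / \<zeta>) ^ k * \<zeta> ^ Suc n / (\<zeta> - z)))) \<longlongrightarrow> (\<Sum>k\<le>n. c k * 0)) at_infinity"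
    by (intro tendsto_sum tendsto_mult_left cauchy_infinity assms continuous_on_mult pow_cont inv_power_cont continuous_on_const continuous_on_id)
  then show ?thesis by simp
qed

lemma polyfun_has_derivative:
  assumes "polyfun f" obtains f' where "polyfun f'" "\<And>z. (f has_field_derivative f' z) (at z)"
proof -
  obtain P where P: "f = poly P" using assms by (auto simp: polyfun_def)
  show ?thesis by (rule that[of "poly (pderiv P)"]) (auto simp: P poly_DERIV)
qed

context biorth_family
begin

text \<open>The \<open>t\<close>-derivative does not satisfy the orthogonality relations itself. Its expansions are found by differentiating in \<open>t\<close>
the expansions of the column, which hold for all \<open>t\<close>.\<close>

lemma col2_dot_unique:
  assumes t: "t \<in> U" and z: "norm z \<noteq> 1" and eq: "\<And>s. s \<in> U \<Longrightarrow> col2 n s z $ i = G s"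
    and G: "(G has_vector_derivative D) (at t)"
  shows "col2_dot n t z $ i = D"
proof -
  have "((\<lambda>s. col2 n s z $ i) has_vector_derivative D) (at t)"
    by (rule has_vector_derivative_transform_within_open[OF G open_U t]) (simp add: eq)
  with col2_t_deriv[OF t z] show ?thesis by (rule vector_derivative_unique_at)
qed

definition kappa_dot :: "nat \<Rightarrow> real \<Rightarrow> complex" where "kappa_dot n t = vector_derivative (\<lambda>s. \<kappa> s n) (at t)"

lemma kappa_dot_deriv: "t \<in> U \<Longrightarrow> ((\<lambda>s. \<kappa> s n) has_vector_derivative kappa_dot n t) (at t)"
  unfolding kappa_dot_def using \<kappa>_diff vector_derivative_works by blast

lemma phi_coeff'_top: assumes t: "t \<in> U" shows "phi_coeff' n t n = kappa_dot n t"
proof -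
  have "((\<lambda>s. phi_coeff n s n) has_vector_derivative kappa_dot n t) (at t)"
    by (rule has_vector_derivative_transform_within_open[OF kappa_dot_deriv[OF t] open_U t]) (simp add: phi_coeff_def bio_facts)
  with phi_coeff_deriv[OF t] show ?thesis by (rule vector_derivative_unique_at)
qed

lemma col2_bigO: assumes t: "t \<in> U" and n: "n \<ge> 1" shows "bigO0 n (\<lambda>z. col2 n t z $ i)"
proof (rule forall_2I[of _ i])
  show "bigO0 n (\<lambda>z. col2 n t z $ 1)"
  proof (rule bigO0_cong)
    show "bigO0 n (\<lambda>z. (\<Sum>k\<le>n. phi_coeff n t k * circle_integral (\<lambda>\<zeta>. w t \<zeta> * (2 * \<zeta> ^ k * (1 / \<zeta>) ^ n * \<zeta> / (\<zeta> - z)))) * z ^ n)"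
      by (rule bigO0_mult[OF bigO0_power row1_bounded[OF w_integrable[OF t]]])
    show "eventually (\<lambda>z. (\<Sum>k\<le>n. phi_coeff n t k * circle_integral (\<lambda>\<zeta>. w t \<zeta> * (2 * \<zeta> ^ k * (1 / \<zeta>) ^ n * \<zeta> / (\<zeta> - z)))) * z ^ n = col2 n t z $ 1) (at 0)"
      using zero_eventually_simple[OF finite.emptyI]
    proof eventually_elim
      case (elim z)
      then have "norm z \<noteq> 1" by simp
      from col2_first_zero[OF t n this] show ?case by (simp only: mult.commute)
    qed
  qed
  show "bigO0 n (\<lambda>z. col2 n t z $ 2)" by (rule row2_bigO[OF w_integrable[OF t]])
qed

lemma col2_dot_bigO: assumes t: "t \<in> U" and n: "n \<ge> 1" shows "bigO0 n (\<lambda>z. col2_dot n t z $ i)"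
proof (rule forall_2I[of _ i])
  define E where "E g c z = (\<Sum>k\<le>n. c k * circle_integral (\<lambda>\<zeta>. g \<zeta> * (2 * \<zeta> ^ k * (1 / \<zeta>) ^ n * \<zeta> / (\<zeta> - z))))" for g c z
  show "bigO0 n (\<lambda>z. col2_dot n t z $ 1)"
  proof (rule bigO0_cong)
    show "bigO0 n (\<lambda>z. (E (w t) (phi_coeff' n t) z + E (w_dot t) (phi_coeff n t) z) * z ^ n)"
      unfolding E_def by (intro bigO0_mult[OF bigO0_power] bigO0_add row1_bounded w_integrable w_dot_integrable t)
    show "eventually (\<lambda>z. (E (w t) (phi_coeff' n t) z + E (w_dot t) (phi_coeff n t) z) * z ^ n = col2_dot n t z $ 1) (at 0)"
      using zero_eventually_simple[OF finite.emptyI]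
    proof eventually_elim
      case (elim z)
      then have z: "norm z \<noteq> 1" by simp
      have nz: "\<zeta> - z \<noteq> 0" "\<zeta> \<noteq> 0" if "norm \<zeta> = 1" for \<zeta> using that z by auto
      have c2: "continuous_on (sphere 0 1) (\<lambda>\<zeta>. 2 * \<zeta> ^ k * (1 / \<zeta>) ^ n * \<zeta> / (\<zeta> - z))" for k using nz by (intro continuous_intros) auto
      have "col2_dot n t z $ 1 = z ^ n * (E (w t) (phi_coeff' n t) z + E (w_dot t) (phi_coeff n t) z)"
        unfolding E_def
        by (rule col2_dot_unique[OF t z col2_first_zero[OF _ n z]], assumption)
           (rule has_vector_derivative_mult_right[OF sum_deriv[OF t phi_coeff_deriv[OF t] c2]])
      then show ?case by (simp only: mult.commute)
    qed
  qed
  show "bigO0 n (\<lambda>z. col2_dot n t z $ 2)" unfolding col2_dot_def vector_add_component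
    by (intro bigO0_add row2_bigO w_integrable w_dot_integrable t)
qed

lemma col2_infinity:
  assumes t: "t \<in> U" and n: "n \<ge> 1"
  shows "((\<lambda>z. col2 n t z $ i) \<longlongrightarrow> (vector [0, - 2 / \<kappa> t n] :: complex^2) $ i) at_infinity"
proof (rule forall_2I[of _ i])
  have ev: "eventually (\<lambda>z::complex. norm z > 1 \<and> z \<noteq> 0 \<and> z \<notin> {}) at_infinity" by (rule infinity_eventually_simple) simp
  have "((\<lambda>z. col2 n t z $ 1) \<longlongrightarrow> 0) at_infinity"
    by (rule Lim_transform_eventually[OF row1_vanishes[OF w_integrable[OF t], where n=n and c="phi_coeff n t"]])
       (use ev in eventually_elim, rule col2_first_infinity[OF t n, symmetric], simp)
  then show "((\<lambda>z. col2 n t z $ 1) \<longlongrightarrow> (vector [0, - 2 / \<kappa> t n] :: complex^2) $ 1) at_infinity" by simp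
  have "((\<lambda>z. (\<Sum>k\<le>n. phib_coeff n t k * circle_integral (\<lambda>\<zeta>. w t \<zeta> * (2 * (1 / \<zeta>) ^ k * \<zeta> ^ Suc n / (\<zeta> - z)))) - 2 / \<kappa> t n) \<longlongrightarrow> 0 - 2 / \<kappa> t n) at_infinity"
    by (intro tendsto_diff tendsto_const row2_vanishes w_integrable t)
  then have "((\<lambda>z. col2 n t z $ 2) \<longlongrightarrow> 0 - 2 / \<kappa> t n) at_infinity"
    by (rule Lim_transform_eventually)
       (use ev in eventually_elim, rule col2_second_infinity[OF t n, symmetric], simp_all)
  then show "((\<lambda>z. col2 n t z $ 2) \<longlongrightarrow> (vector [0, - 2 / \<kappa> t n] :: complex^2) $ 2) at_infinity" by simp
qed

lemma col2_dot_infinity: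
  assumes t: "t \<in> U" and n: "n \<ge> 1"
  shows "((\<lambda>z. col2_dot n t z $ i) \<longlongrightarrow> (vector [0, 2 * kappa_dot n t / (\<kappa> t n)\<^sup>2] :: complex^2) $ i) at_infinity"
proof (rule forall_2I[of _ i])
  have ev: "eventually (\<lambda>z::complex. norm z > 1 \<and> z \<noteq> 0 \<and> z \<notin> {}) at_infinity" by (rule infinity_eventually_simple) simp
  define E where "E g c z = (\<Sum>k\<le>n. c k * circle_integral (\<lambda>\<zeta>. g \<zeta> * (2 * \<zeta> ^ k * \<zeta> / (\<zeta> - z))))" for g c z
  define G where "G g c z = (\<Sum>k\<le>n. c k * circle_integral (\<lambda>\<zeta>. g \<zeta> * (2 * (1 / \<zeta>) ^ k * \<zeta> ^ Suc n / (\<zeta> - z))))" for g c z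
  have "((\<lambda>z. E (w t) (phi_coeff' n t) z + E (w_dot t) (phi_coeff n t) z) \<longlongrightarrow> 0 + 0) at_infinity"
    unfolding E_def by (intro tendsto_add row1_vanishes w_integrable w_dot_integrable t)
  then have "((\<lambda>z. col2_dot n t z $ 1) \<longlongrightarrow> 0 + 0) at_infinity"
  proof (rule Lim_transform_eventually)
    show "eventually (\<lambda>z. E (w t) (phi_coeff' n t) z + E (w_dot t) (phi_coeff n t) z = col2_dot n t z $ 1) at_infinity"
      using ev
    proof eventually_elim
      case (elim z)
      then have z: "norm z \<noteq> 1" by simp
      have nz: "\<zeta> - z \<noteq> 0" if "norm \<zeta> = 1" for \<zeta> using that z by auto
      have c2: "continuous_on (sphere 0 1) (\<lambda>\<zeta>. 2 * \<zeta> ^ k * \<zeta> / (\<zeta> - z))" for k using nz by (intro continuous_intros) auto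
      have "col2_dot n t z $ 1 = E (w t) (phi_coeff' n t) z + E (w_dot t) (phi_coeff n t) z"
        unfolding E_def
        by (rule col2_dot_unique[OF t z col2_first_infinity[OF _ n z]], assumption)
           (rule sum_deriv[OF t phi_coeff_deriv[OF t] c2])
      then show ?case by simp
    qed
  qed
  then show "((\<lambda>z. col2_dot n t z $ 1) \<longlongrightarrow> (vector [0, 2 * kappa_dot n t / (\<kappa> t n)\<^sup>2] :: complex^2) $ 1) at_infinity" by simp
  have k0: "\<kappa> t n \<noteq> 0" using bio_facts[OF t] by simp
  have kdiv: "((\<lambda>s. 2 / \<kappa> s n) has_vector_derivative - (2 * kappa_dot n t / (\<kappa> t n)\<^sup>2)) (at t)"
  proof -
    have "((\<lambda>x. 2 / x) has_field_derivative - 2 / (\<kappa> t n)\<^sup>2) (at (\<kappa> t n))"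
      using k0 by (auto intro!: derivative_eq_intros simp: power2_eq_square)
    from field_vector_diff_chain_at[OF kappa_dot_deriv[OF t] this] show ?thesis by (simp add: o_def mult.commute)
  qed
  have "((\<lambda>z. G (w t) (phib_coeff' n t) z + G (w_dot t) (phib_coeff n t) z - - (2 * kappa_dot n t / (\<kappa> t n)\<^sup>2)) \<longlongrightarrow> 0 + 0 - - (2 * kappa_dot n t / (\<kappa> t n)\<^sup>2)) at_infinity"
    unfolding G_def by (intro tendsto_add tendsto_diff tendsto_const row2_vanishes w_integrable w_dot_integrable t)
  then have "((\<lambda>z. col2_dot n t z $ 2) \<longlongrightarrow> 0 + 0 - - (2 * kappa_dot n t / (\<kappa> t n)\<^sup>2)) at_infinity"
  proof (rule Lim_transform_eventually)
    show "eventually (\<lambda>z. G (w t) (phib_coeff' n t) z + G (w_dot t) (phib_coeff n t) z - - (2 * kappa_dot n t / (\<kappa> t n)\<^sup>2) = col2_dot n t z $ 2) at_infinity"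
      using ev
    proof eventually_elim
      case (elim z)
      then have z: "norm z \<noteq> 1" "z \<noteq> 0" by auto
      have nz: "\<zeta> - z \<noteq> 0" "\<zeta> \<noteq> 0" if "norm \<zeta> = 1" for \<zeta> using that z by auto
      have c2: "continuous_on (sphere 0 1) (\<lambda>\<zeta>. 2 * (1 / \<zeta>) ^ k * \<zeta> ^ Suc n / (\<zeta> - z))" for k using nz by (intro continuous_intros) auto
      have "col2_dot n t z $ 2 = G (w t) (phib_coeff' n t) z + G (w_dot t) (phib_coeff n t) z - - (2 * kappa_dot n t / (\<kappa> t n)\<^sup>2)"
        unfolding G_def
        by (rule col2_dot_unique[OF t z(1) col2_second_infinity[OF _ n z]], assumption)
           (rule has_vector_derivative_diff[OF sum_deriv[OF t phib_coeff_deriv[OF t] c2] kdiv])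
      then show ?case by simp
    qed
  qed
  then show "((\<lambda>z. col2_dot n t z $ 2) \<longlongrightarrow> (vector [0, 2 * kappa_dot n t / (\<kappa> t n)\<^sup>2] :: complex^2) $ 2) at_infinity" by simp
qed

lemma F_eq: "t \<in> U \<Longrightarrow> weight.F (w t) z = circle_integral (\<lambda>\<zeta>. w t \<zeta> * kern z \<zeta>)"
  by (rule weight.F_def[OF wt])

text \<open>The factor \<open>F\<close> cancels in the determinant, which is therefore a polynomial; its growth at 0 and at infinity fixes it.\<close>

lemma determinant:
  assumes t: "t \<in> U" and n: "n \<ge> 1" and z: "norm z \<noteq> 1" "z \<noteq> 0"
  shows "col1 n t z $ 1 * col2 n t z $ 2 - col1 n t z $ 2 * col2 n t z $ 1 = - 2 * z ^ n"
    (is "?d z = _")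
proof -
  note b = bio_facts[OF t]
  obtain p where p: "\<And>i. polyfun (\<lambda>z. p z $ i)"
    "\<And>z. norm z \<noteq> 1 \<Longrightarrow> col2 n t z = circle_integral (\<lambda>\<zeta>. w t \<zeta> * kern z \<zeta>) *s col1 n t z + p z"
    by (rule kernel_column_decomposition[OF w_integrable[OF t]]) blast
  have eq: "col1 n t z $ 1 * p z $ 2 - col1 n t z $ 2 * p z $ 1 = ?d z" if "norm z \<noteq> 1" "z \<noteq> 0" "z \<notin> {}" for z
    unfolding p(2)[OF that(1)] by (simp add: algebra_simps)
  have poly: "polyfun (\<lambda>z. col1 n t z $ 1 * p z $ 2 - col1 n t z $ 2 * p z $ 1)"
    by (intro polyfun_diff polyfun_mult polyfun_poly_column p(1))
  have O: "bigO0 n (\<lambda>z. col2 n t z $ i)" for i by (rule col2_bigO[OF t n])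
  have L1: "((\<lambda>z. col2 n t z $ 1) \<longlongrightarrow> 0) at_infinity" and L2: "((\<lambda>z. col2 n t z $ 2) \<longlongrightarrow> - 2 / \<kappa> t n) at_infinity"
    using col2_infinity[OF t n, of 1] col2_infinity[OF t n, of 2] by simp_all
  have F: "((\<lambda>z. col1 n t z $ i / z ^ n) \<longlongrightarrow> (vector [phi_coeff n t n, phib_coeff n t 0] :: complex^2) $ i) at_infinity" for i
    by (rule poly_column_infinity)
  have "((\<lambda>z. col1 n t z $ 1 / z ^ n * col2 n t z $ 2 - col1 n t z $ 2 / z ^ n * col2 n t z $ 1) \<longlongrightarrow> phi_coeff n t n * (- 2 / \<kappa> t n) - phib_coeff n t 0 * 0) at_infinity"
    using F[of 1] F[of 2] by (intro tendsto_diff tendsto_mult L1 L2) simp_all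
  then have L: "((\<lambda>z. ?d z / z ^ n) \<longlongrightarrow> - 2) at_infinity" 
  proof -
    have "phi_coeff n t n * (- 2 / \<kappa> t n) - phib_coeff n t 0 * 0 = - 2" using b(1)[of n] b(4)[of n] by (simp add: phi_coeff_def)
    moreover assume "((\<lambda>z. col1 n t z $ 1 / z ^ n * col2 n t z $ 2 - col1 n t z $ 2 / z ^ n * col2 n t z $ 1) \<longlongrightarrow> phi_coeff n t n * (- 2 / \<kappa> t n) - phib_coeff n t 0 * 0) at_infinity"
    ultimately show ?thesis by (simp add: diff_divide_distrib)
  qed
  have "bigO0 n ?d"
    by (intro bigO0_diff bigO0_mult O bigO0_cont polyfun_isCont polyfun_poly_column)
  from polyfun_growth'[OF poly finite.emptyI eq this L, of z] eq[OF z] show ?thesis by simp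
qed

text \<open>Inserting \<open>x = F f + p\<close> and the equation of \<open>F\<close> into the spectral equation eliminates \<open>F\<close> and leaves identities between
rational functions; the relations are their residues at \<open>z\<^sub>j\<close>. The second one is multiplied by \<open>z\<close> to clear the
denominator of the inhomogeneity, so it yields nothing at \<open>z\<^sub>j = 0\<close>.\<close>

lemma residue_relations:
  fixes A :: "nat \<Rightarrow> complex^2^2"
  assumes t: "t \<in> U" and S: "infinite S" "\<And>z. z \<in> S \<Longrightarrow> norm z \<noteq> 1 \<and> z \<noteq> 0 \<and> z \<notin> zs t ` {1..m}"
    and c1: "\<And>z. z \<in> S \<Longrightarrow> poly_column' n (phi_coeff n t) (phib_coeff n t) z = partial_fraction_matrix m (zs t) A z *v col1 n t z"
    and c2: "\<And>z. z \<in> S \<Longrightarrow> col2' n t z = partial_fraction_matrix m (zs t) A z *v col2 n t z + weight.log_z_deriv m (zs t) \<rho> z *s col2 n t z"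
    and p: "\<And>i. polyfun (\<lambda>z. p z $ i)"
      "\<And>z. norm z \<noteq> 1 \<Longrightarrow> col2 n t z = circle_integral (\<lambda>\<zeta>. w t \<zeta> * kern z \<zeta>) *s col1 n t z + p z"
    and j: "j \<in> {1..m}"
  shows "A j *v col1 n t (zs t j) = 0"
    and "zs t j \<noteq> 0 \<Longrightarrow> A j *v p (zs t j) = - ((\<rho> j * (weight.w0 (w t) + 2 * zs t j * weight.pole_moment (zs t) (w t) j)) *s col1 n t (zs t j) + \<rho> j *s p (zs t j))"
proof -
  interpret W: weight m "zs t" \<rho> "C t" "w t" using wt[OF t] .
  let ?J = "{1..m}" and ?a = "zs t" and ?f = "col1 n t"
  have Av: "(partial_fraction_matrix m ?a A z *v v) $ i = (\<Sum>j\<in>?J. (A j *v v) $ i / (z - ?a j))" for z v i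
    by (simp add: matrix_vector_mult_def sum_2 partial_fraction_matrix_entry sum_distrib_right sum.distrib[symmetric] add_divide_distrib)
  have "(A j *v ?f (?a j)) $ i = 0" for i
  proof (rule residue_vanishes[where J="?J" and a="?a" and S=S and r="\<lambda>j z. (A j *v ?f z) $ i" and q="\<lambda>z. poly_column' n (phi_coeff n t) (phib_coeff n t) z $ i"])
    show "polyfun (\<lambda>z. (A j *v ?f z) $ i)" for j by (intro polyfun_matrix_vector polyfun_poly_column)
    show "(\<Sum>j\<in>?J. (A j *v ?f z) $ i / (z - ?a j)) = poly_column' n (phi_coeff n t) (phib_coeff n t) z $ i" if "z \<in> S" for z
      unfolding c1[OF that] Av ..
  qed (use S W.distinct j polyfun_poly_column' in auto)
  then show "A j *v ?f (?a j) = 0" by (simp add: Finite_Cartesian_Product.vec_eq_iff)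
  assume a0: "?a j \<noteq> 0"
  have "(A j *v p (?a j)) $ i = - ((\<rho> j * (W.w0 + 2 * ?a j * W.pole_moment j)) * ?f (?a j) $ i + \<rho> j * p (?a j) $ i)" for i
  proof -
    obtain p' where p': "polyfun p'" "\<And>z. ((\<lambda>z. p z $ i) has_field_derivative p' z) (at z)"
      by (rule polyfun_has_derivative[OF p(1)[of i]]) blast
    define r where "r j z = z * (A j *v p z) $ i + \<rho> j * ?a j * (W.w0 + (z + ?a j) * W.pole_moment j) * ?f z $ i + z * \<rho> j * p z $ i" for j z
    have "r j (?a j) = 0"
    proof (rule residue_vanishes[where J="?J" and a="?a" and S=S and r=r and q="\<lambda>z. z * p' z"])
      show "polyfun (r j)" for j unfolding r_def
        by (intro polyfun_add polyfun_mult polyfun_const polyfun_id polyfun_matrix_vector polyfun_poly_column p(1))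
      show "polyfun (\<lambda>z. z * p' z)" by (intro polyfun_mult polyfun_id p')
      fix z assume z: "z \<in> S"
      note zz = S(2)[OF z]
      define Fz where "Fz = W.F z"
      have xz: "col2 n t z = Fz *s ?f z + p z" using p(2) zz by (simp add: Fz_def W.F_def)
      have "((\<lambda>z. W.F z * ?f z $ i + p z $ i) has_field_derivative ((W.log_z_deriv z * W.F z + W.F_inhomogeneity z) * ?f z $ i + poly_column' n (phi_coeff n t) (phib_coeff n t) z $ i * W.F z + p' z)) (at z)"
        using zz by (intro DERIV_add DERIV_mult W.F_deriv poly_column_z_deriv p'(2)) auto
      moreover have op: "open (- sphere (0::complex) 1)" by (intro open_Compl closed_sphere)
      ultimately have "((\<lambda>z. col2 n t z $ i) has_field_derivative ((W.log_z_deriv z * W.F z + W.F_inhomogeneity z) * ?f z $ i + poly_column' n (phi_coeff n t) (phib_coeff n t) z $ i * W.F z + p' z)) (at z)"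
        by (rule has_field_derivative_transform_within_open) (use zz p(2) in \<open>auto simp: W.F_def\<close>)
      moreover have "((\<lambda>z. col2 n t z $ i) has_field_derivative col2' n t z $ i) (at z)"
        by (rule kernel_column_z_deriv[OF w_integrable[OF t]]) (use zz in simp)
      ultimately have X: "col2' n t z $ i = (W.log_z_deriv z * Fz + W.F_inhomogeneity z) * ?f z $ i + poly_column' n (phi_coeff n t) (phib_coeff n t) z $ i * Fz + p' z"
        unfolding Fz_def by (metis DERIV_unique)
      let ?A = "partial_fraction_matrix m ?a A z"
      have Ax: "(?A *v col2 n t z) $ i = Fz * (?A *v ?f z) $ i + (?A *v p z) $ i"
        unfolding xz by (simp add: matrix_vector_right_distrib matrix_vector_smult_right)
      have "col2' n t z $ i = (?A *v col2 n t z) $ i + W.log_z_deriv z * col2 n t z $ i" using c2[OF z] by simp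
      then have key: "(?A *v p z) $ i = W.F_inhomogeneity z * ?f z $ i + p' z - W.log_z_deriv z * p z $ i"
        using X unfolding Ax c1[OF z, symmetric] unfolding xz by (simp add: algebra_simps)
      have zHV: "z * W.F_inhomogeneity z = - (\<Sum>j\<in>?J. \<rho> j * ?a j * (W.w0 + (z + ?a j) * W.pole_moment j) / (z - ?a j))"
        using zz by (simp add: W.F_inhomogeneity_def)
      have "(\<Sum>j\<in>?J. r j z / (z - ?a j)) = z * (?A *v p z) $ i - (z * W.F_inhomogeneity z) * ?f z $ i + z * (W.log_z_deriv z * p z $ i)"
        unfolding Av zHV W.log_z_deriv_def r_def
        by (simp add: sum_distrib_left sum_distrib_right add_divide_distrib sum.distrib mult.assoc)
      also have "\<dots> = z * p' z" unfolding key by (simp add: algebra_simps)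
      finally show "(\<Sum>j\<in>?J. r j z / (z - ?a j)) = z * p' z" .
    qed (use S W.distinct j in auto)
    then have "?a j * ((A j *v p (?a j)) $ i + ((\<rho> j * (W.w0 + 2 * ?a j * W.pole_moment j)) * ?f (?a j) $ i + \<rho> j * p (?a j) $ i)) = 0"
      unfolding r_def mult_2[symmetric] by (simp add: algebra_simps)
    then have "(A j *v p (?a j)) $ i + ((\<rho> j * (W.w0 + 2 * ?a j * W.pole_moment j)) * ?f (?a j) $ i + \<rho> j * p (?a j) $ i) = 0"
      using a0 by simp
    then show ?thesis by (simp only: eq_neg_iff_add_eq_0)
  qed
  then show "A j *v p (?a j) = - ((\<rho> j * (W.w0 + 2 * ?a j * W.pole_moment j)) *s ?f (?a j) + \<rho> j *s p (?a j))"
    by (simp add: Finite_Cartesian_Product.vec_eq_iff)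
qed

text \<open>The spectral equation enters through the residue relations, which are polynomial identities; therefore it is assumed on an
infinite set only, while the conclusion holds at every admissible \<open>z\<close>.\<close>

lemma deformation_equations:
  fixes A :: "nat \<Rightarrow> complex^2^2"
  assumes t: "t \<in> U" and n: "n \<ge> 1"
    and z1: "\<And>s. s \<in> U \<Longrightarrow> zs s 1 = 0" and m: "m \<ge> 1"
    and S: "infinite S" "\<And>z. z \<in> S \<Longrightarrow> norm z \<noteq> 1 \<and> z \<noteq> 0 \<and> z \<notin> zs t ` {1..m}"
    and c1: "\<And>z. z \<in> S \<Longrightarrow> poly_column' n (phi_coeff n t) (phib_coeff n t) z = partial_fraction_matrix m (zs t) A z *v col1 n t z"
    and c2: "\<And>z. z \<in> S \<Longrightarrow> col2' n t z = partial_fraction_matrix m (zs t) A z *v col2 n t z + weight.log_z_deriv m (zs t) \<rho> z *s col2 n t z"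
    and z: "norm z \<noteq> 1" "z \<noteq> 0" "z \<notin> zs t ` {1..m}"
  shows "col1_dot n t z = B_infinity \<kappa> \<phi>b n t *v col1 n t z - (\<Sum>j\<in>{1..m}. (zs_dot t j / (z - zs t j)) *s (A j *v col1 n t z))"
    and "col2_dot n t z = B_infinity \<kappa> \<phi>b n t *v col2 n t z - (\<Sum>j\<in>{1..m}. (zs_dot t j / (z - zs t j)) *s (A j *v col2 n t z)) + log_t_deriv t z *s col2 n t z"
proof -
  interpret W: weight m "zs t" \<rho> "C t" "w t" using wt[OF t] .
  let ?J = "{1..m}" and ?a = "zs t"
  note b = bio_facts[OF t]
  have one: "1 \<in> ?J" using m by simp
  have s1: "zs_dot t 1 = 0"
  proof -
    have "((\<lambda>s. 0) has_vector_derivative zs_dot t 1) (at t)"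
      by (rule has_vector_derivative_transform_within_open[OF zs_deriv[OF t one] open_U t]) (rule z1)
    then show ?thesis using vector_derivative_unique_at[OF _ has_vector_derivative_const] by blast
  qed
  have s0: "?a j \<noteq> 0" if j: "j \<in> ?J" "zs_dot t j \<noteq> 0" for j
  proof
    assume "?a j = 0"
    then have "j = 1" using inj_onD[OF W.distinct, of j 1] z1[OF t] j(1) one by simp
    then show False using s1 j(2) by simp
  qed
  obtain p where p: "\<And>i. polyfun (\<lambda>z. p z $ i)"
    "\<And>z. norm z \<noteq> 1 \<Longrightarrow> col2 n t z = circle_integral (\<lambda>\<zeta>. w t \<zeta> * kern z \<zeta>) *s col1 n t z + p z"
    by (rule kernel_column_decomposition[OF w_integrable[OF t]]) blast
  obtain p1 where p1: "\<And>i. polyfun (\<lambda>z. p1 z $ i)"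
    "\<And>z. norm z \<noteq> 1 \<Longrightarrow> kernel_column (w t) n (phi_coeff' n t) (phib_coeff' n t) z = circle_integral (\<lambda>\<zeta>. w t \<zeta> * kern z \<zeta>) *s col1_dot n t z + p1 z"
    unfolding col1_dot_def by (rule kernel_column_decomposition[OF w_integrable[OF t]]) blast
  obtain p2 where p2: "\<And>i. polyfun (\<lambda>z. p2 z $ i)"
    "\<And>z. norm z \<noteq> 1 \<Longrightarrow> kernel_column (w_dot t) n (phi_coeff n t) (phib_coeff n t) z = circle_integral (\<lambda>\<zeta>. w_dot t \<zeta> * kern z \<zeta>) *s col1 n t z + p2 z"
    by (rule kernel_column_decomposition[OF w_dot_integrable[OF t]]) blast
  have RR1: "A j *v col1 n t (?a j) = 0" if "j \<in> ?J" "zs_dot t j \<noteq> 0" for j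
    by (rule residue_relations(1)[where S=S and p=p]; fact)
  have RR2: "A j *v p (?a j) = - ((\<rho> j * (W.w0 + 2 * ?a j * W.pole_moment j)) *s col1 n t (?a j) + \<rho> j *s p (?a j))" if j: "j \<in> ?J" "zs_dot t j \<noteq> 0" for j
  proof -
    have a0: "?a j \<noteq> 0" by (rule s0[OF j])
    show ?thesis by (rule residue_relations(2)[where S=S and p=p]; fact)
  qed
  define y where "y z = col2_dot n t z - log_t_deriv t z *s col2 n t z" for z
  have Uneg: "- log_t_deriv t z = (\<Sum>j\<in>?J. zs_dot t j * \<rho> j / (z - ?a j))" for z by (simp add: log_t_deriv_def)
  have UO: "bigO0 0 (log_t_deriv t)"
  proof -
    have "bigO0 0 (\<lambda>z. \<Sum>j\<in>?J. zs_dot t j * \<rho> j / (z - ?a j))"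
    proof (rule bigO0_sum)
      fix j assume j: "j \<in> ?J"
      show "bigO0 0 (\<lambda>z. zs_dot t j * \<rho> j / (z - ?a j))"
      proof (cases "zs_dot t j = 0")
        case True then show ?thesis by (simp add: bigO0_zero)
      next
        case False
        show ?thesis using s0[OF j False] by (intro bigO0_cont continuous_intros) auto
      qed
    qed
    from bigO0_minus[OF this] show ?thesis by (simp add: log_t_deriv_def[abs_def])
  qed
  have Uinf: "((\<lambda>z. log_t_deriv t z) \<longlongrightarrow> 0) at_infinity"
  proof -
    have "((\<lambda>z. - (\<Sum>j\<in>?J. zs_dot t j * \<rho> j / (z - ?a j))) \<longlongrightarrow> - (\<Sum>j\<in>?J. 0)) at_infinity"
      by (intro tendsto_minus tendsto_sum tendsto_inverse_shift_infinity)
    then show ?thesis by (simp add: log_t_deriv_def[abs_def])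
  qed
  \<comment> \<open>the four limits at infinity from which the entries of \<open>B_infinity\<close> are formed\<close>
  define fi :: "complex^2" where "fi = vector [phi_coeff n t n, phib_coeff n t 0]"
  define dfi :: "complex^2" where "dfi = vector [phi_coeff' n t n, phib_coeff' n t 0]"
  define xi :: "complex^2" where "xi = vector [0, - 2 / \<kappa> t n]"
  define yi :: "complex^2" where "yi = vector [0, 2 * kappa_dot n t / (\<kappa> t n)\<^sup>2]"
  have "xi $ 1 = 0" "yi $ 1 = 0" by (simp_all add: xi_def yi_def)
  have Bi: "B_infinity \<kappa> \<phi>b n t $ 1 $ 1 = kappa_dot n t / \<kappa> t n" "B_infinity \<kappa> \<phi>b n t $ 1 $ 2 = 0"
    "B_infinity \<kappa> \<phi>b n t $ 2 $ 1 = (\<kappa> t n * phib_coeff' n t 0 + kappa_dot n t * phib_coeff n t 0) / (\<kappa> t n)\<^sup>2" "B_infinity \<kappa> \<phi>b n t $ 2 $ 2 = - (kappa_dot n t / \<kappa> t n)"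
    by (simp_all add: B_infinity_def Let_def vector_2 kappa_dot_def phib_coeff'_def phib_coeff_def poly_0_coeff_0)
  have k0: "\<kappa> t n \<noteq> 0" using b by simp
  have ctop: "phi_coeff n t n = \<kappa> t n" using b by (simp add: phi_coeff_def)
  have prem_y: "y z = weight.F (w t) z *s col1_dot n t z
        + (\<Sum>j\<in>?J. zs_dot t j * \<rho> j * (W.w0 + (z + ?a j) * W.pole_moment j) / (z - ?a j)) *s col1 n t z + (p1 z + p2 z) + (\<Sum>j\<in>?J. zs_dot t j * \<rho> j / (z - ?a j)) *s p z"
    if z: "norm z \<noteq> 1" "z \<noteq> 0" "z \<notin> ?a ` ?J" for z
  proof -
    have uk: "circle_integral (\<lambda>\<zeta>. w_dot t \<zeta> * kern z \<zeta>) = log_t_deriv t z * W.F z + (\<Sum>j\<in>?J. zs_dot t j * \<rho> j * (W.w0 + (z + ?a j) * W.pole_moment j) / (z - ?a j))"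
      using U_kernel[OF t z(1,3)] by (simp add: w_dot_def mult.assoc)
    show ?thesis unfolding y_def col2_dot_def p1(2)[OF z(1)] p2(2)[OF z(1)] p(2)[OF z(1)] uk F_eq[OF t, symmetric] Uneg[symmetric]
      by (simp add: Finite_Cartesian_Product.vec_eq_iff algebra_simps)
  qed
  have prem_O: "bigO0 n (\<lambda>z. y z $ i)" for i
    unfolding y_def using bigO0_diff[OF col2_dot_bigO[OF t n, of i] bigO0_mult[OF col2_bigO[OF t n, of i] UO]] by simp
  have prem_yinf: "((\<lambda>z. y z $ i) \<longlongrightarrow> yi $ i) at_infinity" for i
    unfolding y_def yi_def using tendsto_diff[OF col2_dot_infinity[OF t n, of i] tendsto_mult[OF Uinf col2_infinity[OF t n, of i]]] by simp
  have prem_B1: "dfi $ i * xi $ 2 - yi $ i * fi $ 2 = - 2 * B_infinity \<kappa> \<phi>b n t $ i $ 1" for i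
    by (rule forall_2I[of _ i])
       (use k0 in \<open>simp_all add: Bi dfi_def xi_def yi_def fi_def phi_coeff'_top[OF t] power2_eq_square field_simps\<close>)
  have prem_B2: "yi $ i * fi $ 1 - dfi $ i * xi $ 1 = - 2 * B_infinity \<kappa> \<phi>b n t $ i $ 2" for i
    by (rule forall_2I[of _ i])
       (use k0 in \<open>simp_all add: Bi dfi_def xi_def yi_def fi_def ctop power2_eq_square field_simps\<close>)
  note L = deformation_by_growth[where J="?J" and f="col1 n t" and p=p and df="col1_dot n t" and dp="\<lambda>z. p1 z + p2 z" and x="col2 n t" and y=y
      and a="?a" and F="weight.F (w t)" and s="zs_dot t" and \<rho>=\<rho> and cw="W.w0" and I="W.pole_moment" and A=A and n=n and fi=fi and dfi=dfi and xi=xi and yi=yi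
      and Binf="B_infinity \<kappa> \<phi>b n t" and z=z]
  have polys: "polyfun (\<lambda>z. (p1 z + p2 z) $ i)" for i unfolding vector_add_component by (intro polyfun_add p1 p2)
  have fdp: "polyfun (\<lambda>z. col1_dot n t z $ i)" for i unfolding col1_dot_def by (rule polyfun_poly_column)
  have pF: "col2 n t z = weight.F (w t) z *s col1 n t z + p z" if "norm z \<noteq> 1" "z \<noteq> 0" "z \<notin> ?a ` ?J" for z using p(2)[OF that(1)] F_eq[OF t] by simp
  have inf_f: "((\<lambda>z. col1 n t z $ i / z ^ n) \<longlongrightarrow> fi $ i) at_infinity" "((\<lambda>z. col1_dot n t z $ i / z ^ n) \<longlongrightarrow> dfi $ i) at_infinity" for i
    unfolding fi_def dfi_def col1_dot_def by (rule poly_column_infinity)+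
  have inf_x: "((\<lambda>z. col2 n t z $ i) \<longlongrightarrow> xi $ i) at_infinity" for i unfolding xi_def by (rule col2_infinity[OF t n])
  have dt: "col1 n t z $ 1 * col2 n t z $ 2 - col1 n t z $ 2 * col2 n t z $ 1 = - 2 * z ^ n" if "norm z \<noteq> 1" "z \<noteq> 0" "z \<notin> ?a ` ?J" for z
    by (rule determinant[OF t n that(1,2)])
  have xO: "bigO0 n (\<lambda>z. col2 n t z $ i)" for i by (rule col2_bigO[OF t n])
  have fJ: "finite ?J" by simp
  have fp: "polyfun (\<lambda>z. col1 n t z $ i)" for i by (rule polyfun_poly_column)
  have "col1_dot n t z + (\<Sum>j\<in>?J. (zs_dot t j / (z - ?a j)) *s (A j *v col1 n t z)) = B_infinity \<kappa> \<phi>b n t *v col1 n t z"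
    by (rule L(1)) (fact fJ fp p(1) fdp polys pF prem_y RR1 RR2 s0 dt xO prem_O inf_f inf_x prem_yinf prem_B1 prem_B2 z)+
  then show "col1_dot n t z = B_infinity \<kappa> \<phi>b n t *v col1 n t z - (\<Sum>j\<in>?J. (zs_dot t j / (z - ?a j)) *s (A j *v col1 n t z))"
    by (simp add: eq_diff_eq)
  have "y z + (\<Sum>j\<in>?J. (zs_dot t j / (z - ?a j)) *s (A j *v col2 n t z)) = B_infinity \<kappa> \<phi>b n t *v col2 n t z"
    by (rule L(2)) (fact fJ fp p(1) fdp polys pF prem_y RR1 RR2 s0 dt xO prem_O inf_f inf_x prem_yinf prem_B1 prem_B2 z)+
  then show "col2_dot n t z = B_infinity \<kappa> \<phi>b n t *v col2 n t z - (\<Sum>j\<in>?J. (zs_dot t j / (z - ?a j)) *s (A j *v col2 n t z)) + log_t_deriv t z *s col2 n t z"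
    unfolding y_def by (simp add: algebra_simps)
qed

end

section \<open>The Schlesinger equations\<close>

context biorth_family
begin

lemma Y_first_column:
  assumes t: "t \<in> U" and z: "z \<noteq> 0"
  shows "Y_matrix (w t) (\<phi> t) (\<phi>b t) n z $ i $ 1 = col1 n t z $ i"
proof -
  note b = bio_facts[OF t]
  have 2: "z ^ n * poly (\<phi>b t n) (1 / z) = (\<Sum>k\<le>n. phib_coeff n t k * z ^ (n - k))"
  proof -
    have P: "poly (\<phi>b t n) (1 / z) = (\<Sum>k\<le>n. phib_coeff n t k * (1 / z) ^ k)"
      unfolding phib_coeff_def by (rule poly_sum_le) (simp add: b)
    have "z ^ n * (phib_coeff n t k * (1 / z) ^ k) = phib_coeff n t k * z ^ (n - k)" if "k \<le> n" for k
      using z that by (simp add: power_diff power_one_over field_simps)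
    then show ?thesis unfolding P sum_distrib_left by (intro sum.cong refl) (simp only: atMost_iff)
  qed
  have 1: "poly (\<phi> t n) z = (\<Sum>k\<le>n. phi_coeff n t k * z ^ k)"
    unfolding phi_coeff_def by (rule poly_sum_le) (simp add: b)
  show ?thesis
    by (rule forall_2I[of _ i]) (simp_all add: Y_matrix_def poly_column_def phi_star_def 1 2)
qed

text \<open>Multiplication by the weight turns the second column of \<open>Y\<close> into an expression that is analytic off the circle.\<close>

lemma Y_second_column:
  assumes t: "t \<in> U" and z: "norm z \<noteq> 1"
  shows "Y_matrix (w t) (\<phi> t) (\<phi>b t) n z $ i $ 2 = col2 n t z $ i / w t z"
proof -
  note b = bio_facts[OF t]
  note I = weight.w_mult_integrable[OF wt[OF t]]
  have 1: "epsilon (w t) (\<phi> t) n z = col2 n t z $ 1"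
  proof -
    have "epsilon (w t) (\<phi> t) n z = circle_integral (\<lambda>\<zeta>. \<Sum>k\<le>n. phi_coeff n t k * (w t \<zeta> * (\<zeta> ^ k * kern z \<zeta>)))"
      unfolding epsilon_def
    proof (rule circle_cong)
      fix \<zeta> :: complex
      have P: "poly (\<phi> t n) \<zeta> = (\<Sum>k\<le>n. phi_coeff n t k * \<zeta> ^ k)" unfolding phi_coeff_def by (rule poly_sum_le) (simp add: b)
      show "(\<zeta> + z) / (\<zeta> - z) * w t \<zeta> * poly (\<phi> t n) \<zeta> = (\<Sum>k\<le>n. phi_coeff n t k * (w t \<zeta> * (\<zeta> ^ k * kern z \<zeta>)))"
        unfolding P kern_def sum_distrib_left by (intro sum.cong refl) (simp only: mult_ac)
    qed
    also have "\<dots> = (\<Sum>k\<le>n. circle_integral (\<lambda>\<zeta>. phi_coeff n t k * (w t \<zeta> * (\<zeta> ^ k * kern z \<zeta>))))"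
      by (rule ci_sum) (intro finite_atMost circle_integrable_cmult I continuous_on_mult pow_cont kern_cont z)+
    finally show ?thesis by (simp only: kernel_column_def vector_2_nth ci_cmult)
  qed
  have 2: "- epsilon_star (w t) (\<phi>b t) n z = col2 n t z $ 2"
  proof -
    have "- epsilon_star (w t) (\<phi>b t) n z = z ^ n * circle_integral (\<lambda>\<zeta>. \<Sum>k\<le>n. phib_coeff n t k * (w t \<zeta> * ((1 / \<zeta>) ^ k * kern z \<zeta>)))"
      unfolding epsilon_star_def minus_mult_left[symmetric] minus_minus
    proof (rule arg_cong[of _ _ "\<lambda>x. z ^ n * x"], rule circle_cong)
      fix \<zeta> :: complex
      have P: "poly (\<phi>b t n) (1 / \<zeta>) = (\<Sum>k\<le>n. phib_coeff n t k * (1 / \<zeta>) ^ k)" unfolding phib_coeff_def by (rule poly_sum_le) (simp add: b)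
      show "(\<zeta> + z) / (\<zeta> - z) * w t \<zeta> * poly (\<phi>b t n) (1 / \<zeta>) = (\<Sum>k\<le>n. phib_coeff n t k * (w t \<zeta> * ((1 / \<zeta>) ^ k * kern z \<zeta>)))"
        unfolding P kern_def sum_distrib_left by (intro sum.cong refl) (simp only: mult_ac)
    qed
    also have "circle_integral (\<lambda>\<zeta>. \<Sum>k\<le>n. phib_coeff n t k * (w t \<zeta> * ((1 / \<zeta>) ^ k * kern z \<zeta>)))
        = (\<Sum>k\<le>n. circle_integral (\<lambda>\<zeta>. phib_coeff n t k * (w t \<zeta> * ((1 / \<zeta>) ^ k * kern z \<zeta>))))"
      by (rule ci_sum) (intro finite_atMost circle_integrable_cmult I continuous_on_mult inv_power_cont kern_cont z)+
    finally show ?thesis by (simp only: kernel_column_def vector_2_nth ci_cmult sum_distrib_left mult.left_commute[of "z ^ n"])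
  qed
  show ?thesis
    by (rule forall_2I[of _ i]) (simp_all add: Y_matrix_def 1 2[symmetric])
qed

text \<open>The product rule for \<open>(x / w) w\<close> adds the multiple \<open>w' / w\<close> to the equation of the second column.\<close>

lemma spectral_columns:
  assumes t: "t \<in> U" and z: "z \<notin> C t" "norm z \<noteq> 1" "z \<noteq> 0"
    and spec: "spectral_equation (- C t - sphere 0 1) (Y_matrix (w t) (\<phi> t) (\<phi>b t) n) S"
  shows "poly_column' n (phi_coeff n t) (phib_coeff n t) z = S z *v col1 n t z"
    and "col2' n t z = S z *v col2 n t z + weight.log_z_deriv m (zs t) \<rho> z *s col2 n t z"
proof -
  interpret W: weight m "zs t" \<rho> "C t" "w t" using wt[OF t] .
  let ?Y = "Y_matrix (w t) (\<phi> t) (\<phi>b t) n"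
  define D where "D = - C t - sphere 0 1 - {0::complex}"
  have D: "open D" "z \<in> D"
    unfolding D_def using z W.closed_C by (auto intro!: open_Diff open_Compl)
  have Y: "((\<lambda>x. ?Y x $ i $ k) has_field_derivative S z $ i $ 1 * ?Y z $ 1 $ k + S z $ i $ 2 * ?Y z $ 2 $ k) (at z)" for i k
    using spec z unfolding spectral_equation_def by (simp add: matrix_matrix_mult_def sum_2)
  have 1: "((\<lambda>x. col1 n t x $ i) has_field_derivative S z $ i $ 1 * col1 n t z $ 1 + S z $ i $ 2 * col1 n t z $ 2) (at z)" for i
    by (rule has_field_derivative_transform_within_open[OF Y[of i 1, unfolded Y_first_column[OF t z(3)]] D])
       (simp add: Y_first_column[OF t] D_def)
  have "poly_column' n (phi_coeff n t) (phib_coeff n t) z $ i = S z $ i $ 1 * col1 n t z $ 1 + S z $ i $ 2 * col1 n t z $ 2" for i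
    by (rule DERIV_unique[OF poly_column_z_deriv 1])
  then show "poly_column' n (phi_coeff n t) (phib_coeff n t) z = S z *v col1 n t z"
    by (simp add: Finite_Cartesian_Product.vec_eq_iff matrix_vector_mult_def sum_2)
  have w0: "w t x \<noteq> 0" if "x \<in> D" for x by (rule W.weight_nonzero) (use that in \<open>simp add: D_def\<close>)
  have 2: "((\<lambda>x. col2 n t x $ i) has_field_derivative
      S z $ i $ 1 * col2 n t z $ 1 + S z $ i $ 2 * col2 n t z $ 2 + W.log_z_deriv z * col2 n t z $ i) (at z)" for i
  proof -
    have "((\<lambda>x. ?Y x $ i $ 2 * w t x) has_field_derivative
        (S z $ i $ 1 * ?Y z $ 1 $ 2 + S z $ i $ 2 * ?Y z $ 2 $ 2) * w t z + W.log_z_deriv z * w t z * ?Y z $ i $ 2) (at z)"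
      by (rule DERIV_mult[OF Y W.weight_z_deriv[OF z(1)]])
    also have "(S z $ i $ 1 * ?Y z $ 1 $ 2 + S z $ i $ 2 * ?Y z $ 2 $ 2) * w t z + W.log_z_deriv z * w t z * ?Y z $ i $ 2
        = S z $ i $ 1 * col2 n t z $ 1 + S z $ i $ 2 * col2 n t z $ 2 + W.log_z_deriv z * col2 n t z $ i"
      unfolding Y_second_column[OF t z(2)] using w0[OF D(2)] by (simp add: field_simps)
    finally have d: "((\<lambda>x. ?Y x $ i $ 2 * w t x) has_field_derivative
        S z $ i $ 1 * col2 n t z $ 1 + S z $ i $ 2 * col2 n t z $ 2 + W.log_z_deriv z * col2 n t z $ i) (at z)" .
    have e: "?Y x $ i $ 2 * w t x = col2 n t x $ i" if "x \<in> D" for x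
      using w0[OF that] that by (simp add: Y_second_column[OF t] D_def)
    show ?thesis by (rule has_field_derivative_transform_within_open[OF d D e])
  qed
  have "col2' n t z $ i = S z $ i $ 1 * col2 n t z $ 1 + S z $ i $ 2 * col2 n t z $ 2 + W.log_z_deriv z * col2 n t z $ i" for i
    by (rule DERIV_unique[OF kernel_column_z_deriv[OF w_integrable[OF t] z(2)] 2])
  then show "col2' n t z = S z *v col2 n t z + W.log_z_deriv z *s col2 n t z"
    by (simp add: Finite_Cartesian_Product.vec_eq_iff matrix_vector_mult_def sum_2)
qed

text \<open>Differentiating in \<open>t\<close> at fixed \<open>z\<close> needs points that avoid the cuts for all nearby \<open>t\<close>. On the circle there are only
finitely many exceptional points, so a point of the circle off the cut exists; openness of the joint domain gives a
neighbourhood of it, and the circle itself and 0 are then removed.\<close>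

lemma fixed_domain:
  assumes t0: "t0 \<in> U"
  obtains D where "open D" "D \<noteq> {}" "\<And>z. z \<in> D \<Longrightarrow> norm z \<noteq> 1 \<and> z \<noteq> 0"
    "eventually (\<lambda>t. t \<in> U \<and> (\<forall>z\<in>D. z \<notin> C t)) (nhds t0)"
proof -
  interpret W: weight m "zs t0" \<rho> "C t0" "w t0" using wt[OF t0] .
  have "infinite (sphere 0 1 :: complex set)"
  proof
    assume fin: "finite (sphere 0 1 :: complex set)"
    have "connected (sphere (0::complex) 1)" by (rule connected_sphere) simp
    from iffD1[OF connected_finite_iff_sing[OF this] fin] obtain x where "sphere (0::complex) 1 = {x}" by auto
    moreover have "1 \<in> sphere (0::complex) 1" "-1 \<in> sphere (0::complex) 1" by simp_all
    ultimately have "1 = (-1::complex)" by (metis singletonD)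
    then show False by simp
  qed
  then have "\<not> sphere 0 1 \<subseteq> W.exceptional" using finite_subset[OF _ W.finite_exceptional] by auto
  then obtain \<zeta> where \<zeta>: "norm \<zeta> = 1" "\<zeta> \<notin> W.exceptional" by (auto simp: subset_iff)
  then have "(t0, \<zeta>) \<in> {(t, z). t \<in> U \<and> z \<notin> C t}" using t0 W.not_exceptional by auto
  from open_prod_elim[OF open_dom this] obtain T B
    where "open T" "open B" "(t0, \<zeta>) \<in> T \<times> B" and sub: "T \<times> B \<subseteq> {(t, z). t \<in> U \<and> z \<notin> C t}" .
  then have TB: "open T" "open B" "t0 \<in> T" "\<zeta> \<in> B" by auto
  have TB5: "t \<in> U \<and> z \<notin> C t" if "t \<in> T" "z \<in> B" for t z using sub that by blast
  define D where "D = B \<inter> ball 0 1 - {0}"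
  show thesis
  proof
    show D: "open D" unfolding D_def using TB(2) by (intro open_Diff) auto
    show "D \<noteq> {}"
    proof
      assume "D = {}"
      then have "B \<inter> ball 0 1 \<subseteq> {0}" by (auto simp: D_def)
      then have f: "finite (B \<inter> ball 0 1)" by (rule finite_subset) simp
      have "\<zeta> \<in> closure (ball 0 1)" using \<zeta>(1) by simp
      then have "B \<inter> ball 0 1 \<noteq> {}" using TB(2,4) open_Int_closure_eq_empty[of B "ball 0 1"] by blast
      then show False using f finite_imp_not_open[of "B \<inter> ball 0 1"] TB(2) by blast
    qed
    show "norm z \<noteq> 1 \<and> z \<noteq> 0" if "z \<in> D" for z using that by (auto simp: D_def)
    show "eventually (\<lambda>t. t \<in> U \<and> (\<forall>z\<in>D. z \<notin> C t)) (nhds t0)"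
      using eventually_nhds_in_open[OF TB(1,3)] by eventually_elim (use TB5 TB(4) in \<open>unfold D_def, blast\<close>)
  qed
qed

lemma log_t_deriv_z_deriv:
  assumes "z \<notin> zs t ` {1..m}"
  shows "(log_t_deriv t has_field_derivative (\<Sum>j\<in>{1..m}. \<rho> j * zs_dot t j / (z - zs t j)\<^sup>2)) (at z)"
proof -
  have "((\<lambda>z. - (\<Sum>j\<in>{1..m}. zs_dot t j * \<rho> j / (z - zs t j))) has_field_derivative
      - (\<Sum>j\<in>{1..m}. - (\<rho> j * zs_dot t j / (z - zs t j)\<^sup>2))) (at z)"
  proof (intro DERIV_minus DERIV_sum)
    fix j assume "j \<in> {1..m}"
    then have "z - zs t j \<noteq> 0" using assms by auto
    then show "((\<lambda>z. zs_dot t j * \<rho> j / (z - zs t j)) has_field_derivative - (\<rho> j * zs_dot t j / (z - zs t j)\<^sup>2)) (at z)"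
      by (auto intro!: derivative_eq_intros simp: power2_eq_square)
  qed
  then show ?thesis by (simp add: log_t_deriv_def[abs_def] sum_negf)
qed

lemma log_z_deriv_t_deriv:
  assumes t: "t \<in> U" and z: "z \<notin> zs t ` {1..m}"
  shows "((\<lambda>s. weight.log_z_deriv m (zs s) \<rho> z) has_vector_derivative (\<Sum>j\<in>{1..m}. \<rho> j * zs_dot t j / (z - zs t j)\<^sup>2)) (at t)"
proof -
  have "((\<lambda>s. \<Sum>j\<in>{1..m}. \<rho> j / (z - zs s j)) has_vector_derivative (\<Sum>j\<in>{1..m}. \<rho> j * zs_dot t j / (z - zs t j)\<^sup>2)) (at t)"
  proof (rule has_vector_derivative_sum)
    fix j assume j: "j \<in> {1..m}"
    then have n: "z - zs t j \<noteq> 0" using z by auto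
    have "((\<lambda>x. \<rho> j / (z - x)) has_field_derivative \<rho> j / (z - zs t j)\<^sup>2) (at (zs t j))"
      using n by (auto intro!: derivative_eq_intros simp: power2_eq_square)
    from field_vector_diff_chain_at[OF zs_deriv[OF t j] this]
    show "((\<lambda>s. \<rho> j / (z - zs s j)) has_vector_derivative \<rho> j * zs_dot t j / (z - zs t j)\<^sup>2) (at t)"
      by (simp add: o_def field_simps)
  qed
  moreover have "eventually (\<lambda>s. (\<Sum>j\<in>{1..m}. \<rho> j / (z - zs s j)) = weight.log_z_deriv m (zs s) \<rho> z) (nhds t)"
    using eventually_nhds_in_open[OF open_U t] by eventually_elim (simp add: weight.log_z_deriv_def[OF wt])
  ultimately show ?thesis
    using has_vector_derivative_transform_within_open[OF _ open_U t, of "\<lambda>s. \<Sum>j\<in>{1..m}. \<rho> j / (z - zs s j)"]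
    by (simp add: weight.log_z_deriv_def[OF wt])
qed

theorem schlesinger:
  fixes A :: "real \<Rightarrow> nat \<Rightarrow> complex^2^2"
  assumes t0: "t0 \<in> U" and n: "n \<ge> 1" and m: "m \<ge> 1" and z1: "\<And>s. s \<in> U \<Longrightarrow> zs s 1 = 0"
    and spec: "\<And>t. t \<in> U \<Longrightarrow> spectral_equation (- C t - sphere 0 1) (Y_matrix (w t) (\<phi> t) (\<phi>b t) n)
           (partial_fraction_matrix m (zs t) (A t))"
  shows "\<forall>j\<in>{1..m}. ((\<lambda>t. A t j) has_vector_derivative
      (commutator (B_infinity \<kappa> \<phi>b n t0) (A t0 j)
       + (\<Sum>k\<in>{1..m} - {j}. smult_matrix ((zs_dot t0 j - zs_dot t0 k) / (zs t0 j - zs t0 k)) (commutator (A t0 k) (A t0 j))))) (at t0)"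
proof -
  obtain D where D: "open D" "D \<noteq> {}" "\<And>z. z \<in> D \<Longrightarrow> norm z \<noteq> 1 \<and> z \<noteq> 0"
    "eventually (\<lambda>t. t \<in> U \<and> (\<forall>z\<in>D. z \<notin> C t)) (nhds t0)"
    by (rule fixed_domain[OF t0]) blast
  have D0: "z \<notin> C t0" if "z \<in> D" for z using eventually_nhds_x_imp_x[OF D(4)] that by blast
  have pts: "z \<notin> zs t ` {1..m}" if "t \<in> U" "z \<notin> C t" for t z
    using weight.ne_point[OF wt[OF that(1)] that(2)] by blast
  define S where "S t = partial_fraction_matrix m (zs t) (A t)" for t
  have cols: "poly_column' n (phi_coeff n t) (phib_coeff n t) z = S t z *v col1 n t z"
       "col2' n t z = S t z *v col2 n t z + weight.log_z_deriv m (zs t) \<rho> z *s col2 n t z"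
    if "t \<in> U" "z \<notin> C t" "z \<in> D" for t z
    using spectral_columns[OF that(1,2) _ _ spec[OF that(1)]] D(3)[OF that(3)] unfolding S_def by blast+
  \<comment> \<open>column 1 is polynomial and satisfies both equations without a scalar term\<close>
  define X where "X c t z = (if c = (1::2) then col1 n t z else col2 n t z)" for c t z
  define X' where "X' c t z = (if c = (1::2) then poly_column' n (phi_coeff n t) (phib_coeff n t) z else col2' n t z)" for c t z
  define dX where "dX c z = (if c = (1::2) then col1_dot n t0 z else col2_dot n t0 z)" for c z
  define Q where "Q c z = (if c = (1::2) then poly_column' n (phi_coeff' n t0) (phib_coeff' n t0) z else col2_dot' n t0 z)" for c z
  define v where "v c t z = (if c = (1::2) then 0 else weight.log_z_deriv m (zs t) \<rho> z)" for c t z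
  define u where "u c z = (if c = (1::2) then 0 else log_t_deriv t0 z)" for c z
  define v' where "v' c z = (if c = (1::2) then 0 else (\<Sum>j\<in>{1..m}. \<rho> j * zs_dot t0 j / (z - zs t0 j)\<^sup>2))" for c z
  have infD: "infinite D" using D(1,2) by (meson finite_imp_not_open)
  have L: "col1_dot n t0 z = B_infinity \<kappa> \<phi>b n t0 *v col1 n t0 z - (\<Sum>j\<in>{1..m}. (zs_dot t0 j / (z - zs t0 j)) *s (A t0 j *v col1 n t0 z))"
     "col2_dot n t0 z = B_infinity \<kappa> \<phi>b n t0 *v col2 n t0 z - (\<Sum>j\<in>{1..m}. (zs_dot t0 j / (z - zs t0 j)) *s (A t0 j *v col2 n t0 z)) + log_t_deriv t0 z *s col2 n t0 z"
    if z: "z \<in> D" for z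
  proof -
    have S: "norm z \<noteq> 1 \<and> z \<noteq> 0 \<and> z \<notin> zs t0 ` {1..m}" if "z \<in> D" for z
      using D(3)[OF that] pts[OF t0 D0[OF that]] by blast
    have c1: "poly_column' n (phi_coeff n t0) (phib_coeff n t0) z = partial_fraction_matrix m (zs t0) (A t0) z *v col1 n t0 z" if "z \<in> D" for z
      using cols(1)[OF t0 D0[OF that] that] by (simp only: S_def)
    have c2: "col2' n t0 z = partial_fraction_matrix m (zs t0) (A t0) z *v col2 n t0 z + weight.log_z_deriv m (zs t0) \<rho> z *s col2 n t0 z" if "z \<in> D" for z
      using cols(2)[OF t0 D0[OF that] that] by (simp only: S_def)
    have zz: "norm z \<noteq> 1" "z \<noteq> 0" "z \<notin> zs t0 ` {1..m}" using S[OF z] by blast+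
    show "col1_dot n t0 z = B_infinity \<kappa> \<phi>b n t0 *v col1 n t0 z - (\<Sum>j\<in>{1..m}. (zs_dot t0 j / (z - zs t0 j)) *s (A t0 j *v col1 n t0 z))"
      by (rule deformation_equations(1)[where S=D and A="A t0" and t=t0]) (fact t0 n z1 m infD S c1 c2 zz)+
    show "col2_dot n t0 z = B_infinity \<kappa> \<phi>b n t0 *v col2 n t0 z - (\<Sum>j\<in>{1..m}. (zs_dot t0 j / (z - zs t0 j)) *s (A t0 j *v col2 n t0 z)) + log_t_deriv t0 z *s col2 n t0 z"
      by (rule deformation_equations(2)[where S=D and A="A t0" and t=t0]) (fact t0 n z1 m infD S c1 c2 zz)+
  qed
  have h1: "inj_on (zs t0) {1..m}" by (rule weight.distinct[OF wt[OF t0]])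
  have h2: "((\<lambda>t. zs t j) has_vector_derivative zs_dot t0 j) (at t0)" if "j \<in> {1..m}" for j by (rule zs_deriv[OF t0 that])
  have h3: "eventually (\<lambda>t. \<forall>z\<in>D. z \<notin> zs t ` {1..m}) (nhds t0)"
    by (rule eventually_mono[OF D(4)]) (use pts in blast)
  have h4: "eventually (\<lambda>t. \<forall>z\<in>D. \<forall>c. X' c t z = partial_fraction_matrix m (zs t) (A t) z *v X c t z + v c t z *s X c t z) (nhds t0)"
  proof (rule eventually_mono[OF D(4)], intro ballI allI)
    fix t z and c :: 2
    assume "t \<in> U \<and> (\<forall>z\<in>D. z \<notin> C t)" and z: "z \<in> D"
    then have tz: "t \<in> U" "z \<notin> C t" by blast+
    show "X' c t z = partial_fraction_matrix m (zs t) (A t) z *v X c t z + v c t z *s X c t z"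
    proof (cases "c = 1")
      case True
      then show ?thesis unfolding X'_def X_def v_def using cols(1)[OF tz z] by (simp only: S_def simp_thms if_True vector_smult_lzero add_0_right)
    next
      case False
      then show ?thesis unfolding X'_def X_def v_def using cols(2)[OF tz z] by (simp only: S_def simp_thms if_False)
    qed
  qed
  have h5: "eventually (\<lambda>t. \<forall>z\<in>D. X 1 t z $ 1 * X 2 t z $ 2 - X 1 t z $ 2 * X 2 t z $ 1 \<noteq> 0) (nhds t0)"
  proof (rule eventually_mono[OF D(4)], intro ballI)
    fix t z assume t: "t \<in> U \<and> (\<forall>z\<in>D. z \<notin> C t)" and z: "z \<in> D"
    have "X 1 t z $ 1 * X 2 t z $ 2 - X 1 t z $ 2 * X 2 t z $ 1 = - 2 * z ^ n"
      using determinant[where t=t and n=n and z=z] t n D(3)[OF z] by (simp add: X_def)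
    then show "X 1 t z $ 1 * X 2 t z $ 2 - X 1 t z $ 2 * X 2 t z $ 1 \<noteq> 0" using D(3)[OF z] by simp
  qed
  have zn: "norm z \<noteq> 1" if "z \<in> D" for z using D(3)[OF that] by blast
  have zp: "z \<notin> zs t0 ` {1..m}" if "z \<in> D" for z by (rule pts[OF t0 D0[OF that]])
  have h6: "((\<lambda>t. X c t z $ i) has_vector_derivative dX c z $ i) (at t0)" if "z \<in> D" for z c i
    using col1_t_deriv[OF t0] col2_t_deriv[OF t0 zn[OF that]] by (cases "c = 1") (simp_all only: X_def dX_def simp_thms if_True if_False)
  have h7: "dX c z = B_infinity \<kappa> \<phi>b n t0 *v X c t0 z - (\<Sum>j\<in>{1..m}. (zs_dot t0 j / (z - zs t0 j)) *s (A t0 j *v X c t0 z)) + u c z *s X c t0 z"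
    if z: "z \<in> D" for z c
  proof (cases "c = 1")
    case True
    then show ?thesis unfolding X_def dX_def u_def using L(1)[OF z] by (simp only: simp_thms if_True vector_smult_lzero add_0_right)
  next
    case False
    then show ?thesis unfolding X_def dX_def u_def using L(2)[OF z] by (simp only: simp_thms if_False)
  qed
  have h8: "((\<lambda>z. X c t0 z $ i) has_field_derivative X' c t0 z $ i) (at z)" if "z \<in> D" for z c i
    using poly_column_z_deriv kernel_column_z_deriv[OF w_integrable[OF t0] zn[OF that]] by (cases "c = 1") (simp_all only: X_def X'_def simp_thms if_True if_False)
  have h9: "((\<lambda>t. X' c t z $ i) has_vector_derivative Q c z $ i) (at t0)" if "z \<in> D" for z c i
    using col1'_t_deriv[OF t0] col2'_t_deriv[OF t0 zn[OF that]] by (cases "c = 1") (simp_all only: X'_def Q_def simp_thms if_True if_False)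
  have h10: "((\<lambda>z. dX c z $ i) has_field_derivative Q c z $ i) (at z)" if "z \<in> D" for z c i
    using poly_column_z_deriv col2_dot_z_deriv[OF t0 zn[OF that]] by (cases "c = 1") (simp_all only: dX_def Q_def col1_dot_def simp_thms if_True if_False)
  have h11: "((\<lambda>t. v c t z) has_vector_derivative v' c z) (at t0)" if "z \<in> D" for z c
    using log_z_deriv_t_deriv[OF t0 zp[OF that]] by (cases "c = 1") (simp_all only: v_def v'_def simp_thms if_True if_False has_vector_derivative_const)
  have h12: "(u c has_field_derivative v' c z) (at z)" if "z \<in> D" for z c
    using log_t_deriv_z_deriv[OF zp[OF that]] by (cases "c = 1") (simp_all only: u_def[abs_def] v'_def simp_thms if_True if_False DERIV_const)
  show ?thesis
    by (rule schlesinger_from_cross_differentiation[where zs=zs and A=A and s="zs_dot t0" and ?t0.0=t0 and m=m and D=D and Binf="B_infinity \<kappa> \<phi>b n t0"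
          and X=X and X'=X' and dX=dX and Q=Q and v=v and u=u and v'=v', OF h1 D(1,2) h2 h3 h4 h5 h6 h7 h8 h9 h10 h11 h12])
qed

end

text \<open>The summand is antisymmetric in \<open>j\<close> and \<open>k\<close>: the scalar factor is symmetric and the commutator changes sign. Hence the sum
of all residue matrices evolves by \<open>B\<^sub>\<infinity>\<close> alone.\<close>

lemma commutator_sum_antisymmetric:
  fixes A :: "nat \<Rightarrow> complex^2^2"
  shows "(\<Sum>j\<in>{1..m}. \<Sum>k\<in>{1..m} - {j}. smult_matrix ((s j - s k) / (a j - a k)) (commutator (A k) (A j))) = 0"
proof -
  define g where "g j k = smult_matrix ((s j - s k) / (a j - a k)) (commutator (A k) (A j))" for j k
  have anti: "g j k = - g k j" for j k
  proof -
    have e: "(s k - s j) / (a k - a j) = (s j - s k) / (a j - a k)"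
      by (metis minus_diff_eq minus_divide_left minus_divide_right minus_minus)
    show ?thesis unfolding g_def e
      by (simp add: Finite_Cartesian_Product.vec_eq_iff smult_matrix_def map_matrix_def commutator_def minus_divide_left right_diff_distrib)
  qed
  have diag: "g j j = 0" for j by (simp add: g_def smult_matrix_def map_matrix_def Finite_Cartesian_Product.vec_eq_iff)
  have full: "(\<Sum>j\<in>{1..m}. \<Sum>k\<in>{1..m} - {j}. g j k) = (\<Sum>j\<in>{1..m}. \<Sum>k\<in>{1..m}. g j k)" (is "_ = ?s")
  proof (rule sum.cong[OF refl])
    fix j assume "j \<in> {1..m}"
    then show "(\<Sum>k\<in>{1..m} - {j}. g j k) = (\<Sum>k\<in>{1..m}. g j k)" by (simp only: sum.remove[of "{1..m}" j] finite_atLeastAtMost diag add_0_left)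
  qed
  have "?s = (\<Sum>j\<in>{1..m}. \<Sum>k\<in>{1..m}. - g k j)" by (rule sum.cong[OF refl], rule sum.cong[OF refl], rule anti)
  also have "\<dots> = - (\<Sum>j\<in>{1..m}. \<Sum>k\<in>{1..m}. g k j)" by (simp only: sum_negf)
  also have "(\<Sum>j\<in>{1..m}. \<Sum>k\<in>{1..m}. g k j) = ?s" by (rule sum.swap)
  finally have "?s = - ?s" .
  then have "?s = 0" by (simp add: Finite_Cartesian_Product.vec_eq_iff)
  then show ?thesis using full by (simp add: g_def)
qed

lemma commutator_sum_right: "(\<Sum>j\<in>J. commutator B (A j)) = commutator B (\<Sum>j\<in>J. A j)"
  by (induction J rule: infinite_finite_induct)
     (simp_all add: Finite_Cartesian_Product.vec_eq_iff commutator_entry algebra_simps)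

lemma commutator_minus_right: "commutator B (- M) = - commutator B M"
  by (simp add: Finite_Cartesian_Product.vec_eq_iff commutator_entry)

theorem mainTheorem10:
  fixes U :: "real set" and m n :: nat
    and zs :: "real \<Rightarrow> nat \<Rightarrow> complex" and \<rho> :: "nat \<Rightarrow> complex"
    and C :: "real \<Rightarrow> complex set" and w :: "real \<Rightarrow> complex \<Rightarrow> complex"
    and \<kappa> :: "real \<Rightarrow> nat \<Rightarrow> complex"
    and \<phi> \<phi>b :: "real \<Rightarrow> nat \<Rightarrow> complex poly"
    and A :: "real \<Rightarrow> nat \<Rightarrow> complex^2^2"
  assumes "open U" and "2 \<le> m" and "1 \<le> n"
    and distinct_points: "\<And>t. t \<in> U \<Longrightarrow> inj_on (zs t) {1..m}"
    and points_differentiable: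
      "\<And>t j. t \<in> U \<Longrightarrow> j \<in> {1..m} \<Longrightarrow> (\<lambda>s. zs s j) differentiable (at t)"
    and first_point: "\<And>t. t \<in> U \<Longrightarrow> zs t 1 = 0"
    and exponents: "\<And>j. j \<in> {1..m} \<Longrightarrow> \<rho> j \<notin> \<nat>"
    and branch: "analytic_branch_family U m zs \<rho> C w"
    and closed: "\<And>t. t \<in> U \<Longrightarrow> closed_on_circle (w t)"
    and integrable: "\<And>t (j::int). t \<in> U \<Longrightarrow> circle_integrable (\<lambda>\<zeta>. \<zeta> powi j * w t \<zeta>)"
    and integrable_deriv:
      "\<And>t (j::int). t \<in> U \<Longrightarrow> circle_integrable (\<lambda>\<zeta>. \<zeta> powi j * deriv (w t) \<zeta>)"
    and toeplitz: "\<And>t N. t \<in> U \<Longrightarrow> 1 \<le> N \<Longrightarrow> toeplitz_det (w t) N \<noteq> 0"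
    and biorthonormal: "\<And>t. t \<in> U \<Longrightarrow> biorthonormal_system (w t) (\<kappa> t) (\<phi> t) (\<phi>b t)"
    and kappa_differentiable: "\<And>t N. t \<in> U \<Longrightarrow> (\<lambda>s. \<kappa> s N) differentiable (at t)"
    and nonzero_at_0: "\<And>t N. t \<in> U \<Longrightarrow> poly (\<phi> t N) 0 \<noteq> 0 \<and> poly (\<phi>b t N) 0 \<noteq> 0"
    and residue_matrices:
      "\<And>t. t \<in> U \<Longrightarrow>
         spectral_equation (- C t - sphere 0 1) (Y_matrix (w t) (\<phi> t) (\<phi>b t) n)
           (partial_fraction_matrix m (zs t) (A t))"
  shows "\<forall>t\<in>U.
     (\<forall>j\<in>{1..m}.
        ((\<lambda>s. A s j) has_vector_derivative
           (commutator (B_infinity \<kappa> \<phi>b n t) (A t j)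
            + (\<Sum>k\<in>{1..m} - {j}.
                 smult_matrix
                   ((vector_derivative (\<lambda>s. zs s j) (at t) - vector_derivative (\<lambda>s. zs s k) (at t))
                     / (zs t j - zs t k))
                   (commutator (A t k) (A t j))))) (at t)) \<and>
     ((\<lambda>s. - (\<Sum>j\<in>{1..m}. A s j)) has_vector_derivative
        commutator (B_infinity \<kappa> \<phi>b n t) (- (\<Sum>j\<in>{1..m}. A t j))) (at t)"
proof -
  have br: "open {(t, z). t \<in> U \<and> z \<notin> C t}" "continuous_on {(t, z). t \<in> U \<and> z \<notin> C t} (\<lambda>(t, z). w t z)"
    "\<And>t. t \<in> U \<Longrightarrow> w t holomorphic_on - C t"
    "\<And>t z. t \<in> U \<Longrightarrow> z \<notin> C t \<Longrightarrow> w t z \<in> power_product_values {1..m} (zs t) \<rho> z"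
    "\<And>t. t \<in> U \<Longrightarrow> sphere 0 1 \<inter> C t \<subseteq> insert (-1) (zs t ` {1..m})"
    using branch unfolding analytic_branch_family_def by blast+
  interpret biorth_family U m zs \<rho> C w \<kappa> \<phi> \<phi>b
  proof (intro biorth_family.intro weight_family.intro biorth_family_axioms.intro)
    fix t assume t: "t \<in> U"
    show "weight m (zs t) \<rho> (C t) (w t)"
    proof
      show "\<rho> j \<noteq> 0" if "j \<in> {1..m}" for j using exponents[OF that] by auto
      have "open ((\<lambda>z. (t, z)) -` {(t, z). t \<in> U \<and> z \<notin> C t})" by (intro open_vimage br(1) continuous_intros)
      moreover have "(\<lambda>z. (t, z)) -` {(t, z). t \<in> U \<and> z \<notin> C t} = - C t" using t by auto
      ultimately show "closed (C t)" by (simp add: closed_def)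
      show "continuous_on (- C t) (w t)" by (rule holomorphic_on_imp_continuous_on[OF br(3)[OF t]])
    qed (fact distinct_points[OF t] br(4)[OF t] br(5)[OF t] closed[OF t] integrable[OF t] integrable_deriv[OF t])+
  qed (fact assms(1) points_differentiable br(1,2) biorthonormal kappa_differentiable)+
  show ?thesis
  proof (intro ballI conjI)
    fix t assume t: "t \<in> U"
    let ?B = "B_infinity \<kappa> \<phi>b n t"
    have m1: "m \<ge> 1" using assms(2) by simp
    note main = schlesinger[OF t assms(3) m1 first_point residue_matrices]
    then show "((\<lambda>s. A s j) has_vector_derivative
           (commutator ?B (A t j)
            + (\<Sum>k\<in>{1..m} - {j}.
                 smult_matrix
                   ((vector_derivative (\<lambda>s. zs s j) (at t) - vector_derivative (\<lambda>s. zs s k) (at t))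
                     / (zs t j - zs t k))
                   (commutator (A t k) (A t j))))) (at t)" if "j \<in> {1..m}" for j
      using that unfolding zs_dot_def by blast
    have "((\<lambda>s. - (\<Sum>j\<in>{1..m}. A s j)) has_vector_derivative
        - (\<Sum>j\<in>{1..m}. commutator ?B (A t j) + (\<Sum>k\<in>{1..m} - {j}. smult_matrix ((zs_dot t j - zs_dot t k) / (zs t j - zs t k)) (commutator (A t k) (A t j))))) (at t)"
      by (intro has_vector_derivative_minus has_vector_derivative_sum) (use main in blast)
    then show "((\<lambda>s. - (\<Sum>j\<in>{1..m}. A s j)) has_vector_derivative
        commutator ?B (- (\<Sum>j\<in>{1..m}. A t j))) (at t)"
      by (simp only: sum.distrib commutator_sum_antisymmetric commutator_sum_right commutator_minus_right add_0_right)
  qed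
qed

end
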